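(* Let the Lie group $G$ act on its cosphere bundle $S^*G$ by the lift of left translations on itself. Suppose $0\neq\mu\in\mathfrak g^*$ has kernel group $K_\mu$ and satisfies $\ker\mu+\mathfrak g_\mu=\mathfrak g$, where $\mathfrak g_\mu$ is the isotropy algebra of $\mu$ for the coadjoint action. Then the ray reduced space at $\mu$, $(S^*G)_{\mathbb R^+\mu}$, is well defined and contactomorphic to $$\Big(\operatorname{Diag}\big(S^*(\mathcal O_{\mathbb R^+\mu})\times\tfrac{G}{K_\mu}\big),\ \eta_{\mathcal O_{\mathbb R^+\mu}}\Big),$$ where $\eta_{\mathcal O_{\mathbb R^+\mu}}$ is the one-form whose value at $(\{\mathrm{Ad}^*_g r\mu\},\hat g)$ on the tangent vector defined by $\xi\in\mathfrak g$, $r'\in\mathbb R$ (the velocity at $t=0$ of the curve $(\{\mathrm{Ad}^*_{\exp t\xi}(e^{tr'}\mathrm{Ad}^*_g r\mu)\},\widehat{g\exp t\xi})$) is $$f_\sigma(T^*_gR_{g^{-1}}r\mu)\,\langle \mathrm{Ad}^*_g r\mu,\xi\rangle .$$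
   Context: $\mathbb R^+=(0,\infty)$, $\mathbb R^+\mu=\{r\mu:r>0\}$. $\langle\mathrm{Ad}^*_g\mu,\xi\rangle=\langle\mu,\mathrm{Ad}_g\xi\rangle$; the coadjoint action is $g\cdot\mu=\mathrm{Ad}^*_{g^{-1}}\mu$, with isotropy group $G_\mu$. The kernel group $K_\mu$ is the unique connected normal Lie subgroup of $G_\mu$ with Lie algebra $\ker(\mu|_{\mathfrak g_\mu})$. Cosphere bundle: $\mathbb R^+$ acts by dilations on the fibres of $T^*G\setminus\{0_{T^*G}\}$ and $S^*G=(T^*G\setminus\{0_{T^*G}\})/\mathbb R^+$ with projection $\pi$; $\{\alpha_g\}$ is the class of $\alpha_g$. For a global section $\sigma:S^*G\to T^*G\setminus\{0_{T^*G}\}$ of this principal $\mathbb R^+$-bundle, $\theta_\sigma=\sigma^*\theta$ ($\theta$ the Liouville form) is a contact form for the canonical contact structure, and $\pi^*\theta_\sigma=f_\sigma\theta$ with $f_\sigma:T^*G\setminus\{0\}\to\mathbb R^+$ smooth, $f_\sigma(r\alpha_g)=\frac1rf_\sigma(\alpha_g)$. The lifted left translation action on $S^*G$ is $g'\cdot\{\alpha_g\}=\{T^*_{g'g}L_{g'^{-1}}\alpha_g\}$; $\sigma$ is chosen so that this action preserves $\theta_\sigma$. The momentum map is $\langle J_{sL}(\{\alpha_g\}),\xi\rangle=\theta_\sigma(\xi_{S^*G})(\{\alpha_g\})=f_\sigma(\alpha_g)\alpha_g(\xi_G(g))$, $\xi_G$ being the generator of left translations. The ray reduced space is $(S^*G)_{\mathbb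 R^+\mu}=J_{sL}^{-1}(\mathbb R^+\mu)/K_\mu$ with contact form $\eta_{\mathbb R^+\mu}$ whose pull-back to $J_{sL}^{-1}(\mathbb R^+\mu)$ is the restriction of $\theta_\sigma$. $\mathcal O_{\mathbb R^+\mu}=\{\mathrm{Ad}^*_{g^{-1}}r\mu:g\in G,r\in\mathbb R^+\}$ and $S^*(\mathcal O_{\mathbb R^+\mu})$ is its quotient by the dilation action of $\mathbb R^+$, with $\{\cdot\}$ denoting classes. $G/K_\mu$ is the quotient manifold of $G$ by left translations by $K_\mu$, with $\hat g$ the class of $g$. $\operatorname{Diag}\big(S^*(\mathcal O_{\mathbb R^+\mu})\times\frac G{K_\mu}\big)=\{(\{\mathrm{Ad}^*_g r\mu\},\hat g):g\in G,r\in\mathbb R^+\}$, a submanifold of the product. *)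

theory Defs
  imports "HOL-Analysis.Analysis" "HOL-Algebra.Coset"
begin

section \<open>Smooth functions on open subsets of \<open>R\<^sup>n\<close> and of the line\<close>

text \<open>
  \<open>R\<^sup>n\<close> is \<^const>\<open>Euclidean_space\<close>: the sequences vanishing from index \<open>n\<close> on. A function is
  \<open>C\<^sup>k\<close> if its iterated partial derivatives up to order \<open>k\<close> exist and are continuous.
\<close>

definition partial_deriv :: "nat \<Rightarrow> ((nat \<Rightarrow> real) \<Rightarrow> real) \<Rightarrow> (nat \<Rightarrow> real) \<Rightarrow> real" where
  "partial_deriv i F x = deriv (\<lambda>t. F (x(i := t))) (x i)"

primrec Ck_Rn :: "nat \<Rightarrow> nat \<Rightarrow> (nat \<Rightarrow> real) set \<Rightarrow> ((nat \<Rightarrow> real) \<Rightarrow> real) \<Rightarrow> bool" where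
  "Ck_Rn n 0 V F \<longleftrightarrow> continuous_map (subtopology (Euclidean_space n) V) euclideanreal F"
| "Ck_Rn n (Suc k) V F \<longleftrightarrow>
     continuous_map (subtopology (Euclidean_space n) V) euclideanreal F \<and>
     (\<forall>i<n. (\<forall>x\<in>V. (\<lambda>t. F (x(i := t))) differentiable (at (x i))) \<and>
            Ck_Rn n k V (partial_deriv i F))"

definition smooth_Rn :: "nat \<Rightarrow> (nat \<Rightarrow> real) set \<Rightarrow> ((nat \<Rightarrow> real) \<Rightarrow> real) \<Rightarrow> bool" where
  "smooth_Rn n V F \<longleftrightarrow> openin (Euclidean_space n) V \<and> (\<forall>k. Ck_Rn n k V F)"


section \<open>Smooth spaces and smooth manifolds\<close>

text \<open>
  A smooth structure is recorded as a topology together with the real functions that are smooth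
  on each open set. It is a manifold if it is Hausdorff, second countable and locally isomorphic,
  as a space with smooth functions, to an open subset of \<open>R\<^sup>n\<close>. Quotients, subsets and products
  then carry a canonical structure, and being a manifold is a property of that structure.
  Functions are total on the carrier type; \<open>smooth_fun M U f\<close> constrains \<open>f\<close> only on \<open>U\<close>.
\<close>

record 'a smooth_space =
  space_top :: "'a topology"
  smooth_fun :: "'a set \<Rightarrow> ('a \<Rightarrow> real) \<Rightarrow> bool"

definition points :: "'a smooth_space \<Rightarrow> 'a set" where
  "points M = topspace (space_top M)"

definition chart :: "'a smooth_space \<Rightarrow> 'a set \<Rightarrow> nat \<Rightarrow> ('a \<Rightarrow> nat \<Rightarrow> real) \<Rightarrow> bool" where
  "chart M U n x \<longleftrightarrow>
     openin (space_top M) U \<and> openin (Euclidean_space n) (x ` U) \<and>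
     homeomorphic_map (subtopology (space_top M) U) (subtopology (Euclidean_space n) (x ` U)) x \<and>
     (\<forall>W f. openin (space_top M) W \<and> W \<subseteq> U \<longrightarrow>
        (smooth_fun M W f \<longleftrightarrow> smooth_Rn n (x ` W) (f \<circ> inv_into U x)))"

text \<open>The last conjunct says that smoothness is a local property.\<close>

definition smooth_manifold :: "'a smooth_space \<Rightarrow> bool" where
  "smooth_manifold M \<longleftrightarrow>
     Hausdorff_space (space_top M) \<and> second_countable (space_top M) \<and>
     (\<exists>n. \<forall>p\<in>points M. \<exists>U x. chart M U n x \<and> p \<in> U) \<and>
     (\<forall>W f. smooth_fun M W f \<longleftrightarrow>
        openin (space_top M) W \<and> (\<forall>U n x. chart M U n x \<longrightarrow> smooth_fun M (W \<inter> U) f))"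

definition smooth_map :: "'a smooth_space \<Rightarrow> 'b smooth_space \<Rightarrow> ('a \<Rightarrow> 'b) \<Rightarrow> bool" where
  "smooth_map M N F \<longleftrightarrow>
     continuous_map (space_top M) (space_top N) F \<and>
     (\<forall>V h. smooth_fun N V h \<longrightarrow> smooth_fun M {p \<in> points M. F p \<in> V} (h \<circ> F))"

definition diffeomorphism :: "'a smooth_space \<Rightarrow> 'b smooth_space \<Rightarrow> ('a \<Rightarrow> 'b) \<Rightarrow> bool" where
  "diffeomorphism M N F \<longleftrightarrow> smooth_map M N F \<and>
     (\<exists>F'. smooth_map N M F' \<and> (\<forall>p\<in>points M. F' (F p) = p) \<and> (\<forall>q\<in>points N. F (F' q) = q))"

definition real_space :: "real smooth_space" where
  "real_space = \<lparr>space_top = euclideanreal,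
     smooth_fun = (\<lambda>U f. open U \<and> (\<forall>k. \<forall>t\<in>U. (deriv ^^ k) f differentiable (at t)))\<rparr>"

text \<open>
  Induced structure on a subset: smooth functions are the local restrictions of ambient smooth
  functions. A subset of a manifold is an embedded submanifold iff this structure is a manifold.
\<close>

definition sub_space :: "'a smooth_space \<Rightarrow> 'a set \<Rightarrow> 'a smooth_space" where
  "sub_space M S = \<lparr>space_top = subtopology (space_top M) S,
     smooth_fun = (\<lambda>W f. openin (subtopology (space_top M) S) W \<and>
       (\<forall>p\<in>W. \<exists>V h. p \<in> V \<and> smooth_fun M V h \<and> (\<forall>q\<in>W \<inter> V. f q = h q)))\<rparr>"

definition embedded_submanifold :: "'a smooth_space \<Rightarrow> 'a set \<Rightarrow> bool" where
  "embedded_submanifold M S \<longleftrightarrow> S \<subseteq> points M \<and> smooth_manifold (sub_space M S)"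

definition pos_reals :: "real smooth_space" where
  "pos_reals = sub_space real_space {0<..}"

text \<open>
  Product structure: smooth functions are locally smooth expressions in finitely many smooth
  functions of the first and of the second factor. For manifolds (take local coordinates) this is
  the usual product manifold.
\<close>

definition prod_space :: "'a smooth_space \<Rightarrow> 'b smooth_space \<Rightarrow> ('a \<times> 'b) smooth_space" where
  "prod_space M N = \<lparr>space_top = prod_topology (space_top M) (space_top N),
     smooth_fun = (\<lambda>W f. openin (prod_topology (space_top M) (space_top N)) W \<and>
       (\<forall>p q. (p, q) \<in> W \<longrightarrow>
         (\<exists>U V m n a b D F.
            openin (space_top M) U \<and> p \<in> U \<and> openin (space_top N) V \<and> q \<in> V \<and> U \<times> V \<subseteq> W \<and>
            (\<forall>i<m. smooth_fun M U (a i)) \<and> (\<forall>j<n. smooth_fun N V (b j)) \<and>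
            smooth_Rn (m + n) D F \<and>
            (\<forall>p'\<in>U. \<forall>q'\<in>V.
               let z = (\<lambda>i. if i < m then a i p' else if i < m + n then b (i - m) q' else 0)
               in z \<in> D \<and> f (p', q') = F z))))\<rparr>"

text \<open>Quotient structure on the image of a map \<open>q\<close>, the points being identified by \<open>q\<close>.\<close>

definition quot_space :: "'a smooth_space \<Rightarrow> ('a \<Rightarrow> 'b) \<Rightarrow> 'b smooth_space" where
  "quot_space M q =
     (let T = topology (\<lambda>V. V \<subseteq> q ` points M \<and> openin (space_top M) {p \<in> points M. q p \<in> V})
      in \<lparr>space_top = T,
          smooth_fun = (\<lambda>V h. openin T V \<and> smooth_fun M {p \<in> points M. q p \<in> V} (h \<circ> q))\<rparr>)"

lemma openin_quot_space:
  "openin (space_top (quot_space M q)) V \<longleftrightarrow>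
     V \<subseteq> q ` points M \<and> openin (space_top M) {p \<in> points M. q p \<in> V}"
proof -
  let ?P = "\<lambda>V. V \<subseteq> q ` points M \<and> openin (space_top M) {p \<in> points M. q p \<in> V}"
  have "istopology ?P"
    unfolding istopology_def
  proof (rule conjI; intro allI impI)
    fix S T assume "?P S" and "?P T"
    moreover have "{p \<in> points M. q p \<in> S \<inter> T} = {p \<in> points M. q p \<in> S} \<inter> {p \<in> points M. q p \<in> T}"
      by auto
    ultimately show "?P (S \<inter> T)" by (auto simp: openin_Int)
  next
    fix K assume K: "\<forall>S\<in>K. ?P S"
    have "{p \<in> points M. q p \<in> \<Union>K} = (\<Union>S\<in>K. {p \<in> points M. q p \<in> S})" by auto
    with K show "?P (\<Union>K)" by (auto intro!: openin_Union)
  qed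
  then show ?thesis by (simp add: quot_space_def Let_def)
qed

lemma points_quot_space: "points (quot_space M q) = q ` points M"
proof -
  have "{p \<in> points M. q p \<in> q ` points M} = topspace (space_top M)"
    by (auto simp: points_def)
  then have "openin (space_top (quot_space M q)) (q ` points M)"
    unfolding openin_quot_space by simp
  moreover have "V \<subseteq> q ` points M" if "openin (space_top (quot_space M q)) V" for V
    using that openin_quot_space by metis
  ultimately show ?thesis
    unfolding points_def by (meson openin_subset openin_topspace subset_antisym)
qed


section \<open>Tangent and cotangent vectors\<close>

text \<open>
  A tangent vector is the velocity of a smooth curve, recorded by its action on the functions
  that are smooth near the point (and \<open>0\<close> on all others, so that equal vectors are equal terms).
  Linear operations are pointwise. Covectors and forms vanish outside their domain.
\<close>

type_synonym 'a tvec = "('a \<Rightarrow> real) \<Rightarrow> real"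
type_synonym 'a covec = "'a tvec \<Rightarrow> real"
type_synonym 'a form1 = "'a \<Rightarrow> 'a covec"

definition smooth_near :: "'a smooth_space \<Rightarrow> 'a \<Rightarrow> ('a \<Rightarrow> real) \<Rightarrow> bool" where
  "smooth_near M p f \<longleftrightarrow> (\<exists>U. p \<in> U \<and> smooth_fun M U f)"

definition velocity :: "'a smooth_space \<Rightarrow> (real \<Rightarrow> 'a) \<Rightarrow> real \<Rightarrow> 'a tvec" where
  "velocity M c t = (\<lambda>f. if smooth_near M (c t) f then deriv (\<lambda>s. f (c s)) t else 0)"

definition tangent :: "'a smooth_space \<Rightarrow> 'a \<Rightarrow> 'a tvec set" where
  "tangent M p = {velocity M c 0 | c. smooth_map real_space M c \<and> c 0 = p}"

definition tmap :: "'b smooth_space \<Rightarrow> ('a \<Rightarrow> 'b) \<Rightarrow> 'a \<Rightarrow> 'a tvec \<Rightarrow> 'b tvec" where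
  "tmap N F p v = (\<lambda>h. if smooth_near N (F p) h then v (\<lambda>q. h (F q)) else 0)"

definition immersion :: "'a smooth_space \<Rightarrow> 'b smooth_space \<Rightarrow> ('a \<Rightarrow> 'b) \<Rightarrow> bool" where
  "immersion M N F \<longleftrightarrow> smooth_map M N F \<and> (\<forall>p\<in>points M. inj_on (tmap N F p) (tangent M p))"

definition submersion :: "'a smooth_space \<Rightarrow> 'b smooth_space \<Rightarrow> ('a \<Rightarrow> 'b) \<Rightarrow> bool" where
  "submersion M N F \<longleftrightarrow> smooth_map M N F \<and>
     (\<forall>p\<in>points M. tmap N F p ` tangent M p = tangent N (F p))"

definition quotient_manifold :: "'a smooth_space \<Rightarrow> ('a \<Rightarrow> 'b) \<Rightarrow> bool" where
  "quotient_manifold M q \<longleftrightarrow>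
     smooth_manifold (quot_space M q) \<and> submersion M (quot_space M q) q"

definition cotangent :: "'a smooth_space \<Rightarrow> 'a \<Rightarrow> 'a covec set" where
  "cotangent M p = {\<alpha>.
     (\<forall>v\<in>tangent M p. \<forall>w\<in>tangent M p. \<forall>a b.
        \<alpha> (\<lambda>f. a * v f + b * w f) = a * \<alpha> v + b * \<alpha> w) \<and>
     (\<forall>v. v \<notin> tangent M p \<longrightarrow> \<alpha> v = 0)}"

text \<open>The coordinate vector \<open>\<partial>/\<partial>x\<^sub>i\<close> at \<open>p\<close> of a chart \<open>(U, x)\<close>.\<close>

definition coord_vec :: "'a smooth_space \<Rightarrow> 'a set \<Rightarrow> ('a \<Rightarrow> nat \<Rightarrow> real) \<Rightarrow> nat \<Rightarrow> 'a \<Rightarrow> 'a tvec" where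
  "coord_vec M U x i p =
     (\<lambda>f. if smooth_near M p f then deriv (\<lambda>t. f (inv_into U x ((x p)(i := x p i + t)))) 0 else 0)"


section \<open>One-forms and contact forms\<close>

definition one_form :: "'a smooth_space \<Rightarrow> 'a form1 \<Rightarrow> bool" where
  "one_form M \<eta> \<longleftrightarrow>
     (\<forall>p\<in>points M. \<eta> p \<in> cotangent M p) \<and> (\<forall>p. p \<notin> points M \<longrightarrow> \<eta> p = (\<lambda>_. 0)) \<and>
     (\<forall>U n x. chart M U n x \<longrightarrow> (\<forall>i<n. smooth_fun M U (\<lambda>p. \<eta> p (coord_vec M U x i p))))"

definition pull_form :: "'a smooth_space \<Rightarrow> 'b smooth_space \<Rightarrow> ('a \<Rightarrow> 'b) \<Rightarrow> 'b form1 \<Rightarrow> 'a form1" where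
  "pull_form M N F \<eta> =
     (\<lambda>p v. if p \<in> points M \<and> v \<in> tangent M p then \<eta> (F p) (tmap N F p v) else 0)"

text \<open>
  \<open>d\<eta>(v, w) = \<Sum>\<^sub>i\<^sub>j (\<partial>\<^sub>i \<eta>\<^sub>j - \<partial>\<^sub>j \<eta>\<^sub>i) v\<^sub>i w\<^sub>j\<close>, where \<open>\<eta>\<^sub>j = \<eta>(\<partial>\<^sub>j)\<close> and \<open>v\<^sub>i = v(x\<^sub>i)\<close>.
\<close>

definition ext_deriv ::
  "'a smooth_space \<Rightarrow> 'a set \<Rightarrow> nat \<Rightarrow> ('a \<Rightarrow> nat \<Rightarrow> real) \<Rightarrow> 'a form1 \<Rightarrow> 'a \<Rightarrow> 'a tvec \<Rightarrow> 'a tvec \<Rightarrow> real"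
where
  "ext_deriv M U n x \<eta> p v w =
     (\<Sum>i<n. \<Sum>j<n.
        (coord_vec M U x i p (\<lambda>q. \<eta> q (coord_vec M U x j q)) -
         coord_vec M U x j p (\<lambda>q. \<eta> q (coord_vec M U x i q))) *
        v (\<lambda>q. x q i) * w (\<lambda>q. x q j))"

text \<open>\<open>\<eta>\<close> vanishes nowhere and \<open>d\<eta>\<close> is nondegenerate on the hyperplanes \<open>ker \<eta>\<close>.\<close>

definition contact_form :: "'a smooth_space \<Rightarrow> 'a form1 \<Rightarrow> bool" where
  "contact_form M \<eta> \<longleftrightarrow> smooth_manifold M \<and> one_form M \<eta> \<and>
     (\<forall>p\<in>points M. (\<exists>v\<in>tangent M p. \<eta> p v \<noteq> 0) \<and>
        (\<forall>U n x. chart M U n x \<and> p \<in> U \<longrightarrow>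
           (\<forall>v\<in>tangent M p. \<eta> p v = 0 \<and>
              (\<forall>w\<in>tangent M p. \<eta> p w = 0 \<longrightarrow> ext_deriv M U n x \<eta> p v w = 0) \<longrightarrow> v = (\<lambda>_. 0))))"

definition contactomorphic ::
  "'a smooth_space \<Rightarrow> 'a form1 \<Rightarrow> 'b smooth_space \<Rightarrow> 'b form1 \<Rightarrow> bool" where
  "contactomorphic M \<eta> N \<eta>' \<longleftrightarrow> contact_form M \<eta> \<and> contact_form N \<eta>' \<and>
     (\<exists>F k. diffeomorphism M N F \<and> smooth_fun M (points M) k \<and> (\<forall>p\<in>points M. k p \<noteq> 0) \<and>
        pull_form M N F \<eta>' = (\<lambda>p v. k p * \<eta> p v))"


section \<open>The cotangent and cosphere bundles\<close>

definition cot_points :: "'a smooth_space \<Rightarrow> ('a \<times> 'a covec) set" where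
  "cot_points M = {(p, \<alpha>). p \<in> points M \<and> \<alpha> \<in> cotangent M p}"

text \<open>The chart of \<open>T\<^sup>*M\<close> induced by a chart \<open>x\<close> of \<open>M\<close>: \<open>\<alpha>\<^sub>p \<mapsto> (x\<^sub>i(p), \<alpha>\<^sub>p(\<partial>\<^sub>i))\<close>.\<close>

definition cot_chart ::
  "'a smooth_space \<Rightarrow> 'a set \<Rightarrow> nat \<Rightarrow> ('a \<Rightarrow> nat \<Rightarrow> real) \<Rightarrow> 'a \<times> 'a covec \<Rightarrow> nat \<Rightarrow> real" where
  "cot_chart M U n x = (\<lambda>(p, \<alpha>) i.
     if i < n then x p i else if i < 2 * n then \<alpha> (coord_vec M U x (i - n) p) else 0)"

definition cotangent_bundle :: "'a smooth_space \<Rightarrow> ('a \<times> 'a covec) smooth_space" where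
  "cotangent_bundle M =
     (let T = topology_generated_by
            {{a \<in> cot_points M. fst a \<in> U \<and> cot_chart M U n x a \<in> V} | U n x V.
               chart M U n x \<and> openin (Euclidean_space (2 * n)) V}
      in \<lparr>space_top = T,
          smooth_fun = (\<lambda>W f. openin T W \<and> (\<forall>U n x. chart M U n x \<longrightarrow>
            smooth_Rn (2 * n) (cot_chart M U n x ` {a \<in> W. fst a \<in> U})
              (f \<circ> inv_into {a \<in> cot_points M. fst a \<in> U} (cot_chart M U n x))))\<rparr>)"

definition liouville :: "'a smooth_space \<Rightarrow> ('a \<times> 'a covec) form1" where
  "liouville M = (\<lambda>a v. if a \<in> cot_points M \<and> v \<in> tangent (cotangent_bundle M) a
                        then snd a (tmap M fst a v) else 0)"

definition slit_cotangent_bundle :: "'a smooth_space \<Rightarrow> ('a \<times> 'a covec) smooth_space" where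
  "slit_cotangent_bundle M = sub_space (cotangent_bundle M) {a. snd a \<noteq> (\<lambda>_. 0)}"

text \<open>Rays \<open>R\<^sup>+\<nu>\<close> of functionals, and the classes \<open>{\<alpha>\<^sub>g}\<close> of nonzero covectors.\<close>

definition ray :: "('v \<Rightarrow> real) \<Rightarrow> ('v \<Rightarrow> real) set" where
  "ray \<nu> = {\<lambda>v. r * \<nu> v | r. r > 0}"

definition cot_ray :: "'a \<times> 'a covec \<Rightarrow> ('a \<times> 'a covec) set" where
  "cot_ray a = Pair (fst a) ` ray (snd a)"

type_synonym 'a cosphere = "('a \<times> 'a covec) set"

definition cosphere_bundle :: "'a smooth_space \<Rightarrow> 'a cosphere smooth_space" where
  "cosphere_bundle M = quot_space (slit_cotangent_bundle M) cot_ray"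

definition global_section :: "'a smooth_space \<Rightarrow> ('a cosphere \<Rightarrow> 'a \<times> 'a covec) \<Rightarrow> bool" where
  "global_section M \<sigma> \<longleftrightarrow> smooth_map (cosphere_bundle M) (slit_cotangent_bundle M) \<sigma> \<and>
     (\<forall>x\<in>points (cosphere_bundle M). cot_ray (\<sigma> x) = x)"

definition theta_form ::
  "'a smooth_space \<Rightarrow> ('a cosphere \<Rightarrow> 'a \<times> 'a covec) \<Rightarrow> 'a cosphere form1" where
  "theta_form M \<sigma> = pull_form (cosphere_bundle M) (cotangent_bundle M) \<sigma> (liouville M)"

text \<open>The factor \<open>f\<^sub>\<sigma>\<close> is determined by \<open>\<pi>\<^sup>*\<theta>\<^sub>\<sigma> = f\<^sub>\<sigma> \<theta>\<close>.\<close>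

definition f_sigma ::
  "'a smooth_space \<Rightarrow> ('a cosphere \<Rightarrow> 'a \<times> 'a covec) \<Rightarrow> 'a \<times> 'a covec \<Rightarrow> real" where
  "f_sigma M \<sigma> a = (THE c. \<forall>v.
     pull_form (slit_cotangent_bundle M) (cosphere_bundle M) cot_ray (theta_form M \<sigma>) a v =
     c * pull_form (slit_cotangent_bundle M) (cotangent_bundle M) (\<lambda>b. b) (liouville M) a v)"


section \<open>Lie groups\<close>

record 'g lie_grp = "'g monoid" +
  mfd :: "'g smooth_space"

definition lie_group :: "'g lie_grp \<Rightarrow> bool" where
  "lie_group G \<longleftrightarrow> group G \<and> smooth_manifold (mfd G) \<and> points (mfd G) = carrier G \<and>
     smooth_map (prod_space (mfd G) (mfd G)) (mfd G) (\<lambda>(a, b). a \<otimes>\<^bsub>G\<^esub> b) \<and>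
     smooth_map (mfd G) (mfd G) (\<lambda>a. inv\<^bsub>G\<^esub> a)"

definition lie_algebra :: "'g lie_grp \<Rightarrow> 'g tvec set" where
  "lie_algebra G = tangent (mfd G) \<one>\<^bsub>G\<^esub>"

definition dual_lie_algebra :: "'g lie_grp \<Rightarrow> 'g covec set" where
  "dual_lie_algebra G = cotangent (mfd G) \<one>\<^bsub>G\<^esub>"

text \<open>\<open>\<gamma> t = exp (t\<xi>)\<close>: the one-parameter subgroup with velocity \<open>\<xi>\<close>.\<close>

definition exp_curve :: "'g lie_grp \<Rightarrow> 'g tvec \<Rightarrow> (real \<Rightarrow> 'g) \<Rightarrow> bool" where
  "exp_curve G \<xi> \<gamma> \<longleftrightarrow> smooth_map real_space (mfd G) \<gamma> \<and>
     (\<forall>s t. \<gamma> (s + t) = \<gamma> s \<otimes>\<^bsub>G\<^esub> \<gamma> t) \<and> velocity (mfd G) \<gamma> 0 = \<xi>"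

definition Ad :: "'g lie_grp \<Rightarrow> 'g \<Rightarrow> 'g tvec \<Rightarrow> 'g tvec" where
  "Ad G g = tmap (mfd G) (\<lambda>x. g \<otimes>\<^bsub>G\<^esub> x \<otimes>\<^bsub>G\<^esub> inv\<^bsub>G\<^esub> g) \<one>\<^bsub>G\<^esub>"

definition Ad_star :: "'g lie_grp \<Rightarrow> 'g \<Rightarrow> 'g covec \<Rightarrow> 'g covec" where
  "Ad_star G g \<mu> = (\<lambda>\<xi>. if \<xi> \<in> lie_algebra G then \<mu> (Ad G g \<xi>) else 0)"

definition coad_isotropy :: "'g lie_grp \<Rightarrow> 'g covec \<Rightarrow> 'g set" where
  "coad_isotropy G \<mu> = {g \<in> carrier G. Ad_star G (inv\<^bsub>G\<^esub> g) \<mu> = \<mu>}"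

text \<open>
  \<open>\<gg>\<^sub>\<mu> = {\<xi>. \<xi>\<^bsub>\<gg>*\<^esub>(\<mu>) = 0}\<close>. A tangent vector \<open>\<xi>\<close> at the identity acts on functions on the group, so
  \<open>\<xi>\<close> applied to \<open>h \<mapsto> \<langle>h \<cdot> \<mu>, \<zeta>\<rangle>\<close> is the pairing of the infinitesimal generator at \<open>\<mu>\<close> with \<open>\<zeta>\<close>.
\<close>

definition isotropy_algebra :: "'g lie_grp \<Rightarrow> 'g covec \<Rightarrow> 'g tvec set" where
  "isotropy_algebra G \<mu> = {\<xi> \<in> lie_algebra G.
     \<forall>\<zeta>\<in>lie_algebra G. \<xi> (\<lambda>h. Ad_star G (inv\<^bsub>G\<^esub> h) \<mu> \<zeta>) = 0}"

text \<open>\<open>K\<close> is an immersed Lie subgroup by means of the smooth structure \<open>N\<close>.\<close>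

definition lie_subgroup :: "'g lie_grp \<Rightarrow> 'g set \<Rightarrow> 'g smooth_space \<Rightarrow> bool" where
  "lie_subgroup G K N \<longleftrightarrow> subgroup K G \<and> lie_group (G\<lparr>carrier := K, mfd := N\<rparr>) \<and>
     immersion N (mfd G) (\<lambda>k. k)"

definition kernel_group :: "'g lie_grp \<Rightarrow> 'g covec \<Rightarrow> 'g set \<Rightarrow> bool" where
  "kernel_group G \<mu> K \<longleftrightarrow> K \<lhd> (G\<lparr>carrier := coad_isotropy G \<mu>\<rparr>) \<and>
     (\<exists>N. lie_subgroup G K N \<and> connected_space (space_top N) \<and>
        tmap (mfd G) (\<lambda>k. k) \<one>\<^bsub>G\<^esub> ` tangent N \<one>\<^bsub>G\<^esub> = {\<xi> \<in> isotropy_algebra G \<mu>. \<mu> \<xi> = 0})"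


section \<open>Ray reduction of the cosphere bundle at \<open>\<mu>\<close>\<close>

text \<open>The lifted left translation \<open>\<alpha>\<^sub>g \<mapsto> T\<^sup>*\<^bsub>hg\<^esub>L\<^bsub>h\<^sup>-\<^sup>1\<^esub> \<alpha>\<^sub>g\<close>, and the induced action on classes.\<close>

definition left_lift :: "'g lie_grp \<Rightarrow> 'g \<Rightarrow> 'g \<times> 'g covec \<Rightarrow> 'g \<times> 'g covec" where
  "left_lift G h = (\<lambda>(g, \<alpha>). (h \<otimes>\<^bsub>G\<^esub> g, \<lambda>v.
     if v \<in> tangent (mfd G) (h \<otimes>\<^bsub>G\<^esub> g)
     then \<alpha> (tmap (mfd G) (\<lambda>x. inv\<^bsub>G\<^esub> h \<otimes>\<^bsub>G\<^esub> x) (h \<otimes>\<^bsub>G\<^esub> g) v) else 0))"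

definition cosphere_act :: "'g lie_grp \<Rightarrow> 'g \<Rightarrow> 'g cosphere \<Rightarrow> 'g cosphere" where
  "cosphere_act G h x = left_lift G h ` x"

definition invariant_section :: "'g lie_grp \<Rightarrow> ('g cosphere \<Rightarrow> 'g \<times> 'g covec) \<Rightarrow> bool" where
  "invariant_section G \<sigma> \<longleftrightarrow> global_section (mfd G) \<sigma> \<and>
     (\<forall>h\<in>carrier G.
        pull_form (cosphere_bundle (mfd G)) (cosphere_bundle (mfd G)) (cosphere_act G h)
          (theta_form (mfd G) \<sigma>) = theta_form (mfd G) \<sigma>)"

text \<open>\<open>\<xi>\<^bsub>S*G\<^esub>(x)\<close>, the derivative in direction \<open>\<xi>\<close> at the identity of the orbit map \<open>h \<mapsto> h \<cdot> x\<close>.\<close>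

definition cosphere_generator :: "'g lie_grp \<Rightarrow> 'g tvec \<Rightarrow> 'g cosphere \<Rightarrow> 'g cosphere tvec" where
  "cosphere_generator G \<xi> x =
     tmap (cosphere_bundle (mfd G)) (\<lambda>h. cosphere_act G h x) \<one>\<^bsub>G\<^esub> \<xi>"

definition momentum ::
  "'g lie_grp \<Rightarrow> ('g cosphere \<Rightarrow> 'g \<times> 'g covec) \<Rightarrow> 'g cosphere \<Rightarrow> 'g covec" where
  "momentum G \<sigma> x =
     (\<lambda>\<xi>. if \<xi> \<in> lie_algebra G then theta_form (mfd G) \<sigma> x (cosphere_generator G \<xi> x) else 0)"

definition ray_level ::
  "'g lie_grp \<Rightarrow> ('g cosphere \<Rightarrow> 'g \<times> 'g covec) \<Rightarrow> 'g covec \<Rightarrow> 'g cosphere set" where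
  "ray_level G \<sigma> \<mu> = {x \<in> points (cosphere_bundle (mfd G)). momentum G \<sigma> x \<in> ray \<mu>}"

definition level_space ::
  "'g lie_grp \<Rightarrow> ('g cosphere \<Rightarrow> 'g \<times> 'g covec) \<Rightarrow> 'g covec \<Rightarrow> 'g cosphere smooth_space" where
  "level_space G \<sigma> \<mu> = sub_space (cosphere_bundle (mfd G)) (ray_level G \<sigma> \<mu>)"

definition act_orbit :: "'g lie_grp \<Rightarrow> 'g set \<Rightarrow> 'g cosphere \<Rightarrow> 'g cosphere set" where
  "act_orbit G K x = (\<lambda>k. cosphere_act G k x) ` K"

definition ray_reduced ::
  "'g lie_grp \<Rightarrow> ('g cosphere \<Rightarrow> 'g \<times> 'g covec) \<Rightarrow> 'g covec \<Rightarrow> 'g set \<Rightarrow> 'g cosphere set smooth_space"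
where
  "ray_reduced G \<sigma> \<mu> K = quot_space (level_space G \<sigma> \<mu>) (act_orbit G K)"

definition is_reduced_form ::
  "'g lie_grp \<Rightarrow> ('g cosphere \<Rightarrow> 'g \<times> 'g covec) \<Rightarrow> 'g covec \<Rightarrow> 'g set \<Rightarrow> 'g cosphere set form1 \<Rightarrow> bool"
where
  "is_reduced_form G \<sigma> \<mu> K \<eta> \<longleftrightarrow> contact_form (ray_reduced G \<sigma> \<mu> K) \<eta> \<and>
     pull_form (level_space G \<sigma> \<mu>) (ray_reduced G \<sigma> \<mu> K) (act_orbit G K) \<eta> =
     pull_form (level_space G \<sigma> \<mu>) (cosphere_bundle (mfd G)) (\<lambda>x. x) (theta_form (mfd G) \<sigma>)"

definition reduced_form ::
  "'g lie_grp \<Rightarrow> ('g cosphere \<Rightarrow> 'g \<times> 'g covec) \<Rightarrow> 'g covec \<Rightarrow> 'g set \<Rightarrow> 'g cosphere set form1" where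
  "reduced_form G \<sigma> \<mu> K = (THE \<eta>. is_reduced_form G \<sigma> \<mu> K \<eta>)"

definition ray_reduced_well_defined ::
  "'g lie_grp \<Rightarrow> ('g cosphere \<Rightarrow> 'g \<times> 'g covec) \<Rightarrow> 'g covec \<Rightarrow> 'g set \<Rightarrow> bool" where
  "ray_reduced_well_defined G \<sigma> \<mu> K \<longleftrightarrow>
     embedded_submanifold (cosphere_bundle (mfd G)) (ray_level G \<sigma> \<mu>) \<and>
     (\<forall>k\<in>K. \<forall>x\<in>ray_level G \<sigma> \<mu>. cosphere_act G k x \<in> ray_level G \<sigma> \<mu>) \<and>
     quotient_manifold (level_space G \<sigma> \<mu>) (act_orbit G K) \<and>
     (\<exists>!\<eta>. is_reduced_form G \<sigma> \<mu> K \<eta>)"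


section \<open>The model \<open>Diag(S\<^sup>*(O) \<times> G/K)\<close>\<close>

text \<open>
  The orbit carries its homogeneous structure, as a quotient of \<open>G \<times> R\<^sup>+\<close> by the orbit map.
\<close>

definition ray_orbit :: "'g lie_grp \<Rightarrow> 'g covec \<Rightarrow> 'g covec smooth_space" where
  "ray_orbit G \<mu> = quot_space (prod_space (mfd G) pos_reals)
     (\<lambda>(g, r). Ad_star G (inv\<^bsub>G\<^esub> g) (\<lambda>\<xi>. r * \<mu> \<xi>))"

definition orbit_sphere :: "'g lie_grp \<Rightarrow> 'g covec \<Rightarrow> 'g covec set smooth_space" where
  "orbit_sphere G \<mu> = quot_space (ray_orbit G \<mu>) ray"

text \<open>The quotient of \<open>G\<close> by left translations by \<open>K\<close>; the class of \<open>g\<close> is \<open>Kg\<close>.\<close>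

definition left_quotient :: "'g lie_grp \<Rightarrow> 'g set \<Rightarrow> 'g set smooth_space" where
  "left_quotient G K = quot_space (mfd G) (\<lambda>g. K #>\<^bsub>G\<^esub> g)"

definition Diag :: "'g lie_grp \<Rightarrow> 'g covec \<Rightarrow> 'g set \<Rightarrow> ('g covec set \<times> 'g set) set" where
  "Diag G \<mu> K =
     {(ray (Ad_star G g (\<lambda>\<xi>. r * \<mu> \<xi>)), K #>\<^bsub>G\<^esub> g) | g r. g \<in> carrier G \<and> r > 0}"

definition diag_space ::
  "'g lie_grp \<Rightarrow> 'g covec \<Rightarrow> 'g set \<Rightarrow> ('g covec set \<times> 'g set) smooth_space" where
  "diag_space G \<mu> K = sub_space (prod_space (orbit_sphere G \<mu>) (left_quotient G K)) (Diag G \<mu> K)"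

text \<open>The covector \<open>T\<^sup>*\<^sub>gR\<^bsub>g\<^sup>-\<^sup>1\<^esub> \<nu>\<close> at \<open>g\<close>.\<close>

definition right_cov :: "'g lie_grp \<Rightarrow> 'g \<Rightarrow> 'g covec \<Rightarrow> 'g \<times> 'g covec" where
  "right_cov G g \<nu> = (g, \<lambda>v.
     if v \<in> tangent (mfd G) g
     then \<nu> (tmap (mfd G) (\<lambda>x. x \<otimes>\<^bsub>G\<^esub> inv\<^bsub>G\<^esub> g) g v) else 0)"

definition is_orbit_form ::
  "'g lie_grp \<Rightarrow> ('g cosphere \<Rightarrow> 'g \<times> 'g covec) \<Rightarrow> 'g covec \<Rightarrow> 'g set \<Rightarrow>
   ('g covec set \<times> 'g set) form1 \<Rightarrow> bool" where
  "is_orbit_form G \<sigma> \<mu> K \<eta> \<longleftrightarrow> one_form (diag_space G \<mu> K) \<eta> \<and>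
     (\<forall>g\<in>carrier G. \<forall>r>0. \<forall>\<xi>\<in>lie_algebra G. \<forall>r' \<gamma>. exp_curve G \<xi> \<gamma> \<longrightarrow>
        (let \<nu> = Ad_star G g (\<lambda>\<zeta>. r * \<mu> \<zeta>);
             c = (\<lambda>t. (ray (Ad_star G (\<gamma> t) (\<lambda>\<zeta>. exp (t * r') * \<nu> \<zeta>)), K #>\<^bsub>G\<^esub> (g \<otimes>\<^bsub>G\<^esub> \<gamma> t)))
         in \<eta> (ray \<nu>, K #>\<^bsub>G\<^esub> g) (velocity (diag_space G \<mu> K) c 0) =
            f_sigma (mfd G) \<sigma> (right_cov G g (\<lambda>\<zeta>. r * \<mu> \<zeta>)) * \<nu> \<xi>))"

end

theory Submission
  imports Defs
begin

text \<open>
  Write \<open>R\<^sub>g \<nu>\<close> for the right-invariant covector field with value \<open>\<nu>\<close> at the identity. By invariance of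
  \<open>\<sigma>\<close> the momentum of the class of \<open>R\<^sub>g \<nu>\<close> is a positive multiple of \<open>\<nu>\<close>, so \<open>J\<^sup>-\<^sup>1(R\<^sup>+\<mu>)\<close> is the image of
  the section \<open>g \<mapsto> {R\<^sub>g \<mu>}\<close> of \<open>S\<^sup>*G \<rightarrow> G\<close>, a copy of \<open>G\<close> on which \<open>K\<close> acts by left translations; on it the
  contact form is \<open>f\<^sub>\<sigma>(R\<^sub>g \<mu>) R\<^sub>g \<mu>\<close>. Hence the reduced space is a copy of \<open>G/K\<close>. The diagonal is the graph
  of the smooth map \<open>Kg \<mapsto> {Ad\<^sup>*\<^sub>g \<mu>}\<close>, so it is another copy of \<open>G/K\<close>, and both forms pull back to the same
  form on \<open>G\<close>.

  That form descends because \<open>ker T(G \<rightarrow> G/K)\<close> consists of vectors tangent to \<open>K\<close>, which \<open>\<mu>\<close> annihilates.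
  Its exterior derivative, restricted to its kernel, is a positive multiple of
  \<open>(\<xi>, \<zeta>) \<mapsto> \<langle>\<mu>, [\<xi>, \<zeta>]\<rangle>\<close> on \<open>ker \<mu>\<close>. Since \<open>ker \<mu> + \<gg>\<^sub>\<mu> = \<gg>\<close>, the radical is \<open>ker \<mu> \<inter> \<gg>\<^sub>\<mu>\<close>, the Lie algebra of
  \<open>K\<close>, which is zero on the quotient.
\<close>

section \<open>Calculus in \<open>R\<^sup>n\<close>\<close>

text \<open>The main obstacle is the descent of the form to G/K. The tangent space of
  \<open>K\<close> is known only through the immersed structure of the kernel group, whereas the
  kernel of the tangent map to G/K is defined by the quotient. That the two topologies of
  \<open>K\<close> agree near the identity is a Baire argument; tangent directions are then compared
  by first-order estimates in a chart, so no vector field has to be integrated. Right translations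
  trivialise the bundle because the generators of left translations are right-invariant: momenta are
  read off at the identity, and left translation acts through the coadjoint action. Invariance of
  \<sigma> makes f_\<sigma> constant along the orbits of \<open>K\<close>. Quotient structures are
  defined by pull-back, so the level set, the reduced space and the diagonal become literally equal
  to quotients of G by explicit maps, and the form is built once for any map with fibres Kg. Tangent
  vectors are only velocities of curves; their addition, the smoothness of invariant fields and the
  symmetry of mixed derivatives come from calculus in R^n, where strict differentiability is the
  basic tool.\<close>

abbreviation Rn :: "nat \<Rightarrow> (nat \<Rightarrow> real) set" where
  "Rn n \<equiv> topspace (Euclidean_space n)"

lemma Rn_iff: "x \<in> Rn n \<longleftrightarrow> (\<forall>i\<ge>n. x i = 0)"
  by (simp add: topspace_Euclidean_space)

text \<open>Cubes rather than balls: changing one coordinate at a time within the allowed range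
  stays inside, which the telescoping and mean value arguments rely on.\<close>

definition nbox :: "nat \<Rightarrow> (nat \<Rightarrow> real) \<Rightarrow> real \<Rightarrow> (nat \<Rightarrow> real) set" where
  "nbox n x e = {y \<in> Rn n. \<forall>i<n. \<bar>y i - x i\<bar> < e}"

lemma nbox_mono: "d \<le> e \<Longrightarrow> nbox n x d \<subseteq> nbox n x e"
  by (force simp: nbox_def)

lemma center_in_nbox: "x \<in> Rn n \<Longrightarrow> 0 < e \<Longrightarrow> x \<in> nbox n x e"
  by (simp add: nbox_def)

lemma finite_pos_lower_bound:
  fixes e :: "nat \<Rightarrow> real"
  assumes "\<And>i. i < n \<Longrightarrow> 0 < e i"
  obtains d where "0 < d" "\<And>i. i < n \<Longrightarrow> d \<le> e i"
proof -
  have "\<exists>d>0. \<forall>i<n. d \<le> e i"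
    using assms
  proof (induction n)
    case (Suc n)
    then obtain d where "d > 0" "\<forall>i<n. d \<le> e i" by (metis less_SucI)
    then show ?case
      using Suc.prems[of n] by (intro exI[of _ "min d (e n)"]) (auto simp: less_Suc_eq min.coboundedI1)
  qed (use zero_less_one in blast)
  then show thesis using that by blast
qed

lemma openin_coordinate:
  assumes "open T" "i < n"
  shows "openin (Euclidean_space n) {y \<in> Rn n. y i \<in> T}"
proof (rule openin_continuous_map_preimage)
  show "continuous_map (Euclidean_space n) euclideanreal (\<lambda>y. y i)"
    unfolding Euclidean_space_def
    by (intro continuous_map_from_subtopology continuous_map_product_projection) simp
qed (use assms in simp)

lemma openin_nbox: "openin (Euclidean_space n) (nbox n x e)"
proof -
  have "nbox n x e = Rn n \<inter> (\<Inter>i\<in>{..<n}. {y \<in> Rn n. y i \<in> {x i - e<..<x i + e}})"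
    by (auto simp: nbox_def abs_diff_less_iff)
  moreover have "openin (Euclidean_space n) (Rn n \<inter> (\<Inter>i\<in>{..<n}. {y \<in> Rn n. y i \<in> {x i - e<..<x i + e}}))"
  proof (cases "n = 0")
    case False
    then show ?thesis
      by (intro openin_Int openin_INT2 openin_topspace)
        (auto intro!: openin_coordinate simp del: greaterThanLessThan_iff)
  qed simp
  ultimately show ?thesis by simp
qed

text \<open>A product-open set gives a tolerance in every coordinate. Beyond index \<open>n\<close>
  all points are 0, so only finitely many tolerances matter, and these have a positive lower
  bound.\<close>

lemma openin_Euclidean_iff:
  "openin (Euclidean_space n) V \<longleftrightarrow> V \<subseteq> Rn n \<and> (\<forall>x\<in>V. \<exists>e>0. nbox n x e \<subseteq> V)"
proof (intro iffI conjI ballI; (elim conjE)?)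
  assume V: "openin (Euclidean_space n) V"
  show "V \<subseteq> Rn n" using V openin_subset by blast
  fix x assume x: "x \<in> V"
  obtain T where T: "openin (powertop_real UNIV) T" "V = T \<inter> {x. \<forall>i\<ge>n. x i = 0}"
    using V by (auto simp: Euclidean_space_def openin_subtopology)
  obtain U where U: "\<And>i. open (U i)" "x \<in> Pi\<^sub>E UNIV U" "Pi\<^sub>E UNIV U \<subseteq> T"
    using T x unfolding openin_product_topology_alt
    by (metis (no_types, lifting) IntD1 UNIV_I open_openin)
  have "\<exists>e>0. \<forall>a. \<bar>a - x i\<bar> < e \<longrightarrow> a \<in> U i" for i
    using U by (force simp: open_dist PiE_iff dist_real_def)
  then obtain e where e: "\<And>i. e i > 0" "\<And>i a. \<bar>a - x i\<bar> < e i \<Longrightarrow> a \<in> U i"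
    by metis
  obtain d where d: "0 < d" "\<And>i. i < n \<Longrightarrow> d \<le> e i"
    using e(1) finite_pos_lower_bound by blast
  have "nbox n x d \<subseteq> V"
  proof
    fix y assume y: "y \<in> nbox n x d"
    have "y i \<in> U i" for i
    proof (cases "i < n")
      case True
      then show ?thesis
        using y d(2)[of i] by (intro e(2)) (auto simp: nbox_def intro: order_less_le_trans)
    next
      case False
      then have "y i = x i" using x T y by (auto simp: nbox_def Rn_iff)
      then show ?thesis using e by simp
    qed
    then have "y \<in> T" using U by auto
    then show "y \<in> V" using y T by (auto simp: nbox_def Rn_iff)
  qed
  then show "\<exists>e>0. nbox n x e \<subseteq> V" using d by blast
next
  assume "V \<subseteq> Rn n" and b: "\<forall>x\<in>V. \<exists>e>0. nbox n x e \<subseteq> V"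
  then have "\<forall>x\<in>V. \<exists>T. openin (Euclidean_space n) T \<and> x \<in> T \<and> T \<subseteq> V"
    by (meson center_in_nbox openin_nbox subsetD)
  then show "openin (Euclidean_space n) V" using openin_subopen by fast
qed

lemma continuous_Euclid_iff:
  assumes V: "openin (Euclidean_space n) V"
  shows "continuous_map (subtopology (Euclidean_space n) V) euclideanreal F \<longleftrightarrow>
    (\<forall>x\<in>V. \<forall>e>0. \<exists>d>0. \<forall>y\<in>nbox n x d. y \<in> V \<longrightarrow> \<bar>F y - F x\<bar> < e)"
    (is "?L \<longleftrightarrow> ?R")
proof
  have VR: "V \<subseteq> Rn n" using V openin_subset by blast
  then have ts: "topspace (subtopology (Euclidean_space n) V) = V" by auto
  { assume ?L
    show ?R
    proof (intro ballI allI impI)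
      fix x and e :: real assume x: "x \<in> V" and e: "e > 0"
      have "openin (subtopology (Euclidean_space n) V) {y \<in> V. F y \<in> ball (F x) e}"
        using openin_continuous_map_preimage[OF \<open>?L\<close>, of "ball (F x) e"] VR ts by (simp add: Int_absorb1)
      then have "openin (Euclidean_space n) {y \<in> V. F y \<in> ball (F x) e}"
        using V openin_open_subtopology by blast
      then show "\<exists>d>0. \<forall>y\<in>nbox n x d. y \<in> V \<longrightarrow> \<bar>F y - F x\<bar> < e"
        using x e unfolding openin_Euclidean_iff by (fastforce simp: dist_real_def abs_minus_commute)
    qed }
  assume R: ?R
  show ?L
    unfolding continuous_map_def
  proof (intro conjI allI impI)
    fix U :: "real set" assume "openin euclideanreal U"
    then have U: "open U" by simp
    have "openin (Euclidean_space n) {x \<in> V. F x \<in> U}"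
      unfolding openin_Euclidean_iff
    proof (intro conjI ballI)
      fix x assume x: "x \<in> {x \<in> V. F x \<in> U}"
      then obtain e where e: "e > 0" "ball (F x) e \<subseteq> U" using U open_contains_ball by blast
      obtain d where d: "d > 0" "\<forall>y\<in>nbox n x d. y \<in> V \<longrightarrow> \<bar>F y - F x\<bar> < e" using R x e by blast
      obtain d' where d': "d' > 0" "nbox n x d' \<subseteq> V" using V x unfolding openin_Euclidean_iff by blast
      have "nbox n x (min d d') \<subseteq> {x \<in> V. F x \<in> U}"
      proof
        fix y assume y: "y \<in> nbox n x (min d d')"
        then have "y \<in> V" using nbox_mono d' by (meson min.cobounded2 subsetD)
        moreover have "\<bar>F y - F x\<bar> < e" using d y \<open>y \<in> V\<close> nbox_mono by (meson min.cobounded1 subsetD)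
        ultimately show "y \<in> {x \<in> V. F x \<in> U}"
          using e by (auto simp: dist_real_def abs_minus_commute subset_iff)
      qed
      then show "\<exists>e>0. nbox n x e \<subseteq> {x \<in> V. F x \<in> U}"
        using d d' by (intro exI[of _ "min d d'"]) auto
    qed (use VR in auto)
    then show "openin (subtopology (Euclidean_space n) V) {x \<in> topspace (subtopology (Euclidean_space n) V). F x \<in> U}"
      using VR by (simp add: openin_open_subtopology[OF V] ts Int_absorb1) 
  qed simp
qed

text \<open>Hence \<open>partial_deriv\<close>, which evaluates \<open>F\<close> on a whole
  coordinate line, depends only on the values of \<open>F\<close> on an open set around the
  point.\<close>

lemma line_in_open:
  assumes "openin (Euclidean_space n) V" "x \<in> V" "i < n"
  shows "\<forall>\<^sub>F t in nhds (x i). x(i := t) \<in> V"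
proof -
  obtain e where e: "e > 0" "nbox n x e \<subseteq> V" using assms unfolding openin_Euclidean_iff by blast
  have "x \<in> Rn n" using assms openin_subset by blast
  then have "x(i := t) \<in> nbox n x e" if "\<bar>t - x i\<bar> < e" for t
    using that e assms by (auto simp: nbox_def Rn_iff)
  then show ?thesis
    unfolding eventually_nhds_metric using e by (force simp: dist_real_def)
qed

declare Ck_Rn.simps(2) [simp del]

section \<open>Functions of class C^k: locality and algebra\<close>

lemma Ck_imp_continuous:
  assumes "Ck_Rn n k V F"
  shows "continuous_map (subtopology (Euclidean_space n) V) euclideanreal F"
proof (cases k)
  case 0
  then show ?thesis using assms by simp
next
  case (Suc j)
  then show ?thesis using assms by (simp only: Ck_Rn.simps(2))
qed

lemma partial_deriv_cong:
  assumes "openin (Euclidean_space n) V" "x \<in> V" "i < n" "\<And>y. y \<in> V \<Longrightarrow> F y = F' y"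
  shows "partial_deriv i F x = partial_deriv i F' x"
    and "(\<lambda>t. F (x(i := t))) differentiable (at (x i)) \<longleftrightarrow> (\<lambda>t. F' (x(i := t))) differentiable (at (x i))"
proof -
  have ev: "\<forall>\<^sub>F t in nhds (x i). F (x(i := t)) = F' (x(i := t))"
    by (rule eventually_mono[OF line_in_open[OF assms(1-3)]]) (rule assms(4))
  show "partial_deriv i F x = partial_deriv i F' x"
    unfolding partial_deriv_def by (rule deriv_cong_ev[OF ev refl])
  show "(\<lambda>t. F (x(i := t))) differentiable (at (x i)) \<longleftrightarrow> (\<lambda>t. F' (x(i := t))) differentiable (at (x i))"
    unfolding real_differentiable_def by (simp only: DERIV_cong_ev[OF refl ev refl])
qed

lemma Ck_cong_imp:
  assumes V: "openin (Euclidean_space n) V"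
  shows "(\<And>x. x \<in> V \<Longrightarrow> F x = F' x) \<Longrightarrow> Ck_Rn n k V F \<Longrightarrow> Ck_Rn n k V F'"
proof (induction k arbitrary: F F')
  case 0
  have "continuous_map (subtopology (Euclidean_space n) V) euclideanreal F'"
  proof (rule continuous_map_eq)
    show "continuous_map (subtopology (Euclidean_space n) V) euclideanreal F" using 0(2) by simp
  qed (use 0(1) in simp)
  then show ?case by simp
next
  case (Suc k)
  have "continuous_map (subtopology (Euclidean_space n) V) euclideanreal F'"
  proof (rule continuous_map_eq)
    show "continuous_map (subtopology (Euclidean_space n) V) euclideanreal F"
      by (rule Ck_imp_continuous[OF Suc.prems(2)])
  qed (use Suc.prems(1) in simp)
  moreover have "(\<lambda>t. F' (x(i := t))) differentiable at (x i)" if "i < n" "x \<in> V" for i x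
  proof -
    have "(\<lambda>t. F (x(i := t))) differentiable at (x i)"
      using Suc.prems(2) that by (simp only: Ck_Rn.simps(2))
    moreover have "F y = F' y" if "y \<in> V" for y by (rule Suc.prems(1)[OF that])
    ultimately show ?thesis using partial_deriv_cong(2)[OF V that(2,1), of F F'] by blast
  qed
  moreover have "Ck_Rn n k V (partial_deriv i F')" if "i < n" for i
  proof (rule Suc.IH)
    show "Ck_Rn n k V (partial_deriv i F)" using Suc.prems(2) that by (simp only: Ck_Rn.simps(2))
    show "partial_deriv i F x = partial_deriv i F' x" if "x \<in> V" for x
      by (rule partial_deriv_cong(1)[OF V that \<open>i < n\<close>]) (rule Suc.prems(1))
  qed
  ultimately show ?case by (simp only: Ck_Rn.simps(2)) simp
qed

lemma Ck_cong:
  assumes "openin (Euclidean_space n) V" "\<And>x. x \<in> V \<Longrightarrow> F x = F' x"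
  shows "Ck_Rn n k V F \<longleftrightarrow> Ck_Rn n k V F'"
  using Ck_cong_imp[OF assms(1), of F F'] Ck_cong_imp[OF assms(1), of F' F] assms(2)
  by (metis (no_types, lifting))

lemma Ck_Suc_imp: "Ck_Rn n (Suc k) V F \<Longrightarrow> Ck_Rn n k V F"
proof (induction k arbitrary: F)
  case (Suc k)
  show ?case
    unfolding Ck_Rn.simps(2)[of n k]
  proof (intro conjI allI impI ballI)
    fix i assume i: "i < n"
    then have "Ck_Rn n (Suc k) V (partial_deriv i F)"
      using Suc.prems unfolding Ck_Rn.simps(2)[of n "Suc k"] by blast
    then show "Ck_Rn n k V (partial_deriv i F)" by (rule Suc.IH)
    fix x assume "x \<in> V"
    then show "(\<lambda>t. F (x(i := t))) differentiable at (x i)"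
      using Suc.prems i unfolding Ck_Rn.simps(2)[of n "Suc k"] by blast
  qed (rule Ck_imp_continuous[OF Suc.prems])
qed (simp add: Ck_imp_continuous)

lemma Ck_subset: "Ck_Rn n k V F \<Longrightarrow> W \<subseteq> V \<Longrightarrow> Ck_Rn n k W F"
proof (induction k arbitrary: F)
  case 0
  then show ?case
    using continuous_map_from_subtopology_mono unfolding Ck_Rn.simps by blast
next
  case (Suc k)
  then show ?case
    using continuous_map_from_subtopology_mono unfolding Ck_Rn.simps by blast
qed

lemma continuous_Euclid_local:
  assumes V: "openin (Euclidean_space n) V"
    and loc: "\<And>x. x \<in> V \<Longrightarrow> \<exists>W. openin (Euclidean_space n) W \<and> x \<in> W \<and>
      continuous_map (subtopology (Euclidean_space n) W) euclideanreal F"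
  shows "continuous_map (subtopology (Euclidean_space n) V) euclideanreal F"
  unfolding continuous_Euclid_iff[OF V]
proof (intro ballI allI impI)
  fix x and e :: real assume x: "x \<in> V" and e: "e > 0"
  obtain W where W: "openin (Euclidean_space n) W" "x \<in> W"
    "continuous_map (subtopology (Euclidean_space n) W) euclideanreal F" using loc x by metis
  obtain d where d: "d > 0" "\<forall>y\<in>nbox n x d. y \<in> W \<longrightarrow> \<bar>F y - F x\<bar> < e"
    using W(3) W(2) e unfolding continuous_Euclid_iff[OF W(1)] by metis
  obtain d' where d': "d' > 0" "nbox n x d' \<subseteq> W" using W unfolding openin_Euclidean_iff by metis
  have "\<bar>F y - F x\<bar> < e" if "y \<in> nbox n x (min d d')" for y
  proof -
    have "y \<in> W" using that d' nbox_mono by (meson min.cobounded2 subsetD)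
    then show ?thesis using that d nbox_mono by (meson min.cobounded1 subsetD)
  qed
  then show "\<exists>d>0. \<forall>y\<in>nbox n x d. y \<in> V \<longrightarrow> \<bar>F y - F x\<bar> < e"
    using d d' by (intro exI[of _ "min d d'"]) auto
qed

lemma Ck_local:
  assumes V: "openin (Euclidean_space n) V"
    and "\<And>x. x \<in> V \<Longrightarrow> \<exists>W. openin (Euclidean_space n) W \<and> x \<in> W \<and> Ck_Rn n k W F"
  shows "Ck_Rn n k V F"
  using assms(2)
proof (induction k arbitrary: F)
  case 0
  then show ?case using continuous_Euclid_local[OF V, of F] unfolding Ck_Rn.simps by blast
next
  case (Suc k)
  have "Ck_Rn n k V (partial_deriv i F)" if "i < n" for i
  proof (rule Suc.IH)
    fix x assume "x \<in> V"
    from Suc.prems[OF this] that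
    show "\<exists>W. openin (Euclidean_space n) W \<and> x \<in> W \<and> Ck_Rn n k W (partial_deriv i F)"
      unfolding Ck_Rn.simps by blast
  qed
  moreover have "(\<lambda>t. F (x(i := t))) differentiable at (x i)" if "i < n" "x \<in> V" for i x
    using Suc.prems[OF that(2)] that unfolding Ck_Rn.simps by blast
  moreover have "continuous_map (subtopology (Euclidean_space n) V) euclideanreal F"
    using continuous_Euclid_local[OF V, of F] Suc.prems unfolding Ck_Rn.simps by blast
  ultimately show ?case unfolding Ck_Rn.simps by blast
qed

lemma Ck_partial_DERIV:
  assumes "Ck_Rn n (Suc k) V F" "x \<in> V" "i < n"
  shows "((\<lambda>t. F (x(i := t))) has_real_derivative partial_deriv i F x) (at (x i))"
  using assms by (simp add: Ck_Rn.simps(2) partial_deriv_def DERIV_deriv_iff_real_differentiable)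

lemma Ck_const: "Ck_Rn n k V (\<lambda>x. c)"
proof (induction k arbitrary: c)
  case (Suc k)
  have "partial_deriv i (\<lambda>x. c) = (\<lambda>x. 0)" for i
    by (simp add: partial_deriv_def fun_eq_iff)
  then show ?case using Suc by (simp add: Ck_Rn.simps(2))
qed simp

lemma Ck_coord: "Ck_Rn n k V (\<lambda>x. x i)"
proof -
  have c: "continuous_map (subtopology (Euclidean_space n) V) euclideanreal (\<lambda>x. x i)"
    unfolding Euclidean_space_def
    by (intro continuous_map_from_subtopology continuous_map_product_projection) simp
  have "partial_deriv j (\<lambda>x. x i) = (\<lambda>x. if i = j then 1 else 0)" for j
    by (auto simp: partial_deriv_def)
  moreover have "(\<lambda>t. (x(j := t)) i) differentiable at (x j)" for x :: "nat \<Rightarrow> real" and j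
    by (cases "i = j") auto
  moreover have "Ck_Rn n k V (\<lambda>x. if i = j then 1 else 0)" for j k
    by (rule Ck_const)
  ultimately show ?thesis using c by (cases k) (simp_all add: Ck_Rn.simps(2) del: fun_upd_apply)
qed

lemma Ck_add:
  assumes V: "openin (Euclidean_space n) V"
  shows "Ck_Rn n k V F \<Longrightarrow> Ck_Rn n k V H \<Longrightarrow> Ck_Rn n k V (\<lambda>x. F x + H x)"
proof (induction k arbitrary: F H)
  case 0
  then show ?case by (simp add: continuous_map_add)
next
  case (Suc k)
  have D: "((\<lambda>t. F (x(i := t)) + H (x(i := t))) has_real_derivative
     partial_deriv i F x + partial_deriv i H x) (at (x i))" if "i < n" "x \<in> V" for i x
    by (intro DERIV_add Ck_partial_DERIV[OF Suc.prems(1)] Ck_partial_DERIV[OF Suc.prems(2)] that)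
  have "Ck_Rn n k V (partial_deriv i (\<lambda>x. F x + H x))" if "i < n" for i
  proof -
    have "partial_deriv i (\<lambda>x. F x + H x) x = partial_deriv i F x + partial_deriv i H x" if "x \<in> V" for x
      using D[OF \<open>i < n\<close> that] by (simp add: partial_deriv_def DERIV_imp_deriv)
    then show ?thesis
      using Ck_cong[OF V] Suc that by (metis (no_types, lifting) Ck_Rn.simps(2))
  qed
  then show ?case
    using Suc.prems D unfolding Ck_Rn.simps real_differentiable_def
    by (fast intro: continuous_map_add)
qed

lemma Ck_mult:
  assumes V: "openin (Euclidean_space n) V"
  shows "Ck_Rn n k V F \<Longrightarrow> Ck_Rn n k V H \<Longrightarrow> Ck_Rn n k V (\<lambda>x. F x * H x)"
proof (induction k arbitrary: F H)
  case 0
  then show ?case by (simp add: continuous_map_real_mult)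
next
  case (Suc k)
  have D: "((\<lambda>t. F (x(i := t)) * H (x(i := t))) has_real_derivative
     partial_deriv i F x * H x + partial_deriv i H x * F x) (at (x i))" if "i < n" "x \<in> V" for i x
    using DERIV_mult[OF Ck_partial_DERIV[OF Suc.prems(1) that(2,1)] Ck_partial_DERIV[OF Suc.prems(2) that(2,1)]]
    by (simp only: fun_upd_triv)
  have "Ck_Rn n k V (partial_deriv i (\<lambda>x. F x * H x))" if "i < n" for i
  proof -
    have "partial_deriv i (\<lambda>x. F x * H x) x = partial_deriv i F x * H x + partial_deriv i H x * F x" if "x \<in> V" for x
      using D[OF \<open>i < n\<close> that] by (simp add: partial_deriv_def DERIV_imp_deriv)
    moreover have "Ck_Rn n k V (\<lambda>x. partial_deriv i F x * H x + partial_deriv i H x * F x)"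
      using Suc that Ck_Suc_imp[OF Suc.prems(1)] Ck_Suc_imp[OF Suc.prems(2)]
      by (intro Ck_add[OF V] Suc.IH) (simp_all add: Ck_Rn.simps(2))
    ultimately show ?thesis
      using Ck_cong[OF V] by (metis (no_types, lifting))
  qed
  then show ?case
    using Suc.prems D unfolding Ck_Rn.simps real_differentiable_def
    by (fast intro: continuous_map_real_mult)
qed

lemma Ck_sum:
  assumes V: "openin (Euclidean_space n) V" and "\<And>i. i < m \<Longrightarrow> Ck_Rn n k V (F i)"
  shows "Ck_Rn n k V (\<lambda>x. \<Sum>i<(m::nat). F i x)"
  using assms(2)
proof (induction m)
  case (Suc m)
  show ?case
    unfolding sum.lessThan_Suc using Suc by (intro Ck_add[OF V] Suc.IH Suc.prems) auto
qed (simp add: Ck_const)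

lemma Ck_inverse:
  assumes V: "openin (Euclidean_space n) V" and nz: "\<And>x. x \<in> V \<Longrightarrow> F x \<noteq> 0"
  shows "Ck_Rn n k V F \<Longrightarrow> Ck_Rn n k V (\<lambda>x. inverse (F x))"
proof (induction k)
  case 0
  have "topspace (subtopology (Euclidean_space n) V) = V"
    using openin_subset[OF V] by auto
  with 0 nz show ?case
    unfolding Ck_Rn.simps by (intro continuous_map_real_inverse) simp_all
next
  case (Suc k)
  \<comment> \<open>The derivative of 1/F is written through 1/F itself, so that the induction
    hypothesis covers every factor.\<close>
  have D: "((\<lambda>t. inverse (F (x(i := t)))) has_real_derivative
     (-1) * (partial_deriv i F x * (inverse (F x) * inverse (F x)))) (at (x i))" if "i < n" "x \<in> V" for i x
  proof -
    have "((\<lambda>t. inverse (F (x(i := t)))) has_real_derivative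
      - (inverse (F x) * partial_deriv i F x * inverse (F x))) (at (x i))"
      using DERIV_inverse'[OF Ck_partial_DERIV[OF Suc.prems that(2,1)]] nz[OF that(2)]
      unfolding fun_upd_triv by blast
    moreover have "- (inverse (F x) * partial_deriv i F x * inverse (F x)) =
      (-1) * (partial_deriv i F x * (inverse (F x) * inverse (F x)))" by algebra
    ultimately show ?thesis by metis
  qed
  have "Ck_Rn n k V (partial_deriv i (\<lambda>x. inverse (F x)))" if "i < n" for i
  proof -
    have "partial_deriv i (\<lambda>x. inverse (F x)) x = (-1) * (partial_deriv i F x * (inverse (F x) * inverse (F x)))"
      if "x \<in> V" for x
      using D[OF \<open>i < n\<close> that] by (simp add: partial_deriv_def DERIV_imp_deriv)
    moreover have "Ck_Rn n k V (\<lambda>x. (-1) * (partial_deriv i F x * (inverse (F x) * inverse (F x))))"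
      using Suc that Ck_Suc_imp[OF Suc.prems(1)]
      by (intro Ck_mult[OF V] Suc.IH Ck_const) (simp_all add: Ck_Rn.simps(2))
    ultimately show ?thesis
      using Ck_cong[OF V] by (metis (no_types, lifting))
  qed
  moreover have "topspace (subtopology (Euclidean_space n) V) = V"
    using openin_subset[OF V] by auto
  then have "continuous_map (subtopology (Euclidean_space n) V) euclideanreal (\<lambda>x. inverse (F x))"
    using nz Ck_imp_continuous[OF Suc.prems] by (intro continuous_map_real_inverse) simp_all
  ultimately show ?case
    using D unfolding Ck_Rn.simps real_differentiable_def by fast
qed

section \<open>Strict differentiability and the chain rule\<close>

lemma C1_line_strict:
  assumes C: "Ck_Rn n (Suc k) V F" and box: "nbox n x0 r \<subseteq> V"
    and bd: "\<And>y. y \<in> nbox n x0 r \<Longrightarrow> \<bar>partial_deriv i F y - D\<bar> \<le> e"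
    and y: "y \<in> nbox n x0 r" and i: "i < n" and a: "\<bar>a - x0 i\<bar> < r"
  shows "\<bar>F (y(i := a)) - F y - D * (a - y i)\<bar> \<le> e * \<bar>a - y i\<bar>"
proof -
  define S where "S = {t. \<bar>t - x0 i\<bar> < r}"
  have S: "S = ball (x0 i) r" by (auto simp: S_def dist_real_def)
  have mem: "y(i := t) \<in> nbox n x0 r" if "t \<in> S" for t
    using y i that by (auto simp: nbox_def Rn_iff S_def)
  have der: "((\<lambda>t. F (y(i := t)) - D * t) has_field_derivative
      partial_deriv i F (y(i := t)) - D) (at t within S)" if "t \<in> S" for t
  proof -
    have "((\<lambda>s. F ((y(i := t))(i := s))) has_real_derivative partial_deriv i F (y(i := t))) (at ((y(i := t)) i))"
      by (rule Ck_partial_DERIV[OF C _ i]) (use mem[OF that] box in blast)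
    then have "((\<lambda>s. F (y(i := s))) has_real_derivative partial_deriv i F (y(i := t))) (at t)"
      by simp
    moreover have "((\<lambda>s. D * s) has_real_derivative D) (at t)"
      by (rule DERIV_cmult_Id)
    ultimately show ?thesis
      using DERIV_diff has_field_derivative_at_within by blast
  qed
  \<comment> \<open>Mean value inequality for \<open>F\<close> minus the linear function of slope
    \<open>D\<close>, whose derivative along the line is bounded by \<open>e\<close>.\<close>
  have "norm ((\<lambda>t. F (y(i := t)) - D * t) a - (\<lambda>t. F (y(i := t)) - D * t) (y i)) \<le> e * norm (a - y i)"
  proof (rule field_differentiable_bound[OF _ der])
    show "convex S" by (simp add: S)
    show "norm (partial_deriv i F (y(i := t)) - D) \<le> e" if "t \<in> S" for t
      using bd[OF mem[OF that]] by simp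
    show "a \<in> S" "y i \<in> S" using a y i by (auto simp: S_def nbox_def)
  qed
  then show ?thesis by (simp add: algebra_simps)
qed

text \<open>The difference of values is telescoped, changing one coordinate at a time.\<close>

lemma C1_strict:
  assumes V: "openin (Euclidean_space n) V" and C: "Ck_Rn n (Suc k) V F" and x0: "x0 \<in> V" and e: "e > 0"
  shows "\<exists>r>0. nbox n x0 r \<subseteq> V \<and> (\<forall>z\<in>nbox n x0 r. \<forall>z'\<in>nbox n x0 r.
      \<bar>F z' - F z - (\<Sum>i<n. partial_deriv i F x0 * (z' i - z i))\<bar> \<le> e * (\<Sum>i<n. \<bar>z' i - z i\<bar>))"
proof -
  obtain r0 where r0: "r0 > 0" "nbox n x0 r0 \<subseteq> V"
    using V x0 unfolding openin_Euclidean_iff by metis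
  have "\<exists>d>0. \<forall>y\<in>nbox n x0 d. y \<in> V \<longrightarrow> \<bar>partial_deriv i F y - partial_deriv i F x0\<bar> < e" if "i < n" for i
  proof -
    have "Ck_Rn n k V (partial_deriv i F)" using C that by (simp only: Ck_Rn.simps(2))
    from Ck_imp_continuous[OF this] show ?thesis
      using x0 e unfolding continuous_Euclid_iff[OF V] by metis
  qed
  then obtain d where d: "\<And>i. i < n \<Longrightarrow> 0 < d i"
    "\<And>i y. i < n \<Longrightarrow> y \<in> nbox n x0 (d i) \<Longrightarrow> y \<in> V \<Longrightarrow> \<bar>partial_deriv i F y - partial_deriv i F x0\<bar> < e"
    by metis
  obtain r1 where r1: "0 < r1" "\<And>i. i < n \<Longrightarrow> r1 \<le> d i" using finite_pos_lower_bound d(1) by metis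
  define r where "r = min r0 r1"
  have "nbox n x0 r \<subseteq> nbox n x0 r0" by (rule nbox_mono) (simp add: r_def)
  with r0 r1 have r: "r > 0" "nbox n x0 r \<subseteq> V" by (auto simp: r_def)
  have bd: "\<bar>partial_deriv i F y - partial_deriv i F x0\<bar> \<le> e" if "i < n" "y \<in> nbox n x0 r" for i y
  proof -
    have "y \<in> nbox n x0 (d i)"
      using that(2) r1(2)[OF that(1)] nbox_mono[of r "d i" n x0] unfolding r_def by (meson min.coboundedI2 subsetD)
    then show ?thesis using d(2)[OF that(1)] that(2) r(2) by (meson less_imp_le subsetD)
  qed
  show ?thesis
  proof (intro exI[of _ r] conjI ballI r)
    fix z z' assume z: "z \<in> nbox n x0 r" and z': "z' \<in> nbox n x0 r"
    define h where "h m = (\<lambda>i. if i < m then z' i else z i)" for m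
    have h: "h m \<in> nbox n x0 r" for m
      using z z' by (auto simp: nbox_def h_def Rn_iff)
    have "\<bar>F (h m) - F z - (\<Sum>i<m. partial_deriv i F x0 * (z' i - z i))\<bar> \<le> e * (\<Sum>i<m. \<bar>z' i - z i\<bar>)"
      if "m \<le> n" for m
      using that
    proof (induction m)
      case 0
      then show ?case by (simp add: h_def)
    next
      case (Suc m)
      have upd: "h (Suc m) = (h m)(m := z' m)" by (auto simp: h_def fun_eq_iff less_Suc_eq)
      have "\<bar>F ((h m)(m := z' m)) - F (h m) - partial_deriv m F x0 * (z' m - h m m)\<bar> \<le> e * \<bar>z' m - h m m\<bar>"
        by (rule C1_line_strict[OF C r(2) bd h]) (use Suc.prems z' in \<open>auto simp: nbox_def\<close>)
      then have "\<bar>F (h (Suc m)) - F (h m) - partial_deriv m F x0 * (z' m - z m)\<bar> \<le> e * \<bar>z' m - z m\<bar>"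
        unfolding upd by (simp add: h_def)
      moreover have "\<bar>F (h m) - F z - (\<Sum>i<m. partial_deriv i F x0 * (z' i - z i))\<bar> \<le> e * (\<Sum>i<m. \<bar>z' i - z i\<bar>)"
        using Suc by simp
      ultimately show ?case
        by (simp add: distrib_left)
    qed
    moreover have "h n = z'" using z z' by (auto simp: h_def fun_eq_iff nbox_def Rn_iff)
    ultimately show "\<bar>F z' - F z - (\<Sum>i<n. partial_deriv i F x0 * (z' i - z i))\<bar> \<le> e * (\<Sum>i<n. \<bar>z' i - z i\<bar>)"
      by force
  qed
qed

text \<open>The increment of \<open>F\<close> is its linear part plus a remainder \<open>R\<close>.
  Strict differentiability at \<open>c t0\<close> makes \<open>R\<close> small relative to the
  increment of \<open>c\<close>, which is itself of order \<open>t - t0\<close>. The curve stays in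
  \<open>Rn n\<close> near \<open>t0\<close>, as \<open>F\<close> is controlled only there.\<close>

lemma C1_chain:
  fixes c :: "real \<Rightarrow> nat \<Rightarrow> real"
  assumes V: "openin (Euclidean_space n) V" and C: "Ck_Rn n (Suc k) V F" and x0: "c t0 \<in> V"
    and cR: "\<forall>\<^sub>F t in nhds t0. c t \<in> Rn n"
    and dc: "\<And>i. i < n \<Longrightarrow> ((\<lambda>t. c t i) has_real_derivative c' i) (at t0)"
  shows "((\<lambda>t. F (c t)) has_real_derivative (\<Sum>i<n. partial_deriv i F (c t0) * c' i)) (at t0)"
proof -
  define R where "R t = F (c t) - F (c t0) - (\<Sum>i<n. partial_deriv i F (c t0) * (c t i - c t0 i))" for t
  have q: "((\<lambda>t. (c t i - c t0 i) / (t - t0)) \<longlongrightarrow> c' i) (at t0)" if "i < n" for i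
    using dc[OF that] by (simp add: has_field_derivative_iff)
  have lim0: "((\<lambda>t. R t / (t - t0)) \<longlongrightarrow> 0) (at t0)"
  proof (rule tendstoI)
    fix e :: real assume e: "e > 0"
    \<comment> \<open>\<open>B\<close> eventually bounds the sum of the absolute difference
      quotients; the accuracy \<open>e / (2 * B)\<close> then makes the remainder quotient smaller
      than \<open>e\<close>.\<close>
    define B where "B = (\<Sum>i<n. \<bar>c' i\<bar>) + 1"
    have B: "B > 0" by (simp add: B_def add_nonneg_pos sum_nonneg)
    have eB: "e / (2 * B) > 0" using e B by simp
    obtain r where r: "r > 0" "nbox n (c t0) r \<subseteq> V"
      "\<And>z z'. z \<in> nbox n (c t0) r \<Longrightarrow> z' \<in> nbox n (c t0) r \<Longrightarrow>
      \<bar>F z' - F z - (\<Sum>i<n. partial_deriv i F (c t0) * (z' i - z i))\<bar> \<le> e / (2 * B) * (\<Sum>i<n. \<bar>z' i - z i\<bar>)"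
      using C1_strict[OF V C x0 eB] by blast
    have c0: "c t0 \<in> nbox n (c t0) r" using eventually_nhds_x_imp_x[OF cR] r(1) by (rule center_in_nbox)
    have "\<forall>\<^sub>F t in at t0. \<bar>c t i - c t0 i\<bar> < r" if "i < n" for i
    proof -
      have "((\<lambda>t. c t i) \<longlongrightarrow> c t0 i) (at t0)"
        using DERIV_isCont[OF dc[OF that]] by (simp add: isCont_def)
      from tendstoD[OF this r(1)] show ?thesis by (simp add: dist_real_def)
    qed
    then have "\<forall>\<^sub>F t in at t0. \<forall>i\<in>{..<n}. \<bar>c t i - c t0 i\<bar> < r"
      by (intro eventually_ball_finite) auto
    moreover have "\<forall>\<^sub>F t in at t0. c t \<in> Rn n"
      using cR by (simp add: eventually_at_filter eventually_mono)
    moreover have "\<forall>\<^sub>F t in at t0. (\<Sum>i<n. \<bar>(c t i - c t0 i) / (t - t0)\<bar>) < B"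
    proof -
      have "((\<lambda>t. \<Sum>i<n. \<bar>(c t i - c t0 i) / (t - t0)\<bar>) \<longlongrightarrow> (\<Sum>i<n. \<bar>c' i\<bar>)) (at t0)"
        by (intro tendsto_sum tendsto_rabs q) simp
      then show ?thesis by (rule order_tendstoD) (simp add: B_def)
    qed
    moreover have "\<forall>\<^sub>F t in at t0. t \<noteq> t0" by (simp add: eventually_at_filter)
    ultimately show "\<forall>\<^sub>F t in at t0. dist (R t / (t - t0)) 0 < e"
    proof eventually_elim
      case (elim t)
      have ct: "c t \<in> nbox n (c t0) r" using elim by (simp add: nbox_def)
      have "\<bar>R t\<bar> \<le> e / (2 * B) * (\<Sum>i<n. \<bar>c t i - c t0 i\<bar>)"
        unfolding R_def by (rule r(3)[OF c0 ct])
      moreover have "(\<Sum>i<n. \<bar>c t i - c t0 i\<bar>) = \<bar>t - t0\<bar> * (\<Sum>i<n. \<bar>(c t i - c t0 i) / (t - t0)\<bar>)"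
        unfolding sum_distrib_left using elim(4) by (intro sum.cong) (auto simp: abs_divide)
      ultimately have "\<bar>R t\<bar> \<le> e / (2 * B) * (\<bar>t - t0\<bar> * (\<Sum>i<n. \<bar>(c t i - c t0 i) / (t - t0)\<bar>))" by simp
      also have "\<dots> \<le> e / (2 * B) * (\<bar>t - t0\<bar> * B)"
        using elim e B by (intro mult_left_mono) auto
      also have "\<dots> = e / 2 * \<bar>t - t0\<bar>" using B by simp
      also have "\<dots> < e * \<bar>t - t0\<bar>" using e elim by simp
      finally have "\<bar>R t\<bar> / \<bar>t - t0\<bar> < e" using elim(4) by (simp add: divide_less_eq)
      then show ?case by (simp add: abs_divide)
    qed
  qed
  have "((\<lambda>t. R t / (t - t0) + (\<Sum>i<n. partial_deriv i F (c t0) * ((c t i - c t0 i) / (t - t0))))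
      \<longlongrightarrow> 0 + (\<Sum>i<n. partial_deriv i F (c t0) * c' i)) (at t0)"
    by (intro tendsto_add lim0 tendsto_sum tendsto_mult tendsto_const q) simp
  moreover have "R t / (t - t0) + (\<Sum>i<n. partial_deriv i F (c t0) * ((c t i - c t0 i) / (t - t0)))
      = (F (c t) - F (c t0)) / (t - t0)" for t
    by (simp add: R_def diff_divide_distrib sum_divide_distrib right_diff_distrib sum_subtractf)
  ultimately show ?thesis
    unfolding has_field_derivative_iff by simp
qed

text \<open>By the chain rule the partial derivatives of the composite are sums of products of
  partial derivatives of \<open>f i\<close> with composites of partial derivatives of
  \<open>F\<close>. Therefore \<open>F\<close> is generalised in the induction while the inner
  functions stay fixed. Padding with 0 keeps the tuple in \<open>Rn m\<close>.\<close>

lemma Ck_compose: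
  assumes D: "openin (Euclidean_space m) D" and V: "openin (Euclidean_space n) V"
    and tD: "\<And>x. x \<in> V \<Longrightarrow> (\<lambda>i. if i < m then f i x else 0) \<in> D"
  shows "Ck_Rn m k D F \<Longrightarrow> (\<And>i. i < m \<Longrightarrow> Ck_Rn n k V (f i)) \<Longrightarrow>
    Ck_Rn n k V (\<lambda>x. F (\<lambda>i. if i < m then f i x else 0))"
proof (induction k arbitrary: F)
  case 0
  have "continuous_map (subtopology (Euclidean_space n) V) (Euclidean_space m) (\<lambda>x i. if i < m then f i x else 0)"
    unfolding continuous_map_componentwise_Euclidean_space using 0 by simp
  then have "continuous_map (subtopology (Euclidean_space n) V) (subtopology (Euclidean_space m) D) (\<lambda>x i. if i < m then f i x else 0)"
    unfolding continuous_map_in_subtopology using tD by auto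
  from continuous_map_compose[OF this, of euclideanreal F] 0 show ?case
    by (simp add: o_def)
next
  case (Suc k)
  let ?t = "\<lambda>x i. if i < m then f i x else 0"
  have lo: "Ck_Rn n k V (f i)" if "i < m" for i using Suc.prems(2)[OF that] by (rule Ck_Suc_imp)
  have cont: "continuous_map (subtopology (Euclidean_space n) V) euclideanreal (\<lambda>x. F (?t x))"
    by (rule Ck_imp_continuous, rule Suc.IH) (auto intro: lo Ck_Suc_imp Suc.prems(1))
  have D: "((\<lambda>s. F (?t (x(j := s)))) has_real_derivative
     (\<Sum>i<m. partial_deriv i F (?t x) * partial_deriv j (f i) x)) (at (x j))" if "j < n" "x \<in> V" for j x
  proof -
    have "((\<lambda>s. F (?t (x(j := s)))) has_real_derivative
     (\<Sum>i<m. partial_deriv i F (?t (x(j := x j))) * partial_deriv j (f i) x)) (at (x j))"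
    proof (rule C1_chain[OF D Suc.prems(1)])
      show "?t (x(j := x j)) \<in> D" using tD[OF that(2)] unfolding fun_upd_triv .
      show "\<forall>\<^sub>F s in nhds (x j). ?t (x(j := s)) \<in> Rn m"
        by (rule always_eventually) (simp add: Rn_iff)
      show "((\<lambda>s. ?t (x(j := s)) i) has_real_derivative partial_deriv j (f i) x) (at (x j))" if "i < m" for i
        using Ck_partial_DERIV[OF Suc.prems(2)[OF that] \<open>x \<in> V\<close> \<open>j < n\<close>] that by (simp del: fun_upd_apply)
    qed
    then show ?thesis by (simp only: fun_upd_triv)
  qed
  have "Ck_Rn n k V (partial_deriv j (\<lambda>x. F (?t x)))" if j: "j < n" for j
  proof -
    have "Ck_Rn n k V (\<lambda>x. \<Sum>i<m. partial_deriv i F (?t x) * partial_deriv j (f i) x)"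
    proof (intro Ck_sum[OF V] Ck_mult[OF V])
      fix i assume i: "i < m"
      show "Ck_Rn n k V (\<lambda>x. partial_deriv i F (?t x))"
        using Suc.prems(1) i by (intro Suc.IH lo) (simp add: Ck_Rn.simps(2))
      show "Ck_Rn n k V (partial_deriv j (f i))"
        using Suc.prems(2)[OF i] j by (simp add: Ck_Rn.simps(2))
    qed
    then show ?thesis
    proof (rule Ck_cong_imp[OF V, rotated])
      fix x assume "x \<in> V"
      from D[OF j this] show "(\<Sum>i<m. partial_deriv i F (?t x) * partial_deriv j (f i) x) = partial_deriv j (\<lambda>x. F (?t x)) x"
        unfolding partial_deriv_def by (rule DERIV_imp_deriv[symmetric])
    qed
  qed
  moreover have "(\<lambda>s. F (?t (x(j := s)))) differentiable at (x j)" if "j < n" "x \<in> V" for j x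
    using D[OF that] real_differentiable_def by blast
  ultimately show ?case using cont by (simp only: Ck_Rn.simps(2)) blast
qed

text \<open>The second difference is the increment over [0, h] of \<phi>, a difference in direction
  \<open>j\<close>. The mean value theorem in direction \<open>i\<close> turns it into
  \<open>h\<close> times the difference of \<open>partial_deriv i F\<close> at two points that
  differ by \<open>h\<close> in coordinate \<open>j\<close>, and strict differentiability of
  \<open>partial_deriv i F\<close> at \<open>x\<close> estimates that difference.\<close>

lemma second_difference_bound:
  assumes V: "openin (Euclidean_space n) V" and C: "Ck_Rn n (Suc (Suc k)) V F" and x: "x \<in> V"
    and ij: "i < n" "j < n" "i \<noteq> j" and e: "e > 0"
  shows "\<exists>r>0. \<forall>h. 0 < h \<and> h < r \<longrightarrow>
    \<bar>F (x(i := x i + h, j := x j + h)) - F (x(i := x i + h)) - F (x(j := x j + h)) + F x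
      - partial_deriv j (partial_deriv i F) x * h\<^sup>2\<bar> \<le> e * h\<^sup>2"
proof -
  have Ci: "Ck_Rn n (Suc k) V (partial_deriv i F)" using C ij by (simp add: Ck_Rn.simps(2)[of n "Suc k"])
  obtain r where r: "r > 0" "nbox n x r \<subseteq> V"
    "\<And>z z'. z \<in> nbox n x r \<Longrightarrow> z' \<in> nbox n x r \<Longrightarrow>
      \<bar>partial_deriv i F z' - partial_deriv i F z - (\<Sum>l<n. partial_deriv l (partial_deriv i F) x * (z' l - z l))\<bar> \<le> e * (\<Sum>l<n. \<bar>z' l - z l\<bar>)"
    using C1_strict[OF V Ci x e] by blast
  have xR: "x \<in> Rn n" using V x openin_subset by blast
  show ?thesis
  proof (intro exI[of _ r] conjI allI impI r(1), elim conjE)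
    fix h :: real assume h: "0 < h" "h < r"
    define \<phi> where "\<phi> s = F (x(i := x i + s, j := x j + h)) - F (x(i := x i + s))" for s
    define p where "p s = x(i := x i + s)" for s
    define q where "q s = x(i := x i + s, j := x j + h)" for s
    have pq: "p s \<in> nbox n x r" "q s \<in> nbox n x r" if "0 \<le> s" "s \<le> h" for s
      using that h xR ij by (auto simp: p_def q_def nbox_def Rn_iff)
    have der: "(\<phi> has_real_derivative partial_deriv i F (q s) - partial_deriv i F (p s)) (at s)"
      if "0 \<le> s" "s \<le> h" for s
    proof -
      have "((\<lambda>u. F ((p s)(i := u))) has_real_derivative partial_deriv i F (p s)) (at (x i + s))"
           "((\<lambda>u. F ((q s)(i := u))) has_real_derivative partial_deriv i F (q s)) (at (x i + s))"
        using Ck_partial_DERIV[OF C, of "p s" i] Ck_partial_DERIV[OF C, of "q s" i] pq[OF that] r(2) ij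
        by (auto simp: p_def q_def)
      then have "((\<lambda>u. F ((q s)(i := x i + u)) - F ((p s)(i := x i + u))) has_real_derivative
          partial_deriv i F (q s) - partial_deriv i F (p s)) (at s)"
        by (intro DERIV_diff) (simp_all add: DERIV_shift add.commute)
      moreover have "(\<lambda>u. F ((q s)(i := x i + u)) - F ((p s)(i := x i + u))) = \<phi>"
        using ij by (auto simp: \<phi>_def p_def q_def fun_eq_iff fun_upd_twist intro!: arg_cong[of _ _ F])
      ultimately show ?thesis by simp
    qed
    obtain s where s: "0 < s" "s < h" "\<phi> h - \<phi> 0 = (h - 0) * (partial_deriv i F (q s) - partial_deriv i F (p s))"
      using MVT2[of 0 h \<phi> "\<lambda>s. partial_deriv i F (q s) - partial_deriv i F (p s)"] h der by auto
    have diff: "q s l - p s l = (if l = j then h else 0)" for l using ij by (auto simp: p_def q_def)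
    have "\<bar>partial_deriv i F (q s) - partial_deriv i F (p s) - partial_deriv j (partial_deriv i F) x * h\<bar> \<le> e * h"
      using r(3)[OF pq(1) pq(2), of s s] s ij h unfolding diff by (simp add: if_distrib sum.delta cong: if_cong)
    then have "h * \<bar>partial_deriv i F (q s) - partial_deriv i F (p s) - partial_deriv j (partial_deriv i F) x * h\<bar> \<le> h * (e * h)"
      using h by (intro mult_left_mono) auto
    then have "\<bar>\<phi> h - \<phi> 0 - partial_deriv j (partial_deriv i F) x * h\<^sup>2\<bar> \<le> e * h\<^sup>2"
      unfolding s(3) using h by (simp add: abs_mult_pos' power2_eq_square algebra_simps flip: abs_mult_pos)
    moreover have "\<phi> h - \<phi> 0 = F (x(i := x i + h, j := x j + h)) - F (x(i := x i + h)) - F (x(j := x j + h)) + F x"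
      by (simp add: \<phi>_def)
    ultimately show "\<bar>F (x(i := x i + h, j := x j + h)) - F (x(i := x i + h)) - F (x(j := x j + h)) + F x
      - partial_deriv j (partial_deriv i F) x * h\<^sup>2\<bar> \<le> e * h\<^sup>2" by simp
  qed
qed

text \<open>The second difference does not distinguish \<open>i\<close> from \<open>j\<close>, so
  both mixed derivatives times \<open>h\<^sup>2\<close> approximate the same number.\<close>

lemma partial_deriv_commute:
  assumes V: "openin (Euclidean_space n) V" and C: "Ck_Rn n (Suc (Suc k)) V F" and x: "x \<in> V"
    and ij: "i < n" "j < n"
  shows "partial_deriv j (partial_deriv i F) x = partial_deriv i (partial_deriv j F) x"
proof (cases "i = j")
  case False
  let ?a = "partial_deriv j (partial_deriv i F) x" and ?b = "partial_deriv i (partial_deriv j F) x"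
  have "\<bar>?a - ?b\<bar> \<le> 0 + e" if "e > 0" for e
  proof -
    have e2: "e / 2 > 0" using that by simp
    obtain r where r: "r > 0" "\<And>h. 0 < h \<Longrightarrow> h < r \<Longrightarrow>
     \<bar>F (x(i := x i + h, j := x j + h)) - F (x(i := x i + h)) - F (x(j := x j + h)) + F x - ?a * h\<^sup>2\<bar> \<le> e/2 * h\<^sup>2"
      using second_difference_bound[OF V C x ij False e2] by blast
    obtain r' where r': "r' > 0" "\<And>h. 0 < h \<Longrightarrow> h < r' \<Longrightarrow>
     \<bar>F (x(j := x j + h, i := x i + h)) - F (x(j := x j + h)) - F (x(i := x i + h)) + F x - ?b * h\<^sup>2\<bar> \<le> e/2 * h\<^sup>2"
      using second_difference_bound[OF V C x ij(2,1) False[symmetric] e2] by blast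
    define h where "h = min r r' / 2"
    have h: "0 < h" "h < r" "h < r'" using r r' by (auto simp: h_def)
    have tw: "x(j := x j + h, i := x i + h) = x(i := x i + h, j := x j + h)" using False by (simp add: fun_upd_twist)
    have "\<bar>(?a - ?b) * h\<^sup>2\<bar> \<le> e * h\<^sup>2"
      using r(2)[OF h(1,2)] r'(2)[OF h(1,3)] unfolding tw left_diff_distrib by linarith
    then have "\<bar>?a - ?b\<bar> * h\<^sup>2 \<le> e * h\<^sup>2" by (simp add: abs_mult)
    then show ?thesis using h(1) by simp
  qed
  then have "\<bar>?a - ?b\<bar> \<le> 0" by (rule field_le_epsilon)
  then show ?thesis by simp
qed simp

text \<open>A quantitative form of injectivity, by elimination of the last column. \<open>A'\<close>
  is what remains after subtracting multiples of a pivot row \<open>i0\<close>; the induction bounds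
  the first \<open>m\<close> coefficients, and the pivot row then bounds the last one. For an
  immersion this turns smallness of image coordinates into smallness of parameters.\<close>

lemma injective_lower_bound:
  fixes A :: "nat \<Rightarrow> nat \<Rightarrow> real"
  assumes "\<And>a. (\<And>i. i < n \<Longrightarrow> (\<Sum>j<m. A i j * a j) = 0) \<Longrightarrow> \<forall>j<m. a j = 0"
  shows "\<exists>c>0. \<forall>a. (\<Sum>j<m. \<bar>a j\<bar>) \<le> c * (\<Sum>i<n. \<bar>\<Sum>j<m. A i j * a j\<bar>)"
  using assms
proof (induction m arbitrary: A)
  case 0
  then show ?case by (intro exI[of _ 1]) simp
next
  case (Suc m)
  have "\<exists>i0<n. A i0 m \<noteq> 0"
  proof (rule ccontr)
    assume "\<not> ?thesis"
    then have "\<forall>j<Suc m. (if j = m then 1 else 0 :: real) = 0"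
      by (intro Suc.prems) (auto intro!: sum.neutral)
    then show False by auto
  qed
  then obtain i0 where i0: "i0 < n" "A i0 m \<noteq> 0" by blast
  define \<rho> where "\<rho> i = A i m / A i0 m" for i
  define A' where "A' i j = A i j - \<rho> i * A i0 j" for i j
  have A': "(\<Sum>j<m. A' i j * a j) = (\<Sum>j<Suc m. A i j * a j) - \<rho> i * (\<Sum>j<Suc m. A i0 j * a j)" for i a
    using i0 by (simp add: A'_def \<rho>_def left_diff_distrib sum_subtractf sum_distrib_left algebra_simps)
  have "\<exists>c>0. \<forall>a. (\<Sum>j<m. \<bar>a j\<bar>) \<le> c * (\<Sum>i<n. \<bar>\<Sum>j<m. A' i j * a j\<bar>)"
  proof (rule Suc.IH)
    fix a assume a: "\<And>i. i < n \<Longrightarrow> (\<Sum>j<m. A' i j * a j) = 0"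
    \<comment> \<open>The last coefficient is chosen to make row \<open>i0\<close> vanish, so that a
      null vector of \<open>A'\<close> extends to one of \<open>A\<close>.\<close>
    define a' where "a' = a(m := - (\<Sum>j<m. A i0 j * a j) / A i0 m)"
    have *: "(\<Sum>j<m. F j * a' j) = (\<Sum>j<m. F j * a j)" for F
      by (intro sum.cong) (auto simp: a'_def)
    have "(\<Sum>j<Suc m. A i0 j * a' j) = 0"
      using i0 by (simp add: *) (simp add: a'_def)
    then have "(\<Sum>j<Suc m. A i j * a' j) = 0" if "i < n" for i
      using A'[of i a'] a[OF that] unfolding * by simp
    then have "\<forall>j<Suc m. a' j = 0" by (rule Suc.prems)
    then show "\<forall>j<m. a j = 0" by (auto simp: a'_def less_Suc_eq split: if_splits)
  qed
  then obtain c where c: "c > 0" "\<And>a. (\<Sum>j<m. \<bar>a j\<bar>) \<le> c * (\<Sum>i<n. \<bar>\<Sum>j<m. A' i j * a j\<bar>)" by blast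
  define P where "P = (\<Sum>i<n. \<bar>\<rho> i\<bar>)"
  define M where "M = (\<Sum>j<m. \<bar>A i0 j\<bar>)"
  have PM: "P \<ge> 0" "M \<ge> 0" by (auto simp: P_def M_def intro: sum_nonneg)
  define C where "C = c * (1 + P) + (1 + M * (c * (1 + P))) / \<bar>A i0 m\<bar>"
  have "(\<Sum>j<Suc m. \<bar>a j\<bar>) \<le> C * (\<Sum>i<n. \<bar>\<Sum>j<Suc m. A i j * a j\<bar>)" for a
  proof -
    define b where "b i = (\<Sum>j<Suc m. A i j * a j)" for i
    define N where "N = (\<Sum>i<n. \<bar>b i\<bar>)"
    have b0: "\<bar>b i0\<bar> \<le> N" unfolding N_def using i0 by (intro member_le_sum) auto
    have "(\<Sum>i<n. \<bar>\<Sum>j<m. A' i j * a j\<bar>) \<le> (\<Sum>i<n. \<bar>b i\<bar> + \<bar>\<rho> i\<bar> * \<bar>b i0\<bar>)"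
      unfolding A' b_def[symmetric] by (intro sum_mono) (simp add: abs_mult[symmetric])
    also have "\<dots> = N + P * \<bar>b i0\<bar>" by (simp add: sum.distrib N_def P_def sum_distrib_right)
    also have "\<dots> \<le> N + P * N" using b0 PM by (intro add_left_mono mult_left_mono)
    finally have "(\<Sum>i<n. \<bar>\<Sum>j<m. A' i j * a j\<bar>) \<le> (1 + P) * N" by (simp add: algebra_simps)
    then have "c * (\<Sum>i<n. \<bar>\<Sum>j<m. A' i j * a j\<bar>) \<le> c * ((1 + P) * N)"
      using c(1) by (intro mult_left_mono) auto
    then have am: "(\<Sum>j<m. \<bar>a j\<bar>) \<le> c * (1 + P) * N"
      using c(2)[of a] by (simp add: mult.assoc)
    have "\<bar>A i0 m\<bar> * \<bar>a m\<bar> = \<bar>b i0 - (\<Sum>j<m. A i0 j * a j)\<bar>"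
      by (simp add: b_def abs_mult)
    also have "\<dots> \<le> N + (\<Sum>j<m. \<bar>A i0 j * a j\<bar>)"
      using b0 sum_abs[of "\<lambda>j. A i0 j * a j" "{..<m}"] by linarith
    also have "(\<Sum>j<m. \<bar>A i0 j * a j\<bar>) \<le> (\<Sum>j<m. M * \<bar>a j\<bar>)"
    proof (intro sum_mono)
      fix j assume "j \<in> {..<m}"
      then have "\<bar>A i0 j\<bar> \<le> M" unfolding M_def by (intro member_le_sum) auto
      then show "\<bar>A i0 j * a j\<bar> \<le> M * \<bar>a j\<bar>" by (simp add: abs_mult mult_right_mono)
    qed
    also have "(\<Sum>j<m. M * \<bar>a j\<bar>) \<le> M * (c * (1 + P) * N)"
      using am PM by (simp add: mult_left_mono flip: sum_distrib_left)
    finally have "\<bar>a m\<bar> \<le> (N + M * (c * (1 + P) * N)) / \<bar>A i0 m\<bar>"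
      using i0 by (simp add: pos_le_divide_eq mult.commute)
    also have "\<dots> = (1 + M * (c * (1 + P))) / \<bar>A i0 m\<bar> * N" by (simp add: algebra_simps)
    finally have "(\<Sum>j<Suc m. \<bar>a j\<bar>) \<le> C * N"
      using am by (simp add: C_def distrib_right)
    then show ?thesis by (simp only: N_def b_def)
  qed
  moreover have "C > 0"
    unfolding C_def using c PM i0 by (intro add_pos_nonneg mult_pos_pos divide_nonneg_nonneg add_nonneg_nonneg mult_nonneg_nonneg) auto
  ultimately show ?case by blast
qed

section \<open>Solving nonlinear equations to first order\<close>

lemma geometric_increments_converge:
  fixes W :: "nat \<Rightarrow> real"
  assumes "\<And>k. \<bar>W (Suc k) - W k\<bar> \<le> C * (1/2) ^ k"
  shows "\<exists>w. W \<longlonglongrightarrow> w"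
proof -
  have "summable (\<lambda>k. W (Suc k) - W k)"
    by (rule summable_comparison_test[where g = "\<lambda>k. C * (1/2) ^ k"]) (use assms in \<open>auto intro: summable_mult\<close>)
  then have "convergent (\<lambda>n. \<Sum>k<n. W (Suc k) - W k)"
    by (simp add: summable_iff_convergent)
  then have "convergent (\<lambda>n. W n - W 0)" by (simp add: sum_lessThan_telescope)
  then have "convergent (\<lambda>n. (W n - W 0) + W 0)" by (intro convergent_add convergent_const)
  then show ?thesis by (simp add: convergent_def)
qed

text \<open>The equation \<open>Y (x0 + t v + B w) = Y x0\<close> is solved for \<open>w\<close> by the contraction
  \<open>w \<mapsto> w - (Y (x0 + t v + B w) - Y x0)\<close>.\<close>

lemma fibre_points_along_kernel:
  fixes Y :: "nat \<Rightarrow> (nat \<Rightarrow> real) \<Rightarrow> real" and B :: "nat \<Rightarrow> nat \<Rightarrow> real" and v :: "nat \<Rightarrow> real"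
  assumes D: "openin (Euclidean_space n) D" and x0: "x0 \<in> D"
    and Y: "\<And>l. l < d \<Longrightarrow> Ck_Rn n (Suc k) D (Y l)"
    and B0: "\<And>j i. n \<le> i \<Longrightarrow> B j i = 0" and v0: "\<And>i. n \<le> i \<Longrightarrow> v i = 0"
    and AB: "\<And>l j. l < d \<Longrightarrow> j < d \<Longrightarrow> (\<Sum>i<n. partial_deriv i (Y l) x0 * B j i) = (if l = j then 1 else 0)"
    and Av: "\<And>l. l < d \<Longrightarrow> (\<Sum>i<n. partial_deriv i (Y l) x0 * v i) = 0"
    and e: "e > 0"
  shows "\<exists>\<delta>>0. \<forall>t. \<bar>t\<bar> < \<delta> \<longrightarrow> (\<exists>w. (\<Sum>j<d. \<bar>w j\<bar>) \<le> e * \<bar>t\<bar> \<and>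
    (\<lambda>i. x0 i + t * v i + (\<Sum>j<d. w j * B j i)) \<in> D \<and>
    (\<forall>l<d. Y l (\<lambda>i. x0 i + t * v i + (\<Sum>j<d. w j * B j i)) = Y l x0))"
proof -
  \<comment> \<open>The summand 1 keeps \<beta> and \<nu> positive when the vectors vanish.\<close>
  define \<beta> where "\<beta> = (\<Sum>j<d. \<Sum>i<n. \<bar>B j i\<bar>) + 1"
  define \<nu> where "\<nu> = (\<Sum>i<n. \<bar>v i\<bar>) + 1"
  have pos: "\<beta> > 0" "\<nu> > 0" by (auto simp: \<beta>_def \<nu>_def intro!: add_nonneg_pos sum_nonneg)
  define d' where "d' = real d + 1"
  have d': "d' > 0" "real d \<le> d'" by (auto simp: d'_def)
  \<comment> \<open>The first term makes the iteration contract by the factor 1/2 in the sum norm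
    over the \<open>d\<close> equations; the second makes the first step at most half of
    \<open>e * \<bar>t\<bar>\<close>.\<close>
  define \<epsilon> where "\<epsilon> = min (1 / (2 * d' * \<beta>)) (e / (2 * d' * \<nu>))"
  have \<epsilon>: "\<epsilon> > 0" "d' * \<epsilon> * \<beta> \<le> 1/2" "d' * \<epsilon> * \<nu> \<le> e/2"
  proof -
    show "\<epsilon> > 0" using pos d' e by (simp add: \<epsilon>_def)
    have "\<epsilon> \<le> 1 / (2 * d' * \<beta>)" "\<epsilon> \<le> e / (2 * d' * \<nu>)" by (simp_all add: \<epsilon>_def)
    then show "d' * \<epsilon> * \<beta> \<le> 1/2" "d' * \<epsilon> * \<nu> \<le> e/2"
      using pos d' by (simp_all add: pos_le_divide_eq algebra_simps)
  qed
  have xR: "x0 \<in> Rn n" using D x0 openin_subset by blast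
  define good where "good l r \<longleftrightarrow> (\<forall>z\<in>nbox n x0 r. \<forall>z'\<in>nbox n x0 r.
      \<bar>Y l z' - Y l z - (\<Sum>i<n. partial_deriv i (Y l) x0 * (z' i - z i))\<bar> \<le> \<epsilon> * (\<Sum>i<n. \<bar>z' i - z i\<bar>))" for l r
  have "\<exists>r>0. good l r" if "l < d" for l
    using C1_strict[OF D Y[OF that] x0 \<epsilon>(1)] unfolding good_def by blast
  then obtain R where R: "\<And>l. l < d \<Longrightarrow> R l > 0" "\<And>l. l < d \<Longrightarrow> good l (R l)"
    by metis
  obtain r0 where r0: "r0 > 0" "nbox n x0 r0 \<subseteq> D"
    using D x0 unfolding openin_Euclidean_iff by metis
  obtain r1 where r1: "0 < r1" "\<And>l. l < d \<Longrightarrow> r1 \<le> R l" using finite_pos_lower_bound R(1) by metis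
  define r where "r = min r0 r1"
  have r: "r > 0" using r0 r1 by (simp add: r_def)
  have rD: "nbox n x0 r \<subseteq> D" using r0 nbox_mono[of r r0 n x0] by (auto simp: r_def)
  have strict: "\<bar>Y l z' - Y l z - (\<Sum>i<n. partial_deriv i (Y l) x0 * (z' i - z i))\<bar> \<le> \<epsilon> * (\<Sum>i<n. \<bar>z' i - z i\<bar>)"
    if "l < d" "z \<in> nbox n x0 r" "z' \<in> nbox n x0 r" for l z z'
  proof -
    have "nbox n x0 r \<subseteq> nbox n x0 (R l)" by (rule nbox_mono) (use r1(2)[OF that(1)] in \<open>simp add: r_def\<close>)
    then show ?thesis using R(2)[OF that(1)] that(2,3) unfolding good_def by blast
  qed
  \<comment> \<open>For such \<open>t\<close> every \<open>w\<close> of sum norm at most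
    \<open>e * \<bar>t\<bar>\<close> moves the point by less than \<open>r\<close> in each
    coordinate, so all iterates remain where \<open>strict\<close> applies.\<close>
  define \<delta> where "\<delta> = r / (\<nu> + e * \<beta>)"
  have \<delta>: "\<delta> > 0" using r pos e by (simp add: \<delta>_def add_pos_pos)
  show ?thesis
  proof (intro exI[of _ \<delta>] conjI \<delta> allI impI)
    fix t :: real assume t: "\<bar>t\<bar> < \<delta>"
    define z where "z w = (\<lambda>i. x0 i + t * v i + (\<Sum>j<d. w j * B j i))" for w
    define n1 where "n1 w = (\<Sum>j<d. \<bar>w j\<bar>)" for w :: "nat \<Rightarrow> real"
    have tr: "\<bar>t\<bar> * (\<nu> + e * \<beta>) < r"
      using t pos e by (simp add: \<delta>_def pos_less_divide_eq add_pos_pos)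
    have B1: "(\<Sum>i<n. \<bar>\<Sum>j<d. w j * B j i\<bar>) \<le> \<beta> * n1 w" for w
    proof -
      have "(\<Sum>i<n. \<bar>\<Sum>j<d. w j * B j i\<bar>) \<le> (\<Sum>i<n. \<Sum>j<d. \<bar>w j\<bar> * \<bar>B j i\<bar>)"
        by (intro sum_mono order_trans[OF sum_abs]) (simp add: abs_mult)
      also have "\<dots> = (\<Sum>j<d. \<bar>w j\<bar> * (\<Sum>i<n. \<bar>B j i\<bar>))"
        unfolding sum_distrib_left by (rule sum.swap)
      also have "\<dots> \<le> (\<Sum>j<d. \<bar>w j\<bar> * \<beta>)"
      proof (intro sum_mono mult_left_mono)
        fix j assume "j \<in> {..<d}"
        then have "(\<Sum>i<n. \<bar>B j i\<bar>) \<le> (\<Sum>j<d. \<Sum>i<n. \<bar>B j i\<bar>)"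
          by (intro member_le_sum[of j _ "\<lambda>j. \<Sum>i<n. \<bar>B j i\<bar>"]) (auto intro: sum_nonneg)
        then show "(\<Sum>i<n. \<bar>B j i\<bar>) \<le> \<beta>" by (simp add: \<beta>_def)
      qed simp
      finally show ?thesis by (simp add: n1_def sum_distrib_left mult.commute)
    qed
    have zin: "z w \<in> nbox n x0 r" if "n1 w \<le> e * \<bar>t\<bar>" for w
    proof -
      have "\<bar>z w i - x0 i\<bar> < r" if i: "i < n" for i
      proof -
        have "\<bar>\<Sum>j<d. w j * B j i\<bar> \<le> (\<Sum>i<n. \<bar>\<Sum>j<d. w j * B j i\<bar>)"
          using i by (intro member_le_sum[of i _ "\<lambda>i. \<bar>\<Sum>j<d. w j * B j i\<bar>"]) auto
        also have "\<dots> \<le> \<beta> * (e * \<bar>t\<bar>)"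
          using B1[of w] mult_left_mono[OF \<open>n1 w \<le> e * \<bar>t\<bar>\<close>, of \<beta>] pos by linarith
        finally have 1: "\<bar>\<Sum>j<d. w j * B j i\<bar> \<le> \<beta> * (e * \<bar>t\<bar>)" .
        have "\<bar>v i\<bar> \<le> (\<Sum>i<n. \<bar>v i\<bar>)"
          using i by (intro member_le_sum[of i _ "\<lambda>i. \<bar>v i\<bar>"]) auto
        then have "\<bar>t\<bar> * \<bar>v i\<bar> \<le> \<bar>t\<bar> * \<nu>" by (intro mult_left_mono) (auto simp: \<nu>_def)
        then have "\<bar>t * v i\<bar> \<le> \<bar>t\<bar> * \<nu>" by (simp add: abs_mult)
        then have "\<bar>z w i - x0 i\<bar> \<le> \<bar>t\<bar> * \<nu> + \<beta> * (e * \<bar>t\<bar>)"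
          using 1 by (simp add: z_def)
        also have "\<dots> = \<bar>t\<bar> * (\<nu> + e * \<beta>)" by (simp add: algebra_simps)
        finally show ?thesis using tr by simp
      qed
      moreover have "z w \<in> Rn n" using xR B0 v0 by (simp add: Rn_iff z_def)
      ultimately show ?thesis by (simp add: nbox_def)
    qed
    \<comment> \<open>\<open>B\<close> is a right inverse of the derivative of \<open>Y\<close> at
      \<open>x0\<close>, so the linear part of the increment is exactly \<open>w' l - w l\<close>,
      and the rest is an error of strict differentiability.\<close>
    have key: "\<bar>Y l (z w') - Y l (z w) - (w' l - w l)\<bar> \<le> \<epsilon> * \<beta> * n1 (\<lambda>j. w' j - w j)"
      if l: "l < d" and w: "n1 w \<le> e * \<bar>t\<bar>" "n1 w' \<le> e * \<bar>t\<bar>" for l w w'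
    proof -
      have zz: "z w' i - z w i = (\<Sum>j<d. (w' j - w j) * B j i)" for i
        by (simp add: z_def left_diff_distrib sum_subtractf)
      have "(\<Sum>i<n. partial_deriv i (Y l) x0 * (z w' i - z w i))
          = (\<Sum>j<d. (w' j - w j) * (\<Sum>i<n. partial_deriv i (Y l) x0 * B j i))"
        unfolding zz sum_distrib_left by (subst sum.swap) (simp add: mult_ac)
      also have "\<dots> = (\<Sum>j<d. (w' j - w j) * (if l = j then 1 else 0))"
        using AB[OF l] by (intro sum.cong) auto
      also have "\<dots> = (\<Sum>j<d. if l = j then w' j - w j else 0)"
        by (intro sum.cong) auto
      also have "\<dots> = w' l - w l" using l by (subst sum.delta') auto
      finally have "\<bar>Y l (z w') - Y l (z w) - (w' l - w l)\<bar> \<le> \<epsilon> * (\<Sum>i<n. \<bar>z w' i - z w i\<bar>)"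
        using strict[OF l zin[OF w(1)] zin[OF w(2)]] by simp
      also have "\<dots> \<le> \<epsilon> * (\<beta> * n1 (\<lambda>j. w' j - w j))"
        unfolding zz using B1[of "\<lambda>j. w' j - w j"] \<epsilon>(1) by (intro mult_left_mono) auto
      finally show ?thesis by (simp add: mult.assoc)
    qed
    have key0: "\<bar>Y l (z (\<lambda>_. 0)) - Y l x0\<bar> \<le> \<epsilon> * (\<bar>t\<bar> * \<nu>)" if l: "l < d" for l
    proof -
      have "x0 \<in> nbox n x0 r" using xR r by (rule center_in_nbox)
      moreover have "z (\<lambda>_. 0) \<in> nbox n x0 r" using e by (intro zin) (simp add: n1_def)
      ultimately have "\<bar>Y l (z (\<lambda>_. 0)) - Y l x0 - (\<Sum>i<n. partial_deriv i (Y l) x0 * (t * v i))\<bar> \<le> \<epsilon> * (\<Sum>i<n. \<bar>t * v i\<bar>)"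
        using strict[OF l, of x0 "z (\<lambda>_. 0)"] by (simp add: z_def)
      moreover have "(\<Sum>i<n. partial_deriv i (Y l) x0 * (t * v i)) = t * (\<Sum>i<n. partial_deriv i (Y l) x0 * v i)"
        by (simp add: sum_distrib_left mult_ac)
      moreover have "\<epsilon> * (\<Sum>i<n. \<bar>t * v i\<bar>) \<le> \<epsilon> * (\<bar>t\<bar> * \<nu>)"
        using \<epsilon>(1) by (intro mult_left_mono) (auto simp: \<nu>_def abs_mult sum_distrib_left[symmetric] intro: mult_left_mono)
      ultimately show ?thesis using Av[OF l] by simp
    qed
    define T where "T w = (\<lambda>l. if l < d then w l - (Y l (z w) - Y l x0) else 0)" for w
    define W where "W k = (T ^^ k) (\<lambda>_. 0)" for k
    have WS: "W (Suc k) = T (W k)" and W0: "W 0 = (\<lambda>_. 0)" for k by (simp_all add: W_def)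
    have half: "\<epsilon> * \<beta> * real d \<le> 1/2" "\<epsilon> * \<nu> * real d \<le> e/2"
    proof -
      have "\<epsilon> * \<beta> * real d \<le> \<epsilon> * \<beta> * d'" "\<epsilon> * \<nu> * real d \<le> \<epsilon> * \<nu> * d'"
        using \<epsilon>(1) pos d' by (auto intro!: mult_left_mono)
      moreover have "\<epsilon> * \<beta> * d' = d' * \<epsilon> * \<beta>" "\<epsilon> * \<nu> * d' = d' * \<epsilon> * \<nu>" by simp_all
      ultimately show "\<epsilon> * \<beta> * real d \<le> 1/2" "\<epsilon> * \<nu> * real d \<le> e/2"
        using \<epsilon>(2,3) by linarith+
    qed
    \<comment> \<open>Halving increments keep the partial sums below the geometric sum, so the
      iteration never leaves the ball of radius \<open>e * \<bar>t\<bar>\<close> on which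
      \<open>key\<close> is available.\<close>
    have inc: "n1 (\<lambda>j. W (Suc k) j - W k j) \<le> e * \<bar>t\<bar> / 2 * (1/2) ^ k \<and> n1 (W k) \<le> e * \<bar>t\<bar> * (1 - (1/2) ^ k)
      \<and> n1 (W (Suc k)) \<le> e * \<bar>t\<bar> * (1 - (1/2) ^ Suc k)" for k
    proof (induction k)
      case 0
      have "n1 (\<lambda>j. W (Suc 0) j - W 0 j) \<le> (\<Sum>l<d. \<epsilon> * (\<bar>t\<bar> * \<nu>))"
        unfolding n1_def WS W0 T_def using key0 by (intro sum_mono) (auto simp: abs_minus_commute)
      also have "\<dots> = \<epsilon> * \<nu> * real d * \<bar>t\<bar>" by simp
      also have "\<dots> \<le> e / 2 * \<bar>t\<bar>" using half(2) by (intro mult_right_mono) auto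
      finally show ?case by (simp add: W0 n1_def)
    next
      case (Suc k)
      have le: "n1 (W j) \<le> e * \<bar>t\<bar>" if "j = k \<or> j = Suc k" for j
      proof -
        have "n1 (W j) \<le> e * \<bar>t\<bar> * (1 - (1/2) ^ j)" using Suc that by blast
        also have "\<dots> \<le> e * \<bar>t\<bar> * 1" using e by (intro mult_left_mono) auto
        finally show ?thesis by simp
      qed
      have "n1 (\<lambda>j. W (Suc (Suc k)) j - W (Suc k) j) \<le> (\<Sum>l<d. \<epsilon> * \<beta> * n1 (\<lambda>j. W (Suc k) j - W k j))"
        unfolding n1_def[of "\<lambda>j. W (Suc (Suc k)) j - W (Suc k) j"]
      proof (intro sum_mono)
        fix l assume "l \<in> {..<d}"
        then have l: "l < d" by simp
        have "W (Suc (Suc k)) l - W (Suc k) l = (W (Suc k) l - W k l) - (Y l (z (W (Suc k))) - Y l (z (W k)))"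
          using l by (simp add: WS[of "Suc k"] WS[of k] T_def)
        then show "\<bar>W (Suc (Suc k)) l - W (Suc k) l\<bar> \<le> \<epsilon> * \<beta> * n1 (\<lambda>j. W (Suc k) j - W k j)"
          using key[OF l le le, of k "Suc k"] by (simp add: abs_minus_commute)
      qed
      also have "\<dots> = \<epsilon> * \<beta> * real d * n1 (\<lambda>j. W (Suc k) j - W k j)" by simp
      also have "\<dots> \<le> 1/2 * n1 (\<lambda>j. W (Suc k) j - W k j)"
        using half(1) by (intro mult_right_mono) (auto simp: n1_def intro: sum_nonneg)
      finally have 1: "n1 (\<lambda>j. W (Suc (Suc k)) j - W (Suc k) j) \<le> e * \<bar>t\<bar> / 2 * (1/2) ^ Suc k"
        using Suc by simp
      have "n1 (W (Suc (Suc k))) \<le> n1 (W (Suc k)) + n1 (\<lambda>j. W (Suc (Suc k)) j - W (Suc k) j)"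
        unfolding n1_def sum.distrib[symmetric] by (intro sum_mono) linarith
      also have "\<dots> \<le> e * \<bar>t\<bar> * (1 - (1/2) ^ Suc k) + e * \<bar>t\<bar> / 2 * (1/2) ^ Suc k"
        using 1 Suc by linarith
      also have "\<dots> = e * \<bar>t\<bar> * (1 - (1/2) ^ Suc (Suc k))" by (simp add: field_simps)
      finally show ?case using 1 Suc by blast
    qed
    have Wle: "n1 (W k) \<le> e * \<bar>t\<bar>" for k
    proof -
      have "n1 (W k) \<le> e * \<bar>t\<bar> * (1 - (1/2) ^ k)" using inc by blast
      also have "\<dots> \<le> e * \<bar>t\<bar> * 1" using e by (intro mult_left_mono) auto
      finally show ?thesis by simp
    qed
    have "\<exists>w. (\<lambda>k. W k l) \<longlonglongrightarrow> w" if "l < d" for l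
    proof (rule geometric_increments_converge)
      fix k
      have "\<bar>W (Suc k) l - W k l\<bar> \<le> n1 (\<lambda>j. W (Suc k) j - W k j)"
        unfolding n1_def using that by (intro member_le_sum[of l _ "\<lambda>j. \<bar>W (Suc k) j - W k j\<bar>"]) auto
      then show "\<bar>W (Suc k) l - W k l\<bar> \<le> e * \<bar>t\<bar> / 2 * (1/2) ^ k" using inc[of k] by linarith
    qed
    then obtain w where w: "\<And>l. l < d \<Longrightarrow> (\<lambda>k. W k l) \<longlonglongrightarrow> w l" by metis
    have nw: "n1 w \<le> e * \<bar>t\<bar>"
    proof (rule LIMSEQ_le_const2)
      show "(\<lambda>k. n1 (W k)) \<longlonglongrightarrow> n1 w" unfolding n1_def by (intro tendsto_sum tendsto_rabs w) simp
    qed (use Wle in blast)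
    have lim0: "(\<lambda>k. n1 (\<lambda>j. W k j - w j)) \<longlonglongrightarrow> 0"
    proof -
      have "(\<lambda>k. n1 (\<lambda>j. W k j - w j)) \<longlonglongrightarrow> (\<Sum>j<d. \<bar>w j - w j\<bar>)"
        unfolding n1_def by (intro tendsto_sum tendsto_rabs tendsto_diff w tendsto_const) simp
      then show ?thesis by simp
    qed
    have "Y l (z w) = Y l x0" if l: "l < d" for l
    proof -
      \<comment> \<open>The residual at \<open>w\<close> is compared with the residual at the
        iterate \<open>W k\<close>, which is the increment \<open>W k l - W (Suc k) l\<close>; all
        three terms of the bound tend to 0.\<close>
      have "\<bar>Y l (z w) - Y l x0\<bar> \<le> 0"
      proof (rule LIMSEQ_le_const)
        show "(\<lambda>k. \<bar>W k l - W (Suc k) l\<bar> + \<bar>W k l - w l\<bar> + \<epsilon> * \<beta> * n1 (\<lambda>j. W k j - w j)) \<longlonglongrightarrow> 0"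
        proof -
          have "(\<lambda>k. \<bar>W k l - W (Suc k) l\<bar> + \<bar>W k l - w l\<bar> + \<epsilon> * \<beta> * n1 (\<lambda>j. W k j - w j)) \<longlonglongrightarrow>
            \<bar>w l - w l\<bar> + \<bar>w l - w l\<bar> + \<epsilon> * \<beta> * 0"
            by (intro tendsto_add tendsto_rabs tendsto_diff tendsto_mult tendsto_const w[OF l] lim0
                LIMSEQ_Suc[OF w[OF l]])
          then show ?thesis by simp
        qed
        show "\<exists>N. \<forall>k\<ge>N. \<bar>Y l (z w) - Y l x0\<bar> \<le> \<bar>W k l - W (Suc k) l\<bar> + \<bar>W k l - w l\<bar> + \<epsilon> * \<beta> * n1 (\<lambda>j. W k j - w j)"
        proof (intro exI allI impI)
          fix k
          have "W k l - W (Suc k) l = Y l (z (W k)) - Y l x0" using l by (simp add: WS T_def)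
          then show "\<bar>Y l (z w) - Y l x0\<bar> \<le> \<bar>W k l - W (Suc k) l\<bar> + \<bar>W k l - w l\<bar> + \<epsilon> * \<beta> * n1 (\<lambda>j. W k j - w j)"
            using key[OF l nw Wle[of k]] by linarith
        qed
      qed
      then show ?thesis by simp
    qed
    moreover have "z w \<in> D" using zin[OF nw] rD by blast
    ultimately show "\<exists>w. (\<Sum>j<d. \<bar>w j\<bar>) \<le> e * \<bar>t\<bar> \<and>
      (\<lambda>i. x0 i + t * v i + (\<Sum>j<d. w j * B j i)) \<in> D \<and>
      (\<forall>l<d. Y l (\<lambda>i. x0 i + t * v i + (\<Sum>j<d. w j * B j i)) = Y l x0)"
      using nw unfolding z_def n1_def by blast
  qed
qed

section \<open>Smooth functions, charts and tangent vectors\<close>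

text \<open>The two properties of a sheaf of functions: domains are open, and a function that
  locally agrees with smooth ones is smooth. Quotient structures inherit them before anything is
  known about charts.\<close>

definition local_space :: "'a smooth_space \<Rightarrow> bool" where
  "local_space M \<longleftrightarrow> (\<forall>W f. smooth_fun M W f \<longrightarrow> openin (space_top M) W) \<and>
     (\<forall>W f. openin (space_top M) W \<and>
        (\<forall>p\<in>W. \<exists>V g. p \<in> V \<and> smooth_fun M V g \<and> (\<forall>q\<in>W \<inter> V. f q = g q)) \<longrightarrow> smooth_fun M W f)"

text \<open>The setting of the tangent calculus. Hausdorff separation and second countability are
  kept apart, since they enter only through topological arguments.\<close>

definition charted :: "'a smooth_space \<Rightarrow> bool" where
  "charted M \<longleftrightarrow> local_space M \<and> (\<forall>p\<in>points M. \<exists>U n x. chart M U n x \<and> p \<in> U)"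

lemma smooth_nearI: "p \<in> U \<Longrightarrow> smooth_fun M U f \<Longrightarrow> smooth_near M p f"
  unfolding smooth_near_def by blast

lemma local_spaceI:
  assumes "\<And>W f. smooth_fun M W f \<Longrightarrow> openin (space_top M) W"
    and "\<And>W f. openin (space_top M) W \<Longrightarrow>
      \<forall>p\<in>W. \<exists>V g. p \<in> V \<and> smooth_fun M V g \<and> (\<forall>q\<in>W \<inter> V. f q = g q) \<Longrightarrow> smooth_fun M W f"
  shows "local_space M"
  unfolding local_space_def
proof (intro conjI allI impI; (elim conjE)?)
  fix W f
  show "openin (space_top M) W" if "smooth_fun M W f" by (rule assms(1)[OF that])
  show "smooth_fun M W f" if "openin (space_top M) W"
    "\<forall>p\<in>W. \<exists>V g. p \<in> V \<and> smooth_fun M V g \<and> (\<forall>q\<in>W \<inter> V. f q = g q)"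
    by (rule assms(2)[OF that])
qed

lemma smooth_fun_open: "local_space M \<Longrightarrow> smooth_fun M W f \<Longrightarrow> openin (space_top M) W"
  unfolding local_space_def by blast

lemma smooth_funI_local:
  assumes "local_space M" "openin (space_top M) W"
    and "\<And>p. p \<in> W \<Longrightarrow> \<exists>V g. p \<in> V \<and> smooth_fun M V g \<and> (\<forall>q\<in>W \<inter> V. f q = g q)"
  shows "smooth_fun M W f"
  using assms unfolding local_space_def by blast

lemma charted_local: "charted M \<Longrightarrow> local_space M"
  by (simp add: charted_def)

lemma smooth_fun_subset:
  assumes "local_space M" "smooth_fun M V f" "openin (space_top M) W" "W \<subseteq> V"
  shows "smooth_fun M W f"
  using assms(4) by (intro smooth_funI_local[OF assms(1,3)]) (use assms(2) in blast)

lemma smooth_fun_iff_near: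
  assumes "local_space M"
  shows "smooth_fun M W f \<longleftrightarrow> openin (space_top M) W \<and> (\<forall>p\<in>W. smooth_near M p f)"
proof
  assume "smooth_fun M W f"
  then show "openin (space_top M) W \<and> (\<forall>p\<in>W. smooth_near M p f)"
    using smooth_fun_open[OF assms] unfolding smooth_near_def by blast
next
  assume R: "openin (space_top M) W \<and> (\<forall>p\<in>W. smooth_near M p f)"
  show "smooth_fun M W f"
  proof (rule smooth_funI_local[OF assms])
    fix p assume "p \<in> W"
    then obtain V where "p \<in> V" "smooth_fun M V f" using R unfolding smooth_near_def by blast
    then show "\<exists>V g. p \<in> V \<and> smooth_fun M V g \<and> (\<forall>q\<in>W \<inter> V. f q = g q)" by blast
  qed (use R in blast)
qed

lemma smooth_nearE_open:
  assumes "local_space M" "smooth_near M p f"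
  obtains V where "openin (space_top M) V" "p \<in> V" "smooth_fun M V f"
  using assms smooth_fun_open unfolding smooth_near_def by blast

lemma smooth_near_points: "local_space M \<Longrightarrow> smooth_near M p f \<Longrightarrow> p \<in> points M"
  unfolding points_def by (meson openin_subset smooth_nearE_open subsetD)

lemma smooth_near_cong:
  assumes L: "local_space M" and V: "openin (space_top M) V" "p \<in> V" and eq: "\<And>q. q \<in> V \<Longrightarrow> f q = g q"
    and f: "smooth_near M p f"
  shows "smooth_near M p g"
proof -
  obtain W where W: "openin (space_top M) W" "p \<in> W" "smooth_fun M W f"
    by (rule smooth_nearE_open[OF L f])
  have "smooth_fun M (V \<inter> W) g"
  proof (rule smooth_funI_local[OF L openin_Int[OF V(1) W(1)]])
    fix p assume "p \<in> V \<inter> W"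
    moreover have "\<forall>q\<in>V \<inter> W \<inter> W. g q = f q" using eq by simp
    ultimately show "\<exists>U h. p \<in> U \<and> smooth_fun M U h \<and> (\<forall>q\<in>V \<inter> W \<inter> U. g q = h q)"
      using W(3) by (intro exI[of _ W] exI[of _ f]) simp
  qed
  then show ?thesis using V W unfolding smooth_near_def by blast
qed

lemma smooth_near_common:
  assumes L: "local_space M" and p: "p \<in> points M"
  shows "(\<And>i. i < m \<Longrightarrow> smooth_near M p (f i)) \<Longrightarrow>
    \<exists>W. openin (space_top M) W \<and> p \<in> W \<and> (\<forall>i<(m::nat). smooth_fun M W (f i))"
proof (induction m)
  case 0
  then show ?case using p unfolding points_def by blast
next
  case (Suc m)
  then obtain W where W: "openin (space_top M) W" "p \<in> W" "\<forall>i<m. smooth_fun M W (f i)" by auto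
  obtain V where V: "openin (space_top M) V" "p \<in> V" "smooth_fun M V (f m)"
    using smooth_nearE_open[OF L Suc.prems[of m]] by blast
  have "smooth_fun M (W \<inter> V) (f i)" if "i < Suc m" for i
  proof (cases "i = m")
    case True
    show ?thesis unfolding True by (rule smooth_fun_subset[OF L V(3) openin_Int[OF W(1) V(1)]]) simp
  next
    case False
    with that W(3) have "smooth_fun M W (f i)" by simp
    then show ?thesis by (rule smooth_fun_subset[OF L _ openin_Int[OF W(1) V(1)]]) simp
  qed
  then show ?case using V W by (intro exI[of _ "W \<inter> V"]) auto
qed

section \<open>Charts\<close>

lemma chart_open: "chart M U n x \<Longrightarrow> openin (space_top M) U"
  by (simp add: chart_def)

lemma chart_subset: "chart M U n x \<Longrightarrow> U \<subseteq> points M"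
  by (simp add: chart_open openin_subset points_def)

lemma chart_image_open: "chart M U n x \<Longrightarrow> openin (Euclidean_space n) (x ` U)"
  by (simp add: chart_def)

lemma chart_topspace:
  assumes "chart M U n x"
  shows "topspace (subtopology (space_top M) U) = U" "topspace (subtopology (Euclidean_space n) (x ` U)) = x ` U"
  using chart_subset[OF assms] openin_subset[OF chart_image_open[OF assms]] by (auto simp: points_def)

lemma chart_inj: assumes "chart M U n x" shows "inj_on x U"
proof -
  have "homeomorphic_map (subtopology (space_top M) U) (subtopology (Euclidean_space n) (x ` U)) x"
    using assms unfolding chart_def by blast
  from homeomorphic_imp_injective_map[OF this] show ?thesis
    unfolding chart_topspace(1)[OF assms] .
qed

lemma chart_inv [simp]: "chart M U n x \<Longrightarrow> p \<in> U \<Longrightarrow> inv_into U x (x p) = p"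
  by (simp add: chart_inj)

lemma chart_Rn: "chart M U n x \<Longrightarrow> p \<in> U \<Longrightarrow> x p \<in> Rn n"
  using openin_subset[OF chart_image_open] by blast

lemma chart_open_image:
  assumes "chart M U n x" "openin (space_top M) W" "W \<subseteq> U"
  shows "openin (Euclidean_space n) (x ` W)"
proof -
  have "open_map (subtopology (space_top M) U) (subtopology (Euclidean_space n) (x ` U)) x"
    using assms(1) unfolding chart_def by (intro homeomorphic_imp_open_map) blast
  moreover have "openin (subtopology (space_top M) U) W"
    using assms by (simp add: openin_open_subtopology chart_open)
  ultimately have "openin (subtopology (Euclidean_space n) (x ` U)) (x ` W)"
    unfolding open_map_def by blast
  then show ?thesis using chart_image_open[OF assms(1)] openin_open_subtopology by blast
qed

lemma chart_preimage_open:
  assumes "chart M U n x" "openin (Euclidean_space n) V"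
  shows "openin (space_top M) {p \<in> U. x p \<in> V}"
proof -
  have "continuous_map (subtopology (space_top M) U) (subtopology (Euclidean_space n) (x ` U)) x"
    using assms(1) unfolding chart_def by (intro homeomorphic_imp_continuous_map) blast
  then have "continuous_map (subtopology (space_top M) U) (Euclidean_space n) x"
    using continuous_map_in_subtopology by blast
  from openin_continuous_map_preimage[OF this assms(2)]
  have "openin (subtopology (space_top M) U) {p \<in> U. x p \<in> V}"
    by (simp only: chart_topspace[OF assms(1)])
  then show ?thesis using chart_open[OF assms(1)] openin_open_subtopology by blast
qed

lemma chart_smooth_iff:
  assumes "chart M U n x" "openin (space_top M) W" "W \<subseteq> U"
  shows "smooth_fun M W f \<longleftrightarrow> smooth_Rn n (x ` W) (f \<circ> inv_into U x)"
  using assms unfolding chart_def by blast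

text \<open>The definition of a manifold states locality only for the family of all charts. Gluing
  over an arbitrary cover is checked inside each chart, where it is the locality of C^k
  functions.\<close>

lemma manifold_local:
  assumes "smooth_manifold M"
  shows "local_space M"
proof -
  have iff: "smooth_fun M W f \<longleftrightarrow> openin (space_top M) W \<and> (\<forall>U n x. chart M U n x \<longrightarrow> smooth_fun M (W \<inter> U) f)" for W f
    using assms unfolding smooth_manifold_def by blast
  show ?thesis
    unfolding local_space_def
  proof (intro conjI allI impI; (elim conjE)?)
    fix W and f :: "'a \<Rightarrow> real" assume "smooth_fun M W f"
    then show "openin (space_top M) W" using iff by blast
  next
    fix W and f :: "'a \<Rightarrow> real" assume W: "openin (space_top M) W"
      and loc: "\<forall>p\<in>W. \<exists>V g. p \<in> V \<and> smooth_fun M V g \<and> (\<forall>q\<in>W \<inter> V. f q = g q)"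
    have "smooth_fun M (W \<inter> U) f" if ch: "chart M U n x" for U n x
    proof -
      have WU: "openin (space_top M) (W \<inter> U)" using W chart_open[OF ch] by blast
      have "smooth_Rn n (x ` (W \<inter> U)) (f \<circ> inv_into U x)"
        unfolding smooth_Rn_def
      proof (intro conjI allI)
        show op: "openin (Euclidean_space n) (x ` (W \<inter> U))" by (rule chart_open_image[OF ch WU]) simp
        fix k
        show "Ck_Rn n k (x ` (W \<inter> U)) (f \<circ> inv_into U x)"
        proof (rule Ck_local[OF op])
          fix z assume "z \<in> x ` (W \<inter> U)"
          then obtain p where p: "p \<in> W" "p \<in> U" "z = x p" by blast
          obtain V g where V: "p \<in> V" "smooth_fun M V g" "\<forall>q\<in>W \<inter> V. f q = g q"
            using loc p by blast
          have VU: "smooth_fun M (V \<inter> U) g" using V iff ch by blast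
          then have "openin (space_top M) (V \<inter> U)" using iff by blast
          then have "smooth_Rn n (x ` (V \<inter> U)) (g \<circ> inv_into U x)"
            using chart_smooth_iff[OF ch] VU by blast
          then have C: "Ck_Rn n k (x ` (V \<inter> U)) (g \<circ> inv_into U x)" unfolding smooth_Rn_def by blast
          have WVU: "openin (space_top M) (W \<inter> (V \<inter> U))" using W \<open>openin _ (V \<inter> U)\<close> by blast
          have op2: "openin (Euclidean_space n) (x ` (W \<inter> (V \<inter> U)))" by (rule chart_open_image[OF ch WVU]) blast
          have "Ck_Rn n k (x ` (W \<inter> (V \<inter> U))) (f \<circ> inv_into U x)"
          proof (rule Ck_cong_imp[OF op2])
            show "Ck_Rn n k (x ` (W \<inter> (V \<inter> U))) (g \<circ> inv_into U x)"
              by (rule Ck_subset[OF C]) blast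
            fix y assume "y \<in> x ` (W \<inter> (V \<inter> U))"
            then obtain q where "q \<in> W" "q \<in> V" "q \<in> U" "y = x q" by blast
            then show "(g \<circ> inv_into U x) y = (f \<circ> inv_into U x) y" using V(3) ch by simp
          qed
          then show "\<exists>W. openin (Euclidean_space n) W \<and> z \<in> W \<and> Ck_Rn n k W (f \<circ> inv_into U x)"
            using op2 p V(1) by blast
        qed
      qed
      then show ?thesis using chart_smooth_iff[OF ch WU] by blast
    qed
    then show "smooth_fun M W f" using W iff by blast
  qed
qed

lemma manifold_charted: "smooth_manifold M \<Longrightarrow> charted M"
proof -
  assume m: "smooth_manifold M"
  then have "\<exists>n. \<forall>p\<in>points M. \<exists>U x. chart M U n x \<and> p \<in> U"
    unfolding smooth_manifold_def by (elim conjE)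
  then show "charted M" unfolding charted_def using manifold_local[OF m] by blast
qed

text \<open>In a chart this is the composition of C^k functions, on the part of the chart domain
  where the tuple of representatives lies in \<open>D\<close>. The algebra of smooth germs follows
  by special choices of \<open>F\<close>.\<close>

lemma smooth_near_compose:
  assumes M: "charted M" and p: "p \<in> points M"
    and f: "\<And>i. i < m \<Longrightarrow> smooth_near M p (f i)"
    and F: "smooth_Rn m D F" and pD: "(\<lambda>i. if i < m then f i p else 0) \<in> D"
  shows "smooth_near M p (\<lambda>q. F (\<lambda>i. if i < m then f i q else 0))"
proof -
  have L: "local_space M" using M by (rule charted_local)
  obtain U n x where ch: "chart M U n x" "p \<in> U" using M p unfolding charted_def by blast
  obtain W0 where W0: "openin (space_top M) W0" "p \<in> W0" "\<forall>i<m. smooth_fun M W0 (f i)"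
    using smooth_near_common[OF L p, of m f] f by blast
  define W where "W = W0 \<inter> U"
  have W: "openin (space_top M) W" "p \<in> W" "W \<subseteq> U" using W0 ch chart_open[OF ch(1)] by (auto simp: W_def)
  define g where "g i = f i \<circ> inv_into U x" for i
  have sg: "smooth_Rn n (x ` W) (g i)" if "i < m" for i
  proof -
    have "smooth_fun M W0 (f i)" using W0 that by blast
    then have "smooth_fun M W (f i)" by (rule smooth_fun_subset[OF L _ W(1)]) (simp add: W_def)
    then show ?thesis using chart_smooth_iff[OF ch(1) W(1,3)] by (simp add: g_def)
  qed
  have xW: "openin (Euclidean_space n) (x ` W)" by (rule chart_open_image[OF ch(1) W(1,3)])
  let ?t = "\<lambda>z i. if i < m then g i z else 0"
  have cont: "continuous_map (subtopology (Euclidean_space n) (x ` W)) (Euclidean_space m) ?t"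
    unfolding continuous_map_componentwise_Euclidean_space
    using sg Ck_imp_continuous unfolding smooth_Rn_def by blast
  have D: "openin (Euclidean_space m) D" using F unfolding smooth_Rn_def by blast
  define V where "V = {z \<in> x ` W. ?t z \<in> D}"
  have V: "openin (Euclidean_space n) V"
  proof -
    have "topspace (subtopology (Euclidean_space n) (x ` W)) = x ` W" using openin_subset[OF xW] by auto
    then have "openin (subtopology (Euclidean_space n) (x ` W)) V"
      using openin_continuous_map_preimage[OF cont D] unfolding V_def by simp
    then show ?thesis using xW openin_open_subtopology by blast
  qed
  have pV: "x p \<in> V" using W pD ch by (auto simp: V_def g_def cong: if_cong)
  define W' where "W' = {q \<in> U. x q \<in> V}"
  have xW': "x ` W' = V" using W(3) by (auto simp: W'_def V_def)
  have W': "openin (space_top M) W'" "W' \<subseteq> U" "p \<in> W'"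
    using chart_preimage_open[OF ch(1) V] pV ch(2) by (auto simp: W'_def)
  have "smooth_Rn n V (\<lambda>z. F (?t z))"
    unfolding smooth_Rn_def
  proof (intro conjI allI V)
    fix k show "Ck_Rn n k V (\<lambda>z. F (?t z))"
    proof (rule Ck_compose[OF D V])
      show "?t z \<in> D" if "z \<in> V" for z using that by (simp add: V_def)
      show "Ck_Rn m k D F" using F unfolding smooth_Rn_def by blast
      fix i assume "i < m"
      then have "Ck_Rn n k (x ` W) (g i)" using sg unfolding smooth_Rn_def by blast
      then show "Ck_Rn n k V (g i)" by (rule Ck_subset) (auto simp: V_def)
    qed
  qed
  moreover have "(\<lambda>q. F (\<lambda>i. if i < m then f i q else 0)) \<circ> inv_into U x = (\<lambda>z. F (?t z))"
    by (simp add: g_def o_def cong: if_cong)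
  ultimately have "smooth_fun M W' (\<lambda>q. F (\<lambda>i. if i < m then f i q else 0))"
    unfolding chart_smooth_iff[OF ch(1) W'(1,2)] xW' by simp
  then show ?thesis using W' unfolding smooth_near_def by blast
qed

section \<open>Algebra of smooth germs\<close>

lemma smooth_Rn_whole: "(\<And>k. Ck_Rn n k (Rn n) F) \<Longrightarrow> smooth_Rn n (Rn n) F"
  by (simp add: smooth_Rn_def)

lemma smooth_near_const:
  assumes "charted M" "p \<in> points M"
  shows "smooth_near M p (\<lambda>q. c)"
proof -
  have "smooth_Rn 0 (Rn 0) (\<lambda>z. c)" by (intro smooth_Rn_whole Ck_const)
  from smooth_near_compose[OF assms _ this, of "\<lambda>i q. 0"] show ?thesis by (simp add: Rn_iff)
qed

lemma smooth_near_compose2: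
  assumes M: "charted M" and f: "smooth_near M p f" and g: "smooth_near M p g"
    and F: "smooth_Rn 2 (Rn 2) (\<lambda>z. F (z 0) (z 1))"
  shows "smooth_near M p (\<lambda>q. F (f q) (g q))"
proof -
  have p: "p \<in> points M" using smooth_near_points[OF charted_local[OF M] f] .
  have "smooth_near M p (\<lambda>q. (\<lambda>z :: nat \<Rightarrow> real. F (z 0) (z 1)) (\<lambda>i. if i < 2 then (if i = 0 then f else g) q else 0))"
    by (rule smooth_near_compose[OF M p _ F]) (use f g in \<open>auto simp: Rn_iff\<close>)
  then show ?thesis by simp
qed

lemma smooth_near_add:
  assumes "charted M" "smooth_near M p f" "smooth_near M p g"
  shows "smooth_near M p (\<lambda>q. f q + g q)"
  by (rule smooth_near_compose2[OF assms]) (intro smooth_Rn_whole Ck_add Ck_coord openin_topspace)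

lemma smooth_near_mult:
  assumes "charted M" "smooth_near M p f" "smooth_near M p g"
  shows "smooth_near M p (\<lambda>q. f q * g q)"
  by (rule smooth_near_compose2[OF assms]) (intro smooth_Rn_whole Ck_mult Ck_coord openin_topspace)

lemma smooth_near_cmult:
  assumes "charted M" "smooth_near M p f"
  shows "smooth_near M p (\<lambda>q. c * f q)"
  using smooth_near_points[OF charted_local] assms by (intro smooth_near_mult smooth_near_const) blast+

lemma smooth_near_diff:
  assumes "charted M" "smooth_near M p f" "smooth_near M p g"
  shows "smooth_near M p (\<lambda>q. f q - g q)"
  using smooth_near_add[OF assms(1,2) smooth_near_cmult[OF assms(1,3), of "-1"]] by simp

lemma smooth_near_sum:
  assumes "charted M" "p \<in> points M"
  shows "(\<And>i. i < m \<Longrightarrow> smooth_near M p (f i)) \<Longrightarrow> smooth_near M p (\<lambda>q. \<Sum>i<(m::nat). f i q)"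
proof (induction m)
  case 0
  then show ?case using smooth_near_const[OF assms] by simp
next
  case (Suc m)
  then show ?case unfolding sum.lessThan_Suc by (intro smooth_near_add[OF assms(1)]) auto
qed

lemma smooth_near_divide:
  assumes M: "charted M" and f: "smooth_near M p f" and g: "smooth_near M p g" and nz: "g p \<noteq> 0"
  shows "smooth_near M p (\<lambda>q. f q / g q)"
proof -
  have p: "p \<in> points M" using smooth_near_points[OF charted_local[OF M] f] .
  define D where "D = {z \<in> Rn 1. z 0 \<in> - {0}}"
  have D: "openin (Euclidean_space 1) D" unfolding D_def by (rule openin_coordinate) auto
  have "smooth_Rn 1 D (\<lambda>z. inverse (z 0))"
    unfolding smooth_Rn_def using D by (intro conjI allI Ck_inverse Ck_coord) (auto simp: D_def)
  then have "smooth_near M p (\<lambda>q. (\<lambda>z :: nat \<Rightarrow> real. inverse (z 0)) (\<lambda>i. if i < 1 then g q else 0))"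
    using g nz by (intro smooth_near_compose[OF M p, where f = "\<lambda>i. g"]) (auto simp: D_def Rn_iff)
  then have "smooth_near M p (\<lambda>q. inverse (g q))" by simp
  from smooth_near_mult[OF M f this] show ?thesis by (simp add: divide_inverse)
qed

lemma smooth_near_coord:
  assumes "chart M U n x" "p \<in> U" "local_space M"
  shows "smooth_near M p (\<lambda>q. x q i)"
proof -
  have "smooth_Rn n (x ` U) ((\<lambda>q. x q i) \<circ> inv_into U x)"
    unfolding smooth_Rn_def
  proof (intro conjI allI chart_image_open[OF assms(1)])
    fix k show "Ck_Rn n k (x ` U) ((\<lambda>q. x q i) \<circ> inv_into U x)"
      by (rule Ck_cong_imp[OF chart_image_open[OF assms(1)] _ Ck_coord[of n k _ i]])
        (auto simp: f_inv_into_f)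
  qed
  then have "smooth_fun M U (\<lambda>q. x q i)"
    using chart_smooth_iff[OF assms(1) chart_open[OF assms(1)]] by blast
  then show ?thesis using assms(2) unfolding smooth_near_def by blast
qed

lemma smooth_near_chart_rep:
  assumes L: "local_space M" and ch: "chart M U n x" "p \<in> U" and f: "smooth_near M p f"
  obtains V where "openin (Euclidean_space n) V" "x p \<in> V" "V \<subseteq> x ` U" "smooth_Rn n V (f \<circ> inv_into U x)"
proof -
  obtain W where W: "openin (space_top M) W" "p \<in> W" "smooth_fun M W f"
    by (rule smooth_nearE_open[OF L f])
  have WU: "openin (space_top M) (W \<inter> U)" using W chart_open[OF ch(1)] by blast
  have "smooth_fun M (W \<inter> U) f" by (rule smooth_fun_subset[OF L W(3) WU]) simp
  then have "smooth_Rn n (x ` (W \<inter> U)) (f \<circ> inv_into U x)"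
    using chart_smooth_iff[OF ch(1) WU] by blast
  then show thesis using W ch(2) by (intro that[of "x ` (W \<inter> U)"]) (auto simp: smooth_Rn_def)
qed

lemma continuous_map_of_near:
  assumes M: "charted M" and f: "\<And>p. p \<in> points M \<Longrightarrow> smooth_near M p f"
  shows "continuous_map (space_top M) euclideanreal f"
  unfolding continuous_map_def
proof (intro conjI allI impI)
  fix T :: "real set" assume "openin euclideanreal T"
  show "openin (space_top M) {p \<in> topspace (space_top M). f p \<in> T}"
  proof (subst openin_subopen, intro ballI)
    fix p assume p: "p \<in> {p \<in> topspace (space_top M). f p \<in> T}"
    then have pM: "p \<in> points M" by (simp add: points_def)
    obtain U n x where ch: "chart M U n x" "p \<in> U" using M pM unfolding charted_def by blast
    obtain V where V: "openin (Euclidean_space n) V" "x p \<in> V" "V \<subseteq> x ` U" "smooth_Rn n V (f \<circ> inv_into U x)"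
      by (rule smooth_near_chart_rep[OF charted_local[OF M] ch f[OF pM]])
    have "continuous_map (subtopology (Euclidean_space n) V) euclideanreal (f \<circ> inv_into U x)"
      using V(4) Ck_imp_continuous unfolding smooth_Rn_def by blast
    from openin_continuous_map_preimage[OF this \<open>openin euclideanreal T\<close>]
    have "openin (subtopology (Euclidean_space n) V) {z \<in> V. (f \<circ> inv_into U x) z \<in> T}"
      using openin_subset[OF V(1)] by (simp add: Int_absorb1)
    then have "openin (Euclidean_space n) {z \<in> V. (f \<circ> inv_into U x) z \<in> T}"
      using V(1) openin_open_subtopology by blast
    from chart_preimage_open[OF ch(1) this]
    have "openin (space_top M) {q \<in> U. x q \<in> V \<and> f q \<in> T}"
      by (rule back_subst[of "openin (space_top M)"]) (use ch(1) in auto)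
    then show "\<exists>W. openin (space_top M) W \<and> p \<in> W \<and> W \<subseteq> {p \<in> topspace (space_top M). f p \<in> T}"
      using ch V(2) p chart_subset[OF ch(1)] unfolding points_def
      by (intro exI[of _ "{q \<in> U. x q \<in> V \<and> f q \<in> T}"]) auto
  qed
qed simp

section \<open>The real line as a manifold\<close>

lemma continuous_R1:
  fixes f :: "real \<Rightarrow> real"
  assumes W: "openin (Euclidean_space 1) {z \<in> Rn 1. z 0 \<in> W}"
    and d: "\<And>t. t \<in> W \<Longrightarrow> f differentiable at t"
  shows "continuous_map (subtopology (Euclidean_space 1) {z \<in> Rn 1. z 0 \<in> W}) euclideanreal (\<lambda>z. f (z 0))"
  unfolding continuous_Euclid_iff[OF W]
proof (intro ballI allI impI)
  fix z :: "nat \<Rightarrow> real" and e :: real assume z: "z \<in> {z \<in> Rn 1. z 0 \<in> W}" and e: "e > 0"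
  have "continuous (at (z 0)) f"
    by (rule differentiable_imp_continuous_within) (rule d, use z in simp)
  then obtain r where "r > 0" "\<forall>s. dist s (z 0) < r \<longrightarrow> dist (f s) (f (z 0)) < e"
    unfolding continuous_at_eps_delta using e by blast
  then show "\<exists>d>0. \<forall>y\<in>nbox 1 z d. y \<in> {z \<in> Rn 1. z 0 \<in> W} \<longrightarrow> \<bar>f (y 0) - f (z 0)\<bar> < e"
    by (intro exI[of _ r]) (auto simp: nbox_def dist_real_def)
qed

lemma Ck_R1_intro:
  assumes W: "openin (Euclidean_space 1) {z \<in> Rn 1. z 0 \<in> W}"
  shows "(\<And>m t. m \<le> k \<Longrightarrow> t \<in> W \<Longrightarrow> (deriv ^^ m) f differentiable at t) \<Longrightarrow>
    Ck_Rn 1 k {z \<in> Rn 1. z 0 \<in> W} (\<lambda>z. f (z 0))"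
proof (induction k arbitrary: f)
  case 0
  have "f differentiable at t" if "t \<in> W" for t using 0[of 0 t] that by simp
  from continuous_R1[OF W this] show ?case by simp
next
  case (Suc k)
  have f: "f differentiable at t" if "t \<in> W" for t using Suc.prems[of 0 t] that by simp
  have pd: "partial_deriv 0 (\<lambda>z. f (z 0)) = (\<lambda>z. deriv f (z 0))" by (simp add: partial_deriv_def fun_eq_iff)
  have "Ck_Rn 1 k {z \<in> Rn 1. z 0 \<in> W} (\<lambda>z. deriv f (z 0))"
  proof (rule Suc.IH)
    fix m t assume "m \<le> k" "t \<in> W"
    then show "(deriv ^^ m) (deriv f) differentiable at t"
      using Suc.prems[of "Suc m" t] by (simp only: funpow_Suc_right o_apply Suc_le_mono)
  qed
  then show ?case
    using continuous_R1[OF W f] f by (simp add: Ck_Rn.simps(2) pd)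
qed

text \<open>Differentiability of the \<open>k\<close>-th derivative belongs to order
  \<open>k + 1\<close>, whence \<open>Suc k\<close> in the hypothesis.\<close>

lemma Ck_R1_elim:
  "Ck_Rn 1 (Suc k) {z \<in> Rn 1. z 0 \<in> W} (\<lambda>z. f (z 0)) \<Longrightarrow> t \<in> W \<Longrightarrow> (deriv ^^ k) f differentiable at t"
proof (induction k arbitrary: f)
  case 0
  have "(\<lambda>i. if i = 0 then t else 0) \<in> {z \<in> Rn 1. z 0 \<in> W}" using 0(2) by (simp add: Rn_iff)
  from Ck_partial_DERIV[OF 0(1) this, of 0]
  have "(f has_real_derivative partial_deriv 0 (\<lambda>z. f (z 0)) (\<lambda>i. if i = 0 then t else 0)) (at t)" by simp
  then have "f differentiable at t" using real_differentiable_def by blast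
  then show ?case by simp
next
  case (Suc k)
  have pd: "partial_deriv 0 (\<lambda>z. f (z 0)) = (\<lambda>z. deriv f (z 0))" by (simp add: partial_deriv_def fun_eq_iff)
  have "Ck_Rn 1 (Suc k) {z \<in> Rn 1. z 0 \<in> W} (\<lambda>z. deriv f (z 0))"
    using Suc.prems(1) unfolding Ck_Rn.simps(2)[of 1 "Suc k"] pd[symmetric] by simp
  from Suc.IH[OF this Suc.prems(2)] show ?case by (simp only: funpow_Suc_right o_apply)
qed

lemma points_real_space [simp]: "points real_space = UNIV"
  by (simp add: points_def real_space_def)

lemma local_real_space: "local_space real_space"
proof (rule local_spaceI)
  fix W and f :: "real \<Rightarrow> real"
  assume "openin (space_top real_space) W"
    and "\<forall>p\<in>W. \<exists>V g. p \<in> V \<and> smooth_fun real_space V g \<and> (\<forall>q\<in>W \<inter> V. f q = g q)"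
  then have W: "open W"
    and loc: "\<forall>p\<in>W. \<exists>V g. p \<in> V \<and> (open V \<and> (\<forall>k. \<forall>t\<in>V. (deriv ^^ k) g differentiable at t)) \<and> (\<forall>q\<in>W \<inter> V. f q = g q)"
    by (simp_all add: real_space_def)
  have "\<forall>k. \<forall>t\<in>W. (deriv ^^ k) f differentiable at t"
  proof (intro allI ballI)
    fix k t assume t: "t \<in> W"
    obtain V g where V: "t \<in> V" "open V" "\<forall>k. \<forall>t\<in>V. (deriv ^^ k) g differentiable at t" "\<forall>q\<in>W \<inter> V. f q = g q"
      using loc t by metis
    have op: "open (W \<inter> V)" using W V by auto
    have eq: "(deriv ^^ k) f s = (deriv ^^ k) g s" if "s \<in> W \<inter> V" for s k
      using that
    proof (induction k arbitrary: s)
      case 0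
      then show ?case using V(4) by simp
    next
      case (Suc k)
      have "\<forall>\<^sub>F u in nhds s. (deriv ^^ k) f u = (deriv ^^ k) g u"
        by (rule eventually_mono[OF eventually_nhds_in_open[OF op Suc.prems]]) (rule Suc.IH)
      then show ?case by (simp add: deriv_cong_ev)
    qed
    have "\<forall>\<^sub>F u in nhds t. (deriv ^^ k) f u = (deriv ^^ k) g u"
      by (rule eventually_mono[OF eventually_nhds_in_open[OF op]]) (use t V(1) eq in auto)
    from DERIV_cong_ev[OF refl this refl]
    have iff: "((deriv ^^ k) f has_real_derivative D) (at t) \<longleftrightarrow> ((deriv ^^ k) g has_real_derivative D) (at t)" for D .
    obtain D where "((deriv ^^ k) g has_real_derivative D) (at t)"
      using V(1,3) real_differentiable_def by blast
    then have "((deriv ^^ k) f has_real_derivative D) (at t)" by (simp only: iff)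
    then show "(deriv ^^ k) f differentiable at t" using real_differentiable_def by blast
  qed
  then show "smooth_fun real_space W f" using W by (simp add: real_space_def)
qed (simp add: real_space_def)

text \<open>The structure of the line is defined by iterated derivatives in one variable. This chart
  identifies it with the one-dimensional Euclidean space, so that curves are covered by the general
  theory.\<close>

lemma chart_real_space: "chart real_space UNIV 1 (\<lambda>t i. if i = 0 then t else 0)"
proof -
  let ?j = "\<lambda>(t::real) (i::nat). if i = 0 then t else 0"
  have im: "?j ` W = {z \<in> Rn 1. z 0 \<in> W}" for W
  proof
    show "{z \<in> Rn 1. z 0 \<in> W} \<subseteq> ?j ` W"
    proof
      fix z :: "nat \<Rightarrow> real" assume z: "z \<in> {z \<in> Rn 1. z 0 \<in> W}"
      then have "z = ?j (z 0)" by (auto simp: Rn_iff fun_eq_iff)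
      then show "z \<in> ?j ` W" using z by blast
    qed
  qed (auto simp: Rn_iff)
  have inj: "inj ?j" by (auto simp: inj_on_def fun_eq_iff)
  have inv: "inv_into UNIV ?j z = z 0" if "z \<in> Rn 1" for z
  proof -
    have "z = ?j (z 0)" using that by (auto simp: Rn_iff fun_eq_iff)
    then have "inv_into UNIV ?j z = inv_into UNIV ?j (?j (z 0))" by (rule arg_cong)
    then show ?thesis using inv_into_f_f[OF inj UNIV_I, of "z 0"] by simp
  qed
  have op: "openin (Euclidean_space 1) {z \<in> Rn 1. z 0 \<in> W}" if "open W" for W :: "real set"
    by (rule openin_coordinate[OF that]) simp
  have hom: "homeomorphic_map euclideanreal (Euclidean_space 1) ?j"
    unfolding homeomorphic_map_maps homeomorphic_maps_def
  proof (intro exI[of _ "\<lambda>z. z 0"] conjI ballI)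
    have "continuous_map euclideanreal (Euclidean_space 1) (\<lambda>t i. if i < 1 then (if i = 0 then t else 0) else 0)"
      unfolding continuous_map_componentwise_Euclidean_space by simp
    then show "continuous_map euclideanreal (Euclidean_space 1) ?j"
      by (rule back_subst[of "continuous_map euclideanreal (Euclidean_space 1)"]) (auto simp: fun_eq_iff)
    show "continuous_map (Euclidean_space 1) euclideanreal (\<lambda>z. z 0)"
      using Ck_imp_continuous[OF Ck_coord[of 1 0 "Rn 1" 0]] by simp
  qed (auto simp: Rn_iff fun_eq_iff)
  have sm: "(open W \<and> (\<forall>k. \<forall>t\<in>W. (deriv ^^ k) f differentiable at t)) \<longleftrightarrow> smooth_Rn 1 (?j ` W) (f \<circ> inv_into UNIV ?j)"
    if W: "open W" for W and f :: "real \<Rightarrow> real"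
  proof -
    have "Ck_Rn 1 k {z \<in> Rn 1. z 0 \<in> W} (f \<circ> inv_into UNIV ?j) \<longleftrightarrow> Ck_Rn 1 k {z \<in> Rn 1. z 0 \<in> W} (\<lambda>z. f (z 0))" for k
      by (rule Ck_cong[OF op[OF W]]) (simp add: inv)
    then have "smooth_Rn 1 (?j ` W) (f \<circ> inv_into UNIV ?j) \<longleftrightarrow> (\<forall>k. Ck_Rn 1 k {z \<in> Rn 1. z 0 \<in> W} (\<lambda>z. f (z 0)))"
      unfolding smooth_Rn_def im using op[OF W] by simp
    then show ?thesis using W Ck_R1_intro[OF op[OF W], of _ f] Ck_R1_elim[of _ W f] by blast
  qed
  show ?thesis
    unfolding chart_def
  proof (intro conjI allI impI; (elim conjE)?)
    show "openin (Euclidean_space 1) (range ?j)" unfolding im by (rule op) simp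
    show "homeomorphic_map (subtopology (space_top real_space) UNIV) (subtopology (Euclidean_space 1) (range ?j)) ?j"
      unfolding im using hom by (simp add: real_space_def)
    show "smooth_fun real_space W f \<longleftrightarrow> smooth_Rn 1 (?j ` W) (f \<circ> inv_into UNIV ?j)"
      if "openin (space_top real_space) W" for W f
      using sm[of W f] that by (simp add: real_space_def)
  qed (simp add: real_space_def)
qed

lemma charted_real_space: "charted real_space"
  unfolding charted_def using local_real_space chart_real_space by blast

lemma smooth_near_real_differentiable:
  "smooth_near real_space t f \<Longrightarrow> f differentiable at t"
  unfolding smooth_near_def real_space_def by (auto dest!: spec[of _ 0])

lemma smooth_near_real_DERIV:
  "smooth_near real_space t f \<Longrightarrow> (f has_real_derivative deriv f t) (at t)"
  using smooth_near_real_differentiable DERIV_deriv_iff_real_differentiable by blast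

lemma smooth_near_real_ident: "smooth_near real_space t (\<lambda>s. s)"
  using smooth_near_coord[OF chart_real_space _ local_real_space, of t 0] by simp

text \<open>A minimal requirement on the target of a smooth map. Quotients, products, subspaces and
  cotangent bundles satisfy it by construction, so maps into the cosphere bundle can be handled
  without charts on it.\<close>

definition open_domains :: "'a smooth_space \<Rightarrow> bool" where
  "open_domains M \<longleftrightarrow> (\<forall>V h. smooth_fun M V h \<longrightarrow> openin (space_top M) V)"

lemma local_open_domains: "local_space M \<Longrightarrow> open_domains M"
  unfolding open_domains_def using smooth_fun_open by fast

lemma smooth_map_in: "smooth_map M N F \<Longrightarrow> p \<in> points M \<Longrightarrow> F p \<in> points N"
  unfolding smooth_map_def points_def by (auto dest: continuous_map_funspace)

lemma smooth_map_near:
  assumes "smooth_map M N F" "p \<in> points M" "smooth_near N (F p) h"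
  shows "smooth_near M p (\<lambda>q. h (F q))"
proof -
  obtain V where V: "F p \<in> V" "smooth_fun N V h" using assms(3) unfolding smooth_near_def by blast
  then have "smooth_fun M {p \<in> points M. F p \<in> V} (h \<circ> F)" using assms(1) unfolding smooth_map_def by blast
  from smooth_nearI[OF _ this, of p] show ?thesis using V assms(2) by (simp add: o_def)
qed

lemma smooth_mapI:
  assumes M: "local_space M" and N: "open_domains N"
    and cont: "continuous_map (space_top M) (space_top N) F"
    and near: "\<And>p h. p \<in> points M \<Longrightarrow> smooth_near N (F p) h \<Longrightarrow> smooth_near M p (\<lambda>q. h (F q))"
  shows "smooth_map M N F"
  unfolding smooth_map_def
proof (intro conjI allI impI cont)
  fix V h assume h: "smooth_fun N V h"
  then have "openin (space_top N) V" using N unfolding open_domains_def by blast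
  then have op: "openin (space_top M) {p \<in> points M. F p \<in> V}"
    unfolding points_def by (rule openin_continuous_map_preimage[OF cont])
  have "smooth_near M p (h \<circ> F)" if "p \<in> {p \<in> points M. F p \<in> V}" for p
    using near[of p h] smooth_nearI[OF _ h, of "F p"] that by (simp add: o_def)
  then show "smooth_fun M {p \<in> points M. F p \<in> V} (h \<circ> F)"
    using op smooth_fun_iff_near[OF M] by blast
qed

lemma smooth_map_compose:
  assumes "smooth_map L M F" "smooth_map M N H"
  shows "smooth_map L N (\<lambda>x. H (F x))"
  unfolding smooth_map_def
proof (intro conjI allI impI)
  show "continuous_map (space_top L) (space_top N) (\<lambda>x. H (F x))"
    using assms continuous_map_compose[of "space_top L" "space_top M" F "space_top N" H]
    unfolding smooth_map_def by (simp add: o_def)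
  fix V h assume "smooth_fun N V h"
  then have "smooth_fun M {p \<in> points M. H p \<in> V} (h \<circ> H)" using assms(2) unfolding smooth_map_def by blast
  then have "smooth_fun L {p \<in> points L. F p \<in> {p \<in> points M. H p \<in> V}} (h \<circ> H \<circ> F)"
    using assms(1) unfolding smooth_map_def by blast
  moreover have "{p \<in> points L. F p \<in> {p \<in> points M. H p \<in> V}} = {p \<in> points L. H (F p) \<in> V}"
    using smooth_map_in[OF assms(1)] by blast
  ultimately show "smooth_fun L {p \<in> points L. H (F p) \<in> V} (h \<circ> (\<lambda>x. H (F x)))"
    by (simp add: o_def)
qed

lemma smooth_map_ident: "open_domains M \<Longrightarrow> smooth_map M M (\<lambda>x. x)"
  unfolding smooth_map_def
proof (intro conjI allI impI)
  fix V h assume M: "open_domains M" and h: "smooth_fun M V h"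
  then have "V \<subseteq> points M" unfolding open_domains_def points_def by (blast dest: openin_subset)
  then have "{p \<in> points M. p \<in> V} = V" by blast
  then show "smooth_fun M {p \<in> points M. p \<in> V} (h \<circ> (\<lambda>x. x))" using h by (simp add: o_def)
qed simp

lemma smooth_map_const:
  assumes "charted L" "open_domains N" "c \<in> points N"
  shows "smooth_map L N (\<lambda>_. c)"
proof (rule smooth_mapI[OF charted_local[OF assms(1)] assms(2)])
  show "continuous_map (space_top L) (space_top N) (\<lambda>_. c)" using assms(3) by (simp add: points_def)
qed (rule smooth_near_const[OF assms(1)])

lemma smooth_map_eq:
  assumes L: "local_space L" and N: "open_domains N" and F: "smooth_map L N F" and eq: "\<And>p. p \<in> points L \<Longrightarrow> F p = F' p"
  shows "smooth_map L N F'"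
proof (rule smooth_mapI[OF L N])
  show "continuous_map (space_top L) (space_top N) F'"
    by (rule continuous_map_eq[of _ _ F]) (use F eq in \<open>auto simp: smooth_map_def points_def\<close>)
  fix p h assume p: "p \<in> points L" and h: "smooth_near N (F' p) h"
  have "smooth_near L p (\<lambda>q. h (F q))" by (rule smooth_map_near[OF F p]) (use h eq[OF p] in simp)
  then show "smooth_near L p (\<lambda>q. h (F' q))"
    by (rule smooth_near_cong[OF L openin_topspace, rotated 2]) (use p eq in \<open>auto simp: points_def\<close>)
qed

section \<open>Tangent vectors as derivations\<close>

lemma tangentI: "smooth_map real_space M c \<Longrightarrow> c 0 = p \<Longrightarrow> velocity M c 0 \<in> tangent M p"
  unfolding tangent_def by blast

lemma tmap_velocity:
  assumes "smooth_map M N F" "c t \<in> points M" "c t = p"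
  shows "tmap N F p (velocity M c t) = velocity N (\<lambda>s. F (c s)) t"
  using smooth_map_near[OF assms(1,2)] unfolding assms(3)[symmetric] by (auto simp: tmap_def velocity_def fun_eq_iff)

lemma tangentE:
  assumes "v \<in> tangent M p"
  obtains c where "smooth_map real_space M c" "c 0 = p" "v = velocity M c 0"
  using assms unfolding tangent_def by blast

lemma tangent_points: "v \<in> tangent M p \<Longrightarrow> p \<in> points M"
  using smooth_map_in[of real_space M _ 0] by (auto elim!: tangentE)

lemma tmap_tangent:
  assumes "smooth_map M N F" "v \<in> tangent M p"
  shows "tmap N F p v \<in> tangent N (F p)"
proof -
  obtain c where c: "smooth_map real_space M c" "c 0 = p" "v = velocity M c 0" by (rule tangentE[OF assms(2)])
  have "tmap N F p v = velocity N (\<lambda>s. F (c s)) 0"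
    unfolding c(3) using tangent_points[OF assms(2)] c(2) by (intro tmap_velocity[OF assms(1)]) auto
  then show ?thesis using tangentI[OF smooth_map_compose[OF c(1) assms(1)]] c(2) by simp
qed

lemma tmap_compose:
  assumes "smooth_map M N F" "smooth_map N P H" "p \<in> points M"
  shows "tmap P H (F p) (tmap N F p v) = tmap P (\<lambda>x. H (F x)) p v"
  using smooth_map_near[OF assms(2) smooth_map_in[OF assms(1,3)]] by (auto simp: tmap_def fun_eq_iff)

lemma tangent_not_near: "v \<in> tangent M p \<Longrightarrow> \<not> smooth_near M p f \<Longrightarrow> v f = 0"
  by (auto elim!: tangentE simp: velocity_def)

lemma tmap_ident: "v \<in> tangent M p \<Longrightarrow> tmap M (\<lambda>x. x) p v = v"
  using tangent_not_near by (fastforce simp: tmap_def fun_eq_iff)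

lemma tmap_apply: "smooth_near N (F p) h \<Longrightarrow> tmap N F p v h = v (\<lambda>q. h (F q))"
  by (simp add: tmap_def)

lemma tmap_lincomb:
  "tmap N F p (\<lambda>f. a * v f + b * w f) = (\<lambda>h. a * tmap N F p v h + b * tmap N F p w h)"
  by (auto simp: tmap_def)

text \<open>A velocity is defined through the total operator \<open>deriv\<close>. For functions
  smooth near the point the derivative really exists, and one curve serves all of them.\<close>

lemma tangent_DERIV:
  assumes "v \<in> tangent M p"
  obtains c where "smooth_map real_space M c" "c 0 = p"
    "\<And>f. smooth_near M p f \<Longrightarrow> ((\<lambda>s. f (c s)) has_real_derivative v f) (at 0)"
proof -
  obtain c where c: "smooth_map real_space M c" "c 0 = p" "v = velocity M c 0" by (rule tangentE[OF assms])
  have "((\<lambda>s. f (c s)) has_real_derivative v f) (at 0)" if "smooth_near M p f" for f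
    using smooth_near_real_DERIV[OF smooth_map_near[OF c(1), of 0 f]] that c by (simp add: velocity_def)
  then show thesis using that[OF c(1,2)] by blast
qed

lemma curve_eventually:
  assumes "smooth_map real_space M c" "openin (space_top M) V" "c t \<in> V"
  shows "\<forall>\<^sub>F s in nhds t. c s \<in> V"
proof -
  have "continuous_map euclideanreal (space_top M) c" using assms(1) unfolding smooth_map_def by (simp add: real_space_def)
  from openin_continuous_map_preimage[OF this assms(2)] have "open {s. c s \<in> V}" by simp
  from eventually_nhds_in_open[OF this, of t] show ?thesis using assms(3) by simp
qed

text \<open>A tangent vector is a functional on total functions that vanishes on those not smooth
  near \<open>p\<close>. Both the derivative along the curve and the smoothness test depend only on
  the germ.\<close>

lemma tangent_near_cong:
  assumes M: "local_space M" and v: "v \<in> tangent M p" and V: "openin (space_top M) V" "p \<in> V"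
    and eq: "\<And>q. q \<in> V \<Longrightarrow> f q = g q"
  shows "v f = v g"
proof -
  obtain c where c: "smooth_map real_space M c" "c 0 = p" "v = velocity M c 0" by (rule tangentE[OF v])
  have iff: "smooth_near M p f \<longleftrightarrow> smooth_near M p g"
    using smooth_near_cong[OF M V, of f g] smooth_near_cong[OF M V, of g f] eq by auto
  have "\<forall>\<^sub>F s in nhds 0. f (c s) = g (c s)"
    by (rule eventually_mono[OF curve_eventually[OF c(1) V(1)]]) (use c V eq in auto)
  from deriv_cong_ev[OF this refl] show ?thesis
    unfolding c(3) velocity_def c(2) using iff by simp
qed

lemma tmap_cong:
  assumes M: "local_space M" and v: "v \<in> tangent M p" and V: "openin (space_top M) V" "p \<in> V"
    and eq: "\<And>q. q \<in> V \<Longrightarrow> F q = F' q"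
  shows "tmap N F p v = tmap N F' p v"
proof
  fix h
  have "v (\<lambda>q. h (F q)) = v (\<lambda>q. h (F' q))"
    by (rule tangent_near_cong[OF M v V]) (use eq in simp)
  then show "tmap N F p v h = tmap N F' p v h" using eq[OF V(2)] by (simp add: tmap_def)
qed

lemma tangent_compose:
  assumes M: "charted M" and v: "v \<in> tangent M p"
    and f: "\<And>i. i < m \<Longrightarrow> smooth_near M p (f i)"
    and F: "smooth_Rn m D F" and pD: "(\<lambda>i. if i < m then f i p else 0) \<in> D"
  shows "v (\<lambda>q. F (\<lambda>i. if i < m then f i q else 0)) =
    (\<Sum>i<m. partial_deriv i F (\<lambda>i. if i < m then f i p else 0) * v (f i))"
proof -
  obtain c where c: "smooth_map real_space M c" "c 0 = p"
    "\<And>f. smooth_near M p f \<Longrightarrow> ((\<lambda>s. f (c s)) has_real_derivative v f) (at 0)"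
    using tangent_DERIV[OF v] by blast
  have "smooth_near M p (\<lambda>q. F (\<lambda>i. if i < m then f i q else 0))"
    by (rule smooth_near_compose[OF M tangent_points[OF v] f F pD])
  from c(3)[OF this] have d1: "((\<lambda>s. F (\<lambda>i. if i < m then f i (c s) else 0)) has_real_derivative
      v (\<lambda>q. F (\<lambda>i. if i < m then f i q else 0))) (at 0)" .
  have D: "openin (Euclidean_space m) D" and CF: "Ck_Rn m (Suc 0) D F" using F unfolding smooth_Rn_def by blast+
  have "((\<lambda>s. F (\<lambda>i. if i < m then f i (c s) else 0)) has_real_derivative
      (\<Sum>i<m. partial_deriv i F (\<lambda>i. if i < m then f i (c 0) else 0) * v (f i))) (at 0)"
  proof (rule C1_chain[OF D CF])
    show "(\<lambda>i. if i < m then f i (c 0) else 0) \<in> D" unfolding c(2) by (rule pD)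
    show "\<forall>\<^sub>F s in nhds 0. (\<lambda>i. if i < m then f i (c s) else 0) \<in> Rn m" by (simp add: Rn_iff)
    show "((\<lambda>s. if i < m then f i (c s) else 0) has_real_derivative v (f i)) (at 0)" if "i < m" for i
      using c(3)[OF f[OF that]] that by simp
  qed
  from DERIV_unique[OF d1 this] show ?thesis unfolding c(2) .
qed

lemma tangent_const: "v \<in> tangent M p \<Longrightarrow> v (\<lambda>q. c) = 0"
  by (auto elim!: tangentE simp: velocity_def)

lemma tangent_add:
  assumes "charted M" "v \<in> tangent M p" "smooth_near M p f" "smooth_near M p g"
  shows "v (\<lambda>q. f q + g q) = v f + v g"
proof -
  obtain c where c: "\<And>f. smooth_near M p f \<Longrightarrow> ((\<lambda>s. f (c s)) has_real_derivative v f) (at 0)"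
    using tangent_DERIV[OF assms(2)] by blast
  show ?thesis
    by (rule DERIV_unique[OF c[OF smooth_near_add[OF assms(1,3,4)]] DERIV_add[OF c[OF assms(3)] c[OF assms(4)]]])
qed

lemma tangent_mult:
  assumes "charted M" "v \<in> tangent M p" "smooth_near M p f" "smooth_near M p g"
  shows "v (\<lambda>q. f q * g q) = v f * g p + v g * f p"
proof -
  obtain c where c: "c 0 = p" "\<And>f. smooth_near M p f \<Longrightarrow> ((\<lambda>s. f (c s)) has_real_derivative v f) (at 0)"
    using tangent_DERIV[OF assms(2)] by blast
  from DERIV_unique[OF c(2)[OF smooth_near_mult[OF assms(1,3,4)]] DERIV_mult[OF c(2)[OF assms(3)] c(2)[OF assms(4)]]]
  show ?thesis by (simp add: c(1))
qed

lemma tangent_cmult: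
  assumes "charted M" "v \<in> tangent M p" "smooth_near M p f"
  shows "v (\<lambda>q. a * f q) = a * v f"
  using tangent_mult[OF assms(1,2) smooth_near_const[OF assms(1) tangent_points[OF assms(2)]] assms(3), of a]
  by (simp add: tangent_const[OF assms(2)])

lemma tangent_sum:
  assumes M: "charted M" and v: "v \<in> tangent M p"
  shows "(\<And>i. i < m \<Longrightarrow> smooth_near M p (f i)) \<Longrightarrow> v (\<lambda>q. \<Sum>i<(m::nat). f i q) = (\<Sum>i<m. v (f i))"
proof (induction m)
  case 0
  then show ?case by (simp add: tangent_const[OF v])
next
  case (Suc m)
  have "smooth_near M p (\<lambda>q. \<Sum>i<m. f i q)"
    by (rule smooth_near_sum[OF M tangent_points[OF v]]) (use Suc.prems in auto)
  from tangent_add[OF M v this Suc.prems[of m]] Suc show ?case by simp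
qed

section \<open>Coordinate vectors\<close>

lemma coord_vec_eq:
  assumes L: "local_space M" and ch: "chart M U n x" "p \<in> U" and f: "smooth_near M p f" and i: "i < n"
  shows "coord_vec M U x i p f = partial_deriv i (f \<circ> inv_into U x) (x p)"
proof -
  obtain V where V: "openin (Euclidean_space n) V" "x p \<in> V" "smooth_Rn n V (f \<circ> inv_into U x)"
    by (rule smooth_near_chart_rep[OF L ch f])
  have "Ck_Rn n (Suc 0) V (f \<circ> inv_into U x)" using V(3) unfolding smooth_Rn_def by blast
  from Ck_partial_DERIV[OF this V(2) i]
  have "((\<lambda>t. (f \<circ> inv_into U x) ((x p)(i := x p i + t))) has_real_derivative
      partial_deriv i (f \<circ> inv_into U x) (x p)) (at 0)"
    using DERIV_shift[of "\<lambda>s. (f \<circ> inv_into U x) ((x p)(i := s))" _ 0 "x p i"] by (simp add: add.commute)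
  from DERIV_imp_deriv[OF this] show ?thesis using f by (simp add: coord_vec_def)
qed

text \<open>Smoothness of a map that is given by its coordinates. With the real line as source it
  produces the curves that realise tangent vectors.\<close>

lemma smooth_map_into_chart:
  assumes L: "charted L" and M: "local_space M" and ch: "chart M U n x"
    and z: "\<And>p i. p \<in> points L \<Longrightarrow> i < n \<Longrightarrow> smooth_near L p (\<lambda>q. z q i)"
    and zU: "\<And>p. p \<in> points L \<Longrightarrow> z p \<in> x ` U"
  shows "smooth_map L M (\<lambda>p. inv_into U x (z p))"
proof (rule smooth_mapI[OF charted_local[OF L] local_open_domains[OF M]])
  have zeq: "(\<lambda>i. if i < n then z p i else 0) = z p" if "p \<in> points L" for p
  proof -
    have "z p \<in> Rn n" using zU[OF that] openin_subset[OF chart_image_open[OF ch]] by blast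
    then show ?thesis by (auto simp: Rn_iff fun_eq_iff)
  qed
  have "continuous_map (space_top L) (Euclidean_space n) (\<lambda>p i. if i < n then z p i else 0)"
    unfolding continuous_map_componentwise_Euclidean_space using continuous_map_of_near[OF L z] by blast
  then have cz: "continuous_map (space_top L) (Euclidean_space n) z"
    by (rule continuous_map_eq) (use zeq in \<open>simp add: points_def\<close>)
  have inU: "inv_into U x (z p) \<in> U" if "p \<in> points L" for p using zU[OF that] by (rule inv_into_into)
  have xinv: "x (inv_into U x (z p)) = z p" if "p \<in> points L" for p using zU[OF that] by (rule f_inv_into_f)
  show "continuous_map (space_top L) (space_top M) (\<lambda>p. inv_into U x (z p))"
    unfolding continuous_map_def
  proof (intro conjI allI impI)
    show "(\<lambda>p. inv_into U x (z p)) \<in> topspace (space_top L) \<rightarrow> topspace (space_top M)"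
      using inU chart_subset[OF ch] by (auto simp: points_def)
    fix W assume W: "openin (space_top M) W"
    have "openin (space_top M) (W \<inter> U)" using W chart_open[OF ch] by blast
    then have "openin (Euclidean_space n) (x ` (W \<inter> U))" by (rule chart_open_image[OF ch]) simp
    from openin_continuous_map_preimage[OF cz this]
    have "openin (space_top L) {p \<in> topspace (space_top L). z p \<in> x ` (W \<inter> U)}" .
    moreover have "z p \<in> x ` (W \<inter> U) \<longleftrightarrow> inv_into U x (z p) \<in> W" if "p \<in> points L" for p
    proof
      assume "z p \<in> x ` (W \<inter> U)"
      then obtain q where "q \<in> W" "q \<in> U" "z p = x q" by blast
      then show "inv_into U x (z p) \<in> W" using ch by simp
    next
      assume "inv_into U x (z p) \<in> W"
      then show "z p \<in> x ` (W \<inter> U)" using inU[OF that] xinv[OF that] by (metis IntI imageI)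
    qed
    ultimately show "openin (space_top L) {p \<in> topspace (space_top L). inv_into U x (z p) \<in> W}"
      by (simp add: points_def cong: conj_cong)
  qed
  fix p h assume p: "p \<in> points L" and h: "smooth_near M (inv_into U x (z p)) h"
  obtain V where V: "openin (Euclidean_space n) V" "x (inv_into U x (z p)) \<in> V" "smooth_Rn n V (h \<circ> inv_into U x)"
    by (rule smooth_near_chart_rep[OF M ch inU[OF p] h])
  have "smooth_near L p (\<lambda>q. (h \<circ> inv_into U x) (\<lambda>i. if i < n then z q i else 0))"
  proof (rule smooth_near_compose[OF L p _ V(3)])
    show "(\<lambda>i. if i < n then z p i else 0) \<in> V" unfolding zeq[OF p] using V(2) xinv[OF p] by simp
  qed (rule z[OF p])
  then show "smooth_near L p (\<lambda>q. h (inv_into U x (z q)))"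
    by (rule smooth_near_cong[OF charted_local[OF L] openin_topspace, rotated 2])
      (use p zeq in \<open>auto simp: points_def\<close>)
qed

text \<open>Near \<open>p\<close> a function is its chart representative composed with the
  coordinate functions, so the chain rule expresses \<open>v f\<close> through the values of
  \<open>v\<close> on the coordinates.\<close>

lemma tangent_expand:
  assumes M: "charted M" and v: "v \<in> tangent M p" and ch: "chart M U n x" "p \<in> U"
  shows "v = (\<lambda>f. \<Sum>i<n. v (\<lambda>q. x q i) * coord_vec M U x i p f)"
proof
  fix f
  have L: "local_space M" using M by (rule charted_local)
  show "v f = (\<Sum>i<n. v (\<lambda>q. x q i) * coord_vec M U x i p f)"
  proof (cases "smooth_near M p f")
    case False
    then show ?thesis using tangent_not_near[OF v False] by (simp add: coord_vec_def)
  next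
    case True
    obtain V where V: "openin (Euclidean_space n) V" "x p \<in> V" "smooth_Rn n V (f \<circ> inv_into U x)"
      by (rule smooth_near_chart_rep[OF L ch True])
    have xeq: "(\<lambda>i. if i < n then x q i else 0) = x q" if "q \<in> U" for q
      using chart_Rn[OF ch(1) that] by (auto simp: Rn_iff fun_eq_iff)
    have "v f = v (\<lambda>q. (f \<circ> inv_into U x) (\<lambda>i. if i < n then x q i else 0))"
      by (rule tangent_near_cong[OF L v chart_open[OF ch(1)] ch(2)]) (use xeq ch(1) in simp)
    also have "\<dots> = (\<Sum>i<n. partial_deriv i (f \<circ> inv_into U x) (\<lambda>i. if i < n then x p i else 0) * v (\<lambda>q. x q i))"
    proof (rule tangent_compose[OF M v _ V(3)])
      show "(\<lambda>i. if i < n then x p i else 0) \<in> V" unfolding xeq[OF ch(2)] by (rule V(2))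
    qed (rule smooth_near_coord[OF ch L])
    also have "\<dots> = (\<Sum>i<n. v (\<lambda>q. x q i) * coord_vec M U x i p f)"
      unfolding xeq[OF ch(2)] using coord_vec_eq[OF L ch True] by (intro sum.cong) auto
    finally show ?thesis .
  qed
qed

text \<open>The coordinate line is reparametrised by \<open>t / (1 + (t/\<epsilon>)\<^sup>2)\<close>, which keeps it inside the chart for
  all \<open>t\<close>, as a curve has to be defined on the whole real line.\<close>

lemma tangent_combo:
  assumes M: "charted M" and ch: "chart M U n x" "p \<in> U"
  shows "(\<lambda>f. \<Sum>i<n. a i * coord_vec M U x i p f) \<in> tangent M p"
proof -
  have L: "local_space M" using M by (rule charted_local)
  have xR: "x p \<in> Rn n" by (rule chart_Rn[OF ch])
  obtain e where e: "e > 0" "nbox n (x p) e \<subseteq> x ` U"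
    using chart_image_open[OF ch(1)] ch(2) unfolding openin_Euclidean_iff by blast
  define A where "A = (\<Sum>i<n. \<bar>a i\<bar>) + 1"
  have A: "A > 0" "\<And>i. i < n \<Longrightarrow> \<bar>a i\<bar> \<le> A"
  proof -
    show "A > 0" by (simp add: A_def add_nonneg_pos sum_nonneg)
    fix i assume "i < n"
    then have "\<bar>a i\<bar> \<le> (\<Sum>i<n. \<bar>a i\<bar>)" by (intro member_le_sum[of i _ "\<lambda>i. \<bar>a i\<bar>"]) auto
    then show "\<bar>a i\<bar> \<le> A" by (simp add: A_def)
  qed
  \<comment> \<open>Each \<bar>\<open>a i\<close>\<bar> is at most \<open>A\<close> and \<phi> stays
    below \<epsilon> in absolute value, so every coordinate moves by less than
    \<open>e\<close>.\<close>
  define \<epsilon> where "\<epsilon> = e / A"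
  have \<epsilon>: "\<epsilon> > 0" using e A by (simp add: \<epsilon>_def)
  define \<phi> where "\<phi> t = t / (1 + (t / \<epsilon>) * (t / \<epsilon>))" for t :: real
  have den: "1 + (t / \<epsilon>) * (t / \<epsilon>) > 0" for t using add_pos_nonneg[of 1 "(t / \<epsilon>) * (t / \<epsilon>)"] by simp
  have \<phi>s: "smooth_near real_space t \<phi>" for t
    unfolding \<phi>_def divide_inverse[of _ \<epsilon>] mult.commute[of _ "inverse \<epsilon>"]
    using den[of t] unfolding divide_inverse[of _ \<epsilon>] mult.commute[of _ "inverse \<epsilon>"]
    by (intro smooth_near_divide smooth_near_add smooth_near_mult smooth_near_const charted_real_space smooth_near_real_ident) auto
  have \<phi>0: "\<phi> 0 = 0" by (simp add: \<phi>_def)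
  have d\<phi>: "(\<phi> has_real_derivative 1) (at 0)"
    unfolding \<phi>_def using \<epsilon> by (auto intro!: derivative_eq_intros)
  have \<phi>b: "\<bar>\<phi> t\<bar> < \<epsilon>" for t
  proof -
    \<comment> \<open>The inequality 2 u \<le> 1 + u^2 with u the absolute value of t/\<epsilon>,
      from the square of u - 1.\<close>
    have "2 * \<bar>t / \<epsilon>\<bar> \<le> 1 + (t / \<epsilon>) * (t / \<epsilon>)"
      using zero_le_power2[of "\<bar>t / \<epsilon>\<bar> - 1"] by (simp add: power2_eq_square algebra_simps)
    then have "\<bar>t / \<epsilon>\<bar> < 1 + (t / \<epsilon>) * (t / \<epsilon>)" using den[of t] by linarith
    then have "\<bar>t\<bar> < \<epsilon> * (1 + (t / \<epsilon>) * (t / \<epsilon>))" using \<epsilon> by (simp add: abs_divide pos_divide_less_eq mult.commute)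
    then show ?thesis using den[of t] by (simp add: \<phi>_def abs_divide pos_divide_less_eq)
  qed
  define z where "z t = (\<lambda>i. if i < n then x p i + a i * \<phi> t else 0)" for t
  have zU: "z t \<in> x ` U" for t
  proof -
    have "\<bar>z t i - x p i\<bar> < e" if "i < n" for i
    proof -
      have "\<bar>a i * \<phi> t\<bar> \<le> A * \<bar>\<phi> t\<bar>" using A(2)[OF that] by (simp add: abs_mult mult_right_mono)
      also have "\<dots> < A * \<epsilon>" using A \<phi>b by simp
      also have "\<dots> = e" using A by (simp add: \<epsilon>_def)
      finally show ?thesis using that by (simp add: z_def)
    qed
    then have "z t \<in> nbox n (x p) e" by (auto simp: nbox_def Rn_iff z_def)
    then show ?thesis using e by blast
  qed
  have z0: "z 0 = x p"
  proof
    fix i show "z 0 i = x p i" using xR unfolding z_def \<phi>0 Rn_iff by (cases "i < n") simp_all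
  qed
  have zs: "smooth_near real_space t (\<lambda>s. z s i)" if "i < n" for t i
    using that unfolding z_def
    by simp (intro smooth_near_add smooth_near_cmult smooth_near_const charted_real_space \<phi>s, simp)
  define c where "c t = inv_into U x (z t)" for t
  have c: "smooth_map real_space M c"
    unfolding c_def by (rule smooth_map_into_chart[OF charted_real_space L ch(1)]) (use zs zU in auto)
  have c0: "c 0 = p" using ch by (simp add: c_def z0)
  have "velocity M c 0 = (\<lambda>f. \<Sum>i<n. a i * coord_vec M U x i p f)"
  proof
    fix f
    show "velocity M c 0 f = (\<Sum>i<n. a i * coord_vec M U x i p f)"
    proof (cases "smooth_near M p f")
      case False
      then show ?thesis by (simp add: velocity_def c0 coord_vec_def)
    next
      case True
      obtain V where V: "openin (Euclidean_space n) V" "x p \<in> V" "smooth_Rn n V (f \<circ> inv_into U x)"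
        by (rule smooth_near_chart_rep[OF L ch True])
      have "((\<lambda>t. (f \<circ> inv_into U x) (z t)) has_real_derivative
          (\<Sum>i<n. partial_deriv i (f \<circ> inv_into U x) (z 0) * a i)) (at 0)"
      proof (rule C1_chain[OF V(1)])
        show "Ck_Rn n (Suc 0) V (f \<circ> inv_into U x)" using V(3) unfolding smooth_Rn_def by blast
        show "z 0 \<in> V" unfolding z0 by (rule V(2))
        show "\<forall>\<^sub>F t in nhds 0. z t \<in> Rn n" by (simp add: Rn_iff z_def)
        fix i assume i: "i < n"
        have "((\<lambda>t. x p i + a i * \<phi> t) has_real_derivative 0 + a i * 1) (at 0)"
          by (intro DERIV_add DERIV_const DERIV_cmult d\<phi>)
        then show "((\<lambda>t. z t i) has_real_derivative a i) (at 0)" using i by (simp add: z_def)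
      qed
      from DERIV_imp_deriv[OF this]
      have "deriv (\<lambda>t. f (c t)) 0 = (\<Sum>i<n. partial_deriv i (f \<circ> inv_into U x) (x p) * a i)"
        by (simp add: z0 c_def)
      then have "velocity M c 0 f = (\<Sum>i<n. partial_deriv i (f \<circ> inv_into U x) (x p) * a i)"
        using True by (simp add: velocity_def c0)
      also have "\<dots> = (\<Sum>i<n. a i * coord_vec M U x i p f)"
        using coord_vec_eq[OF L ch True] by (intro sum.cong) auto
      finally show ?thesis .
    qed
  qed
  then show ?thesis using tangentI[OF c c0] by simp
qed

lemma coord_vec_coord:
  assumes L: "local_space M" and ch: "chart M U n x" "p \<in> U" and i: "i < n"
  shows "coord_vec M U x i p (\<lambda>q. x q j) = (if i = j then 1 else 0)"
proof -
  have op: "openin (Euclidean_space n) (x ` U)" by (rule chart_image_open[OF ch(1)])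
  have "coord_vec M U x i p (\<lambda>q. x q j) = partial_deriv i ((\<lambda>q. x q j) \<circ> inv_into U x) (x p)"
    by (rule coord_vec_eq[OF L ch smooth_near_coord[OF ch L] i])
  also have "\<dots> = partial_deriv i (\<lambda>z. z j) (x p)"
    by (rule partial_deriv_cong(1)[OF op _ i]) (use ch(2) in \<open>auto simp: f_inv_into_f\<close>)
  also have "\<dots> = (if i = j then 1 else 0)" by (auto simp: partial_deriv_def)
  finally show ?thesis .
qed

lemma coord_vec_tangent:
  assumes M: "charted M" and ch: "chart M U n x" "p \<in> U" and i: "i < n"
  shows "coord_vec M U x i p \<in> tangent M p"
proof -
  have "(\<lambda>f. \<Sum>j<n. (if j = i then 1 else 0) * coord_vec M U x j p f) = coord_vec M U x i p"
    using i by (auto simp: fun_eq_iff if_distrib[of "\<lambda>a. a * _"] cong: if_cong)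
  with tangent_combo[OF M ch, of "\<lambda>j. if j = i then 1 else 0"] show ?thesis by simp
qed

lemma charted_pointE:
  assumes "charted M" "p \<in> points M"
  obtains U n x where "chart M U n x" "p \<in> U"
  using assms unfolding charted_def by blast

text \<open>Tangent vectors are velocities of curves, which cannot be added. The combination is
  formed from the coordinates of both vectors and realised by a curve in a chart through
  \<open>tangent_combo\<close>.\<close>

lemma tangent_lincomb:
  assumes M: "charted M" and v: "v \<in> tangent M p" and w: "w \<in> tangent M p"
  shows "(\<lambda>f. a * v f + b * w f) \<in> tangent M p"
proof -
  obtain U n x where ch: "chart M U n x" "p \<in> U" by (rule charted_pointE[OF M tangent_points[OF v]])
  have "(\<lambda>f. a * v f + b * w f) = (\<lambda>f. \<Sum>i<n. (a * v (\<lambda>q. x q i) + b * w (\<lambda>q. x q i)) * coord_vec M U x i p f)"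
  proof
    fix f
    have "v f = (\<Sum>i<n. v (\<lambda>q. x q i) * coord_vec M U x i p f)" by (rule fun_cong[OF tangent_expand[OF M v ch]])
    moreover have "w f = (\<Sum>i<n. w (\<lambda>q. x q i) * coord_vec M U x i p f)" by (rule fun_cong[OF tangent_expand[OF M w ch]])
    ultimately show "a * v f + b * w f = (\<Sum>i<n. (a * v (\<lambda>q. x q i) + b * w (\<lambda>q. x q i)) * coord_vec M U x i p f)"
      by (simp add: distrib_right sum.distrib sum_distrib_left mult.assoc)
  qed
  then show ?thesis using tangent_combo[OF M ch] by simp
qed

lemma tangent_zero:
  assumes "charted M" "p \<in> points M"
  shows "(\<lambda>f. 0) \<in> tangent M p"
proof -
  obtain U n x where ch: "chart M U n x" "p \<in> U" by (rule charted_pointE[OF assms])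
  from tangent_combo[OF assms(1) ch, of "\<lambda>i. 0"] show ?thesis by simp
qed

lemma tangent_setsum:
  assumes M: "charted M" and p: "p \<in> points M"
  shows "(\<And>i. i < m \<Longrightarrow> V i \<in> tangent M p) \<Longrightarrow> (\<lambda>f. \<Sum>i<(m::nat). a i * V i f) \<in> tangent M p"
proof (induction m)
  case 0
  then show ?case by (simp add: tangent_zero[OF M p])
next
  case (Suc m)
  have "(\<lambda>f. \<Sum>i<m. a i * V i f) \<in> tangent M p" using Suc by simp
  from tangent_lincomb[OF M this Suc.prems[of m], of 1 "a m"] show ?case by simp
qed

section \<open>Covectors\<close>

lemma cotangent_lincomb:
  assumes "\<alpha> \<in> cotangent M p" "v \<in> tangent M p" "w \<in> tangent M p"
  shows "\<alpha> (\<lambda>f. a * v f + b * w f) = a * \<alpha> v + b * \<alpha> w"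
  using assms unfolding cotangent_def by blast

lemma cotangent_outside: "\<alpha> \<in> cotangent M p \<Longrightarrow> v \<notin> tangent M p \<Longrightarrow> \<alpha> v = 0"
  unfolding cotangent_def by blast

lemma cotangent_zero_vec:
  assumes "charted M" "\<alpha> \<in> cotangent M p" "p \<in> points M"
  shows "\<alpha> (\<lambda>f. 0) = 0"
  using cotangent_lincomb[OF assms(2) tangent_zero[OF assms(1,3)] tangent_zero[OF assms(1,3)], of 0 0] by simp

lemma cotangent_sum:
  assumes M: "charted M" and \<alpha>: "\<alpha> \<in> cotangent M p" and p: "p \<in> points M"
  shows "(\<And>i. i < m \<Longrightarrow> V i \<in> tangent M p) \<Longrightarrow> \<alpha> (\<lambda>f. \<Sum>i<(m::nat). a i * V i f) = (\<Sum>i<m. a i * \<alpha> (V i))"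
proof (induction m)
  case 0
  then show ?case by (simp add: cotangent_zero_vec[OF M \<alpha> p])
next
  case (Suc m)
  have "(\<lambda>f. \<Sum>i<m. a i * V i f) \<in> tangent M p" by (rule tangent_setsum[OF M p]) (use Suc.prems in auto)
  from cotangent_lincomb[OF \<alpha> this Suc.prems[of m], of 1 "a m"] Suc show ?case by simp
qed

lemma cotangent_expand:
  assumes M: "charted M" and \<alpha>: "\<alpha> \<in> cotangent M p" and ch: "chart M U n x" "p \<in> U" and v: "v \<in> tangent M p"
  shows "\<alpha> v = (\<Sum>i<n. v (\<lambda>q. x q i) * \<alpha> (coord_vec M U x i p))"
  using cotangent_sum[OF M \<alpha> tangent_points[OF v], of n "\<lambda>i. coord_vec M U x i p" "\<lambda>i. v (\<lambda>q. x q i)"]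
    coord_vec_tangent[OF M ch] tangent_expand[OF M v ch] by simp

section \<open>Quotients, subsets and products\<close>

lemma smooth_space_eqI:
  fixes A B :: "'a smooth_space"
  assumes "\<And>V. openin (space_top A) V \<longleftrightarrow> openin (space_top B) V"
    and "\<And>V f. smooth_fun A V f \<longleftrightarrow> smooth_fun B V f"
  shows "A = B"
proof (rule smooth_space.equality)
  show "space_top A = space_top B" unfolding topology_eq using assms(1) by blast
  show "smooth_fun A = smooth_fun B" using assms(2) by (intro ext) blast
qed simp

lemma smooth_fun_quot_space:
  "smooth_fun (quot_space M q) V h \<longleftrightarrow>
    openin (space_top (quot_space M q)) V \<and> smooth_fun M {p \<in> points M. q p \<in> V} (h \<circ> q)"
  by (simp add: quot_space_def Let_def)

text \<open>Openness and smoothness on a quotient are both defined by pull-back, so a quotient in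
  two stages is the same record, not merely a diffeomorphic one. Iterated quotients can thereby be
  rewritten as quotients of the group.\<close>

lemma quot_space_compose: "quot_space (quot_space M q) r = quot_space M (\<lambda>p. r (q p))"
proof (rule smooth_space_eqI)
  have pre: "{p \<in> points M. q p \<in> {y \<in> q ` points M. r y \<in> V}} = {p \<in> points M. r (q p) \<in> V}" for V by blast
  show op: "openin (space_top (quot_space (quot_space M q) r)) V \<longleftrightarrow>
      openin (space_top (quot_space M (\<lambda>p. r (q p)))) V" for V
    unfolding openin_quot_space points_quot_space pre by (auto simp: image_image)
  show "smooth_fun (quot_space (quot_space M q) r) V f \<longleftrightarrow> smooth_fun (quot_space M (\<lambda>p. r (q p))) V f" for V f
  proof -
    have "smooth_fun (quot_space (quot_space M q) r) V f \<longleftrightarrow>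
        openin (space_top (quot_space M (\<lambda>p. r (q p)))) V \<and>
        openin (space_top (quot_space M q)) {y \<in> q ` points M. r y \<in> V} \<and>
        smooth_fun M {p \<in> points M. r (q p) \<in> V} (f \<circ> r \<circ> q)"
      unfolding smooth_fun_quot_space op points_quot_space pre ..
    also have "\<dots> \<longleftrightarrow> smooth_fun (quot_space M (\<lambda>p. r (q p))) V f"
      unfolding smooth_fun_quot_space openin_quot_space[of M q] pre
      by (auto simp: openin_quot_space o_def)
    finally show ?thesis .
  qed
qed

lemma smooth_fun_cong_imp:
  assumes "local_space M" "smooth_fun M W f" "\<And>p. p \<in> W \<Longrightarrow> f p = g p"
  shows "smooth_fun M W g"
proof (rule smooth_funI_local[OF assms(1) smooth_fun_open[OF assms(1,2)]])
  fix p assume "p \<in> W"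
  then show "\<exists>V h. p \<in> V \<and> smooth_fun M V h \<and> (\<forall>q\<in>W \<inter> V. g q = h q)"
    using assms(2,3) by (intro exI[of _ W] exI[of _ f]) simp
qed

lemma smooth_fun_cong:
  assumes "local_space M" "\<And>p. p \<in> W \<Longrightarrow> f p = g p"
  shows "smooth_fun M W f \<longleftrightarrow> smooth_fun M W g"
  using smooth_fun_cong_imp[OF assms(1), of W f g] smooth_fun_cong_imp[OF assms(1), of W g f] assms(2) by auto

lemma quot_space_cong:
  assumes M: "local_space M" and eq: "\<And>p. p \<in> points M \<Longrightarrow> q p = r p"
  shows "quot_space M q = quot_space M r"
proof (rule smooth_space_eqI)
  have pre: "{p \<in> points M. q p \<in> V} = {p \<in> points M. r p \<in> V}" for V using eq by auto
  have im: "q ` points M = r ` points M" using eq by auto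
  show op: "openin (space_top (quot_space M q)) V \<longleftrightarrow> openin (space_top (quot_space M r)) V" for V
    unfolding openin_quot_space pre im ..
  have "smooth_fun M {p \<in> points M. r p \<in> V} (f \<circ> q) \<longleftrightarrow> smooth_fun M {p \<in> points M. r p \<in> V} (f \<circ> r)" for V f
    by (rule smooth_fun_cong[OF M]) (simp add: eq)
  then show "smooth_fun (quot_space M q) V f \<longleftrightarrow> smooth_fun (quot_space M r) V f" for V f
    unfolding smooth_fun_quot_space op pre by simp
qed

lemma open_domains_quot: "open_domains (quot_space M q)"
  unfolding open_domains_def smooth_fun_quot_space by blast

lemma local_quot:
  assumes M: "local_space M"
  shows "local_space (quot_space M q)"
proof (rule local_spaceI)
  fix W f assume W: "openin (space_top (quot_space M q)) W"
    and loc: "\<forall>p\<in>W. \<exists>V g. p \<in> V \<and> smooth_fun (quot_space M q) V g \<and> (\<forall>q\<in>W \<inter> V. f q = g q)"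
  have "smooth_fun M {p \<in> points M. q p \<in> W} (f \<circ> q)"
  proof (rule smooth_funI_local[OF M])
    show "openin (space_top M) {p \<in> points M. q p \<in> W}" using W unfolding openin_quot_space by blast
    fix p assume p: "p \<in> {p \<in> points M. q p \<in> W}"
    then obtain V g where V: "q p \<in> V" "smooth_fun (quot_space M q) V g" "\<forall>q\<in>W \<inter> V. f q = g q"
      using loc by blast
    show "\<exists>V g. p \<in> V \<and> smooth_fun M V g \<and> (\<forall>q'\<in>{p \<in> points M. q p \<in> W} \<inter> V. (f \<circ> q) q' = g q')"
      using p V by (intro exI[of _ "{p \<in> points M. q p \<in> V}"] exI[of _ "g \<circ> q"]) (auto simp: smooth_fun_quot_space)
  qed
  then show "smooth_fun (quot_space M q) W f" using W by (simp add: smooth_fun_quot_space)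
qed (simp add: smooth_fun_quot_space)

lemma smooth_map_quot: "smooth_map M (quot_space M q) q"
  unfolding smooth_map_def
proof (intro conjI allI impI)
  show "continuous_map (space_top M) (space_top (quot_space M q)) q"
    unfolding continuous_map_def using points_quot_space[of M q] openin_quot_space[of M q]
    by (auto simp: points_def)
qed (simp add: smooth_fun_quot_space)

text \<open>The universal property of the quotient structure. It is the source of the maps out of
  the cosphere bundle, the coset space and the reduced space.\<close>

lemma smooth_map_from_quot:
  assumes F: "smooth_map M N (\<lambda>p. F (q p))" and N: "open_domains N"
  shows "smooth_map (quot_space M q) N F"
proof -
  have pre: "{p \<in> points M. q p \<in> {y \<in> q ` points M. F y \<in> V}} = {p \<in> points M. F (q p) \<in> V}" for V by blast
  have op: "openin (space_top (quot_space M q)) {y \<in> points (quot_space M q). F y \<in> V}"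
    if "openin (space_top N) V" for V
  proof -
    have "continuous_map (space_top M) (space_top N) (\<lambda>p. F (q p))" using F unfolding smooth_map_def by blast
    from openin_continuous_map_preimage[OF this that]
    show ?thesis unfolding openin_quot_space points_quot_space pre by (auto simp: points_def)
  qed
  show ?thesis
    unfolding smooth_map_def
  proof (intro conjI allI impI)
    show "continuous_map (space_top (quot_space M q)) (space_top N) F"
      unfolding continuous_map_def
    proof (intro conjI allI impI)
      show "F \<in> topspace (space_top (quot_space M q)) \<rightarrow> topspace (space_top N)"
        using smooth_map_in[OF F] points_quot_space[of M q] by (auto simp: points_def)
      show "openin (space_top (quot_space M q)) {y \<in> topspace (space_top (quot_space M q)). F y \<in> V}"
        if "openin (space_top N) V" for V using op[OF that] by (simp add: points_def)
    qed
    fix V h assume h: "smooth_fun N V h"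
    then have V: "openin (space_top N) V" using N unfolding open_domains_def by blast
    have "smooth_fun M {p \<in> points M. F (q p) \<in> V} (h \<circ> (\<lambda>p. F (q p)))"
      using F h unfolding smooth_map_def by blast
    then show "smooth_fun (quot_space M q) {y \<in> points (quot_space M q). F y \<in> V} (h \<circ> F)"
      unfolding smooth_fun_quot_space using op[OF V] by (simp add: points_quot_space pre[simplified] o_def conj_ac cong: conj_cong)
  qed
qed

section \<open>Induced structures on subsets\<close>

lemma smooth_fun_sub_space:
  "smooth_fun (sub_space M S) W f \<longleftrightarrow> openin (subtopology (space_top M) S) W \<and>
    (\<forall>p\<in>W. \<exists>V h. p \<in> V \<and> smooth_fun M V h \<and> (\<forall>q\<in>W \<inter> V. f q = h q))"
  by (simp add: sub_space_def)

lemma space_top_sub_space [simp]: "space_top (sub_space M S) = subtopology (space_top M) S"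
  by (simp add: sub_space_def)

lemma points_sub_space: "points (sub_space M S) = points M \<inter> S"
  by (simp add: points_def)

lemma open_domains_sub: "open_domains (sub_space M S)"
  unfolding open_domains_def smooth_fun_sub_space by simp

lemma smooth_map_sub_incl:
  assumes "open_domains M"
  shows "smooth_map (sub_space M S) M (\<lambda>p. p)"
  unfolding smooth_map_def
proof (intro conjI allI impI)
  show "continuous_map (space_top (sub_space M S)) (space_top M) (\<lambda>p. p)"
    by (simp add: continuous_map_from_subtopology)
  fix V h assume h: "smooth_fun M V h"
  then have V: "openin (space_top M) V" using assms unfolding open_domains_def by blast
  have eq: "{p \<in> points (sub_space M S). p \<in> V} = V \<inter> S"
    using openin_subset[OF V] by (auto simp: points_sub_space) (simp add: points_def subsetD)
  show "smooth_fun (sub_space M S) {p \<in> points (sub_space M S). p \<in> V} (h \<circ> (\<lambda>p. p))"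
    unfolding eq smooth_fun_sub_space
  proof (intro conjI ballI)
    show "openin (subtopology (space_top M) S) (V \<inter> S)" using V unfolding openin_subtopology by blast
    fix p assume "p \<in> V \<inter> S"
    then show "\<exists>V' h'. p \<in> V' \<and> smooth_fun M V' h' \<and> (\<forall>q\<in>V \<inter> S \<inter> V'. (h \<circ> (\<lambda>p. p)) q = h' q)"
      using h by (intro exI[of _ V] exI[of _ h]) simp
  qed
qed

lemma smooth_map_into_sub:
  assumes L: "local_space L" and F: "smooth_map L M F" and S: "\<And>p. p \<in> points L \<Longrightarrow> F p \<in> S"
  shows "smooth_map L (sub_space M S) F"
proof (rule smooth_mapI[OF L open_domains_sub])
  show "continuous_map (space_top L) (space_top (sub_space M S)) F"
    using F S unfolding smooth_map_def space_top_sub_space continuous_map_in_subtopology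
    by (auto simp: points_def)
  fix p h assume p: "p \<in> points L" and "smooth_near (sub_space M S) (F p) h"
  then obtain W where W: "F p \<in> W" "smooth_fun (sub_space M S) W h" unfolding smooth_near_def by blast
  obtain V g where V: "F p \<in> V" "smooth_fun M V g" "\<forall>q\<in>W \<inter> V. h q = g q"
    using W unfolding smooth_fun_sub_space by blast
  obtain T where T: "openin (space_top M) T" "W = T \<inter> S"
    using W(2) unfolding smooth_fun_sub_space openin_subtopology by blast
  have c: "continuous_map (space_top L) (space_top M) F" using F unfolding smooth_map_def by blast
  have s1: "smooth_fun L {q \<in> points L. F q \<in> V} (g \<circ> F)" using F V(2) unfolding smooth_map_def by blast
  have op: "openin (space_top L) ({q \<in> points L. F q \<in> T} \<inter> {q \<in> points L. F q \<in> V})"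
    using openin_continuous_map_preimage[OF c T(1)] smooth_fun_open[OF L s1] unfolding points_def by blast
  have "smooth_near L p (g \<circ> F)" by (rule smooth_nearI[OF _ s1]) (use p V in simp)
  then show "smooth_near L p (\<lambda>q. h (F q))"
    by (rule smooth_near_cong[OF L op, rotated 2]) (use p V W T S in \<open>auto simp: o_def\<close>)
qed

lemma smooth_map_sub_sub:
  assumes F: "smooth_map M N F" and S: "\<And>p. p \<in> points M \<Longrightarrow> p \<in> S \<Longrightarrow> F p \<in> S'"
  shows "smooth_map (sub_space M S) (sub_space N S') F"
  unfolding smooth_map_def
proof (intro conjI allI impI)
  have c: "continuous_map (space_top M) (space_top N) F" using F unfolding smooth_map_def by blast
  show cs: "continuous_map (space_top (sub_space M S)) (space_top (sub_space N S')) F"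
    unfolding space_top_sub_space continuous_map_in_subtopology
    using c S by (auto simp: continuous_map_from_subtopology points_def)
  fix W h assume h: "smooth_fun (sub_space N S') W h"
  show "smooth_fun (sub_space M S) {p \<in> points (sub_space M S). F p \<in> W} (h \<circ> F)"
    unfolding smooth_fun_sub_space
  proof (intro conjI ballI)
    have "openin (space_top (sub_space N S')) W" using h unfolding smooth_fun_sub_space by simp
    from openin_continuous_map_preimage[OF cs this]
    show "openin (subtopology (space_top M) S) {p \<in> points (sub_space M S). F p \<in> W}"
      unfolding points_def by simp
    fix p assume p: "p \<in> {p \<in> points (sub_space M S). F p \<in> W}"
    then obtain V g where V: "F p \<in> V" "smooth_fun N V g" "\<forall>q\<in>W \<inter> V. h q = g q"
      using h unfolding smooth_fun_sub_space by blast
    have "smooth_fun M {p \<in> points M. F p \<in> V} (g \<circ> F)" using F V(2) unfolding smooth_map_def by blast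
    then show "\<exists>V g. p \<in> V \<and> smooth_fun M V g \<and> (\<forall>q\<in>{p \<in> points (sub_space M S). F p \<in> W} \<inter> V. (h \<circ> F) q = g q)"
      using p V by (intro exI[of _ "{p \<in> points M. F p \<in> V}"] exI[of _ "g \<circ> F"]) (auto simp: points_sub_space)
  qed
qed

text \<open>The retraction \<open>r\<close> extends a function on the image of \<open>s\<close> to
  an open subset of \<open>N\<close>, so the induced structure on the image is the one carried over
  from \<open>M\<close>. Both the level set in the cosphere bundle and the diagonal are images of
  sections of this kind.\<close>

lemma sub_space_section:
  assumes M: "local_space M" and N: "open_domains N" and s: "smooth_map M N s" and r: "smooth_map N M r"
    and rs: "\<And>p. p \<in> points M \<Longrightarrow> r (s p) = p"
  shows "sub_space N (s ` points M) = quot_space M s"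
proof (rule smooth_space_eqI)
  have cs: "continuous_map (space_top M) (space_top N) s" using s unfolding smooth_map_def by blast
  have cr: "continuous_map (space_top N) (space_top M) r" using r unfolding smooth_map_def by blast
  show op: "openin (space_top (sub_space N (s ` points M))) V \<longleftrightarrow> openin (space_top (quot_space M s)) V" for V
  proof
    assume "openin (space_top (sub_space N (s ` points M))) V"
    then obtain T where T: "openin (space_top N) T" "V = T \<inter> s ` points M"
      by (auto simp: openin_subtopology)
    have "{p \<in> points M. s p \<in> V} = {p \<in> topspace (space_top M). s p \<in> T}"
      unfolding T(2) points_def by blast
    then show "openin (space_top (quot_space M s)) V"
      unfolding openin_quot_space using T openin_continuous_map_preimage[OF cs T(1)] by auto
  next
    assume V: "openin (space_top (quot_space M s)) V"
    then have V': "V \<subseteq> s ` points M" "openin (space_top M) {p \<in> points M. s p \<in> V}"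
      unfolding openin_quot_space by auto
    have "V = {q \<in> topspace (space_top N). r q \<in> {p \<in> points M. s p \<in> V}} \<inter> s ` points M"
      using V'(1) rs smooth_map_in[OF s] by (auto simp: points_def)
    then show "openin (space_top (sub_space N (s ` points M))) V"
      using openin_continuous_map_preimage[OF cr V'(2)] unfolding space_top_sub_space openin_subtopology by blast
  qed
  show "smooth_fun (sub_space N (s ` points M)) V f \<longleftrightarrow> smooth_fun (quot_space M s) V f" for V f
  proof
    assume f: "smooth_fun (sub_space N (s ` points M)) V f"
    then have V: "openin (space_top (quot_space M s)) V"
      unfolding op[symmetric] smooth_fun_sub_space by simp
    have "smooth_fun M {p \<in> points M. s p \<in> V} (f \<circ> s)"
    proof (rule smooth_funI_local[OF M])
      show "openin (space_top M) {p \<in> points M. s p \<in> V}" using V unfolding openin_quot_space by blast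
      fix p assume p: "p \<in> {p \<in> points M. s p \<in> V}"
      then obtain W h where W: "s p \<in> W" "smooth_fun N W h" "\<forall>q\<in>V \<inter> W. f q = h q"
        using f unfolding smooth_fun_sub_space by blast
      have "smooth_fun M {p \<in> points M. s p \<in> W} (h \<circ> s)" using s W(2) unfolding smooth_map_def by blast
      then show "\<exists>W g. p \<in> W \<and> smooth_fun M W g \<and> (\<forall>q\<in>{p \<in> points M. s p \<in> V} \<inter> W. (f \<circ> s) q = g q)"
        using p W by (intro exI[of _ "{p \<in> points M. s p \<in> W}"] exI[of _ "h \<circ> s"]) auto
    qed
    then show "smooth_fun (quot_space M s) V f" using V unfolding smooth_fun_quot_space by blast
  next
    assume f: "smooth_fun (quot_space M s) V f"
    show "smooth_fun (sub_space N (s ` points M)) V f"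
      unfolding smooth_fun_sub_space
    proof (intro conjI ballI)
      have V: "openin (space_top (quot_space M s)) V" using f unfolding smooth_fun_quot_space by blast
      then show "openin (subtopology (space_top N) (s ` points M)) V" using op by simp
      have Vs: "V \<subseteq> s ` points M" using V unfolding openin_quot_space by blast
      let ?W = "{q \<in> points N. r q \<in> {p \<in> points M. s p \<in> V}}"
      have "smooth_fun M {p \<in> points M. s p \<in> V} (f \<circ> s)" using f unfolding smooth_fun_quot_space by blast
      then have W: "smooth_fun N ?W (f \<circ> s \<circ> r)" using r unfolding smooth_map_def by blast
      fix y assume y: "y \<in> V"
      have "s (r q) = q" if "q \<in> V" for q using that Vs rs by auto
      moreover have "y \<in> ?W" using y Vs rs smooth_map_in[OF s] by auto
      ultimately show "\<exists>W h. y \<in> W \<and> smooth_fun N W h \<and> (\<forall>q\<in>V \<inter> W. f q = h q)"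
        using W by (intro exI[of _ ?W] exI[of _ "f \<circ> s \<circ> r"]) simp
    qed
  qed
qed

section \<open>Transport of manifolds along bijections\<close>

lemma smooth_Rn_cong:
  assumes "\<And>z. z \<in> V \<Longrightarrow> F z = F' z"
  shows "smooth_Rn n V F \<longleftrightarrow> smooth_Rn n V F'"
  unfolding smooth_Rn_def using Ck_cong[of n V F F'] assms by blast

lemma chart_pullback:
  assumes M: "local_space M" and N: "local_space N" and F: "smooth_map M N F" and F': "smooth_map N M F'"
    and F'F: "\<And>p. p \<in> points M \<Longrightarrow> F' (F p) = p" and FF': "\<And>q. q \<in> points N \<Longrightarrow> F (F' q) = q"
    and ch: "chart N U n x"
  shows "chart M {p \<in> points M. F p \<in> U} n (\<lambda>p. x (F p))"
proof -
  let ?W = "{p \<in> points M. F p \<in> U}"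
  have cF: "continuous_map (space_top M) (space_top N) F" using F unfolding smooth_map_def by blast
  have cF': "continuous_map (space_top N) (space_top M) F'" using F' unfolding smooth_map_def by blast
  have UN: "U \<subseteq> points N" by (rule chart_subset[OF ch])
  have Wop: "openin (space_top M) ?W"
    using openin_continuous_map_preimage[OF cF chart_open[OF ch]] unfolding points_def .
  have FW: "F ` ?W = U" using UN FF' smooth_map_in[OF F'] by (auto simp: image_iff) (metis subsetD)
  have im: "(\<lambda>p. x (F p)) ` ?W = x ` U" using FW by (metis image_image)
  have sm: "smooth_fun M W f \<longleftrightarrow> smooth_fun N (F ` W) (f \<circ> F')" if W: "openin (space_top M) W" "W \<subseteq> ?W" for W f
  proof -
    have eqW: "{p \<in> points M. F p \<in> F ` W} = W"
    proof
      show "{p \<in> points M. F p \<in> F ` W} \<subseteq> W"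
      proof
        fix p assume "p \<in> {p \<in> points M. F p \<in> F ` W}"
        then obtain q where "p \<in> points M" "q \<in> W" "F p = F q" by auto
        then show "p \<in> W" using F'F[of p] F'F[of q] W(2) by auto
      qed
    qed (use W(2) in blast)
    have eqF: "{q \<in> points N. F' q \<in> W} = F ` W"
    proof
      show "{q \<in> points N. F' q \<in> W} \<subseteq> F ` W" using FF' by (auto simp: image_iff) metis
      show "F ` W \<subseteq> {q \<in> points N. F' q \<in> W}" using W(2) F'F smooth_map_in[OF F] by auto
    qed
    show ?thesis
    proof
      assume "smooth_fun M W f"
      then show "smooth_fun N (F ` W) (f \<circ> F')" using F' eqF unfolding smooth_map_def by metis
    next
      assume "smooth_fun N (F ` W) (f \<circ> F')"
      then have "smooth_fun M W (f \<circ> F' \<circ> F)" using F eqW unfolding smooth_map_def by metis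
      then show "smooth_fun M W f"
        by (rule smooth_fun_cong_imp[OF M]) (use W(2) F'F in auto)
    qed
  qed
  have inj: "inj_on (\<lambda>p. x (F p)) ?W"
  proof (rule inj_onI)
    fix p q assume pq: "p \<in> ?W" "q \<in> ?W" and eq: "x (F p) = x (F q)"
    have "F p = F q" by (rule inj_onD[OF chart_inj[OF ch] eq]) (use pq in simp_all)
    then have "F' (F p) = F' (F q)" by (rule arg_cong)
    moreover have "F' (F p) = p" "F' (F q) = q" using pq by (simp_all add: F'F)
    ultimately show "p = q" by (simp only:)
  qed
  have hF: "homeomorphic_map (subtopology (space_top M) ?W) (subtopology (space_top N) U) F"
    unfolding homeomorphic_map_maps homeomorphic_maps_def
  proof (intro exI[of _ F'] conjI ballI)
    show "continuous_map (subtopology (space_top M) ?W) (subtopology (space_top N) U) F"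
      using cF by (auto simp: continuous_map_in_subtopology continuous_map_from_subtopology)
    show "continuous_map (subtopology (space_top N) U) (subtopology (space_top M) ?W) F'"
      using cF' FF' UN smooth_map_in[OF F'] by (auto simp: continuous_map_in_subtopology continuous_map_from_subtopology)
  qed (use F'F FF' in \<open>auto simp: points_def\<close>)
  have hx: "homeomorphic_map (subtopology (space_top N) U) (subtopology (Euclidean_space n) (x ` U)) x"
    using ch unfolding chart_def by blast
  have "homeomorphic_map (subtopology (space_top M) ?W) (subtopology (Euclidean_space n) (x ` U)) (x \<circ> F)"
    by (rule homeomorphic_map_compose[OF hF hx])
  then have h: "homeomorphic_map (subtopology (space_top M) ?W) (subtopology (Euclidean_space n) ((\<lambda>p. x (F p)) ` ?W)) (\<lambda>p. x (F p))"
    unfolding im by (simp add: o_def)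
  show ?thesis
    unfolding chart_def
  proof (intro conjI allI impI Wop h; (elim conjE)?)
    show "openin (Euclidean_space n) ((\<lambda>p. x (F p)) ` ?W)" unfolding im by (rule chart_image_open[OF ch])
    fix W f assume W: "openin (space_top M) W" "W \<subseteq> ?W"
    have FWo: "openin (space_top N) (F ` W)"
    proof -
      have "{q \<in> topspace (space_top N). F' q \<in> W} = F ` W"
        using W(2) F'F FF' smooth_map_in[OF F] by (auto simp: points_def image_iff) metis
      then show ?thesis using openin_continuous_map_preimage[OF cF' W(1)] by simp
    qed
    have FWU: "F ` W \<subseteq> U" using W(2) by blast
    have "smooth_fun M W f \<longleftrightarrow> smooth_Rn n (x ` F ` W) ((f \<circ> F') \<circ> inv_into U x)"
      unfolding sm[OF W] by (rule chart_smooth_iff[OF ch FWo FWU])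
    also have "\<dots> \<longleftrightarrow> smooth_Rn n (x ` F ` W) (f \<circ> inv_into ?W (\<lambda>p. x (F p)))"
    proof (rule smooth_Rn_cong)
      fix z assume "z \<in> x ` F ` W"
      then obtain p where p: "p \<in> W" "z = x (F p)" by blast
      have "inv_into ?W (\<lambda>p. x (F p)) z = p" unfolding p(2) by (rule inv_into_f_f[OF inj]) (use p W in blast)
      moreover have "inv_into U x z = F p" unfolding p(2) using p W(2) ch by (intro chart_inv) auto
      moreover have "F' (F p) = p" using F'F p W(2) by blast
      ultimately show "((f \<circ> F') \<circ> inv_into U x) z = (f \<circ> inv_into ?W (\<lambda>p. x (F p))) z" by simp
    qed
    also have "x ` F ` W = (\<lambda>p. x (F p)) ` W" by (simp add: image_image)
    finally show "smooth_fun M W f \<longleftrightarrow> smooth_Rn n ((\<lambda>p. x (F p)) ` W) (f \<circ> inv_into ?W (\<lambda>p. x (F p)))" .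
  qed
qed

lemma manifoldI:
  assumes L: "local_space M" and "Hausdorff_space (space_top M)" "second_countable (space_top M)"
    and ch: "\<And>p. p \<in> points M \<Longrightarrow> \<exists>U x. chart M U n x \<and> p \<in> U"
  shows "smooth_manifold M"
  unfolding smooth_manifold_def
proof (intro conjI allI assms(2,3))
  show "\<exists>n. \<forall>p\<in>points M. \<exists>U x. chart M U n x \<and> p \<in> U" using ch by blast
  fix W f
  show "smooth_fun M W f \<longleftrightarrow> openin (space_top M) W \<and> (\<forall>U n x. chart M U n x \<longrightarrow> smooth_fun M (W \<inter> U) f)"
  proof
    assume f: "smooth_fun M W f"
    then have W: "openin (space_top M) W" by (rule smooth_fun_open[OF L])
    have "smooth_fun M (W \<inter> U) f" if "chart M U n x" for U n x
      by (rule smooth_fun_subset[OF L f openin_Int[OF W chart_open[OF that]]]) simp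
    then show "openin (space_top M) W \<and> (\<forall>U n x. chart M U n x \<longrightarrow> smooth_fun M (W \<inter> U) f)"
      using W by blast
  next
    assume R: "openin (space_top M) W \<and> (\<forall>U n x. chart M U n x \<longrightarrow> smooth_fun M (W \<inter> U) f)"
    then have W: "openin (space_top M) W" by blast
    have "smooth_near M p f" if p: "p \<in> W" for p
    proof -
      have "p \<in> points M" using openin_subset[OF W] p by (auto simp: points_def)
      then obtain U x where U: "chart M U n x" "p \<in> U" using ch by blast
      then have "smooth_fun M (W \<inter> U) f" using R by blast
      then show ?thesis by (rule smooth_nearI[rotated]) (use p U in simp)
    qed
    then show "smooth_fun M W f" unfolding smooth_fun_iff_near[OF L] using W by blast
  qed
qed

lemma smooth_map_inv_injective:
  assumes M: "local_space M" and inj: "inj_on F (points M)"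
  shows "smooth_map (quot_space M F) M (inv_into (points M) F)"
proof (rule smooth_map_from_quot[OF _ local_open_domains[OF M]])
  show "smooth_map M M (\<lambda>p. inv_into (points M) F (F p))"
    by (rule smooth_map_eq[OF M local_open_domains[OF M] smooth_map_ident[OF local_open_domains[OF M]]])
      (simp add: inj)
qed

text \<open>The quotient by an injective map is \<open>M\<close> with renamed points; charts are
  pulled back along the inverse.\<close>

lemma manifold_injective_quot:
  assumes M: "smooth_manifold M" and inj: "inj_on F (points M)"
  shows "smooth_manifold (quot_space M F)"
proof -
  let ?N = "quot_space M F" and ?F' = "inv_into (points M) F"
  have L: "local_space M" by (rule manifold_local[OF M])
  have LN: "local_space ?N" by (rule local_quot[OF L])
  have F: "smooth_map M ?N F" by (rule smooth_map_quot)
  have F': "smooth_map ?N M ?F'" by (rule smooth_map_inv_injective[OF L inj])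
  have i1: "?F' (F p) = p" if "p \<in> points M" for p using inj that by simp
  have i2: "F (?F' q) = q" if "q \<in> points ?N" for q
    using that unfolding points_quot_space by (rule f_inv_into_f)
  have hom: "space_top M homeomorphic_space space_top ?N"
    unfolding homeomorphic_space_def homeomorphic_maps_def
    using F F' i1 i2 unfolding smooth_map_def points_def by blast
  have "\<exists>n. \<forall>p\<in>points M. \<exists>U x. chart M U n x \<and> p \<in> U"
    using M unfolding smooth_manifold_def by (elim conjE)
  then obtain n where n: "\<And>p. p \<in> points M \<Longrightarrow> \<exists>U x. chart M U n x \<and> p \<in> U" by blast
  show ?thesis
  proof (rule manifoldI[OF LN, of n])
    have "Hausdorff_space (space_top M)" using M unfolding smooth_manifold_def by (elim conjE)
    then show "Hausdorff_space (space_top ?N)" using homeomorphic_Hausdorff_space[OF hom] by simp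
    have "second_countable (space_top M)" using M unfolding smooth_manifold_def by (elim conjE)
    then show "second_countable (space_top ?N)" using homeomorphic_space_second_countability[OF hom] by simp
    fix q assume q: "q \<in> points ?N"
    then have "?F' q \<in> points M" by (rule smooth_map_in[OF F'])
    then obtain U x where U: "chart M U n x" "?F' q \<in> U" using n by blast
    from chart_pullback[OF LN L F' F i2 i1 U(1)]
    have "chart ?N {q \<in> points ?N. ?F' q \<in> U} n (\<lambda>q. x (?F' q))" .
    then show "\<exists>U x. chart ?N U n x \<and> q \<in> U" using q U(2) by blast
  qed
qed

lemma tangent_diffeo:
  assumes M: "local_space M" and N: "local_space N" and F: "smooth_map M N F" and F': "smooth_map N M F'"
    and F'F: "\<And>p. p \<in> points M \<Longrightarrow> F' (F p) = p" and FF': "\<And>q. q \<in> points N \<Longrightarrow> F (F' q) = q"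
    and p: "p \<in> points M"
  shows "tmap N F p ` tangent M p = tangent N (F p)"
proof
  show "tmap N F p ` tangent M p \<subseteq> tangent N (F p)" using tmap_tangent[OF F] by blast
  show "tangent N (F p) \<subseteq> tmap N F p ` tangent M p"
  proof
    fix w assume w: "w \<in> tangent N (F p)"
    have pN: "F p \<in> points N" by (rule smooth_map_in[OF F p])
    have v: "tmap M F' (F p) w \<in> tangent M p" using tmap_tangent[OF F' w] F'F[OF p] by simp
    have "tmap N F (F' (F p)) (tmap M F' (F p) w) = tmap N (\<lambda>q. F (F' q)) (F p) w"
      by (rule tmap_compose[OF F' F pN])
    also have "\<dots> = tmap N (\<lambda>q. q) (F p) w"
      by (rule tmap_cong[OF N w openin_topspace]) (use pN FF' in \<open>auto simp: points_def\<close>)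
    also have "\<dots> = w" by (rule tmap_ident[OF w])
    finally show "w \<in> tmap N F p ` tangent M p" using v F'F[OF p] by force
  qed
qed

lemma tangent_injective_quot:
  assumes M: "local_space M" and inj: "inj_on F (points M)" and p: "p \<in> points M"
  shows "tmap (quot_space M F) F p ` tangent M p = tangent (quot_space M F) (F p)"
proof (rule tangent_diffeo[OF M local_quot[OF M] smooth_map_quot smooth_map_inv_injective[OF M inj] _ _ p])
  show "inv_into (points M) F (F p) = p" if "p \<in> points M" for p using inj that by simp
  show "F (inv_into (points M) F q) = q" if "q \<in> points (quot_space M F)" for q
    using that unfolding points_quot_space by (rule f_inv_into_f)
qed

text \<open>Renaming the points of the quotient changes nothing essential. Thus the assumption on
  the coset space carries over to every model whose points correspond to cosets.\<close>

lemma quotient_manifold_postcompose: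
  assumes M: "local_space M" and q: "quotient_manifold M q" and inj: "inj_on F (q ` points M)"
  shows "quotient_manifold M (\<lambda>p. F (q p))"
proof -
  let ?Q = "quot_space M q" and ?N = "quot_space M (\<lambda>p. F (q p))"
  have mQ: "smooth_manifold ?Q" and sub: "submersion M ?Q q" using q unfolding quotient_manifold_def by auto
  have N: "quot_space ?Q F = ?N" by (rule quot_space_compose)
  have inj': "inj_on F (points ?Q)" using inj by (simp add: points_quot_space)
  have "smooth_manifold ?N" using manifold_injective_quot[OF mQ inj'] unfolding N .
  moreover have "submersion M ?N (\<lambda>p. F (q p))"
    unfolding submersion_def
  proof (intro conjI ballI smooth_map_quot)
    fix p assume p: "p \<in> points M"
    have F: "smooth_map ?Q ?N F" using smooth_map_quot[of ?Q F] unfolding N .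
    have "tmap ?N (\<lambda>p. F (q p)) p v = tmap ?N F (q p) (tmap ?Q q p v)" for v
      by (rule tmap_compose[OF smooth_map_quot F p, symmetric])
    then have "tmap ?N (\<lambda>p. F (q p)) p ` tangent M p = tmap ?N F (q p) ` (tmap ?Q q p ` tangent M p)"
      by (simp add: image_image)
    also have "tmap ?Q q p ` tangent M p = tangent ?Q (q p)" using sub p unfolding submersion_def by blast
    also have "tmap ?N F (q p) ` tangent ?Q (q p) = tangent ?N (F (q p))"
      using tangent_injective_quot[OF manifold_local[OF mQ] inj' smooth_map_in[OF smooth_map_quot p]] unfolding N .
    finally show "tmap ?N (\<lambda>p. F (q p)) p ` tangent M p = tangent ?N (F (q p))" .
  qed
  ultimately show ?thesis unfolding quotient_manifold_def by blast
qed

text \<open>Here the source is replaced by the copy \<open>quot_space M s\<close> of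
  \<open>M\<close>. With \<open>s\<close> the parametrisation of the level set this yields the
  quotient of the level set by \<open>K\<close>.\<close>

lemma quotient_manifold_precompose:
  assumes M: "local_space M" and inj: "inj_on s (points M)" and q: "quotient_manifold M (\<lambda>p. r (s p))"
  shows "quotient_manifold (quot_space M s) r"
proof -
  let ?S = "quot_space M s" and ?N = "quot_space M (\<lambda>p. r (s p))"
  have N: "quot_space ?S r = ?N" by (rule quot_space_compose)
  have mN: "smooth_manifold ?N" and sub: "submersion M ?N (\<lambda>p. r (s p))" using q unfolding quotient_manifold_def by auto
  have r: "smooth_map ?S ?N r" using smooth_map_quot[of ?S r] unfolding N .
  have "submersion ?S ?N r"
    unfolding submersion_def
  proof (intro conjI ballI r)
    fix y assume "y \<in> points ?S"
    then obtain p where p: "p \<in> points M" "y = s p" unfolding points_quot_space by blast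
    have "tmap ?N r y ` tangent ?S y = tmap ?N r (s p) ` (tmap ?S s p ` tangent M p)"
      unfolding p(2) tangent_injective_quot[OF M inj p(1)] ..
    also have "\<dots> = tmap ?N (\<lambda>p. r (s p)) p ` tangent M p"
      using tmap_compose[OF smooth_map_quot r p(1)] by (simp add: image_image)
    also have "\<dots> = tangent ?N (r y)" using sub p unfolding submersion_def by blast
    finally show "tmap ?N r y ` tangent ?S y = tangent ?N (r y)" .
  qed
  then show ?thesis unfolding quotient_manifold_def N using mN by blast
qed

section \<open>Products\<close>

lemma space_top_prod [simp]: "space_top (prod_space M N) = prod_topology (space_top M) (space_top N)"
  by (simp add: prod_space_def)

lemma points_prod: "points (prod_space M N) = points M \<times> points N"
  by (simp add: points_def)

text \<open>The tuple is put in the form \<open>if i < m + n then _ else 0\<close>, the shape in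
  which the chain rule lemmas expect their arguments.\<close>

lemma smooth_fun_prodE:
  assumes "smooth_fun (prod_space M N) W f" "(p, q) \<in> W"
  obtains U V m n a b D F where "openin (space_top M) U" "p \<in> U" "openin (space_top N) V" "q \<in> V" "U \<times> V \<subseteq> W"
    "\<And>i. i < m \<Longrightarrow> smooth_fun M U (a i)" "\<And>j. j < n \<Longrightarrow> smooth_fun N V (b j)" "smooth_Rn (m + n) D F"
    "\<And>p' q'. p' \<in> U \<Longrightarrow> q' \<in> V \<Longrightarrow>
      (\<lambda>i. if i < m + n then (if i < m then a i p' else b (i - m) q') else 0) \<in> D \<and>
      f (p', q') = F (\<lambda>i. if i < m + n then (if i < m then a i p' else b (i - m) q') else 0)"
proof -
  have z: "(\<lambda>i. if i < m then A i else if i < m + n then B i else 0) =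
    (\<lambda>i. if i < m + n then (if i < m then A i else B i) else (0::real))" for m n :: nat and A B by (auto simp: fun_eq_iff)
  from assms obtain U V m n a b D F where *: "openin (space_top M) U" "p \<in> U" "openin (space_top N) V" "q \<in> V" "U \<times> V \<subseteq> W"
    "\<forall>i<m. smooth_fun M U (a i)" "\<forall>j<n. smooth_fun N V (b j)" "smooth_Rn (m + n) D F"
    "\<forall>p'\<in>U. \<forall>q'\<in>V. let z = (\<lambda>i. if i < m then a i p' else if i < m + n then b (i - m) q' else 0) in z \<in> D \<and> f (p', q') = F z"
    unfolding prod_space_def smooth_space.simps by blast
  show thesis
    by (rule that[OF *(1-5) _ _ *(8)]) (use *(6,7) *(9)[unfolded Let_def z] in auto)
qed

lemma open_domains_prod: "open_domains (prod_space M N)"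
  unfolding open_domains_def by (simp add: prod_space_def)

lemma smooth_map_snd:
  assumes "open_domains N"
  shows "smooth_map (prod_space M N) N snd"
  unfolding smooth_map_def
proof (intro conjI allI impI)
  show "continuous_map (space_top (prod_space M N)) (space_top N) snd" by (simp add: continuous_map_snd)
  fix V h assume h: "smooth_fun N V h"
  then have V: "openin (space_top N) V" using assms unfolding open_domains_def by blast
  have eq: "{p \<in> points (prod_space M N). snd p \<in> V} = points M \<times> V"
    using openin_subset[OF V] by (auto simp: points_prod points_def)
  have M: "openin (space_top M) (points M)" by (simp add: points_def)
  show "smooth_fun (prod_space M N) {p \<in> points (prod_space M N). snd p \<in> V} (h \<circ> snd)"
    unfolding eq
    unfolding prod_space_def smooth_space.simps
  proof (intro conjI allI impI)
    show "openin (prod_topology (space_top M) (space_top N)) (points M \<times> V)"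
      using M V by (simp add: openin_prod_Times_iff)
    fix p q assume pq: "(p, q) \<in> points M \<times> V"
    have "smooth_Rn (0 + 1) (Rn 1) (\<lambda>z. z 0)" unfolding add_0 by (intro smooth_Rn_whole Ck_coord)
    then show "\<exists>U V' m n a b D F. openin (space_top M) U \<and> p \<in> U \<and> openin (space_top N) V' \<and> q \<in> V' \<and>
          U \<times> V' \<subseteq> points M \<times> V \<and> (\<forall>i<m. smooth_fun M U (a i)) \<and> (\<forall>j<n. smooth_fun N V' (b j)) \<and>
          smooth_Rn (m + n) D F \<and> (\<forall>p'\<in>U. \<forall>q'\<in>V'. let z = \<lambda>i. if i < m then a i p' else if i < m + n then b (i - m) q' else 0
            in z \<in> D \<and> (h \<circ> snd) (p', q') = F z)"
      using M V pq h
      by (intro exI[of _ "points M"] exI[of _ V] exI[of _ 0] exI[of _ 1] exI[of _ "\<lambda>_ _. 0"] exI[of _ "\<lambda>_. h"]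
          exI[of _ "Rn 1"] exI[of _ "\<lambda>z. z 0"]) (auto simp: Rn_iff Let_def)
  qed
qed

lemma smooth_map_pair:
  assumes L: "charted L" and A: "smooth_map L M A" and B: "smooth_map L N B"
  shows "smooth_map L (prod_space M N) (\<lambda>x. (A x, B x))"
proof (rule smooth_mapI[OF charted_local[OF L] open_domains_prod])
  have cA: "continuous_map (space_top L) (space_top M) A" using A unfolding smooth_map_def by blast
  have cB: "continuous_map (space_top L) (space_top N) B" using B unfolding smooth_map_def by blast
  show "continuous_map (space_top L) (space_top (prod_space M N)) (\<lambda>x. (A x, B x))"
    using cA cB by (simp add: continuous_map_pairedI)
  fix p h assume p: "p \<in> points L" and "smooth_near (prod_space M N) (A p, B p) h"
  then obtain W where W: "(A p, B p) \<in> W" "smooth_fun (prod_space M N) W h" unfolding smooth_near_def by blast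
  obtain U V m n a b D F where *: "openin (space_top M) U" "A p \<in> U" "openin (space_top N) V" "B p \<in> V" "U \<times> V \<subseteq> W"
    "\<And>i. i < m \<Longrightarrow> smooth_fun M U (a i)" "\<And>j. j < n \<Longrightarrow> smooth_fun N V (b j)" "smooth_Rn (m + n) D F"
    "\<And>p' q'. p' \<in> U \<Longrightarrow> q' \<in> V \<Longrightarrow>
      (\<lambda>i. if i < m + n then (if i < m then a i p' else b (i - m) q') else 0) \<in> D \<and>
      h (p', q') = F (\<lambda>i. if i < m + n then (if i < m then a i p' else b (i - m) q') else 0)"
    by (rule smooth_fun_prodE[OF W(2,1)]) (rule that; assumption)
  let ?f = "\<lambda>i x. if i < m then a i (A x) else b (i - m) (B x)"
  have s: "smooth_near L p (\<lambda>x. F (\<lambda>i. if i < m + n then ?f i x else 0))"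
  proof (rule smooth_near_compose[where f = ?f and D = D, OF L p _ *(8)])
    show "(\<lambda>i. if i < m + n then ?f i p else 0) \<in> D" using *(9)[OF *(2,4)] by blast
    fix i assume i: "i < m + n"
    show "smooth_near L p (?f i)"
    proof (cases "i < m")
      case True
      have "smooth_near L p (\<lambda>x. a i (A x))"
        by (rule smooth_map_near[OF A p smooth_nearI[OF *(2) *(6)[OF True]]])
      then show ?thesis using True by simp
    next
      case False
      have "smooth_near L p (\<lambda>x. b (i - m) (B x))"
        by (rule smooth_map_near[OF B p smooth_nearI[OF *(4) *(7)]]) (use i False in simp)
      then show ?thesis using False by simp
    qed
  qed
  have op: "openin (space_top L) ({x \<in> topspace (space_top L). A x \<in> U} \<inter> {x \<in> topspace (space_top L). B x \<in> V})"
    by (intro openin_Int openin_continuous_map_preimage[OF cA *(1)] openin_continuous_map_preimage[OF cB *(3)])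
  show "smooth_near L p (\<lambda>x. h (A x, B x))"
  proof (rule smooth_near_cong[OF charted_local[OF L] op _ _ s])
    show "p \<in> {x \<in> topspace (space_top L). A x \<in> U} \<inter> {x \<in> topspace (space_top L). B x \<in> V}"
      using p * by (simp add: points_def)
    fix x assume "x \<in> {x \<in> topspace (space_top L). A x \<in> U} \<inter> {x \<in> topspace (space_top L). B x \<in> V}"
    then show "F (\<lambda>i. if i < m + n then ?f i x else 0) = h (A x, B x)" using *(9)[of "A x" "B x"] by simp
  qed
qed

lemma smooth_Rn_partial:
  assumes "smooth_Rn n D F" "i < n"
  shows "smooth_Rn n D (partial_deriv i F)"
  unfolding smooth_Rn_def
proof (intro conjI allI)
  show "openin (Euclidean_space n) D" using assms unfolding smooth_Rn_def by blast
  fix k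
  have "Ck_Rn n (Suc k) D F" using assms(1) unfolding smooth_Rn_def by blast
  then show "Ck_Rn n k D (partial_deriv i F)" using assms(2) by (simp add: Ck_Rn.simps(2))
qed

text \<open>Differentiating the local expression in the first slot leaves a sum of partial
  derivatives of \<open>F\<close>, taken at \<open>p0\<close> and \<open>q\<close>, times the
  constants \<xi>(\<open>a i\<close>); the components that come from \<open>q\<close> are constant
  in the first slot and contribute 0. The sum is smooth in \<open>q\<close>. Smoothness of invariant
  vector fields rests on this.\<close>

lemma slot_derivative:
  assumes M: "charted M" and N: "charted N" and f: "smooth_fun (prod_space M N) W f" and pq: "(p0, q0) \<in> W"
    and \<xi>: "\<xi> \<in> tangent M p0"
  shows "smooth_near N q0 (\<lambda>q. \<xi> (\<lambda>p. f (p, q)))"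
proof -
  obtain U V m n a b D F where *: "openin (space_top M) U" "p0 \<in> U" "openin (space_top N) V" "q0 \<in> V" "U \<times> V \<subseteq> W"
    "\<And>i. i < m \<Longrightarrow> smooth_fun M U (a i)" "\<And>j. j < n \<Longrightarrow> smooth_fun N V (b j)" "smooth_Rn (m + n) D F"
    "\<And>p' q'. p' \<in> U \<Longrightarrow> q' \<in> V \<Longrightarrow>
      (\<lambda>i. if i < m + n then (if i < m then a i p' else b (i - m) q') else 0) \<in> D \<and>
      f (p', q') = F (\<lambda>i. if i < m + n then (if i < m then a i p' else b (i - m) q') else 0)"
    by (rule smooth_fun_prodE[OF f pq]) (rule that; assumption)
  have p0: "p0 \<in> points M" by (rule tangent_points[OF \<xi>])
  have q0: "q0 \<in> points N" using openin_subset[OF *(3)] *(4) by (auto simp: points_def)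
  define c where "c i = (if i < m then \<xi> (a i) else 0)" for i
  let ?z = "\<lambda>p q i. if i < m + n then (if i < m then a i p else b (i - m) q) else 0"
  have near_a: "smooth_near M p0 (a i)" if "i < m" for i by (rule smooth_nearI[OF *(2) *(6)[OF that]])
  have near_b: "smooth_near N q (b (i - m))" if "i < m + n" "\<not> i < m" "q \<in> V" for i q
    by (rule smooth_nearI[OF that(3) *(7)]) (use that in simp)
  have eq: "\<xi> (\<lambda>p. f (p, q)) = (\<Sum>i<m + n. partial_deriv i F (?z p0 q) * c i)" if q: "q \<in> V" for q
  proof -
    have "\<xi> (\<lambda>p. f (p, q)) = \<xi> (\<lambda>p. F (?z p q))"
      by (rule tangent_near_cong[OF charted_local[OF M] \<xi> *(1,2)]) (use *(9)[OF _ q] in blast)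
    also have "\<dots> = (\<Sum>i<m + n. partial_deriv i F (?z p0 q) * \<xi> (\<lambda>p. if i < m then a i p else b (i - m) q))"
    proof (rule tangent_compose[where f = "\<lambda>i p. if i < m then a i p else b (i - m) q" and D = D, OF M \<xi> _ *(8)])
      show "smooth_near M p0 (\<lambda>p. if i < m then a i p else b (i - m) q)" for i
        using near_a smooth_near_const[OF M p0] by (cases "i < m") simp_all
      show "?z p0 q \<in> D" using *(9)[OF *(2) q] by blast
    qed
    also have "\<dots> = (\<Sum>i<m + n. partial_deriv i F (?z p0 q) * c i)"
      by (intro sum.cong refl) (auto simp: c_def tangent_const[OF \<xi>])
    finally show ?thesis .
  qed
  have "smooth_near N q0 (\<lambda>q. \<Sum>i<m + n. partial_deriv i F (?z p0 q) * c i)"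
  proof (rule smooth_near_sum[OF N q0])
    fix i assume i: "i < m + n"
    have "smooth_near N q0 (\<lambda>q. partial_deriv i F (?z p0 q))"
    proof (rule smooth_near_compose[where f = "\<lambda>i q. if i < m then a i p0 else b (i - m) q" and D = D, OF N q0 _ smooth_Rn_partial[OF *(8) i]])
      show "smooth_near N q0 (\<lambda>q. if j < m then a j p0 else b (j - m) q)" if "j < m + n" for j
        using near_b[OF that _ *(4)] smooth_near_const[OF N q0] by (cases "j < m") simp_all
      show "?z p0 q0 \<in> D" using *(9)[OF *(2,4)] by blast
    qed
    then show "smooth_near N q0 (\<lambda>q. partial_deriv i F (?z p0 q) * c i)"
      by (rule smooth_near_mult[OF N _ smooth_near_const[OF N q0]])
  qed
  then show ?thesis
    by (rule smooth_near_cong[OF charted_local[OF N] *(3,4), rotated]) (rule eq[symmetric])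
qed

section \<open>Smooth dependence of covector components\<close>

lemma smooth_near_preimage:
  assumes M: "charted M" and f: "smooth_near M p f" and T: "open T" "f p \<in> T"
  obtains V where "openin (space_top M) V" "p \<in> V" "\<And>q. q \<in> V \<Longrightarrow> f q \<in> T"
proof -
  have L: "local_space M" by (rule charted_local[OF M])
  obtain U n x where ch: "chart M U n x" "p \<in> U" by (rule charted_pointE[OF M smooth_near_points[OF L f]])
  obtain V where V: "openin (Euclidean_space n) V" "x p \<in> V" "V \<subseteq> x ` U" "smooth_Rn n V (f \<circ> inv_into U x)"
    by (rule smooth_near_chart_rep[OF L ch f])
  have "continuous_map (subtopology (Euclidean_space n) V) euclideanreal (f \<circ> inv_into U x)"
    using V(4) Ck_imp_continuous unfolding smooth_Rn_def by blast
  from openin_continuous_map_preimage[OF this, of T]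
  have "openin (subtopology (Euclidean_space n) V) {z \<in> V. (f \<circ> inv_into U x) z \<in> T}"
    using openin_subset[OF V(1)] T by (simp add: Int_absorb1)
  then have op: "openin (Euclidean_space n) {z \<in> V. (f \<circ> inv_into U x) z \<in> T}"
    using V(1) openin_open_subtopology by blast
  show thesis
  proof (rule that[OF chart_preimage_open[OF ch(1) op]])
    show "p \<in> {q \<in> U. x q \<in> {z \<in> V. (f \<circ> inv_into U x) z \<in> T}}" using ch V(2) T by simp
    fix q assume "q \<in> {q \<in> U. x q \<in> {z \<in> V. (f \<circ> inv_into U x) z \<in> T}}"
    then have q: "q \<in> U" "(f \<circ> inv_into U x) (x q) \<in> T" by auto
    then show "f q \<in> T" using chart_inv[OF ch(1) q(1)] by simp
  qed
qed

text \<open>Continuity of a tuple of smooth germs: finitely many coordinate conditions, imposed one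
  after the other, still leave a neighbourhood.\<close>

lemma smooth_tuple_preimage:
  assumes M: "charted M" and f: "\<And>i. i < m \<Longrightarrow> smooth_near M p (f i)" and p: "p \<in> points M"
    and V: "openin (Euclidean_space m) V" "(\<lambda>i. if i < m then f i p else 0) \<in> V"
  obtains W where "openin (space_top M) W" "p \<in> W" "\<And>q. q \<in> W \<Longrightarrow> (\<lambda>i. if i < m then f i q else 0) \<in> V"
proof -
  obtain e where e: "e > 0" "nbox m (\<lambda>i. if i < m then f i p else 0) e \<subseteq> V"
    using V unfolding openin_Euclidean_iff by blast
  have "\<exists>W. openin (space_top M) W \<and> p \<in> W \<and> (\<forall>q\<in>W. \<forall>i<k. \<bar>f i q - f i p\<bar> < e)" if "k \<le> m" for k
    using that
  proof (induction k)
    case 0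
    then show ?case using p by (intro exI[of _ "points M"]) (simp add: points_def)
  next
    case (Suc k)
    then obtain W where W: "openin (space_top M) W" "p \<in> W" "\<forall>q\<in>W. \<forall>i<k. \<bar>f i q - f i p\<bar> < e" by auto
    have fk: "smooth_near M p (f k)" by (rule f) (use Suc.prems in simp)
    have bk: "f k p \<in> ball (f k p) e" using e by simp
    obtain V where V: "openin (space_top M) V" "p \<in> V" "\<And>q. q \<in> V \<Longrightarrow> f k q \<in> ball (f k p) e"
      by (rule smooth_near_preimage[OF M fk open_ball bk]) (rule that; assumption)
    show ?case
    proof (intro exI[of _ "W \<inter> V"] conjI ballI allI impI)
      fix q i assume q: "q \<in> W \<inter> V" and i: "i < Suc k"
      show "\<bar>f i q - f i p\<bar> < e"
      proof (cases "i = k")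
        case True
        then show ?thesis using V(3)[of q] q by (simp add: dist_real_def abs_minus_commute)
      next
        case False
        then show ?thesis using W(3) q i by simp
      qed
    qed (use W V in auto)
  qed
  from this[OF order_refl] obtain W where W: "openin (space_top M) W" "p \<in> W"
    "\<forall>q\<in>W. \<forall>i<m. \<bar>f i q - f i p\<bar> < e" by blast
  show thesis
  proof (rule that[OF W(1,2)])
    fix q assume "q \<in> W"
    then have "(\<lambda>i. if i < m then f i q else 0) \<in> nbox m (\<lambda>i. if i < m then f i p else 0) e"
      using W(3) by (simp add: nbox_def Rn_iff)
    then show "(\<lambda>i. if i < m then f i q else 0) \<in> V" using e by blast
  qed
qed

text \<open>Gaussian elimination; near \<open>p\<close> the pivots do not vanish.\<close>

lemma smooth_solve:
  assumes M: "charted M" and p: "p \<in> points M"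
  shows "(\<And>i j. i < d \<Longrightarrow> j < d \<Longrightarrow> smooth_near M p (A j i)) \<Longrightarrow> (\<And>j. j < d \<Longrightarrow> smooth_near M p (r j)) \<Longrightarrow>
    (\<And>i j. i < d \<Longrightarrow> j < d \<Longrightarrow> A j i p = (if i = j then 1 else 0)) \<Longrightarrow>
    openin (space_top M) V \<Longrightarrow> p \<in> V \<Longrightarrow>
    (\<And>q j. q \<in> V \<Longrightarrow> j < d \<Longrightarrow> (\<Sum>i<(d::nat). A j i q * h i q) = r j q) \<Longrightarrow>
    \<forall>i<d. smooth_near M p (h i)"
proof (induction d arbitrary: A r V)
  case (Suc d)
  have L: "local_space M" by (rule charted_local[OF M])
  have Add: "smooth_near M p (A d d)" "A d d p \<noteq> 0" using Suc.prems(1,3)[of d d] by simp_all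
  obtain W where W: "openin (space_top M) W" "p \<in> W" "\<And>q. q \<in> W \<Longrightarrow> A d d q \<noteq> 0"
    using Add(2) by (rule_tac smooth_near_preimage[OF M Add(1), of "- {0}"]) (auto simp: open_Compl)
  have VW: "openin (space_top M) (V \<inter> W)" "p \<in> V \<inter> W" using W Suc.prems(4,5) by auto
  have hd: "h d q = (r d q - (\<Sum>i<d. A d i q * h i q)) / A d d q" if "q \<in> V \<inter> W" for q
    using Suc.prems(6)[of q d] W(3)[of q] that by (simp add: field_simps)
  have IH: "\<forall>i<d. smooth_near M p (h i)"
  \<comment> \<open>Elimination of the last unknown. The reduced system still has the identity
    matrix at \<open>p\<close>, so the induction hypothesis applies.\<close>
  proof (rule Suc.IH[where A = "\<lambda>j i q. A j i q - A j d q * A d i q / A d d q" and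
        r = "\<lambda>j q. r j q - A j d q * r d q / A d d q", OF _ _ _ VW])
    show "smooth_near M p (\<lambda>q. A j i q - A j d q * A d i q / A d d q)" if "i < d" "j < d" for i j
      using that Suc.prems(1) Add by (intro smooth_near_diff[OF M] smooth_near_divide[OF M] smooth_near_mult[OF M]) auto
    show "smooth_near M p (\<lambda>q. r j q - A j d q * r d q / A d d q)" if "j < d" for j
      using that Suc.prems(1,2) Add by (intro smooth_near_diff[OF M] smooth_near_divide[OF M] smooth_near_mult[OF M]) auto
    show "A j i p - A j d p * A d i p / A d d p = (if i = j then 1 else 0)" if "i < d" "j < d" for i j
      using that Suc.prems(3)[of i j] Suc.prems(3)[of d j] by simp
    fix q j assume q: "q \<in> V \<inter> W" and j: "j < d"
    have "(\<Sum>i<d. (A j i q - A j d q * A d i q / A d d q) * h i q)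
        = (\<Sum>i<d. A j i q * h i q) - A j d q / A d d q * (\<Sum>i<d. A d i q * h i q)"
      unfolding left_diff_distrib sum_subtractf sum_distrib_left by (simp add: mult.assoc)
    also have "(\<Sum>i<d. A j i q * h i q) = r j q - A j d q * h d q"
      using Suc.prems(6)[of q j] q j by simp
    also have "(\<Sum>i<d. A d i q * h i q) = r d q - A d d q * h d q"
      using Suc.prems(6)[of q d] q by simp
    also have "r j q - A j d q * h d q - A j d q / A d d q * (r d q - A d d q * h d q)
        = r j q - A j d q * r d q / A d d q"
      using W(3)[of q] q by (simp add: field_simps)
    finally show "(\<Sum>i<d. (A j i q - A j d q * A d i q / A d d q) * h i q) = r j q - A j d q * r d q / A d d q" .
  qed
  have "smooth_near M p (\<lambda>q. (r d q - (\<Sum>i<d. A d i q * h i q)) / A d d q)"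
    using Suc.prems(1,2) Add IH
    by (intro smooth_near_divide[OF M] smooth_near_diff[OF M] smooth_near_sum[OF M p] smooth_near_mult[OF M]) auto
  then have "smooth_near M p (h d)"
    by (rule smooth_near_cong[OF L VW, rotated]) (rule hd[symmetric])
  with IH show ?case by (auto simp: less_Suc_eq)
qed simp

text \<open>The components of \<alpha> in the coordinate frame solve a linear system over
  \<open>M\<close>: its right-hand sides are the pairings with the fields \<open>X j\<close>, its
  matrix consists of the derivatives of the coordinates along these fields, and at \<open>g\<close>
  it is the identity. The system lives on \<open>M\<close> because the fields need not descend to
  \<open>Q\<close>.\<close>

lemma covector_components_smooth_pullback:
  assumes M: "charted M" and Q: "charted Q" and q: "smooth_map M Q q" and g: "g \<in> points M"
    and \<alpha>: "\<And>y. y \<in> points Q \<Longrightarrow> \<alpha> y \<in> cotangent Q y"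
    and X: "\<And>j h. j < n \<Longrightarrow> h \<in> points M \<Longrightarrow> X j h \<in> tangent M h"
    and Xs: "\<And>j f. j < n \<Longrightarrow> smooth_near M g f \<Longrightarrow> smooth_near M g (\<lambda>h. X j h f)"
    and ch: "chart Q U n x" "q g \<in> U"
    and Xp: "\<And>j. j < n \<Longrightarrow> tmap Q q g (X j g) = coord_vec Q U x j (q g)"
    and r: "\<And>j. j < n \<Longrightarrow> smooth_near M g (\<lambda>h. \<alpha> (q h) (tmap Q q h (X j h)))" and i: "i < n"
  shows "smooth_near M g (\<lambda>h. \<alpha> (q h) (coord_vec Q U x i (q h)))"
proof -
  have L: "local_space Q" by (rule charted_local[OF Q])
  define V where "V = {h \<in> topspace (space_top M). q h \<in> U}"
  have V: "openin (space_top M) V" unfolding V_def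
    by (rule openin_continuous_map_preimage[OF _ chart_open[OF ch(1)]]) (use q in \<open>simp add: smooth_map_def\<close>)
  have gV: "g \<in> V" using g ch(2) by (simp add: V_def points_def)
  have V': "h \<in> points M" "q h \<in> U" if "h \<in> V" for h using that by (simp_all add: V_def points_def)
  have "\<forall>i<n. smooth_near M g (\<lambda>h. \<alpha> (q h) (coord_vec Q U x i (q h)))"
  proof (rule smooth_solve[where A = "\<lambda>j i h. X j h (\<lambda>p. x (q p) i)" and r = "\<lambda>j h. \<alpha> (q h) (tmap Q q h (X j h))", OF M g _ _ _ V gV])
    show "smooth_near M g (\<lambda>h. X j h (\<lambda>p. x (q p) i))" if "i < n" "j < n" for i j
      by (rule Xs[OF that(2)]) (rule smooth_map_near[OF q g smooth_near_coord[OF ch L]])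
    show "smooth_near M g (\<lambda>h. \<alpha> (q h) (tmap Q q h (X j h)))" if "j < n" for j by (rule r[OF that])
    have app: "X j h (\<lambda>p. x (q p) i) = tmap Q q h (X j h) (\<lambda>y. x y i)" if "q h \<in> U" for i j h
      using smooth_near_coord[OF ch(1) that L] by (simp add: tmap_def)
    show "X j g (\<lambda>p. x (q p) i) = (if i = j then 1 else 0)" if "i < n" "j < n" for i j
      unfolding app[OF ch(2)] Xp[OF that(2)] using coord_vec_coord[OF L ch that(2), of i] by auto
    fix h j assume h: "h \<in> V" and j: "j < n"
    show "(\<Sum>i<n. X j h (\<lambda>p. x (q p) i) * \<alpha> (q h) (coord_vec Q U x i (q h))) = \<alpha> (q h) (tmap Q q h (X j h))"
      unfolding app[OF V'(2)[OF h]]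
      by (rule cotangent_expand[OF Q \<alpha>[OF smooth_map_in[OF q V'(1)[OF h]]] ch(1) V'(2)[OF h]
          tmap_tangent[OF q X[OF j V'(1)[OF h]]], symmetric])
  qed
  then show ?thesis using i by blast
qed

lemma covector_components_smooth:
  assumes M: "charted M" and \<alpha>: "\<And>q. q \<in> points M \<Longrightarrow> \<alpha> q \<in> cotangent M q"
    and X: "\<And>j q. j < n \<Longrightarrow> q \<in> points M \<Longrightarrow> X j q \<in> tangent M q"
    and Xs: "\<And>j f. j < n \<Longrightarrow> smooth_near M p f \<Longrightarrow> smooth_near M p (\<lambda>q. X j q f)"
    and ch: "chart M U n x" "p \<in> U"
    and Xp: "\<And>j. j < n \<Longrightarrow> X j p = coord_vec M U x j p"
    and r: "\<And>j. j < n \<Longrightarrow> smooth_near M p (\<lambda>q. \<alpha> q (X j q))" and i: "i < n"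
  shows "smooth_near M p (\<lambda>q. \<alpha> q (coord_vec M U x i q))"
proof (rule covector_components_smooth_pullback[where q = "\<lambda>q. q" and X = X, OF M M _ _ \<alpha> X Xs ch _ _ i])
  have L: "local_space M" by (rule charted_local[OF M])
  show "smooth_map M M (\<lambda>q. q)" by (rule smooth_map_ident[OF local_open_domains[OF L]])
  show p: "p \<in> points M" using chart_subset[OF ch(1)] ch(2) by blast
  show "tmap M (\<lambda>q. q) p (X j p) = coord_vec M U x j p" if "j < n" for j
    using tmap_ident[OF X[OF that p]] Xp[OF that] by simp
  show "smooth_near M p (\<lambda>h. \<alpha> h (tmap M (\<lambda>q. q) h (X j h)))" if "j < n" for j
  proof (rule smooth_near_cong[OF L _ p _ r[OF that]])
    show "openin (space_top M) (points M)" by (simp add: points_def)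
    show "\<alpha> q (X j q) = \<alpha> q (tmap M (\<lambda>q. q) q (X j q))" if "q \<in> points M" for q
      using tmap_ident[OF X[OF \<open>j < n\<close> that]] by simp
  qed
qed

section \<open>Invariant vector and covector fields on a Lie group\<close>

locale lie = group G for G :: "'g lie_grp" (structure) +
  assumes manifold: "smooth_manifold (mfd G)" and points_mfd: "points (mfd G) = carrier G"
    and mult_smooth: "smooth_map (prod_space (mfd G) (mfd G)) (mfd G) (\<lambda>(a, b). a \<otimes> b)"
    and inv_smooth: "smooth_map (mfd G) (mfd G) (\<lambda>a. inv a)"
begin

abbreviation "M \<equiv> mfd G"

lemma charted_M: "charted M" by (rule manifold_charted[OF manifold])
lemma local_M: "local_space M" by (rule manifold_local[OF manifold])
lemma open_M: "open_domains M" by (rule local_open_domains[OF local_M])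
lemma openin_carrier: "openin (space_top M) (carrier G)" using points_mfd by (metis openin_topspace points_def)

lemma smooth_mult:
  assumes "charted L" "smooth_map L M A" "smooth_map L M B"
  shows "smooth_map L M (\<lambda>x. A x \<otimes> B x)"
  using smooth_map_compose[OF smooth_map_pair[OF assms] mult_smooth] by simp

lemma smooth_const: "charted L \<Longrightarrow> g \<in> carrier G \<Longrightarrow> smooth_map L M (\<lambda>_. g)"
  using smooth_map_const[OF _ open_M, of L g] points_mfd by simp

lemma smooth_left: "g \<in> carrier G \<Longrightarrow> smooth_map M M (\<lambda>x. g \<otimes> x)"
  by (intro smooth_mult smooth_const charted_M smooth_map_ident open_M)

lemma smooth_right: "g \<in> carrier G \<Longrightarrow> smooth_map M M (\<lambda>x. x \<otimes> g)"
  by (intro smooth_mult smooth_const charted_M smooth_map_ident open_M)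

lemma smooth_conj: "g \<in> carrier G \<Longrightarrow> smooth_map M M (\<lambda>x. g \<otimes> x \<otimes> inv g)"
  by (rule smooth_map_compose[OF smooth_left smooth_right]) auto

text \<open>Since \<open>p \<otimes> g\<close> is differentiated in \<open>p\<close>, this
  right-invariant field is the infinitesimal generator of left translations.\<close>

definition Rv :: "'g tvec \<Rightarrow> 'g \<Rightarrow> 'g tvec" where "Rv \<xi> g = tmap M (\<lambda>p. p \<otimes> g) \<one> \<xi>"
definition Lv :: "'g tvec \<Rightarrow> 'g \<Rightarrow> 'g tvec" where "Lv \<xi> g = tmap M (\<lambda>p. g \<otimes> p) \<one> \<xi>"

lemma Rv_tangent: "\<xi> \<in> lie_algebra G \<Longrightarrow> g \<in> carrier G \<Longrightarrow> Rv \<xi> g \<in> tangent M g"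
  using tmap_tangent[OF smooth_right, of g \<xi> \<one>] by (simp add: Rv_def lie_algebra_def)

lemma Lv_tangent: "\<xi> \<in> lie_algebra G \<Longrightarrow> g \<in> carrier G \<Longrightarrow> Lv \<xi> g \<in> tangent M g"
  using tmap_tangent[OF smooth_left, of g \<xi> \<one>] by (simp add: Lv_def lie_algebra_def)

lemma tmap_cong_carrier:
  assumes "v \<in> tangent M g" "\<And>x. x \<in> carrier G \<Longrightarrow> F x = F' x"
  shows "tmap N F g v = tmap N F' g v"
  by (rule tmap_cong[OF local_M assms(1) openin_carrier _ assms(2)])
    (use tangent_points[OF assms(1)] points_mfd in simp_all)

lemma tmap_right_compose:
  assumes "v \<in> tangent M p" "p \<in> carrier G" "g \<in> carrier G" "h \<in> carrier G"
  shows "tmap M (\<lambda>x. x \<otimes> h) (p \<otimes> g) (tmap M (\<lambda>x. x \<otimes> g) p v) = tmap M (\<lambda>x. x \<otimes> (g \<otimes> h)) p v"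
proof -
  have "tmap M (\<lambda>x. x \<otimes> h) (p \<otimes> g) (tmap M (\<lambda>x. x \<otimes> g) p v) = tmap M (\<lambda>x. x \<otimes> g \<otimes> h) p v"
    by (rule tmap_compose[OF smooth_right smooth_right]) (use assms points_mfd in simp_all)
  also have "\<dots> = tmap M (\<lambda>x. x \<otimes> (g \<otimes> h)) p v"
    by (rule tmap_cong_carrier[OF assms(1)]) (use assms in \<open>simp add: m_assoc\<close>)
  finally show ?thesis .
qed

lemma tmap_one_right: "v \<in> tangent M p \<Longrightarrow> tmap M (\<lambda>x. x \<otimes> \<one>) p v = v"
  using tmap_cong_carrier[of v p "\<lambda>x. x \<otimes> \<one>" "\<lambda>x. x" M] tmap_ident[of v M p] by simp

lemma right_back_tangent: "v \<in> tangent M g \<Longrightarrow> tmap M (\<lambda>x. x \<otimes> inv g) g v \<in> lie_algebra G"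
  using tmap_tangent[OF smooth_right[OF inv_closed], of g v g] tangent_points[of v M g]
  by (simp add: lie_algebra_def points_mfd)

lemma Rv_right_back:
  assumes v: "v \<in> tangent M g"
  shows "Rv (tmap M (\<lambda>x. x \<otimes> inv g) g v) g = v"
proof -
  have g: "g \<in> carrier G" using tangent_points[OF v] points_mfd by simp
  show ?thesis
    using tmap_right_compose[OF v g inv_closed[OF g] g] g tmap_one_right[OF v] by (simp add: Rv_def)
qed

lemma right_back_Rv:
  assumes \<xi>: "\<xi> \<in> lie_algebra G" and g: "g \<in> carrier G"
  shows "tmap M (\<lambda>x. x \<otimes> inv g) g (Rv \<xi> g) = \<xi>"
  using tmap_right_compose[of \<xi> \<one> g "inv g"] \<xi> g tmap_one_right[of \<xi> \<one>] by (simp add: Rv_def lie_algebra_def)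

section \<open>The adjoint action and smoothness of invariant fields\<close>

lemma Ad_closed: "\<xi> \<in> lie_algebra G \<Longrightarrow> g \<in> carrier G \<Longrightarrow> Ad G g \<xi> \<in> lie_algebra G"
  using tmap_tangent[OF smooth_conj, of g \<xi> \<one>] by (simp add: Ad_def lie_algebra_def)

lemma Ad_mult:
  assumes \<xi>: "\<xi> \<in> lie_algebra G" and g: "g \<in> carrier G" and h: "h \<in> carrier G"
  shows "Ad G g (Ad G h \<xi>) = Ad G (g \<otimes> h) \<xi>"
proof -
  have "Ad G g (Ad G h \<xi>) = tmap M (\<lambda>x. g \<otimes> (h \<otimes> x \<otimes> inv h) \<otimes> inv g) \<one> \<xi>"
    using tmap_compose[OF smooth_conj[OF h] smooth_conj[OF g], of \<one> \<xi>] h points_mfd by (simp add: Ad_def)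
  also have "\<dots> = tmap M (\<lambda>x. (g \<otimes> h) \<otimes> x \<otimes> inv (g \<otimes> h)) \<one> \<xi>"
    by (rule tmap_cong_carrier[of \<xi>]) (use \<xi> g h in \<open>simp_all add: lie_algebra_def m_assoc inv_mult_group\<close>)
  finally show ?thesis by (simp add: Ad_def)
qed

lemma Ad_one: "\<xi> \<in> lie_algebra G \<Longrightarrow> Ad G \<one> \<xi> = \<xi>"
  using tmap_cong_carrier[of \<xi> \<one> "\<lambda>x. \<one> \<otimes> x \<otimes> inv \<one>" "\<lambda>x. x" M] tmap_ident[of \<xi> M \<one>]
  by (simp add: Ad_def lie_algebra_def)

lemma Lv_eq_Rv_Ad:
  assumes \<xi>: "\<xi> \<in> lie_algebra G" and g: "g \<in> carrier G"
  shows "Lv \<xi> g = Rv (Ad G g \<xi>) g"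
proof -
  have "Rv (Ad G g \<xi>) g = tmap M (\<lambda>x. g \<otimes> x \<otimes> inv g \<otimes> g) \<one> \<xi>"
    using tmap_compose[OF smooth_conj[OF g] smooth_right[OF g], of \<one> \<xi>] g points_mfd by (simp add: Rv_def Ad_def)
  also have "\<dots> = Lv \<xi> g"
    unfolding Lv_def by (rule tmap_cong_carrier[of \<xi>]) (use \<xi> g in \<open>simp_all add: lie_algebra_def m_assoc\<close>)
  finally show ?thesis by simp
qed

lemma Rv_apply:
  assumes "g \<in> carrier G" "smooth_near M g f"
  shows "Rv \<xi> g f = \<xi> (\<lambda>p. f (p \<otimes> g))"
  unfolding Rv_def by (rule tmap_apply) (use assms in simp)

lemma Lv_apply:
  assumes "g \<in> carrier G" "smooth_near M g f"
  shows "Lv \<xi> g f = \<xi> (\<lambda>p. f (g \<otimes> p))"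
  unfolding Lv_def by (rule tmap_apply) (use assms in simp)

text \<open>The value on \<open>f\<close> is the derivative of \<open>f (p \<otimes> h)\<close> in
  the slot \<open>p\<close> at the identity, hence smooth in \<open>h\<close>.\<close>

lemma Rv_smooth:
  assumes \<xi>: "\<xi> \<in> lie_algebra G" and f: "smooth_near M g f"
  shows "smooth_near M g (\<lambda>h. Rv \<xi> h f)"
proof -
  have g: "g \<in> carrier G" using smooth_near_points[OF local_M f] points_mfd by simp
  obtain V where V: "openin (space_top M) V" "g \<in> V" "smooth_fun M V f" by (rule smooth_nearE_open[OF local_M f])
  have Vc: "V \<subseteq> carrier G" using openin_subset[OF V(1)] points_mfd by (simp add: points_def)
  have s: "smooth_fun (prod_space M M) {z \<in> points (prod_space M M). (\<lambda>(a, b). a \<otimes> b) z \<in> V} (f \<circ> (\<lambda>(a, b). a \<otimes> b))"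
    using mult_smooth V(3) unfolding smooth_map_def by blast
  have "smooth_near M g (\<lambda>h. \<xi> (\<lambda>p. (f \<circ> (\<lambda>(a, b). a \<otimes> b)) (p, h)))"
    by (rule slot_derivative[OF charted_M charted_M s, of \<one>])
      (use \<xi> g V(2) in \<open>simp_all add: points_prod points_mfd lie_algebra_def\<close>)
  then show ?thesis
  proof (rule smooth_near_cong[OF local_M V(1,2), rotated])
    fix h assume h: "h \<in> V"
    have "Rv \<xi> h f = \<xi> (\<lambda>p. f (p \<otimes> h))" by (rule Rv_apply) (use h Vc smooth_nearI[OF h V(3)] in auto)
    then show "\<xi> (\<lambda>p. (f \<circ> (\<lambda>(a, b). a \<otimes> b)) (p, h)) = Rv \<xi> h f" by simp
  qed
qed

text \<open>Left-invariant derivatives reduce to right-invariant ones by inversion.\<close>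

lemma Lv_smooth:
  assumes \<xi>: "\<xi> \<in> lie_algebra G" and f: "smooth_near M g f"
  shows "smooth_near M g (\<lambda>h. Lv \<xi> h f)"
proof -
  have g: "g \<in> carrier G" using smooth_near_points[OF local_M f] points_mfd by simp
  define \<xi>' where "\<xi>' = tmap M (\<lambda>a. inv a) \<one> \<xi>"
  have \<xi>': "\<xi>' \<in> lie_algebra G"
    using tmap_tangent[OF inv_smooth, of \<xi> \<one>] \<xi> by (simp add: \<xi>'_def lie_algebra_def)
  obtain V where V: "openin (space_top M) V" "g \<in> V" "smooth_fun M V f" by (rule smooth_nearE_open[OF local_M f])
  have Vc: "V \<subseteq> carrier G" using openin_subset[OF V(1)] points_mfd by (simp add: points_def)
  have near: "smooth_near M (inv h) (\<lambda>x. f (inv x))" if "h \<in> V" for h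
    by (rule smooth_map_near[OF inv_smooth]) (use that Vc smooth_nearI[OF that V(3)] points_mfd in auto)
  have "smooth_near M (inv g) (\<lambda>h. Rv \<xi>' h (\<lambda>x. f (inv x)))" by (rule Rv_smooth[OF \<xi>' near[OF V(2)]])
  then have "smooth_near M g (\<lambda>h. Rv \<xi>' (inv h) (\<lambda>x. f (inv x)))"
    by (rule smooth_map_near[OF inv_smooth, rotated]) (use g points_mfd in simp)
  then show ?thesis
  proof (rule smooth_near_cong[OF local_M V(1,2), rotated])
    fix h assume h: "h \<in> V"
    then have hc: "h \<in> carrier G" using Vc by blast
    have near1: "smooth_near M \<one> (\<lambda>p. f (inv (p \<otimes> inv h)))"
      by (rule smooth_map_near[OF smooth_right]) (use near[OF h] hc points_mfd in simp_all)
    have "Rv \<xi>' (inv h) (\<lambda>x. f (inv x)) = \<xi>' (\<lambda>p. f (inv (p \<otimes> inv h)))"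
      by (rule Rv_apply) (use hc near[OF h] in simp_all)
    also have "\<dots> = \<xi> (\<lambda>p. f (inv (inv p \<otimes> inv h)))"
      unfolding \<xi>'_def by (rule tmap_apply) (use near1 in simp)
    also have "\<dots> = \<xi> (\<lambda>p. f (h \<otimes> p))"
      by (rule tangent_near_cong[OF local_M _ openin_carrier one_closed])
        (use \<xi> hc in \<open>simp_all add: lie_algebra_def inv_mult_group\<close>)
    also have "\<dots> = Lv \<xi> h f" by (rule Lv_apply[symmetric]) (use hc smooth_nearI[OF h V(3)] in simp_all)
    finally show "Rv \<xi>' (inv h) (\<lambda>x. f (inv x)) = Lv \<xi> h f" .
  qed
qed

section \<open>Invariant covector fields\<close>

lemma dual_lincomb:
  assumes "\<nu> \<in> dual_lie_algebra G" "\<xi> \<in> lie_algebra G" "\<zeta> \<in> lie_algebra G"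
  shows "\<nu> (\<lambda>f. a * \<xi> f + b * \<zeta> f) = a * \<nu> \<xi> + b * \<nu> \<zeta>"
  using cotangent_lincomb[of \<nu> M \<one> \<xi> \<zeta>] assms by (simp add: dual_lie_algebra_def lie_algebra_def)

definition rcov :: "'g covec \<Rightarrow> 'g \<Rightarrow> 'g covec" where
  "rcov \<nu> g = snd (right_cov G g \<nu>)"

lemma right_cov_eq: "right_cov G g \<nu> = (g, rcov \<nu> g)"
  by (simp add: rcov_def right_cov_def)

lemma rcov_apply: "v \<in> tangent M g \<Longrightarrow> rcov \<nu> g v = \<nu> (tmap M (\<lambda>x. x \<otimes> inv g) g v)"
  by (simp add: rcov_def right_cov_def)

lemma rcov_cotangent:
  assumes \<nu>: "\<nu> \<in> dual_lie_algebra G" and g: "g \<in> carrier G"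
  shows "rcov \<nu> g \<in> cotangent M g"
  unfolding cotangent_def
proof (intro CollectI conjI ballI allI impI)
  fix v w a b assume vw: "v \<in> tangent M g" "w \<in> tangent M g"
  have "(\<lambda>f. a * v f + b * w f) \<in> tangent M g" by (rule tangent_lincomb[OF charted_M vw])
  then show "rcov \<nu> g (\<lambda>f. a * v f + b * w f) = a * rcov \<nu> g v + b * rcov \<nu> g w"
    using vw by (simp add: rcov_apply tmap_lincomb dual_lincomb[OF \<nu> right_back_tangent right_back_tangent])
qed (simp add: rcov_def right_cov_def)

lemma rcov_Rv: "\<xi> \<in> lie_algebra G \<Longrightarrow> g \<in> carrier G \<Longrightarrow> rcov \<nu> g (Rv \<xi> g) = \<nu> \<xi>"
  by (simp add: rcov_apply Rv_tangent right_back_Rv)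

text \<open>The coordinate vectors at \<open>p\<close> extend to right-invariant fields, and the
  values of \<alpha> on these fields determine its components near \<open>p\<close>
  smoothly.\<close>

lemma covector_smooth_of_Rv:
  assumes \<alpha>: "\<And>q. q \<in> carrier G \<Longrightarrow> \<alpha> q \<in> cotangent M q"
    and r: "\<And>\<xi>. \<xi> \<in> lie_algebra G \<Longrightarrow> smooth_near M p (\<lambda>q. \<alpha> q (Rv \<xi> q))"
    and ch: "chart M U n x" "p \<in> U" and i: "i < n"
  shows "smooth_near M p (\<lambda>q. \<alpha> q (coord_vec M U x i q))"
proof (rule covector_components_smooth[where X = "\<lambda>j. Rv (tmap M (\<lambda>x. x \<otimes> inv p) p (coord_vec M U x j p))",
    OF charted_M _ _ _ ch _ _ i])
  show "\<alpha> q \<in> cotangent M q" if "q \<in> points M" for q using \<alpha> that points_mfd by simp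
  have \<xi>: "tmap M (\<lambda>x. x \<otimes> inv p) p (coord_vec M U x j p) \<in> lie_algebra G" if "j < n" for j
    by (rule right_back_tangent[OF coord_vec_tangent[OF charted_M ch that]])
  show "Rv (tmap M (\<lambda>x. x \<otimes> inv p) p (coord_vec M U x j p)) q \<in> tangent M q" if "j < n" "q \<in> points M" for j q
    by (rule Rv_tangent[OF \<xi>[OF that(1)] that(2)[unfolded points_mfd]])
  show "smooth_near M p (\<lambda>q. Rv (tmap M (\<lambda>x. x \<otimes> inv p) p (coord_vec M U x j p)) q f)" if "j < n" "smooth_near M p f" for j f
    by (rule Rv_smooth[OF \<xi>[OF that(1)] that(2)])
  show "Rv (tmap M (\<lambda>x. x \<otimes> inv p) p (coord_vec M U x j p)) p = coord_vec M U x j p" if "j < n" for j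
    by (rule Rv_right_back[OF coord_vec_tangent[OF charted_M ch that]])
  show "smooth_near M p (\<lambda>q. \<alpha> q (Rv (tmap M (\<lambda>x. x \<otimes> inv p) p (coord_vec M U x j p)) q))" if "j < n" for j
    by (rule r[OF \<xi>[OF that]])
qed

lemma tmap_left_compose:
  assumes "v \<in> tangent M p" "p \<in> carrier G" "g \<in> carrier G" "h \<in> carrier G"
  shows "tmap M (\<lambda>x. h \<otimes> x) (g \<otimes> p) (tmap M (\<lambda>x. g \<otimes> x) p v) = tmap M (\<lambda>x. (h \<otimes> g) \<otimes> x) p v"
proof -
  have "tmap M (\<lambda>x. h \<otimes> x) (g \<otimes> p) (tmap M (\<lambda>x. g \<otimes> x) p v) = tmap M (\<lambda>x. h \<otimes> (g \<otimes> x)) p v"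
    by (rule tmap_compose[OF smooth_left smooth_left]) (use assms points_mfd in simp_all)
  also have "\<dots> = tmap M (\<lambda>x. (h \<otimes> g) \<otimes> x) p v"
    by (rule tmap_cong_carrier[OF assms(1)]) (use assms in \<open>simp add: m_assoc\<close>)
  finally show ?thesis .
qed

lemma tmap_one_left: "v \<in> tangent M p \<Longrightarrow> tmap M (\<lambda>x. \<one> \<otimes> x) p v = v"
  using tmap_cong_carrier[of v p "\<lambda>x. \<one> \<otimes> x" "\<lambda>x. x" M] tmap_ident[of v M p] by simp

lemma left_back_tangent: "v \<in> tangent M g \<Longrightarrow> tmap M (\<lambda>x. inv g \<otimes> x) g v \<in> lie_algebra G"
  using tmap_tangent[OF smooth_left[OF inv_closed], of g v g] tangent_points[of v M g]
  by (simp add: lie_algebra_def points_mfd)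

lemma Lv_left_back:
  assumes v: "v \<in> tangent M g"
  shows "Lv (tmap M (\<lambda>x. inv g \<otimes> x) g v) g = v"
proof -
  have g: "g \<in> carrier G" using tangent_points[OF v] points_mfd by simp
  show ?thesis
    using tmap_left_compose[OF v g inv_closed[OF g] g] g tmap_one_left[OF v] by (simp add: Lv_def)
qed

text \<open>The left-invariant counterpart, for covector fields such as \<open>lcov\<close> whose
  values on left-invariant vector fields are constant.\<close>

lemma covector_smooth_of_Lv:
  assumes \<alpha>: "\<And>q. q \<in> carrier G \<Longrightarrow> \<alpha> q \<in> cotangent M q"
    and r: "\<And>\<xi>. \<xi> \<in> lie_algebra G \<Longrightarrow> smooth_near M p (\<lambda>q. \<alpha> q (Lv \<xi> q))"
    and ch: "chart M U n x" "p \<in> U" and i: "i < n"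
  shows "smooth_near M p (\<lambda>q. \<alpha> q (coord_vec M U x i q))"
proof (rule covector_components_smooth[where X = "\<lambda>j. Lv (tmap M (\<lambda>x. inv p \<otimes> x) p (coord_vec M U x j p))",
    OF charted_M _ _ _ ch _ _ i])
  show "\<alpha> q \<in> cotangent M q" if "q \<in> points M" for q using \<alpha> that points_mfd by simp
  have \<xi>: "tmap M (\<lambda>x. inv p \<otimes> x) p (coord_vec M U x j p) \<in> lie_algebra G" if "j < n" for j
    by (rule left_back_tangent[OF coord_vec_tangent[OF charted_M ch that]])
  show "Lv (tmap M (\<lambda>x. inv p \<otimes> x) p (coord_vec M U x j p)) q \<in> tangent M q" if "j < n" "q \<in> points M" for j q
    by (rule Lv_tangent[OF \<xi>[OF that(1)] that(2)[unfolded points_mfd]])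
  show "smooth_near M p (\<lambda>q. Lv (tmap M (\<lambda>x. inv p \<otimes> x) p (coord_vec M U x j p)) q f)" if "j < n" "smooth_near M p f" for j f
    by (rule Lv_smooth[OF \<xi>[OF that(1)] that(2)])
  show "Lv (tmap M (\<lambda>x. inv p \<otimes> x) p (coord_vec M U x j p)) p = coord_vec M U x j p" if "j < n" for j
    by (rule Lv_left_back[OF coord_vec_tangent[OF charted_M ch that]])
  show "smooth_near M p (\<lambda>q. \<alpha> q (Lv (tmap M (\<lambda>x. inv p \<otimes> x) p (coord_vec M U x j p)) q))" if "j < n" for j
    by (rule r[OF \<xi>[OF that]])
qed

lemma rcov_smooth:
  assumes \<nu>: "\<nu> \<in> dual_lie_algebra G" and ch: "chart M U n x" "p \<in> U" and i: "i < n"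
  shows "smooth_near M p (\<lambda>q. rcov \<nu> q (coord_vec M U x i q))"
proof (rule covector_smooth_of_Rv[OF rcov_cotangent[OF \<nu>] _ ch i])
  fix \<xi> assume \<xi>: "\<xi> \<in> lie_algebra G"
  have p: "p \<in> carrier G" using chart_subset[OF ch(1)] ch(2) points_mfd by blast
  have "smooth_near M p (\<lambda>q. \<nu> \<xi>)" by (rule smooth_near_const[OF charted_M]) (simp add: p points_mfd)
  then show "smooth_near M p (\<lambda>q. rcov \<nu> q (Rv \<xi> q))"
    by (rule smooth_near_cong[OF local_M openin_carrier p, rotated]) (simp add: rcov_Rv \<xi>)
qed

text \<open>The function is the pairing of the right-invariant covector field of \<nu> with the
  left-invariant vector field of \<xi>, and both have smooth components.\<close>

lemma Ad_smooth:
  assumes \<nu>: "\<nu> \<in> dual_lie_algebra G" and \<xi>: "\<xi> \<in> lie_algebra G" and p: "p \<in> carrier G"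
  shows "smooth_near M p (\<lambda>g. \<nu> (Ad G g \<xi>))"
proof -
  obtain U n x where ch: "chart M U n x" "p \<in> U" by (rule charted_pointE[OF charted_M]) (use p points_mfd in auto)
  have Uc: "U \<subseteq> carrier G" using chart_subset[OF ch(1)] points_mfd by simp
  have "smooth_near M p (\<lambda>g. \<Sum>i<n. Lv \<xi> g (\<lambda>q. x q i) * rcov \<nu> g (coord_vec M U x i g))"
    by (intro smooth_near_sum[OF charted_M] smooth_near_mult[OF charted_M] Lv_smooth[OF \<xi>] smooth_near_coord[OF ch local_M]
        rcov_smooth[OF \<nu> ch]) (use p points_mfd in simp)
  then show ?thesis
  proof (rule smooth_near_cong[OF local_M chart_open[OF ch(1)] ch(2), rotated])
    fix g assume g: "g \<in> U"
    then have gc: "g \<in> carrier G" using Uc by blast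
    have "\<nu> (Ad G g \<xi>) = rcov \<nu> g (Lv \<xi> g)"
      unfolding Lv_eq_Rv_Ad[OF \<xi> gc] by (rule rcov_Rv[OF Ad_closed[OF \<xi> gc] gc, symmetric])
    also have "\<dots> = (\<Sum>i<n. Lv \<xi> g (\<lambda>q. x q i) * rcov \<nu> g (coord_vec M U x i g))"
      by (rule cotangent_expand[OF charted_M rcov_cotangent[OF \<nu> gc] ch(1) g Lv_tangent[OF \<xi> gc]])
    finally show "(\<Sum>i<n. Lv \<xi> g (\<lambda>q. x q i) * rcov \<nu> g (coord_vec M U x i g)) = \<nu> (Ad G g \<xi>)" by simp
  qed
qed

end

section \<open>The cotangent bundle\<close>

definition cot_dom :: "'a smooth_space \<Rightarrow> 'a set \<Rightarrow> ('a \<times> 'a covec) set" where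
  "cot_dom M U = {a \<in> cot_points M. fst a \<in> U}"

text \<open>The coordinate form of the bundle projection: the first \<open>n\<close> coordinates of
  an induced chart are those of the base point.\<close>

definition Rn_proj :: "nat \<Rightarrow> (nat \<Rightarrow> real) \<Rightarrow> nat \<Rightarrow> real" where
  "Rn_proj n z = (\<lambda>i. if i < n then z i else 0)"

lemma cot_chart_Rn: "cot_chart M U n x a \<in> Rn (2 * n)"
  by (simp add: Rn_iff cot_chart_def split: prod.split)

lemma topspace_cotangent_bundle:
  assumes M: "charted M"
  shows "points (cotangent_bundle M) = cot_points M"
proof -
  let ?S = "{{a \<in> cot_points M. fst a \<in> U \<and> cot_chart M U n x a \<in> V} | U n x V.
               chart M U n x \<and> openin (Euclidean_space (2 * n)) V}"
  have "\<Union>?S = cot_points M"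
  proof
    show "cot_points M \<subseteq> \<Union>?S"
    proof
      fix a assume a: "a \<in> cot_points M"
      then have "fst a \<in> points M" by (auto simp: cot_points_def)
      then obtain U n x where ch: "chart M U n x" "fst a \<in> U" by (rule charted_pointE[OF M])
      have "a \<in> {a \<in> cot_points M. fst a \<in> U \<and> cot_chart M U n x a \<in> Rn (2 * n)}"
        by (intro CollectI conjI a ch(2) cot_chart_Rn)
      moreover have "{a \<in> cot_points M. fst a \<in> U \<and> cot_chart M U n x a \<in> Rn (2 * n)} \<in> ?S"
        using ch(1) by (intro CollectI exI[of _ U] exI[of _ n] exI[of _ x] exI[of _ "Rn (2 * n)"]) simp
      ultimately show "a \<in> \<Union>?S" by (rule UnionI[rotated])
    qed
    show "\<Union>?S \<subseteq> cot_points M"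
    proof (rule Union_least)
      fix T assume "T \<in> ?S"
      then obtain U n x V where "T = {a \<in> cot_points M. fst a \<in> U \<and> cot_chart M U n x a \<in> V}" by blast
      then show "T \<subseteq> cot_points M" by (simp only: Collect_subset)
    qed
  qed
  then show ?thesis
    unfolding points_def cotangent_bundle_def Let_def smooth_space.simps topology_generated_by_topspace .
qed

lemma openin_cot_basic:
  assumes "chart M U n x" "openin (Euclidean_space (2 * n)) V"
  shows "openin (space_top (cotangent_bundle M)) {a \<in> cot_points M. fst a \<in> U \<and> cot_chart M U n x a \<in> V}"
  unfolding cotangent_bundle_def Let_def smooth_space.simps
  by (rule topology_generated_by_Basis) (use assms in blast)

lemma continuous_map_into_cot:
  "continuous_map X (space_top (cotangent_bundle M)) f \<longleftrightarrow>
    (\<forall>U n x V. chart M U n x \<and> openin (Euclidean_space (2 * n)) V \<longrightarrow>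
      openin X (f -` {a \<in> cot_points M. fst a \<in> U \<and> cot_chart M U n x a \<in> V} \<inter> topspace X)) \<and>
    f ` topspace X \<subseteq> points (cotangent_bundle M)"
  unfolding points_def cotangent_bundle_def Let_def smooth_space.simps continuous_on_generated_topo_iff
    topology_generated_by_topspace by blast

lemma smooth_fun_cot:
  "smooth_fun (cotangent_bundle M) W f \<longleftrightarrow> openin (space_top (cotangent_bundle M)) W \<and>
    (\<forall>U n x. chart M U n x \<longrightarrow> smooth_Rn (2 * n) (cot_chart M U n x ` {a \<in> W. fst a \<in> U})
      (f \<circ> inv_into (cot_dom M U) (cot_chart M U n x)))"
  unfolding cotangent_bundle_def Let_def smooth_space.simps cot_dom_def ..

lemma open_domains_cot: "open_domains (cotangent_bundle M)"
  unfolding open_domains_def smooth_fun_cot by blast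

lemma Rn_proj_cot_chart:
  assumes "chart M U n x" "fst a \<in> U"
  shows "Rn_proj n (cot_chart M U n x a) = x (fst a)"
proof
  fix i
  have "x (fst a) \<in> Rn n" by (rule chart_Rn[OF assms])
  then show "Rn_proj n (cot_chart M U n x a) i = x (fst a) i"
    by (auto simp: Rn_proj_def cot_chart_def Rn_iff split: prod.split)
qed

lemma cot_chart_fibre: "i < n \<Longrightarrow> cot_chart M U n x a (n + i) = snd a (coord_vec M U x i (fst a))"
  by (auto simp: cot_chart_def split: prod.split)

lemma cotangent_eqI:
  assumes M: "charted M" and ch: "chart M U n x" "p \<in> U" and \<alpha>: "\<alpha> \<in> cotangent M p" and \<beta>: "\<beta> \<in> cotangent M p"
    and eq: "\<And>i. i < n \<Longrightarrow> \<alpha> (coord_vec M U x i p) = \<beta> (coord_vec M U x i p)"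
  shows "\<alpha> = \<beta>"
proof
  fix v
  show "\<alpha> v = \<beta> v"
  proof (cases "v \<in> tangent M p")
    case True
    then show ?thesis
      unfolding cotangent_expand[OF M \<alpha> ch True] cotangent_expand[OF M \<beta> ch True]
      by (intro sum.cong) (auto simp: eq)
  next
    case False
    then show ?thesis using cotangent_outside[OF \<alpha>] cotangent_outside[OF \<beta>] by simp
  qed
qed

lemma tangent_eqI:
  assumes M: "charted M" and ch: "chart M U n x" "p \<in> U" and v: "v \<in> tangent M p" and w: "w \<in> tangent M p"
    and eq: "\<And>i. i < n \<Longrightarrow> v (\<lambda>q. x q i) = w (\<lambda>q. x q i)"
  shows "v = w"
proof
  fix f
  have "v f = (\<Sum>i<n. v (\<lambda>q. x q i) * coord_vec M U x i p f)" by (rule fun_cong[OF tangent_expand[OF M v ch]])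
  also have "\<dots> = (\<Sum>i<n. w (\<lambda>q. x q i) * coord_vec M U x i p f)" by (intro sum.cong) (auto simp: eq)
  also have "\<dots> = w f" by (rule fun_cong[OF tangent_expand[OF M w ch], symmetric])
  finally show "v f = w f" .
qed

lemma cot_chart_inj:
  assumes M: "charted M" and ch: "chart M U n x"
  shows "inj_on (cot_chart M U n x) (cot_dom M U)"
proof (rule inj_onI)
  fix a b assume a: "a \<in> cot_dom M U" and b: "b \<in> cot_dom M U" and eq: "cot_chart M U n x a = cot_chart M U n x b"
  have aU: "fst a \<in> U" "snd a \<in> cotangent M (fst a)" and bU: "fst b \<in> U" "snd b \<in> cotangent M (fst b)"
    using a b by (auto simp: cot_dom_def cot_points_def)
  have "x (fst a) = x (fst b)" using Rn_proj_cot_chart[OF ch] aU bU eq by metis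
  then have fe: "fst a = fst b" by (rule inj_onD[OF chart_inj[OF ch]]) (use aU bU in simp_all)
  have "snd a (coord_vec M U x i (fst a)) = snd b (coord_vec M U x i (fst a))" if "i < n" for i
    using cot_chart_fibre[OF that, of M U x a] cot_chart_fibre[OF that, of M U x b] eq fe by simp
  note e = this
  have "snd a = snd b"
    by (rule cotangent_eqI[OF M ch aU(1) aU(2) _ e]) (use bU fe in simp_all)
  with fe show "a = b" by (simp add: prod_eq_iff)
qed

lemma cot_chart_inv: "charted M \<Longrightarrow> chart M U n x \<Longrightarrow> a \<in> cot_dom M U \<Longrightarrow>
    inv_into (cot_dom M U) (cot_chart M U n x) (cot_chart M U n x a) = a"
  by (rule inv_into_f_f[OF cot_chart_inj])

lemma combination_cotangent:
  assumes M: "charted M" and p: "p \<in> points M"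
  shows "(\<lambda>v. if v \<in> tangent M p then \<Sum>i<(n::nat). v (u i) * c i else 0) \<in> cotangent M p"
  unfolding cotangent_def
proof (intro CollectI conjI ballI allI impI)
  fix v w a b assume v: "v \<in> tangent M p" "w \<in> tangent M p"
  then have "(\<lambda>f. a * v f + b * w f) \<in> tangent M p" by (rule tangent_lincomb[OF M])
  then show "(if (\<lambda>f. a * v f + b * w f) \<in> tangent M p then \<Sum>i<n. (a * v (u i) + b * w (u i)) * c i else 0) =
    a * (if v \<in> tangent M p then \<Sum>i<n. v (u i) * c i else 0) + b * (if w \<in> tangent M p then \<Sum>i<n. w (u i) * c i else 0)"
    using v by (simp add: distrib_right sum.distrib sum_distrib_left mult.assoc)
qed simp

lemma cot_chart_image:
  assumes M: "charted M" and ch: "chart M U n x" and B: "B \<subseteq> U"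
  shows "cot_chart M U n x ` {a \<in> cot_points M. fst a \<in> B} = {z \<in> Rn (2 * n). Rn_proj n z \<in> x ` B}"
proof
  show "cot_chart M U n x ` {a \<in> cot_points M. fst a \<in> B} \<subseteq> {z \<in> Rn (2 * n). Rn_proj n z \<in> x ` B}"
    using cot_chart_Rn Rn_proj_cot_chart[OF ch] B by fastforce
  show "{z \<in> Rn (2 * n). Rn_proj n z \<in> x ` B} \<subseteq> cot_chart M U n x ` {a \<in> cot_points M. fst a \<in> B}"
  proof
    fix z assume "z \<in> {z \<in> Rn (2 * n). Rn_proj n z \<in> x ` B}"
    then obtain p where z: "z \<in> Rn (2 * n)" and p: "p \<in> B" "Rn_proj n z = x p" by blast
    have pU: "p \<in> U" and pM: "p \<in> points M" using p B chart_subset[OF ch] by auto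
    \<comment> \<open>The covector at \<open>p\<close> with prescribed components, the last
      \<open>n\<close> coordinates of \<open>z\<close>; it shows that the induced chart reaches
      every fibre coordinate.\<close>
    define \<alpha> where "\<alpha> = (\<lambda>v. if v \<in> tangent M p then \<Sum>i<n. v (\<lambda>q. x q i) * z (n + i) else 0)"
    have \<alpha>: "\<alpha> \<in> cotangent M p" unfolding \<alpha>_def by (rule combination_cotangent[OF M pM])
    have \<alpha>c: "\<alpha> (coord_vec M U x j p) = z (n + j)" if "j < n" for j
    proof -
      have "\<alpha> (coord_vec M U x j p) = (\<Sum>i<n. (if j = i then 1 else 0) * z (n + i))"
        unfolding \<alpha>_def using coord_vec_tangent[OF M ch pU that] coord_vec_coord[OF charted_local[OF M] ch pU that] by simp
      also have "\<dots> = (\<Sum>i<n. if j = i then z (n + i) else 0)" by (intro sum.cong) auto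
      also have "\<dots> = z (n + j)" using that by (subst sum.delta') auto
      finally show ?thesis .
    qed
    have "cot_chart M U n x (p, \<alpha>) i = z i" for i
    proof -
      consider "i < n" | "n \<le> i" "i < 2 * n" | "2 * n \<le> i" by linarith
      then show ?thesis
      proof cases
        case 1
        then show ?thesis using fun_cong[OF p(2), of i] by (simp add: cot_chart_def Rn_proj_def)
      next
        case 2
        then show ?thesis using \<alpha>c[of "i - n"] by (simp add: cot_chart_def)
      next
        case 3
        then show ?thesis using z by (simp add: cot_chart_def Rn_iff)
      qed
    qed
    then have "z = cot_chart M U n x (p, \<alpha>)" by (intro ext) simp
    moreover have "(p, \<alpha>) \<in> {a \<in> cot_points M. fst a \<in> B}" using p pM \<alpha> by (simp add: cot_points_def)
    ultimately show "z \<in> cot_chart M U n x ` {a \<in> cot_points M. fst a \<in> B}" by blast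
  qed
qed

lemma openin_Rn_proj_preimage:
  assumes "openin (Euclidean_space n) V"
  shows "openin (Euclidean_space (2 * n)) {z \<in> Rn (2 * n). Rn_proj n z \<in> V}"
proof -
  have "continuous_map (Euclidean_space (2 * n)) euclideanreal (\<lambda>z. z i)" for i
    using Ck_imp_continuous[OF Ck_coord[of "2 * n" 0 "Rn (2 * n)" i]] by simp
  then have "continuous_map (Euclidean_space (2 * n)) (Euclidean_space n) (\<lambda>z i. if i < n then z i else 0)"
    unfolding continuous_map_componentwise_Euclidean_space by blast
  from openin_continuous_map_preimage[OF this assms] show ?thesis unfolding Rn_proj_def .
qed

lemma smooth_Rn_proj_compose:
  assumes F: "smooth_Rn n V F"
  shows "smooth_Rn (2 * n) {z \<in> Rn (2 * n). Rn_proj n z \<in> V} (\<lambda>z. F (Rn_proj n z))"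
proof -
  have V: "openin (Euclidean_space n) V" using F unfolding smooth_Rn_def by blast
  show ?thesis
    unfolding smooth_Rn_def
  proof (intro conjI allI openin_Rn_proj_preimage[OF V])
    fix k
    have C: "Ck_Rn n k V F" using F unfolding smooth_Rn_def by blast
    show "Ck_Rn (2 * n) k {z \<in> Rn (2 * n). Rn_proj n z \<in> V} (\<lambda>z. F (Rn_proj n z))"
      unfolding Rn_proj_def
      by (rule Ck_compose[where f = "\<lambda>i z. z i", OF V openin_Rn_proj_preimage[OF V, unfolded Rn_proj_def] _ C])
        (simp, rule Ck_coord)
  qed
qed

lemma openin_cot_over:
  assumes M: "charted M" and V: "openin (space_top M) V"
  shows "openin (space_top (cotangent_bundle M)) {a \<in> cot_points M. fst a \<in> V}"
proof (subst openin_subopen, intro ballI)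
  fix a assume a: "a \<in> {a \<in> cot_points M. fst a \<in> V}"
  then have "fst a \<in> points M" by (auto simp: cot_points_def)
  then obtain U n x where ch: "chart M U n x" "fst a \<in> U" by (rule charted_pointE[OF M])
  have VU: "openin (space_top M) (V \<inter> U)" using V chart_open[OF ch(1)] by blast
  let ?Z = "{z \<in> Rn (2 * n). Rn_proj n z \<in> x ` (V \<inter> U)}"
  let ?T = "{a \<in> cot_points M. fst a \<in> U \<and> cot_chart M U n x a \<in> ?Z}"
  have op: "openin (space_top (cotangent_bundle M)) ?T"
    by (rule openin_cot_basic[OF ch(1) openin_Rn_proj_preimage[OF chart_open_image[OF ch(1) VU]]]) simp
  have "b \<in> ?T \<longleftrightarrow> b \<in> cot_points M \<and> fst b \<in> V \<and> fst b \<in> U" for b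
  proof -
    have "x (fst b) \<in> x ` (V \<inter> U) \<longleftrightarrow> fst b \<in> V" if "fst b \<in> U"
      using inj_on_image_mem_iff[OF chart_inj[OF ch(1)] that, of "V \<inter> U"] that by simp
    moreover have "b \<in> ?T \<longleftrightarrow> b \<in> cot_points M \<and> fst b \<in> U \<and> Rn_proj n (cot_chart M U n x b) \<in> x ` (V \<inter> U)"
      by (simp only: mem_Collect_eq cot_chart_Rn simp_thms)
    ultimately show ?thesis using Rn_proj_cot_chart[OF ch(1), of b] by (cases "fst b \<in> U") simp_all
  qed
  then show "\<exists>T. openin (space_top (cotangent_bundle M)) T \<and> a \<in> T \<and> T \<subseteq> {a \<in> cot_points M. fst a \<in> V}"
    using op a ch(2) by (intro exI[of _ ?T] conjI) auto
qed

lemma smooth_map_cot_fst: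
  assumes M: "charted M"
  shows "smooth_map (cotangent_bundle M) M fst"
  unfolding smooth_map_def
proof (intro conjI allI impI)
  have pts: "points (cotangent_bundle M) = cot_points M" by (rule topspace_cotangent_bundle[OF M])
  show "continuous_map (space_top (cotangent_bundle M)) (space_top M) fst"
    unfolding continuous_map_def
  proof (intro conjI allI impI)
    show "fst \<in> topspace (space_top (cotangent_bundle M)) \<rightarrow> topspace (space_top M)"
      using pts by (auto simp: points_def cot_points_def)
    show "openin (space_top (cotangent_bundle M)) {a \<in> topspace (space_top (cotangent_bundle M)). fst a \<in> V}"
      if "openin (space_top M) V" for V
      using openin_cot_over[OF M that] pts by (simp add: points_def)
  qed
  fix V h assume h: "smooth_fun M V h"
  then have V: "openin (space_top M) V" by (rule smooth_fun_open[OF charted_local[OF M]])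
  show "smooth_fun (cotangent_bundle M) {a \<in> points (cotangent_bundle M). fst a \<in> V} (h \<circ> fst)"
    unfolding smooth_fun_cot pts
  proof (intro conjI allI impI openin_cot_over[OF M V])
    fix U n x assume ch: "chart M U n x"
    have VU: "openin (space_top M) (V \<inter> U)" using V chart_open[OF ch] by blast
    have eq: "{a \<in> {a \<in> cot_points M. fst a \<in> V}. fst a \<in> U} = {a \<in> cot_points M. fst a \<in> V \<inter> U}" by auto
    have "smooth_fun M (V \<inter> U) h" by (rule smooth_fun_subset[OF charted_local[OF M] h VU]) simp
    then have "smooth_Rn n (x ` (V \<inter> U)) (h \<circ> inv_into U x)" using chart_smooth_iff[OF ch VU] by simp
    from smooth_Rn_proj_compose[OF this]
    have s: "smooth_Rn (2 * n) {z \<in> Rn (2 * n). Rn_proj n z \<in> x ` (V \<inter> U)} (\<lambda>z. (h \<circ> inv_into U x) (Rn_proj n z))" .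
    have im: "cot_chart M U n x ` {a \<in> {a \<in> cot_points M. fst a \<in> V}. fst a \<in> U} = {z \<in> Rn (2 * n). Rn_proj n z \<in> x ` (V \<inter> U)}"
      unfolding eq by (rule cot_chart_image[OF M ch]) simp
    show "smooth_Rn (2 * n) (cot_chart M U n x ` {a \<in> {a \<in> cot_points M. fst a \<in> V}. fst a \<in> U})
          (h \<circ> fst \<circ> inv_into (cot_dom M U) (cot_chart M U n x))"
    proof (subst smooth_Rn_cong)
      fix z assume "z \<in> cot_chart M U n x ` {a \<in> {a \<in> cot_points M. fst a \<in> V}. fst a \<in> U}"
      then obtain a where a: "a \<in> cot_dom M U" "z = cot_chart M U n x a" by (auto simp: cot_dom_def)
      then have "fst a \<in> U" by (simp add: cot_dom_def)
      then show "(h \<circ> fst \<circ> inv_into (cot_dom M U) (cot_chart M U n x)) z = (h \<circ> inv_into U x) (Rn_proj n z)"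
        unfolding a(2) using cot_chart_inv[OF M ch a(1)] Rn_proj_cot_chart[OF ch] chart_inv[OF ch] by simp
    next
      show "smooth_Rn (2 * n) (cot_chart M U n x ` {a \<in> {a \<in> cot_points M. fst a \<in> V}. fst a \<in> U})
        (\<lambda>z. (h \<circ> inv_into U x) (Rn_proj n z))" unfolding im by (rule s)
    qed
  qed
qed

text \<open>In an induced chart this is the sum of the components of \<open>X\<close> times the
  fibre coordinates. It serves to extract the factor f_\<sigma> from the section \<sigma>.\<close>

lemma smooth_fun_cot_eval:
  assumes M: "charted M" and X: "\<And>p. p \<in> points M \<Longrightarrow> X p \<in> tangent M p"
    and Xs: "\<And>p f. smooth_near M p f \<Longrightarrow> smooth_near M p (\<lambda>q. X q f)"
  shows "smooth_fun (cotangent_bundle M) (cot_points M) (\<lambda>a. snd a (X (fst a)))"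
  unfolding smooth_fun_cot
proof (intro conjI allI impI)
  have L: "local_space M" by (rule charted_local[OF M])
  show "openin (space_top (cotangent_bundle M)) (cot_points M)"
    using topspace_cotangent_bundle[OF M] by (metis openin_topspace points_def)
  fix U n x assume ch: "chart M U n x"
  let ?Z = "{z \<in> Rn (2 * n). Rn_proj n z \<in> x ` U}"
  have im: "cot_chart M U n x ` {a \<in> cot_points M. fst a \<in> U} = ?Z" by (rule cot_chart_image[OF M ch]) simp
  have "smooth_Rn (2 * n) ?Z (\<lambda>z. \<Sum>i<n. ((\<lambda>q. X q (\<lambda>q. x q i)) \<circ> inv_into U x) (Rn_proj n z) * z (n + i))"
    unfolding smooth_Rn_def
  proof (intro conjI allI)
    show op: "openin (Euclidean_space (2 * n)) ?Z" by (rule openin_Rn_proj_preimage[OF chart_image_open[OF ch]])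
    fix k
    show "Ck_Rn (2 * n) k ?Z (\<lambda>z. \<Sum>i<n. ((\<lambda>q. X q (\<lambda>q. x q i)) \<circ> inv_into U x) (Rn_proj n z) * z (n + i))"
    proof (intro Ck_sum[OF op] Ck_mult[OF op] Ck_coord)
      fix i
      have "smooth_near M p (\<lambda>q. X q (\<lambda>q. x q i))" if "p \<in> U" for p
        by (rule Xs[OF smooth_near_coord[OF ch that L]])
      then have "smooth_fun M U (\<lambda>q. X q (\<lambda>q. x q i))"
        unfolding smooth_fun_iff_near[OF L] using chart_open[OF ch] by blast
      then have "smooth_Rn n (x ` U) ((\<lambda>q. X q (\<lambda>q. x q i)) \<circ> inv_into U x)"
        using chart_smooth_iff[OF ch chart_open[OF ch] order_refl] by blast
      from smooth_Rn_proj_compose[OF this]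
      show "Ck_Rn (2 * n) k ?Z (\<lambda>z. ((\<lambda>q. X q (\<lambda>q. x q i)) \<circ> inv_into U x) (Rn_proj n z))"
        unfolding smooth_Rn_def by blast
    qed
  qed
  note sm = this
  have eq: "((\<lambda>a. snd a (X (fst a))) \<circ> inv_into (cot_dom M U) (cot_chart M U n x)) z
      = (\<Sum>i<n. ((\<lambda>q. X q (\<lambda>q. x q i)) \<circ> inv_into U x) (Rn_proj n z) * z (n + i))"
    if z: "z \<in> cot_chart M U n x ` {a \<in> cot_points M. fst a \<in> U}" for z
  proof -
    obtain a where a: "a \<in> cot_dom M U" "z = cot_chart M U n x a" using z by (auto simp: cot_dom_def)
    then have aU: "fst a \<in> U" "snd a \<in> cotangent M (fst a)" "fst a \<in> points M" by (auto simp: cot_dom_def cot_points_def)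
    have "snd a (X (fst a)) = (\<Sum>i<n. X (fst a) (\<lambda>q. x q i) * snd a (coord_vec M U x i (fst a)))"
      by (rule cotangent_expand[OF M aU(2) ch aU(1) X[OF aU(3)]])
    also have "\<dots> = (\<Sum>i<n. ((\<lambda>q. X q (\<lambda>q. x q i)) \<circ> inv_into U x) (Rn_proj n z) * z (n + i))"
      unfolding a(2) Rn_proj_cot_chart[OF ch aU(1)]
      by (intro sum.cong) (auto simp: cot_chart_fibre chart_inv[OF ch aU(1)])
    finally show ?thesis unfolding a(2) using cot_chart_inv[OF M ch a(1)] by simp
  qed
  show "smooth_Rn (2 * n) (cot_chart M U n x ` {a \<in> cot_points M. fst a \<in> U})
       ((\<lambda>a. snd a (X (fst a))) \<circ> inv_into (cot_dom M U) (cot_chart M U n x))"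
    by (subst smooth_Rn_cong[OF eq], assumption) (unfold im, rule sm)
qed

text \<open>Base coordinates and fibre components together are the coordinates of an induced chart.
  One such chart around the image point is enough, as smooth functions on the bundle are smooth in
  every induced chart.\<close>

lemma cot_map_smooth:
  assumes L: "charted L" and M: "charted M" and A: "smooth_map L M A"
    and \<alpha>: "\<And>l. l \<in> points L \<Longrightarrow> \<alpha> l \<in> cotangent M (A l)"
    and s: "\<And>l U n x i. l \<in> points L \<Longrightarrow> chart M U n x \<Longrightarrow> A l \<in> U \<Longrightarrow> i < n \<Longrightarrow>
      smooth_near L l (\<lambda>l. \<alpha> l (coord_vec M U x i (A l)))"
  shows "smooth_map L (cotangent_bundle M) (\<lambda>l. (A l, \<alpha> l))"
proof (rule smooth_mapI[OF charted_local[OF L] open_domains_cot])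
  let ?c = "\<lambda>U n x i l. if i < n then x (A l) i else \<alpha> l (coord_vec M U x (i - n) (A l))"
  have cA: "continuous_map (space_top L) (space_top M) A" using A unfolding smooth_map_def by blast
  have sc: "smooth_near L l (?c U n x i)" if "l \<in> points L" "chart M U n x" "A l \<in> U" "i < 2 * n" for l U n x i
  proof (cases "i < n")
    case True
    have "smooth_near L l (\<lambda>l. x (A l) i)"
      by (rule smooth_map_near[OF A that(1) smooth_near_coord[OF that(2,3) charted_local[OF M]]])
    then show ?thesis using True by simp
  next
    case False
    then show ?thesis using s[OF that(1-3), of "i - n"] that(4) by simp
  qed
  have tup: "cot_chart M U n x (A l, \<alpha> l) = (\<lambda>i. if i < 2 * n then ?c U n x i l else 0)" for U n x l
    by (auto simp: cot_chart_def fun_eq_iff)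
  have pL: "(A l, \<alpha> l) \<in> cot_points M" if "l \<in> points L" for l
    using \<alpha>[OF that] smooth_map_in[OF A that] by (simp add: cot_points_def)
  show "continuous_map (space_top L) (space_top (cotangent_bundle M)) (\<lambda>l. (A l, \<alpha> l))"
    unfolding continuous_map_into_cot
  proof (intro conjI allI impI; (elim conjE)?)
    show "(\<lambda>l. (A l, \<alpha> l)) ` topspace (space_top L) \<subseteq> points (cotangent_bundle M)"
      unfolding topspace_cotangent_bundle[OF M] using pL by (auto simp: points_def)
    fix U n x V assume ch: "chart M U n x" and V: "openin (Euclidean_space (2 * n)) V"
    let ?P = "(\<lambda>l. (A l, \<alpha> l)) -` {a \<in> cot_points M. fst a \<in> U \<and> cot_chart M U n x a \<in> V} \<inter> topspace (space_top L)"
    show "openin (space_top L) ?P"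
    proof (subst openin_subopen, intro ballI)
      fix l assume l: "l \<in> ?P"
      then have lL: "l \<in> points L" and lU: "A l \<in> U" and lV: "cot_chart M U n x (A l, \<alpha> l) \<in> V" by (auto simp: points_def)
      obtain W where W: "openin (space_top L) W" "l \<in> W" "\<And>q. q \<in> W \<Longrightarrow> (\<lambda>i. if i < 2 * n then ?c U n x i q else 0) \<in> V"
        by (rule smooth_tuple_preimage[where f = "?c U n x", OF L sc[OF lL ch lU] lL V lV[unfolded tup]]) (assumption, (rule that; assumption))
      have LU: "openin (space_top L) {q \<in> topspace (space_top L). A q \<in> U}"
        by (rule openin_continuous_map_preimage[OF cA chart_open[OF ch]])
      show "\<exists>T. openin (space_top L) T \<and> l \<in> T \<and> T \<subseteq> ?P"
      proof (intro exI[of _ "W \<inter> {q \<in> topspace (space_top L). A q \<in> U}"] conjI openin_Int W(1) LU)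
        show "l \<in> W \<inter> {q \<in> topspace (space_top L). A q \<in> U}" using W(2) l lU by blast
        show "W \<inter> {q \<in> topspace (space_top L). A q \<in> U} \<subseteq> ?P"
          using W(3) tup pL by (auto simp: points_def)
      qed
    qed
  qed
  fix l h assume l: "l \<in> points L" and "smooth_near (cotangent_bundle M) (A l, \<alpha> l) h"
  then obtain W where W: "(A l, \<alpha> l) \<in> W" "smooth_fun (cotangent_bundle M) W h" unfolding smooth_near_def by blast
  obtain U n x where ch: "chart M U n x" "A l \<in> U" by (rule charted_pointE[OF M smooth_map_in[OF A l]])
  have F: "smooth_Rn (2 * n) (cot_chart M U n x ` {a \<in> W. fst a \<in> U}) (h \<circ> inv_into (cot_dom M U) (cot_chart M U n x))"
    using W(2) ch(1) unfolding smooth_fun_cot by blast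
  have "smooth_near L l (\<lambda>l. (h \<circ> inv_into (cot_dom M U) (cot_chart M U n x)) (\<lambda>i. if i < 2 * n then ?c U n x i l else 0))"
  proof (rule smooth_near_compose[where f = "?c U n x", OF L l sc[OF l ch] F])
    show "(\<lambda>i. if i < 2 * n then ?c U n x i l else 0) \<in> cot_chart M U n x ` {a \<in> W. fst a \<in> U}"
      unfolding tup[symmetric] using W(1) ch(2) by auto
  qed
  moreover have "openin (space_top L) {q \<in> topspace (space_top L). A q \<in> U}"
    by (rule openin_continuous_map_preimage[OF cA chart_open[OF ch(1)]])
  ultimately show "smooth_near L l (\<lambda>l. h (A l, \<alpha> l))"
  proof (rule smooth_near_cong[OF charted_local[OF L], rotated -1])
    show "l \<in> {q \<in> topspace (space_top L). A q \<in> U}" using l ch(2) by (simp add: points_def)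
    fix q assume "q \<in> {q \<in> topspace (space_top L). A q \<in> U}"
    then have "(A q, \<alpha> q) \<in> cot_dom M U" using pL by (simp add: cot_dom_def points_def)
    then show "(h \<circ> inv_into (cot_dom M U) (cot_chart M U n x)) (\<lambda>i. if i < 2 * n then ?c U n x i q else 0) = h (A q, \<alpha> q)"
      unfolding tup[symmetric] using cot_chart_inv[OF M ch(1)] by simp
  qed
qed

section \<open>Left translations of the cosphere bundle\<close>

context lie
begin

abbreviation "T \<equiv> cotangent_bundle M"
abbreviation "Sl \<equiv> slit_cotangent_bundle M"
abbreviation "S \<equiv> cosphere_bundle M"

lemma points_T: "points T = cot_points M" by (rule topspace_cotangent_bundle[OF charted_M])

lemma left_lift_eq:
  "left_lift G h (g, \<alpha>) = (h \<otimes> g, \<lambda>v. if v \<in> tangent M (h \<otimes> g)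
     then \<alpha> (tmap M (\<lambda>x. inv h \<otimes> x) (h \<otimes> g) v) else 0)"
  by (simp add: left_lift_def)

lemma inv_cancel: "h \<in> carrier G \<Longrightarrow> g \<in> carrier G \<Longrightarrow> inv h \<otimes> (h \<otimes> g) = g"
  by (simp add: m_assoc[symmetric])

lemma left_back:
  assumes "h \<in> carrier G" "g \<in> carrier G" "v \<in> tangent M (h \<otimes> g)"
  shows "tmap M (\<lambda>x. inv h \<otimes> x) (h \<otimes> g) v \<in> tangent M g"
  using tmap_tangent[OF smooth_left[OF inv_closed[OF assms(1)]] assms(3)] assms by (simp add: inv_cancel)

lemma cot_pointsE:
  assumes "a \<in> cot_points M"
  obtains g \<alpha> where "a = (g, \<alpha>)" "g \<in> carrier G" "\<alpha> \<in> cotangent M g"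
  using assms points_mfd unfolding cot_points_def by blast

lemma left_lift_cot:
  assumes a: "a \<in> cot_points M" and h: "h \<in> carrier G"
  shows "left_lift G h a \<in> cot_points M"
proof -
  obtain g \<alpha> where ga: "a = (g, \<alpha>)" "g \<in> carrier G" "\<alpha> \<in> cotangent M g" by (rule cot_pointsE[OF a])
  have "snd (left_lift G h a) \<in> cotangent M (h \<otimes> g)"
    unfolding ga(1) left_lift_eq snd_conv cotangent_def
  proof (intro CollectI conjI ballI allI impI)
    fix v w :: "'g tvec" and c d :: real assume v: "v \<in> tangent M (h \<otimes> g)" "w \<in> tangent M (h \<otimes> g)"
    have "(\<lambda>f. c * v f + d * w f) \<in> tangent M (h \<otimes> g)" by (rule tangent_lincomb[OF charted_M v])
    then show "(if (\<lambda>f. c * v f + d * w f) \<in> tangent M (h \<otimes> g)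
        then \<alpha> (tmap M (\<lambda>x. inv h \<otimes> x) (h \<otimes> g) (\<lambda>f. c * v f + d * w f)) else 0) =
      c * (if v \<in> tangent M (h \<otimes> g) then \<alpha> (tmap M (\<lambda>x. inv h \<otimes> x) (h \<otimes> g) v) else 0) +
      d * (if w \<in> tangent M (h \<otimes> g) then \<alpha> (tmap M (\<lambda>x. inv h \<otimes> x) (h \<otimes> g) w) else 0)"
      using v cotangent_lincomb[OF ga(3) left_back[OF h ga(2) v(1)] left_back[OF h ga(2) v(2)], of c d]
      by (simp add: tmap_lincomb)
  qed simp
  then show ?thesis using ga h points_mfd by (simp add: cot_points_def left_lift_eq)
qed

lemma left_lift_inv:
  assumes a: "a \<in> cot_points M" and h: "h \<in> carrier G"
  shows "left_lift G h (left_lift G (inv h) a) = a"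
proof -
  obtain g \<alpha> where ga: "a = (g, \<alpha>)" "g \<in> carrier G" "\<alpha> \<in> cotangent M g" by (rule cot_pointsE[OF a])
  have hg: "h \<otimes> (inv h \<otimes> g) = g" using h ga by (simp add: m_assoc[symmetric])
  have "(if v \<in> tangent M g then
        (if tmap M (\<lambda>x. inv h \<otimes> x) g v \<in> tangent M (inv h \<otimes> g)
         then \<alpha> (tmap M (\<lambda>x. inv (inv h) \<otimes> x) (inv h \<otimes> g) (tmap M (\<lambda>x. inv h \<otimes> x) g v)) else 0) else 0) = \<alpha> v" for v
  proof (cases "v \<in> tangent M g")
    case True
    have "tmap M (\<lambda>x. inv h \<otimes> x) g v \<in> tangent M (inv h \<otimes> g)"
      by (rule tmap_tangent[OF smooth_left True]) (use h in simp)
    moreover have "tmap M (\<lambda>x. h \<otimes> x) (inv h \<otimes> g) (tmap M (\<lambda>x. inv h \<otimes> x) g v) = v"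
      using tmap_left_compose[OF True ga(2) inv_closed[OF h] h] h tmap_one_left[OF True] by simp
    ultimately show ?thesis using True h by simp
  next
    case False
    then show ?thesis using cotangent_outside[OF ga(3)] by simp
  qed
  then show ?thesis unfolding ga(1) left_lift_eq hg by simp
qed

lemma left_lift_one: "a \<in> cot_points M \<Longrightarrow> left_lift G \<one> a = a"
proof -
  assume a: "a \<in> cot_points M"
  obtain g \<alpha> where ga: "a = (g, \<alpha>)" "g \<in> carrier G" "\<alpha> \<in> cotangent M g" by (rule cot_pointsE[OF a])
  have "(if v \<in> tangent M g then \<alpha> (tmap M (\<lambda>x. \<one> \<otimes> x) g v) else 0) = \<alpha> v" for v
    using tmap_one_left[of v g] cotangent_outside[OF ga(3)] by auto
  then show ?thesis using ga by (simp add: left_lift_eq cong: if_cong)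
qed

text \<open>The chart \<open>x1\<close> is the left translate of \<open>x2\<close>. Translation
  matches their coordinate frames, so in the induced charts the lift has the identity as its
  coordinate expression.\<close>

lemma left_lift_chart:
  assumes h: "h \<in> carrier G" and ch1: "chart M U1 n x1" and ch2: "chart M U2 n x2"
    and U: "\<And>p. p \<in> carrier G \<Longrightarrow> p \<in> U1 \<longleftrightarrow> h \<otimes> p \<in> U2" and x: "\<And>p. p \<in> U1 \<Longrightarrow> x1 p = x2 (h \<otimes> p)"
    and a: "a \<in> cot_points M" "fst a \<in> U1"
  shows "cot_chart M U2 n x2 (left_lift G h a) = cot_chart M U1 n x1 a"
proof -
  obtain g \<alpha> where ga: "a = (g, \<alpha>)" "g \<in> carrier G" "\<alpha> \<in> cotangent M g" by (rule cot_pointsE[OF a(1)])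
  have g1: "g \<in> U1" and g2: "h \<otimes> g \<in> U2" using a ga U by auto
  have U2c: "U2 \<subseteq> carrier G" using chart_subset[OF ch2] points_mfd by simp
  have key: "tmap M (\<lambda>x. inv h \<otimes> x) (h \<otimes> g) (coord_vec M U2 x2 j (h \<otimes> g)) = coord_vec M U1 x1 j g" if j: "j < n" for j
  proof (rule tangent_eqI[OF charted_M ch1 g1 left_back[OF h ga(2) coord_vec_tangent[OF charted_M ch2 g2 j]]
        coord_vec_tangent[OF charted_M ch1 g1 j]])
    fix i assume "i < n"
    have near: "smooth_near M (inv h \<otimes> (h \<otimes> g)) (\<lambda>q. x1 q i)"
      unfolding inv_cancel[OF h ga(2)] by (rule smooth_near_coord[OF ch1 g1 local_M])
    have "tmap M (\<lambda>x. inv h \<otimes> x) (h \<otimes> g) (coord_vec M U2 x2 j (h \<otimes> g)) (\<lambda>q. x1 q i)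
        = coord_vec M U2 x2 j (h \<otimes> g) (\<lambda>q. x1 (inv h \<otimes> q) i)" by (rule tmap_apply) (rule near)
    also have "\<dots> = coord_vec M U2 x2 j (h \<otimes> g) (\<lambda>q. x2 q i)"
    proof (rule tangent_near_cong[OF local_M coord_vec_tangent[OF charted_M ch2 g2 j] chart_open[OF ch2] g2])
      fix q assume q: "q \<in> U2"
      then have qc: "q \<in> carrier G" using U2c by blast
      have e: "h \<otimes> (inv h \<otimes> q) = q" using h qc by (simp add: m_assoc[symmetric])
      have "inv h \<otimes> q \<in> U1" using U[of "inv h \<otimes> q"] h qc q e by simp
      then show "x1 (inv h \<otimes> q) i = x2 q i" using x e by simp
    qed
    also have "\<dots> = (if j = i then 1 else 0)" by (rule coord_vec_coord[OF local_M ch2 g2 j])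
    also have "\<dots> = coord_vec M U1 x1 j g (\<lambda>q. x1 q i)" by (rule coord_vec_coord[OF local_M ch1 g1 j, symmetric])
    finally show "tmap M (\<lambda>x. inv h \<otimes> x) (h \<otimes> g) (coord_vec M U2 x2 j (h \<otimes> g)) (\<lambda>q. x1 q i)
        = coord_vec M U1 x1 j g (\<lambda>q. x1 q i)" .
  qed
  have "cot_chart M U2 n x2 (left_lift G h a) i = cot_chart M U1 n x1 a i" for i
  proof -
    have "(if coord_vec M U2 x2 (i - n) (h \<otimes> g) \<in> tangent M (h \<otimes> g)
        then \<alpha> (tmap M (\<lambda>x. inv h \<otimes> x) (h \<otimes> g) (coord_vec M U2 x2 (i - n) (h \<otimes> g))) else 0)
        = \<alpha> (coord_vec M U1 x1 (i - n) g)" if "\<not> i < n" "i < 2 * n"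
      using coord_vec_tangent[OF charted_M ch2 g2, of "i - n"] key[of "i - n"] that by simp
    then show ?thesis using x[OF g1] by (simp add: ga(1) left_lift_eq cot_chart_def)
  qed
  then show ?thesis by (intro ext)
qed

lemma left_translate_chart:
  assumes h: "h \<in> carrier G" and ch: "chart M U n x"
  shows "chart M {p \<in> carrier G. h \<otimes> p \<in> U} n (\<lambda>p. x (h \<otimes> p))"
  using chart_pullback[OF local_M local_M smooth_left[OF h] smooth_left[OF inv_closed[OF h]] _ _ ch] h
  by (simp add: points_mfd m_assoc[symmetric])

text \<open>Each chart is compared with its own left translate, in which the lift leaves the
  coordinates unchanged. No change of coordinates between unrelated induced charts occurs.\<close>

lemma left_lift_smooth:
  assumes h: "h \<in> carrier G"
  shows "smooth_map T T (left_lift G h)"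
  unfolding smooth_map_def
proof (intro conjI allI impI)
  have hi: "inv h \<in> carrier G" using h by simp
  have fst_lift: "fst (left_lift G h a) = h \<otimes> fst a" for a by (cases a) (simp add: left_lift_eq)
  show cont: "continuous_map (space_top T) (space_top T) (left_lift G h)"
    unfolding continuous_map_into_cot
  proof (intro conjI allI impI; (elim conjE)?)
    show "left_lift G h ` topspace (space_top T) \<subseteq> points T"
      using left_lift_cot[OF _ h] points_T by (auto simp: points_def)
    fix U n x V assume ch: "chart M U n x" and V: "openin (Euclidean_space (2 * n)) V"
    let ?U = "{p \<in> carrier G. h \<otimes> p \<in> U}" and ?x = "\<lambda>p. x (h \<otimes> p)"
    have ch': "chart M ?U n ?x" by (rule left_translate_chart[OF h ch])
    have "a \<in> left_lift G h -` {a \<in> cot_points M. fst a \<in> U \<and> cot_chart M U n x a \<in> V} \<inter> topspace (space_top T) \<longleftrightarrow>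
        a \<in> {a \<in> cot_points M. fst a \<in> ?U \<and> cot_chart M ?U n ?x a \<in> V}" for a
    proof (cases "a \<in> cot_points M \<and> fst a \<in> ?U")
      case True
      have "cot_chart M U n x (left_lift G h a) = cot_chart M ?U n ?x a"
        by (rule left_lift_chart[OF h ch' ch]) (use True in simp_all)
      then show ?thesis using True left_lift_cot[OF _ h] points_T fst_lift by (simp add: points_def)
    next
      case False
      then show ?thesis using points_T fst_lift by (auto simp: points_def elim!: cot_pointsE)
    qed
    then have "left_lift G h -` {a \<in> cot_points M. fst a \<in> U \<and> cot_chart M U n x a \<in> V} \<inter> topspace (space_top T)
        = {a \<in> cot_points M. fst a \<in> ?U \<and> cot_chart M ?U n ?x a \<in> V}" by blast
    then show "openin (space_top T) (left_lift G h -` {a \<in> cot_points M. fst a \<in> U \<and> cot_chart M U n x a \<in> V} \<inter> topspace (space_top T))"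
      using openin_cot_basic[OF ch' V] by simp
  qed
  fix W f assume f: "smooth_fun T W f"
  then have W: "openin (space_top T) W" using smooth_fun_cot by blast
  have Wc: "W \<subseteq> cot_points M" using openin_subset[OF W] points_T by (simp add: points_def)
  let ?W = "{a \<in> points T. left_lift G h a \<in> W}"
  show "smooth_fun T ?W (f \<circ> left_lift G h)"
    unfolding smooth_fun_cot
  proof (intro conjI allI impI)
    show "openin (space_top T) ?W" using openin_continuous_map_preimage[OF cont W] unfolding points_def .
    fix U n x assume ch: "chart M U n x"
    let ?U = "{p \<in> carrier G. inv h \<otimes> p \<in> U}" and ?x = "\<lambda>p. x (inv h \<otimes> p)"
    have ch': "chart M ?U n ?x" by (rule left_translate_chart[OF hi ch])
    have Uc: "U \<subseteq> carrier G" using chart_subset[OF ch] points_mfd by simp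
    have cc: "cot_chart M ?U n ?x (left_lift G h a) = cot_chart M U n x a" if "a \<in> cot_points M" "fst a \<in> U" for a
      by (rule left_lift_chart[OF h ch ch' _ _ that]) (use h Uc in \<open>auto simp: inv_cancel\<close>)
    have in_dom: "left_lift G h a \<in> cot_dom M ?U" if "a \<in> cot_points M" "fst a \<in> U" for a
      using left_lift_cot[OF that(1) h] that h Uc fst_lift by (auto simp: cot_dom_def inv_cancel)
    have s: "smooth_Rn (2 * n) (cot_chart M ?U n ?x ` {a \<in> W. fst a \<in> ?U}) (f \<circ> inv_into (cot_dom M ?U) (cot_chart M ?U n ?x))"
      using f ch' unfolding smooth_fun_cot by blast
    have im: "cot_chart M ?U n ?x ` {a \<in> W. fst a \<in> ?U} = cot_chart M U n x ` {a \<in> ?W. fst a \<in> U}"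
    proof
      show "cot_chart M U n x ` {a \<in> ?W. fst a \<in> U} \<subseteq> cot_chart M ?U n ?x ` {a \<in> W. fst a \<in> ?U}"
      proof
        fix z assume "z \<in> cot_chart M U n x ` {a \<in> ?W. fst a \<in> U}"
        then obtain a where a: "a \<in> cot_points M" "left_lift G h a \<in> W" "fst a \<in> U" "z = cot_chart M U n x a"
          using points_T by blast
        have "z = cot_chart M ?U n ?x (left_lift G h a)" using cc[OF a(1,3)] a(4) by simp
        moreover have "left_lift G h a \<in> {a \<in> W. fst a \<in> ?U}" using a(2) in_dom[OF a(1,3)] by (simp add: cot_dom_def)
        ultimately show "z \<in> cot_chart M ?U n ?x ` {a \<in> W. fst a \<in> ?U}" by blast
      qed
      show "cot_chart M ?U n ?x ` {a \<in> W. fst a \<in> ?U} \<subseteq> cot_chart M U n x ` {a \<in> ?W. fst a \<in> U}"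
      proof
        fix z assume "z \<in> cot_chart M ?U n ?x ` {a \<in> W. fst a \<in> ?U}"
        then obtain b where b: "b \<in> W" "fst b \<in> ?U" "z = cot_chart M ?U n ?x b" by blast
        have bc: "b \<in> cot_points M" using b Wc by blast
        define a where "a = left_lift G (inv h) b"
        have a: "a \<in> cot_points M" "left_lift G h a = b"
          unfolding a_def using left_lift_cot[OF bc hi] left_lift_inv[OF bc h] by simp_all
        have aU: "fst a \<in> U" using b(2) unfolding a_def by (cases b) (simp add: left_lift_eq)
        have "z = cot_chart M U n x a" using cc[OF a(1) aU] a(2) b(3) by simp
        moreover have "a \<in> {a \<in> ?W. fst a \<in> U}" using a(1) aU b(1) points_T by (simp add: a(2))
        ultimately show "z \<in> cot_chart M U n x ` {a \<in> ?W. fst a \<in> U}" by (rule image_eqI)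
      qed
    qed
    have eq: "(f \<circ> left_lift G h \<circ> inv_into (cot_dom M U) (cot_chart M U n x)) z
        = (f \<circ> inv_into (cot_dom M ?U) (cot_chart M ?U n ?x)) z" if z: "z \<in> cot_chart M U n x ` {a \<in> ?W. fst a \<in> U}" for z
    proof -
      obtain a where aW: "z = cot_chart M U n x a" "a \<in> {a \<in> ?W. fst a \<in> U}"
        by (rule imageE[OF z])
      then have a: "a \<in> cot_points M" "fst a \<in> U" "z = cot_chart M U n x a" by (simp_all add: points_T)
      have "inv_into (cot_dom M U) (cot_chart M U n x) z = a"
        unfolding a(3) by (rule cot_chart_inv[OF charted_M ch]) (use a in \<open>simp add: cot_dom_def\<close>)
      moreover have "inv_into (cot_dom M ?U) (cot_chart M ?U n ?x) z = left_lift G h a"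
        unfolding a(3) cc[OF a(1,2), symmetric] by (rule cot_chart_inv[OF charted_M ch' in_dom[OF a(1,2)]])
      ultimately show ?thesis by simp
    qed
    show "smooth_Rn (2 * n) (cot_chart M U n x ` {a \<in> ?W. fst a \<in> U})
        (f \<circ> left_lift G h \<circ> inv_into (cot_dom M U) (cot_chart M U n x))"
      by (subst smooth_Rn_cong[OF eq], assumption) (unfold im[symmetric], rule s)
  qed
qed

section \<open>The cosphere bundle and its projection\<close>

lemma points_Sl: "points Sl = {a \<in> cot_points M. snd a \<noteq> (\<lambda>_. 0)}"
  unfolding slit_cotangent_bundle_def points_sub_space points_T by blast

lemma points_S: "points S = cot_ray ` points Sl"
  unfolding cosphere_bundle_def points_quot_space ..

lemma left_lift_zero: "snd a = (\<lambda>_. 0) \<Longrightarrow> snd (left_lift G h a) = (\<lambda>_. 0)"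
  by (cases a) (simp add: left_lift_eq)

lemma left_lift_Sl:
  assumes "a \<in> points Sl" "h \<in> carrier G"
  shows "left_lift G h a \<in> points Sl"
proof -
  have a: "a \<in> cot_points M" "snd a \<noteq> (\<lambda>_. 0)" using assms(1) by (simp_all add: points_Sl)
  have "left_lift G (inv h) (left_lift G h a) = a"
    using left_lift_inv[OF a(1) inv_closed[OF assms(2)]] assms(2) by simp
  then have "snd (left_lift G h a) \<noteq> (\<lambda>_. 0)" using left_lift_zero[of "left_lift G h a" "inv h"] a(2) by auto
  then show ?thesis using left_lift_cot[OF a(1) assms(2)] by (simp add: points_Sl)
qed

lemma left_lift_smooth_Sl: "h \<in> carrier G \<Longrightarrow> smooth_map Sl Sl (left_lift G h)"
  unfolding slit_cotangent_bundle_def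
  using left_lift_Sl[of _ h] points_Sl points_T by (intro smooth_map_sub_sub[OF left_lift_smooth]) auto

lemma smooth_cot_ray: "smooth_map Sl S cot_ray"
  unfolding cosphere_bundle_def by (rule smooth_map_quot)

lemma open_S: "open_domains S"
  unfolding cosphere_bundle_def by (rule open_domains_quot)

lemma Sl_incl: "smooth_map Sl T (\<lambda>a. a)"
  unfolding slit_cotangent_bundle_def by (rule smooth_map_sub_incl[OF open_domains_cot])

lemma ray_image: "ray \<nu> = (\<lambda>r v. r * \<nu> v) ` {0<..}"
  unfolding ray_def by auto

lemma cosphere_act_ray: "cosphere_act G h (cot_ray a) = cot_ray (left_lift G h a)"
proof -
  obtain g \<alpha> where a: "a = (g, \<alpha>)" by (cases a)
  have "left_lift G h (g, \<lambda>v. r * \<alpha> v) = (h \<otimes> g, \<lambda>v. r * snd (left_lift G h (g, \<alpha>)) v)" for r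
    by (auto simp: left_lift_eq)
  then show ?thesis
    unfolding cosphere_act_def cot_ray_def a ray_image by (simp add: image_image left_lift_eq)
qed

lemma cosphere_act_smooth: "h \<in> carrier G \<Longrightarrow> smooth_map S S (cosphere_act G h)"
  unfolding cosphere_bundle_def
  using smooth_map_compose[OF left_lift_smooth_Sl smooth_cot_ray, of h] open_S
  by (intro smooth_map_from_quot) (simp_all add: cosphere_act_ray cosphere_bundle_def)

text \<open>All covectors of a class have the same base point, so the choice is immaterial.\<close>

definition base :: "'g cosphere \<Rightarrow> 'g" where "base x = fst (SOME a. a \<in> x)"

lemma cot_ray_self: "a \<in> cot_ray a"
  unfolding cot_ray_def ray_image by (cases a) (auto intro!: image_eqI[of _ _ 1])

lemma base_cot_ray: "base (cot_ray a) = fst a"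
proof -
  have "(SOME b. b \<in> cot_ray a) \<in> cot_ray a" using cot_ray_self by (rule someI)
  then show ?thesis unfolding base_def cot_ray_def by auto
qed

lemma smooth_fst_T: "smooth_map T M fst" by (rule smooth_map_cot_fst[OF charted_M])

lemma smooth_fst_Sl: "smooth_map Sl M fst"
  using smooth_map_compose[OF Sl_incl smooth_fst_T] by simp

lemma smooth_base: "smooth_map S M base"
  unfolding cosphere_bundle_def
  by (rule smooth_map_from_quot[OF _ open_M]) (simp add: base_cot_ray smooth_fst_Sl)

lemma cot_ray_scale:
  assumes "r > 0"
  shows "cot_ray (g, \<lambda>v. r * \<alpha> v) = cot_ray (g, \<alpha>)"
proof -
  have "ray (\<lambda>v. r * \<alpha> v) = ray \<alpha>"
  proof
    show "ray (\<lambda>v. r * \<alpha> v) \<subseteq> ray \<alpha>"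
    proof
      fix b assume "b \<in> ray (\<lambda>v. r * \<alpha> v)"
      then obtain s where "s > 0" "b = (\<lambda>v. s * (r * \<alpha> v))" unfolding ray_def by blast
      then have "s * r > 0" "b = (\<lambda>v. (s * r) * \<alpha> v)" using assms by (simp_all add: mult.assoc)
      then show "b \<in> ray \<alpha>" unfolding ray_def by blast
    qed
    show "ray \<alpha> \<subseteq> ray (\<lambda>v. r * \<alpha> v)"
    proof
      fix b assume "b \<in> ray \<alpha>"
      then obtain s where "s > 0" "b = (\<lambda>v. s * \<alpha> v)" unfolding ray_def by blast
      then have "s / r > 0" "b = (\<lambda>v. (s / r) * (r * \<alpha> v))" using assms by simp_all
      then show "b \<in> ray (\<lambda>v. r * \<alpha> v)" unfolding ray_def by blast
    qed
  qed
  then show ?thesis by (simp add: cot_ray_def)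
qed

lemma cot_ray_eqD:
  assumes "b \<in> cot_ray a"
  obtains r where "r > 0" "b = (fst a, \<lambda>v. r * snd a v)"
  using assms unfolding cot_ray_def ray_def by blast

lemma nonzero_pairing:
  assumes "\<alpha> \<in> cotangent M g" "\<alpha> \<noteq> (\<lambda>_. 0)"
  obtains u where "u \<in> tangent M g" "\<alpha> u \<noteq> 0"
  using assms cotangent_outside by (metis (no_types, lifting) ext)

section \<open>Invariant covector fields as sections\<close>

lemma rcov_smooth_map:
  assumes "\<nu> \<in> dual_lie_algebra G"
  shows "smooth_map M T (\<lambda>g. (g, rcov \<nu> g))"
  by (rule cot_map_smooth[OF charted_M charted_M smooth_map_ident[OF open_M]])
    (use rcov_cotangent[OF assms] rcov_smooth[OF assms] points_mfd in auto)

lemma rcov_nonzero: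
  assumes \<nu>: "\<nu> \<in> dual_lie_algebra G" "\<nu> \<noteq> (\<lambda>_. 0)" and g: "g \<in> carrier G"
  shows "rcov \<nu> g \<noteq> (\<lambda>_. 0)"
proof -
  obtain \<xi> where "\<xi> \<in> lie_algebra G" "\<nu> \<xi> \<noteq> 0"
    using nonzero_pairing[of \<nu> \<one>] \<nu> unfolding dual_lie_algebra_def lie_algebra_def by blast
  then show ?thesis using rcov_Rv[of \<xi> g \<nu>] g by (metis (no_types))
qed

lemma rcov_Sl: "\<nu> \<in> dual_lie_algebra G \<Longrightarrow> \<nu> \<noteq> (\<lambda>_. 0) \<Longrightarrow> g \<in> carrier G \<Longrightarrow> (g, rcov \<nu> g) \<in> points Sl"
  using rcov_nonzero rcov_cotangent points_mfd by (simp add: points_Sl cot_points_def)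

lemma rcov_smooth_Sl:
  assumes "\<nu> \<in> dual_lie_algebra G" "\<nu> \<noteq> (\<lambda>_. 0)"
  shows "smooth_map M Sl (\<lambda>g. (g, rcov \<nu> g))"
  unfolding slit_cotangent_bundle_def
  by (rule smooth_map_into_sub[OF local_M rcov_smooth_map[OF assms(1)]])
    (use rcov_nonzero[OF assms] points_mfd in simp)

text \<open>The trivialisation of the cotangent bundle by right translations: a covector is carried
  back to the identity by pairing it with right-invariant fields.\<close>

lemma rcov_surj:
  assumes \<alpha>: "\<alpha> \<in> cotangent M g" and g: "g \<in> carrier G"
  obtains \<nu> where "\<nu> \<in> dual_lie_algebra G" "rcov \<nu> g = \<alpha>"
proof -
  define \<nu> where "\<nu> = (\<lambda>\<xi>. if \<xi> \<in> lie_algebra G then \<alpha> (Rv \<xi> g) else 0)"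
  have "\<nu> \<in> dual_lie_algebra G"
    unfolding dual_lie_algebra_def cotangent_def
  proof (intro CollectI conjI ballI allI impI)
    fix v w a b assume v: "v \<in> tangent M \<one>" "w \<in> tangent M \<one>"
    then have vw: "(\<lambda>f. a * v f + b * w f) \<in> tangent M \<one>" by (rule tangent_lincomb[OF charted_M])
    have "Rv (\<lambda>f. a * v f + b * w f) g = (\<lambda>f. a * Rv v g f + b * Rv w g f)"
      unfolding Rv_def by (rule tmap_lincomb)
    then show "\<nu> (\<lambda>f. a * v f + b * w f) = a * \<nu> v + b * \<nu> w"
      using v vw g cotangent_lincomb[OF \<alpha> Rv_tangent Rv_tangent, of v w a b] by (simp add: \<nu>_def lie_algebra_def)
  qed (simp add: \<nu>_def lie_algebra_def)
  moreover have "rcov \<nu> g = \<alpha>"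
  proof
    fix v show "rcov \<nu> g v = \<alpha> v"
    proof (cases "v \<in> tangent M g")
      case True
      then show ?thesis using right_back_tangent[OF True] by (simp add: rcov_apply \<nu>_def Rv_right_back)
    next
      case False
      then show ?thesis using cotangent_outside[OF \<alpha>] by (simp add: rcov_def right_cov_def)
    qed
  qed
  ultimately show thesis by (rule that)
qed

text \<open>The left-invariant covector field with value \<alpha> at \<open>g\<close>: left
  multiplication by \<open>g \<otimes> inv k\<close> moves \<open>k\<close> to
  \<open>g\<close>.\<close>

definition lcov :: "'g \<Rightarrow> 'g covec \<Rightarrow> 'g \<Rightarrow> 'g covec" where
  "lcov g \<alpha> k = (\<lambda>v. if v \<in> tangent M k then \<alpha> (tmap M (\<lambda>x. (g \<otimes> inv k) \<otimes> x) k v) else 0)"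

lemma left_lift_lcov:
  assumes "g \<in> carrier G" "h \<in> carrier G"
  shows "left_lift G h (g, \<alpha>) = (h \<otimes> g, lcov g \<alpha> (h \<otimes> g))"
proof -
  have "g \<otimes> inv (h \<otimes> g) = inv h" using assms by (simp add: inv_mult_group m_assoc[symmetric])
  then show ?thesis by (simp add: left_lift_eq lcov_def cong: if_cong)
qed

lemma lcov_smooth_map:
  assumes \<alpha>: "\<alpha> \<in> cotangent M g" and g: "g \<in> carrier G"
  shows "smooth_map M T (\<lambda>k. (k, lcov g \<alpha> k))"
proof -
  have move: "tmap M (\<lambda>x. (g \<otimes> inv k) \<otimes> x) k v \<in> tangent M g" if "v \<in> tangent M k" for v k
  proof -
    have k: "k \<in> carrier G" using tangent_points[OF that] points_mfd by simp
    show ?thesis using tmap_tangent[OF smooth_left[of "g \<otimes> inv k"] that] g k by (simp add: m_assoc)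
  qed
  have co: "lcov g \<alpha> k \<in> cotangent M k" if "k \<in> carrier G" for k
    unfolding cotangent_def
  proof (intro CollectI conjI ballI allI impI)
    fix v w a b assume v: "v \<in> tangent M k" "w \<in> tangent M k"
    then have "(\<lambda>f. a * v f + b * w f) \<in> tangent M k" by (rule tangent_lincomb[OF charted_M])
    then show "lcov g \<alpha> k (\<lambda>f. a * v f + b * w f) = a * lcov g \<alpha> k v + b * lcov g \<alpha> k w"
      using v cotangent_lincomb[OF \<alpha> move move, of v k w k a b] by (simp add: lcov_def tmap_lincomb)
  qed (simp add: lcov_def)
  have const: "lcov g \<alpha> k (Lv \<xi> k) = \<alpha> (Lv \<xi> g)" if \<xi>: "\<xi> \<in> lie_algebra G" and k: "k \<in> carrier G" for \<xi> k
  proof -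
    have "tmap M (\<lambda>x. (g \<otimes> inv k) \<otimes> x) k (Lv \<xi> k) = Lv \<xi> g"
      using tmap_left_compose[of \<xi> \<one> k "g \<otimes> inv k"] \<xi> g k by (simp add: Lv_def lie_algebra_def m_assoc)
    then show ?thesis using Lv_tangent[OF \<xi> k] by (simp add: lcov_def)
  qed
  show ?thesis
  proof (rule cot_map_smooth[OF charted_M charted_M smooth_map_ident[OF open_M]])
    show "lcov g \<alpha> k \<in> cotangent M k" if "k \<in> points M" for k using co that points_mfd by simp
    fix k U n x i assume k: "k \<in> points M" and ch: "chart M U n x" "k \<in> U" and i: "i < n"
    have kc: "k \<in> carrier G" using k points_mfd by simp
    show "smooth_near M k (\<lambda>l. lcov g \<alpha> l (coord_vec M U x i l))"
    proof (rule covector_smooth_of_Lv[OF co _ ch i])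
      fix \<xi> assume \<xi>: "\<xi> \<in> lie_algebra G"
      have "smooth_near M k (\<lambda>l. \<alpha> (Lv \<xi> g))" by (rule smooth_near_const[OF charted_M k])
      then show "smooth_near M k (\<lambda>l. lcov g \<alpha> l (Lv \<xi> l))"
        by (rule smooth_near_cong[OF local_M openin_carrier kc, rotated]) (simp add: const[OF \<xi>])
    qed
  qed
qed

text \<open>The orbit map is the left-invariant covector field through \<open>a\<close>, evaluated
  at \<open>h \<otimes> g\<close>. Its smoothness makes \<open>cosphere_generator\<close>, which
  differentiates this map after passage to classes, a genuine tangent vector.\<close>

lemma left_lift_orbit_smooth:
  assumes a: "a \<in> points Sl"
  shows "smooth_map M Sl (\<lambda>h. left_lift G h a)"
proof -
  have ac: "a \<in> cot_points M" using a by (simp add: points_Sl)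
  obtain g \<alpha> where ga: "a = (g, \<alpha>)" "g \<in> carrier G" "\<alpha> \<in> cotangent M g" by (rule cot_pointsE[OF ac])
  have "smooth_map M T (\<lambda>h. (h \<otimes> g, lcov g \<alpha> (h \<otimes> g)))"
    using smooth_map_compose[OF smooth_right[OF ga(2)] lcov_smooth_map[OF ga(3,2)]] .
  then have "smooth_map M T (\<lambda>h. left_lift G h a)"
    by (rule smooth_map_eq[OF local_M open_domains_cot]) (simp add: ga left_lift_lcov points_mfd)
  then show ?thesis
    unfolding slit_cotangent_bundle_def
    by (rule smooth_map_into_sub[OF local_M]) (use left_lift_Sl[OF a] points_mfd points_Sl in simp)
qed

lemma cosphere_orbit_smooth:
  assumes x: "x \<in> points S"
  shows "smooth_map M S (\<lambda>h. cosphere_act G h x)"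
proof -
  obtain a where a: "a \<in> points Sl" "x = cot_ray a" using x points_S by blast
  show ?thesis
    unfolding a(2) cosphere_act_ray by (rule smooth_map_compose[OF left_lift_orbit_smooth[OF a(1)] smooth_cot_ray])
qed

section \<open>The coadjoint action in right trivialisation\<close>

lemma Ad_star_compose:
  assumes "g \<in> carrier G" "h \<in> carrier G"
  shows "Ad_star G g (Ad_star G h \<mu>) = Ad_star G (h \<otimes> g) \<mu>"
  using assms by (auto simp: Ad_star_def fun_eq_iff Ad_closed Ad_mult)

lemma Ad_star_scale: "Ad_star G g (\<lambda>\<zeta>. r * \<mu> \<zeta>) = (\<lambda>\<zeta>. r * Ad_star G g \<mu> \<zeta>)"
  by (auto simp: Ad_star_def)

lemma rcov_scale: "rcov (\<lambda>\<zeta>. r * \<nu> \<zeta>) g = (\<lambda>v. r * rcov \<nu> g v)"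
  by (auto simp: rcov_def right_cov_def)

text \<open>Multiplication by \<open>inv k\<close> on the left and \<open>inv g\<close> on the right
  is right translation by \<open>inv (k \<otimes> g)\<close> followed by conjugation with
  \<open>inv k\<close>. Left translation therefore acts on right-trivialised covectors through the
  coadjoint action.\<close>

lemma left_lift_rcov:
  assumes k: "k \<in> carrier G" and g: "g \<in> carrier G"
  shows "left_lift G k (g, rcov \<mu> g) = (k \<otimes> g, rcov (Ad_star G (inv k) \<mu>) (k \<otimes> g))"
proof -
  have "rcov \<mu> g (tmap M (\<lambda>x. inv k \<otimes> x) (k \<otimes> g) v) = rcov (Ad_star G (inv k) \<mu>) (k \<otimes> g) v"
    if v: "v \<in> tangent M (k \<otimes> g)" for v
  proof -
    have kg: "k \<otimes> g \<in> points M" using k g points_mfd by simp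
    have "tmap M (\<lambda>x. x \<otimes> inv g) (inv k \<otimes> (k \<otimes> g)) (tmap M (\<lambda>x. inv k \<otimes> x) (k \<otimes> g) v)
        = tmap M (\<lambda>x. inv k \<otimes> x \<otimes> inv g) (k \<otimes> g) v"
      by (rule tmap_compose[OF smooth_left smooth_right kg]) (use k g in simp_all)
    also have "\<dots> = tmap M (\<lambda>x. inv k \<otimes> (x \<otimes> inv (k \<otimes> g)) \<otimes> inv (inv k)) (k \<otimes> g) v"
      by (rule tmap_cong_carrier[OF v]) (use k g in \<open>simp add: m_assoc inv_mult_group\<close>)
    also have "\<dots> = tmap M (\<lambda>x. inv k \<otimes> x \<otimes> inv (inv k)) (k \<otimes> g \<otimes> inv (k \<otimes> g)) (tmap M (\<lambda>x. x \<otimes> inv (k \<otimes> g)) (k \<otimes> g) v)"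
      by (rule tmap_compose[OF smooth_right smooth_conj kg, symmetric]) (use k g in simp_all)
    also have "\<dots> = Ad G (inv k) (tmap M (\<lambda>x. x \<otimes> inv (k \<otimes> g)) (k \<otimes> g) v)"
      using k g by (simp add: Ad_def)
    finally show ?thesis
      using v right_back_tangent[OF v] left_back[OF k g v] k g by (simp add: rcov_apply Ad_star_def inv_cancel)
  qed
  then show ?thesis
    by (auto simp: left_lift_eq rcov_def right_cov_def fun_eq_iff)
qed

end

section \<open>The momentum map\<close>

locale lie_section = lie G for G :: "'g lie_grp" (structure) +
  fixes \<sigma> :: "'g cosphere \<Rightarrow> 'g \<times> 'g covec"
  assumes invariant: "invariant_section G \<sigma>"
begin

section \<open>The section and its conformal factor\<close>

lemma sigma_smooth: "smooth_map S Sl \<sigma>"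
  using invariant unfolding invariant_section_def global_section_def by blast

lemma sigma_ray: "x \<in> points S \<Longrightarrow> cot_ray (\<sigma> x) = x"
  using invariant unfolding invariant_section_def global_section_def by blast

lemma ray_in_S: "a \<in> points Sl \<Longrightarrow> cot_ray a \<in> points S"
  using points_S by blast

lemma sigma_factor:
  assumes a: "a \<in> points Sl"
  obtains c where "c > 0" "\<sigma> (cot_ray a) = (fst a, \<lambda>v. c * snd a v)"
proof -
  have "\<sigma> (cot_ray a) \<in> cot_ray a"
    using cot_ray_self[of "\<sigma> (cot_ray a)"] sigma_ray[OF ray_in_S[OF a]] by simp
  then show thesis by (rule cot_ray_eqD) (rule that; assumption)
qed

lemma sigma_base: "x \<in> points S \<Longrightarrow> fst (\<sigma> x) = base x"
  using base_cot_ray[of "\<sigma> x"] sigma_ray[of x] by simp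

lemma sigma_smooth_T: "smooth_map S T \<sigma>"
  using smooth_map_compose[OF sigma_smooth Sl_incl] by simp

text \<open>The Liouville form pairs the covector \<sigma>(x) with the projected vector, and
  \<sigma> covers the projection \<open>base\<close>.\<close>

lemma theta_eq:
  assumes x: "x \<in> points S" and v: "v \<in> tangent S x"
  shows "theta_form M \<sigma> x v = snd (\<sigma> x) (tmap M base x v)"
proof -
  have sx: "\<sigma> x \<in> cot_points M" using smooth_map_in[OF sigma_smooth_T x] points_T by simp
  have tv: "tmap T \<sigma> x v \<in> tangent T (\<sigma> x)" by (rule tmap_tangent[OF sigma_smooth_T v])
  \<comment> \<open>The base point of \<sigma>(y) is known to be \<open>base y\<close> only for
    points \<open>y\<close> of the bundle, so the two maps are compared along a curve representing
    \<open>v\<close>.\<close>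
  obtain c where c: "smooth_map real_space S c" "c 0 = x" "v = velocity S c 0" by (rule tangentE[OF v])
  have cS: "c s \<in> points S" for s by (rule smooth_map_in[OF c(1)]) simp
  have "tmap M fst (\<sigma> x) (tmap T \<sigma> x v) = tmap M (\<lambda>y. fst (\<sigma> y)) x v"
    by (rule tmap_compose[OF sigma_smooth_T smooth_fst_T x])
  also have "\<dots> = velocity M (\<lambda>s. fst (\<sigma> (c s))) 0"
    unfolding c(3) by (rule tmap_velocity[where c = c and t = 0, OF smooth_map_compose[OF sigma_smooth_T smooth_fst_T] cS c(2)])
  also have "(\<lambda>s. fst (\<sigma> (c s))) = (\<lambda>s. base (c s))" using sigma_base[OF cS] by simp
  also have "velocity M (\<lambda>s. base (c s)) 0 = tmap M base x v"
    unfolding c(3) by (rule tmap_velocity[where c = c and t = 0, OF smooth_base cS c(2), symmetric])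
  finally show ?thesis
    using x v sx tv by (simp add: theta_form_def pull_form_def liouville_def)
qed

lemma theta_cot_ray:
  assumes a: "a \<in> points Sl" and v: "v \<in> tangent Sl a"
  shows "theta_form M \<sigma> (cot_ray a) (tmap S cot_ray a v) = snd (\<sigma> (cot_ray a)) (tmap M fst a v)"
  using theta_eq[OF ray_in_S[OF a] tmap_tangent[OF smooth_cot_ray v]] tmap_compose[OF smooth_cot_ray smooth_base a, of v]
  by (simp add: base_cot_ray)

lemma liouville_Sl:
  assumes a: "a \<in> points Sl" and v: "v \<in> tangent Sl a"
  shows "liouville M a (tmap T (\<lambda>b. b) a v) = snd a (tmap M fst a v)"
proof -
  have "a \<in> cot_points M" using a points_Sl by blast
  moreover have "tmap T (\<lambda>b. b) a v \<in> tangent T a" using tmap_tangent[OF Sl_incl v] .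
  moreover have "tmap M fst a (tmap T (\<lambda>b. b) a v) = tmap M fst a v"
    using tmap_compose[OF Sl_incl smooth_fst_T a, of v] by simp
  ultimately show ?thesis by (simp add: liouville_def)
qed

lemma lift_tangent:
  assumes \<nu>: "\<nu> \<in> dual_lie_algebra G" "\<nu> \<noteq> (\<lambda>_. 0)" and u: "u \<in> tangent M g"
  shows "tmap Sl (\<lambda>g. (g, rcov \<nu> g)) g u \<in> tangent Sl (g, rcov \<nu> g)"
    and "tmap M fst (g, rcov \<nu> g) (tmap Sl (\<lambda>g. (g, rcov \<nu> g)) g u) = u"
proof -
  have s: "smooth_map M Sl (\<lambda>g. (g, rcov \<nu> g))" by (rule rcov_smooth_Sl[OF \<nu>])
  show "tmap Sl (\<lambda>g. (g, rcov \<nu> g)) g u \<in> tangent Sl (g, rcov \<nu> g)" by (rule tmap_tangent[OF s u])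
  show "tmap M fst (g, rcov \<nu> g) (tmap Sl (\<lambda>g. (g, rcov \<nu> g)) g u) = u"
    using tmap_compose[OF s smooth_fst_Sl tangent_points[OF u], of u] tmap_ident[OF u] by simp
qed

lemma Sl_rcovE:
  assumes "a \<in> points Sl"
  obtains g \<nu> where "a = (g, rcov \<nu> g)" "g \<in> carrier G" "\<nu> \<in> dual_lie_algebra G" "\<nu> \<noteq> (\<lambda>_. 0)"
proof -
  have a: "a \<in> cot_points M" "snd a \<noteq> (\<lambda>_. 0)" using assms points_Sl by auto
  obtain g \<alpha> where ga: "a = (g, \<alpha>)" "g \<in> carrier G" "\<alpha> \<in> cotangent M g" by (rule cot_pointsE[OF a(1)])
  obtain \<nu> where \<nu>: "\<nu> \<in> dual_lie_algebra G" "rcov \<nu> g = \<alpha>" by (rule rcov_surj[OF ga(3,2)])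
  have "\<nu> \<noteq> (\<lambda>_. 0)"
  proof
    assume "\<nu> = (\<lambda>_. 0)"
    then have "rcov \<nu> g = (\<lambda>_. 0)" by (simp add: rcov_def right_cov_def)
    then show False using a(2) ga(1) \<nu>(2) by simp
  qed
  then show thesis using that ga \<nu> by blast
qed

text \<open>Uniqueness of the factor in \<open>f_sigma\<close> depends on such a vector. A nonzero
  covector is detected by a vector of the base, which lifts to the bundle through a right-invariant
  covector field.\<close>

lemma Sl_witness:
  assumes a: "a \<in> points Sl"
  obtains v where "v \<in> tangent Sl a" "snd a (tmap M fst a v) \<noteq> 0"
proof -
  obtain g \<nu> where n: "a = (g, rcov \<nu> g)" "g \<in> carrier G" "\<nu> \<in> dual_lie_algebra G" "\<nu> \<noteq> (\<lambda>_. 0)"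
    by (rule Sl_rcovE[OF a])
  obtain u where u: "u \<in> tangent M g" "rcov \<nu> g u \<noteq> 0"
    by (rule nonzero_pairing[OF rcov_cotangent[OF n(3,2)] rcov_nonzero[OF n(3,4,2)]])
  show thesis
    by (rule that[of "tmap Sl (\<lambda>g. (g, rcov \<nu> g)) g u"]) (use lift_tangent[OF n(3,4) u(1)] u(2) in \<open>simp_all add: n(1)\<close>)
qed

text \<open>Both pull-backs in the definition of \<open>f_sigma\<close> evaluate covectors on the
  projection of \<open>v\<close> to the group. For a suitable \<open>v\<close> this pairing is
  nonzero, so the factor is unique.\<close>

lemma f_sigma_eqI:
  assumes a: "a \<in> points Sl" and c: "\<sigma> (cot_ray a) = (fst a, \<lambda>v. c * snd a v)"
  shows "f_sigma M \<sigma> a = c"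
  unfolding f_sigma_def
proof (rule the_equality)
  have L: "pull_form Sl S cot_ray (theta_form M \<sigma>) a v = c * snd a (tmap M fst a v)" if "v \<in> tangent Sl a" for v
    using theta_cot_ray[OF a that] a that c by (simp add: pull_form_def)
  have R: "pull_form Sl T (\<lambda>b. b) (liouville M) a v = snd a (tmap M fst a v)" if "v \<in> tangent Sl a" for v
    using liouville_Sl[OF a that] a that by (simp add: pull_form_def)
  show "\<forall>v. pull_form Sl S cot_ray (theta_form M \<sigma>) a v = c * pull_form Sl T (\<lambda>b. b) (liouville M) a v"
  proof
    fix v
    show "pull_form Sl S cot_ray (theta_form M \<sigma>) a v = c * pull_form Sl T (\<lambda>b. b) (liouville M) a v"
    proof (cases "v \<in> tangent Sl a")
      case True
      then show ?thesis by (simp add: L R)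
    qed (simp add: pull_form_def)
  qed
  fix d assume d: "\<forall>v. pull_form Sl S cot_ray (theta_form M \<sigma>) a v = d * pull_form Sl T (\<lambda>b. b) (liouville M) a v"
  obtain v where v: "v \<in> tangent Sl a" "snd a (tmap M fst a v) \<noteq> 0" by (rule Sl_witness[OF a])
  have "c * snd a (tmap M fst a v) = d * snd a (tmap M fst a v)"
    using d[rule_format, of v] L[OF v(1)] R[OF v(1)] by simp
  then show "d = c" using v(2) by simp
qed

lemma
  assumes a: "a \<in> points Sl"
  shows f_sigma_pos: "f_sigma M \<sigma> a > 0"
    and sigma_f_sigma: "\<sigma> (cot_ray a) = (fst a, \<lambda>v. f_sigma M \<sigma> a * snd a v)"
proof -
  obtain c where c: "c > 0" "\<sigma> (cot_ray a) = (fst a, \<lambda>v. c * snd a v)" by (rule sigma_factor[OF a])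
  have f: "f_sigma M \<sigma> a = c" by (rule f_sigma_eqI[OF a c(2)])
  show "f_sigma M \<sigma> a > 0" unfolding f by (rule c(1))
  show "\<sigma> (cot_ray a) = (fst a, \<lambda>v. f_sigma M \<sigma> a * snd a v)" unfolding f by (rule c(2))
qed

lemma f_sigma_scale:
  assumes a: "(g, \<alpha>) \<in> points Sl" and r: "r > 0"
  shows "r * f_sigma M \<sigma> (g, \<lambda>v. r * \<alpha> v) = f_sigma M \<sigma> (g, \<alpha>)"
proof -
  have "(\<lambda>v. r * \<alpha> v) \<in> cotangent M g" "(\<lambda>v. r * \<alpha> v) \<noteq> (\<lambda>_. 0)"
    using a r unfolding points_Sl cot_points_def cotangent_def by (auto simp: fun_eq_iff algebra_simps)
  then have a': "(g, \<lambda>v. r * \<alpha> v) \<in> points Sl" using a unfolding points_Sl cot_points_def by simp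
  have "f_sigma M \<sigma> (g, \<lambda>v. r * \<alpha> v) = f_sigma M \<sigma> (g, \<alpha>) / r"
    by (rule f_sigma_eqI[OF a']) (use r sigma_f_sigma[OF a] in \<open>simp add: cot_ray_scale[OF r]\<close>)
  then show ?thesis using r by simp
qed

text \<open>The invariance of the contact form is evaluated on the image of a vector
  \<open>v\<close> that pairs nontrivially with \<open>a\<close>. At the class of \<open>a\<close>
  it gives the factor of \<open>a\<close> times this pairing; at the translated class it gives the
  factor there times the same pairing, since the lift preserves pairings.\<close>

lemma f_sigma_left:
  assumes h: "h \<in> carrier G" and a: "a \<in> points Sl"
  shows "f_sigma M \<sigma> (left_lift G h a) = f_sigma M \<sigma> a"
proof -
  obtain v where v: "v \<in> tangent Sl a" "snd a (tmap M fst a v) \<noteq> 0" by (rule Sl_witness[OF a])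
  let ?u = "tmap M fst a v" and ?w = "tmap S cot_ray a v" and ?b = "left_lift G h a"
  have w: "?w \<in> tangent S (cot_ray a)" by (rule tmap_tangent[OF smooth_cot_ray v(1)])
  have b: "?b \<in> points Sl" by (rule left_lift_Sl[OF a h])
  have ga: "fst a \<in> carrier G" using a points_Sl points_mfd unfolding cot_points_def by auto
  have uT: "?u \<in> tangent M (fst a)" by (rule tmap_tangent[OF smooth_fst_Sl v(1)])
  have fb: "fst ?b = h \<otimes> fst a" by (cases a) (simp add: left_lift_eq)
  have "pull_form S S (cosphere_act G h) (theta_form M \<sigma>) = theta_form M \<sigma>"
    using invariant h unfolding invariant_section_def by blast
  then have "theta_form M \<sigma> (cot_ray a) ?w = pull_form S S (cosphere_act G h) (theta_form M \<sigma>) (cot_ray a) ?w" by simp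
  also have "\<dots> = theta_form M \<sigma> (cosphere_act G h (cot_ray a)) (tmap S (cosphere_act G h) (cot_ray a) ?w)"
    using ray_in_S[OF a] w by (simp add: pull_form_def)
  also have "tmap S (cosphere_act G h) (cot_ray a) ?w = tmap S (\<lambda>c. cot_ray (left_lift G h c)) a v"
    using tmap_compose[OF smooth_cot_ray cosphere_act_smooth[OF h] a, of v] by (simp add: cosphere_act_ray)
  also have "\<dots> = tmap S cot_ray ?b (tmap Sl (left_lift G h) a v)"
    by (rule tmap_compose[OF left_lift_smooth_Sl[OF h] smooth_cot_ray a, symmetric])
  also have "theta_form M \<sigma> (cosphere_act G h (cot_ray a)) (tmap S cot_ray ?b (tmap Sl (left_lift G h) a v))
      = snd (\<sigma> (cot_ray ?b)) (tmap M fst ?b (tmap Sl (left_lift G h) a v))"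
    unfolding cosphere_act_ray by (rule theta_cot_ray[OF b tmap_tangent[OF left_lift_smooth_Sl[OF h] v(1)]])
  also have "tmap M fst ?b (tmap Sl (left_lift G h) a v) = tmap M (\<lambda>c. fst (left_lift G h c)) a v"
    by (rule tmap_compose[OF left_lift_smooth_Sl[OF h] smooth_fst_Sl a])
  also have "(\<lambda>c. fst (left_lift G h c)) = (\<lambda>c. h \<otimes> fst c)" by (auto simp: left_lift_eq fun_eq_iff)
  also have "tmap M (\<lambda>c. h \<otimes> fst c) a v = tmap M (\<lambda>x. h \<otimes> x) (fst a) ?u"
    by (rule tmap_compose[OF smooth_fst_Sl smooth_left[OF h] a, symmetric])
  also have "snd (\<sigma> (cot_ray ?b)) (tmap M (\<lambda>x. h \<otimes> x) (fst a) ?u)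
      = f_sigma M \<sigma> ?b * snd ?b (tmap M (\<lambda>x. h \<otimes> x) (fst a) ?u)"
    by (simp add: sigma_f_sigma[OF b])
  also have "snd ?b (tmap M (\<lambda>x. h \<otimes> x) (fst a) ?u) = snd a ?u"
  proof -
    have "tmap M (\<lambda>x. h \<otimes> x) (fst a) ?u \<in> tangent M (h \<otimes> fst a)" by (rule tmap_tangent[OF smooth_left[OF h] uT])
    moreover have "tmap M (\<lambda>x. inv h \<otimes> x) (h \<otimes> fst a) (tmap M (\<lambda>x. h \<otimes> x) (fst a) ?u) = ?u"
      using tmap_left_compose[OF uT ga h inv_closed[OF h]] h tmap_one_left[OF uT] by simp
    ultimately show ?thesis by (cases a) (simp add: left_lift_eq)
  qed
  finally have "theta_form M \<sigma> (cot_ray a) ?w = f_sigma M \<sigma> ?b * snd a ?u" .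
  moreover have "theta_form M \<sigma> (cot_ray a) ?w = f_sigma M \<sigma> a * snd a ?u"
    using theta_cot_ray[OF a v(1)] by (simp add: sigma_f_sigma[OF a])
  ultimately show ?thesis using v(2) by simp
qed

text \<open>\<open>f_sigma\<close> is a definite description, so smoothness has to come from a
  formula: \<sigma> of the class of R_g \<nu>, evaluated on the right-invariant field of \<xi>, is
  the factor times \<nu>(\<xi>), a nonzero constant.\<close>

lemma f_sigma_smooth:
  assumes \<nu>: "\<nu> \<in> dual_lie_algebra G" "\<nu> \<noteq> (\<lambda>_. 0)" and p: "p \<in> carrier G"
  shows "smooth_near M p (\<lambda>g. f_sigma M \<sigma> (g, rcov \<nu> g))"
proof -
  obtain \<xi> where \<xi>: "\<xi> \<in> lie_algebra G" "\<nu> \<xi> \<noteq> 0"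
    using nonzero_pairing[of \<nu> \<one>] \<nu> unfolding dual_lie_algebra_def lie_algebra_def by blast
  let ?P = "\<lambda>a. snd a (Rv \<xi> (fst a))"
  have P: "smooth_fun T (cot_points M) ?P"
    by (rule smooth_fun_cot_eval[OF charted_M]) (use Rv_tangent[OF \<xi>(1)] points_mfd Rv_smooth[OF \<xi>(1)] in auto)
  have s: "smooth_map M T (\<lambda>g. \<sigma> (cot_ray (g, rcov \<nu> g)))"
    by (rule smooth_map_compose[OF smooth_map_compose[OF rcov_smooth_Sl[OF \<nu>] smooth_cot_ray] sigma_smooth_T])
  have pM: "p \<in> points M" using p points_mfd by simp
  have "smooth_near M p (\<lambda>g. ?P (\<sigma> (cot_ray (g, rcov \<nu> g))))"
    by (rule smooth_map_near[OF s pM smooth_nearI[OF _ P]]) (use smooth_map_in[OF s pM] points_T in simp)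
  then have "smooth_near M p (\<lambda>g. ?P (\<sigma> (cot_ray (g, rcov \<nu> g))) / \<nu> \<xi>)"
    by (rule smooth_near_divide[OF charted_M _ smooth_near_const[OF charted_M pM] \<xi>(2)])
  then show ?thesis
  proof (rule smooth_near_cong[OF local_M openin_carrier p, rotated])
    fix g assume g: "g \<in> carrier G"
    show "?P (\<sigma> (cot_ray (g, rcov \<nu> g))) / \<nu> \<xi> = f_sigma M \<sigma> (g, rcov \<nu> g)"
      using sigma_f_sigma[OF rcov_Sl[OF \<nu> g]] \<xi> rcov_Rv[OF \<xi>(1) g] by simp
  qed
qed

text \<open>The generator on the cosphere bundle projects to the generator of left translations, the
  right-invariant field of \<xi>, on which R_g \<nu> takes the value \<nu>(\<xi>).\<close>

lemma momentum_rcov: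
  assumes \<nu>: "\<nu> \<in> dual_lie_algebra G" "\<nu> \<noteq> (\<lambda>_. 0)" and g: "g \<in> carrier G"
  shows "momentum G \<sigma> (cot_ray (g, rcov \<nu> g)) = (\<lambda>\<xi>. f_sigma M \<sigma> (g, rcov \<nu> g) * \<nu> \<xi>)"
proof
  fix \<xi>
  let ?a = "(g, rcov \<nu> g)"
  have a: "?a \<in> points Sl" by (rule rcov_Sl[OF \<nu> g])
  have x: "cot_ray ?a \<in> points S" by (rule ray_in_S[OF a])
  show "momentum G \<sigma> (cot_ray ?a) \<xi> = f_sigma M \<sigma> ?a * \<nu> \<xi>"
  proof (cases "\<xi> \<in> lie_algebra G")
    case True
    have one: "\<one> \<in> points M" by (simp add: points_mfd)
    have ac: "?a \<in> cot_points M" using a points_Sl by blast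
    have act1: "cosphere_act G \<one> (cot_ray ?a) = cot_ray ?a" by (simp add: cosphere_act_ray left_lift_one[OF ac])
    have o: "smooth_map M S (\<lambda>h. cosphere_act G h (cot_ray ?a))" by (rule cosphere_orbit_smooth[OF x])
    have gen: "cosphere_generator G \<xi> (cot_ray ?a) \<in> tangent S (cot_ray ?a)"
      using tmap_tangent[OF o, of \<xi> \<one>] True by (simp add: cosphere_generator_def lie_algebra_def act1)
    have "tmap M base (cot_ray ?a) (cosphere_generator G \<xi> (cot_ray ?a))
        = tmap M (\<lambda>h. base (cosphere_act G h (cot_ray ?a))) \<one> \<xi>"
      using tmap_compose[OF o smooth_base one, of \<xi>] by (simp add: cosphere_generator_def act1)
    also have "\<dots> = Rv \<xi> g" by (simp add: cosphere_act_ray base_cot_ray left_lift_eq Rv_def)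
    finally show ?thesis
      using True theta_eq[OF x gen] sigma_f_sigma[OF a] rcov_Rv[OF True g] by (simp add: momentum_def)
  next
    case False
    have "\<nu> \<xi> = 0" using cotangent_outside[of \<nu> M \<one> \<xi>] \<nu>(1) False by (simp add: dual_lie_algebra_def lie_algebra_def)
    then show ?thesis using False by (simp add: momentum_def)
  qed
qed

text \<open>The momentum of the class of R_g \<nu> is a positive multiple of \<nu>; if it lies on
  the ray of \<mu>, then so does \<nu>, and the class does not see the positive factor.\<close>

lemma ray_level_eq:
  assumes \<mu>: "\<mu> \<in> dual_lie_algebra G" "\<mu> \<noteq> (\<lambda>_. 0)"
  shows "ray_level G \<sigma> \<mu> = (\<lambda>g. cot_ray (g, rcov \<mu> g)) ` carrier G"
proof
  show "(\<lambda>g. cot_ray (g, rcov \<mu> g)) ` carrier G \<subseteq> ray_level G \<sigma> \<mu>"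
  proof
    fix x assume "x \<in> (\<lambda>g. cot_ray (g, rcov \<mu> g)) ` carrier G"
    then obtain g where g: "g \<in> carrier G" "x = cot_ray (g, rcov \<mu> g)" by blast
    have a: "(g, rcov \<mu> g) \<in> points Sl" by (rule rcov_Sl[OF \<mu> g(1)])
    show "x \<in> ray_level G \<sigma> \<mu>"
      unfolding ray_level_def mem_Collect_eq g(2) momentum_rcov[OF \<mu> g(1)] ray_def
      using ray_in_S[OF a] f_sigma_pos[OF a] by blast
  qed
  show "ray_level G \<sigma> \<mu> \<subseteq> (\<lambda>g. cot_ray (g, rcov \<mu> g)) ` carrier G"
  proof
    fix x assume x: "x \<in> ray_level G \<sigma> \<mu>"
    then obtain a where a: "a \<in> points Sl" "x = cot_ray a" unfolding ray_level_def points_S by blast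
    obtain g \<nu> where n: "a = (g, rcov \<nu> g)" "g \<in> carrier G" "\<nu> \<in> dual_lie_algebra G" "\<nu> \<noteq> (\<lambda>_. 0)"
      by (rule Sl_rcovE[OF a(1)])
    let ?f = "f_sigma M \<sigma> (g, rcov \<nu> g)"
    have f: "?f > 0" using f_sigma_pos[OF a(1)] n(1) by simp
    obtain r where r: "r > 0" "(\<lambda>\<xi>. ?f * \<nu> \<xi>) = (\<lambda>\<xi>. r * \<mu> \<xi>)"
      using x unfolding ray_level_def mem_Collect_eq a(2) n(1) momentum_rcov[OF n(3,4,2)] ray_def by blast
    have "\<nu> = (\<lambda>\<xi>. (r / ?f) * \<mu> \<xi>)"
    proof
      fix \<xi> show "\<nu> \<xi> = (r / ?f) * \<mu> \<xi>" using fun_cong[OF r(2), of \<xi>] f by (simp add: field_simps)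
    qed
    then have "rcov \<nu> g = rcov (\<lambda>\<xi>. (r / ?f) * \<mu> \<xi>) g" by (rule arg_cong)
    then have "rcov \<nu> g = (\<lambda>v. (r / ?f) * rcov \<mu> g v)" unfolding rcov_scale .
    then have "x = cot_ray (g, \<lambda>v. (r / ?f) * rcov \<mu> g v)" using a(2) n(1) by simp
    also have "\<dots> = cot_ray (g, rcov \<mu> g)" by (rule cot_ray_scale) (use r(1) f in simp)
    finally show "x \<in> (\<lambda>g. cot_ray (g, rcov \<mu> g)) ` carrier G" using n(2) by blast
  qed
qed

end

section \<open>Fibres of a quotient by an immersed subgroup\<close>

text \<open>Tychonoff: the set is a product of compact intervals and, in the coordinates from
  \<open>n\<close> on, of the singleton {0}.\<close>

lemma compactin_closed_box:
  "compactin (Euclidean_space n) {y \<in> Rn n. \<forall>i<n. \<bar>y i - x i\<bar> \<le> e}"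
proof -
  let ?S = "\<lambda>i. if i < n then {x i - e..x i + e} else {0}"
  have "compactin (powertop_real UNIV) (Pi\<^sub>E UNIV ?S)"
    unfolding compactin_PiE by simp
  moreover have "Pi\<^sub>E UNIV ?S = {y \<in> Rn n. \<forall>i<n. \<bar>y i - x i\<bar> \<le> e}"
  proof (rule Set.set_eqI)
    fix y
    have "y i \<in> ?S i \<longleftrightarrow> (i < n \<longrightarrow> \<bar>y i - x i\<bar> \<le> e) \<and> (i \<ge> n \<longrightarrow> y i = 0)" for i
      by (cases "i < n") (simp_all add: abs_le_iff, linarith)
    then show "y \<in> Pi\<^sub>E UNIV ?S \<longleftrightarrow> y \<in> {y \<in> Rn n. \<forall>i<n. \<bar>y i - x i\<bar> \<le> e}"
      unfolding PiE_UNIV_domain Pi_iff mem_Collect_eq Rn_iff by blast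
  qed
  ultimately have c: "compactin (powertop_real UNIV) {y \<in> Rn n. \<forall>i<n. \<bar>y i - x i\<bar> \<le> e}" by (simp only:)
  have "{y \<in> Rn n. \<forall>i<n. \<bar>y i - x i\<bar> \<le> e} \<subseteq> {x. \<forall>i\<ge>n. x i = 0}"
    unfolding Rn_iff by blast
  with c have "compactin (subtopology (powertop_real UNIV) {x. \<forall>i\<ge>n. x i = 0}) {y \<in> Rn n. \<forall>i<n. \<bar>y i - x i\<bar> \<le> e}"
    unfolding compactin_subtopology by blast
  then show ?thesis by (simp only: Euclidean_space_def)
qed

lemma charted_locally_compact:
  assumes M: "charted M"
  shows "locally_compact_space (space_top M)"
  unfolding locally_compact_space_def
proof
  fix p assume "p \<in> topspace (space_top M)"
  then have "p \<in> points M" by (simp add: points_def)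
  then obtain U n x where ch: "chart M U n x" "p \<in> U" by (rule charted_pointE[OF M])
  obtain e where e: "e > 0" "nbox n (x p) e \<subseteq> x ` U"
    using chart_image_open[OF ch(1)] ch(2) unfolding openin_Euclidean_iff by blast
  \<comment> \<open>Half the radius, so that the closed box still lies in the image of the
    chart.\<close>
  let ?B = "{y \<in> Rn n. \<forall>i<n. \<bar>y i - x p i\<bar> \<le> e / 2}"
  have B: "?B \<subseteq> x ` U" using e unfolding nbox_def by fastforce
  let ?C = "{q \<in> U. x q \<in> ?B}"
  have im: "x ` ?C = ?B" using B by auto
  have h: "homeomorphic_map (subtopology (space_top M) U) (subtopology (Euclidean_space n) (x ` U)) x"
    using ch(1) unfolding chart_def by blast
  have CU: "?C \<subseteq> topspace (subtopology (space_top M) U)" unfolding chart_topspace(1)[OF ch(1)] by blast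
  have "compactin (subtopology (Euclidean_space n) (x ` U)) ?B"
    unfolding compactin_subtopology using compactin_closed_box B by blast
  then have "compactin (subtopology (space_top M) U) ?C"
    using homeomorphic_map_compactness[OF h CU] unfolding im by blast
  then have C: "compactin (space_top M) ?C" unfolding compactin_subtopology by blast
  have op: "openin (space_top M) {q \<in> U. x q \<in> nbox n (x p) (e / 2)}"
    by (rule chart_preimage_open[OF ch(1) openin_nbox])
  show "\<exists>W C. openin (space_top M) W \<and> compactin (space_top M) C \<and> p \<in> W \<and> W \<subseteq> C"
  proof (rule exI[of _ "{q \<in> U. x q \<in> nbox n (x p) (e / 2)}"], rule exI[of _ ?C], intro conjI)
    show "openin (space_top M) {q \<in> U. x q \<in> nbox n (x p) (e / 2)}" by (rule op)
    show "compactin (space_top M) ?C" by (rule C)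
    show "p \<in> {q \<in> U. x q \<in> nbox n (x p) (e / 2)}" using ch e center_in_nbox[OF chart_Rn[OF ch], of "e / 2"] by simp
    show "{q \<in> U. x q \<in> nbox n (x p) (e / 2)} \<subseteq> ?C" by (auto simp: nbox_def intro: less_imp_le)
  qed
qed

text \<open>To first order the coordinates of \<open>F k - F p\<close> lie in the image of the tangent map, where \<open>\<mu>\<close> vanishes,
  and injectivity bounds the error in terms of these coordinates.\<close>

lemma immersion_tangency:
  assumes N: "charted N" and M: "charted M" and F: "smooth_map N M F" and p: "p \<in> points N"
    and inj: "inj_on (tmap M F p) (tangent N p)" and \<mu>: "\<mu> \<in> cotangent M (F p)"
    and van: "\<And>v. v \<in> tangent N p \<Longrightarrow> \<mu> (tmap M F p v) = 0"
    and ch: "chart M U n x" "F p \<in> U" and e: "e > 0"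
  shows "\<exists>A. openin (space_top N) A \<and> p \<in> A \<and> (\<forall>k\<in>A.
    \<bar>\<Sum>i<n. \<mu> (coord_vec M U x i (F p)) * (x (F k) i - x (F p) i)\<bar> \<le> e * (\<Sum>i<n. \<bar>x (F k) i - x (F p) i\<bar>))"
proof -
  have LN: "local_space N" and LM: "local_space M" using N M charted_local by blast+
  obtain V m w where cw: "chart N V m w" "p \<in> V" by (rule charted_pointE[OF N p])
  define f where "f i k = x (F k) i" for i k
  have near_x: "smooth_near M (F p) (\<lambda>q. x q i)" for i by (rule smooth_near_coord[OF ch LM])
  have fs: "smooth_near N p (f i)" for i unfolding f_def by (rule smooth_map_near[OF F p near_x])
  define \<mu>c where "\<mu>c i = \<mu> (coord_vec M U x i (F p))" for i
  \<comment> \<open>The linear form \<mu> applied to the coordinates of \<open>F k\<close>; by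
    \<open>van\<close> all its first derivatives at \<open>p\<close> vanish.\<close>
  define \<phi> where "\<phi> k = (\<Sum>i<n. \<mu>c i * f i k)" for k
  have \<phi>s: "smooth_near N p \<phi>"
    unfolding \<phi>_def by (rule smooth_near_sum[OF N p]) (rule smooth_near_cmult[OF N fs])
  define A where "A i j = coord_vec N V w j p (f i)" for i j
  have cT: "coord_vec N V w j p \<in> tangent N p" if "j < m" for j by (rule coord_vec_tangent[OF N cw that])
  have push: "tmap M F p v (\<lambda>q. x q i) = v (f i)" for v i
    unfolding f_def by (simp add: tmap_def near_x)
  have \<phi>0: "coord_vec N V w j p \<phi> = 0" if j: "j < m" for j
  proof -
    let ?v = "coord_vec N V w j p"
    have t: "tmap M F p ?v \<in> tangent M (F p)" by (rule tmap_tangent[OF F cT[OF j]])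
    have "?v \<phi> = (\<Sum>i<n. ?v (\<lambda>k. \<mu>c i * f i k))"
      unfolding \<phi>_def by (rule tangent_sum[OF N cT[OF j]]) (rule smooth_near_cmult[OF N fs])
    also have "\<dots> = (\<Sum>i<n. tmap M F p ?v (\<lambda>q. x q i) * \<mu>c i)"
      unfolding push by (intro sum.cong refl) (simp add: tangent_cmult[OF N cT[OF j] fs])
    also have "\<dots> = \<mu> (tmap M F p ?v)" unfolding \<mu>c_def by (rule cotangent_expand[OF M \<mu> ch t, symmetric])
    also have "\<dots> = 0" by (rule van[OF cT[OF j]])
    finally show ?thesis .
  qed
  have Ainj: "\<forall>j<m. a j = 0" if a: "\<And>i. i < n \<Longrightarrow> (\<Sum>j<m. A i j * a j) = 0" for a
  proof -
    define v where "v = (\<lambda>h. \<Sum>j<m. a j * coord_vec N V w j p h)"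
    have v: "v \<in> tangent N p" unfolding v_def by (rule tangent_combo[OF N cw])
    have z: "(\<lambda>f. 0) \<in> tangent N p" by (rule tangent_zero[OF N p])
    have "tmap M F p v = tmap M F p (\<lambda>f. 0)"
    proof (rule tangent_eqI[OF M ch tmap_tangent[OF F v] tmap_tangent[OF F z]])
      fix i assume "i < n"
      then show "tmap M F p v (\<lambda>q. x q i) = tmap M F p (\<lambda>f. 0) (\<lambda>q. x q i)"
        unfolding push using a[of i] by (simp add: v_def A_def mult.commute)
    qed
    then have v0: "v = (\<lambda>f. 0)" by (rule inj_onD[OF inj _ v z])
    show ?thesis
    proof (intro allI impI)
      fix j assume j: "j < m"
      have "v (\<lambda>q. w q j) = (\<Sum>i<m. a i * (if i = j then 1 else 0))"
        unfolding v_def by (intro sum.cong refl) (simp add: coord_vec_coord[OF LN cw])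
      also have "\<dots> = (\<Sum>i<m. if i = j then a i else 0)" by (intro sum.cong) auto
      also have "\<dots> = a j" using j by (subst sum.delta) auto
      finally show "a j = 0" using v0 by simp
    qed
  qed
  \<comment> \<open>Injectivity of the tangent map bounds the parameters by the linearised image
    coordinates.\<close>
  have lb: "\<exists>c>0. \<forall>a. (\<Sum>j<m. \<bar>a j\<bar>) \<le> c * (\<Sum>i<n. \<bar>\<Sum>j<m. A i j * a j\<bar>)"
    by (rule injective_lower_bound) (rule Ainj)
  obtain c where c: "c > 0" "\<forall>a. (\<Sum>j<m. \<bar>a j\<bar>) \<le> c * (\<Sum>i<n. \<bar>\<Sum>j<m. A i j * a j\<bar>)"
    using lb by (elim exE conjE) (rule that; assumption)
  \<comment> \<open>Small enough that the linearisation errors of the \<open>n\<close> coordinates,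
    amplified by \<open>c\<close>, are absorbed into half of the parameter sum.\<close>
  define \<delta> where "\<delta> = 1 / (2 * c * (real n + 1))"
  have \<delta>: "\<delta> > 0" "c * (real n * \<delta>) \<le> 1/2"
  proof -
    show "\<delta> > 0" using c(1) by (simp add: \<delta>_def)
    have "c * (real n * \<delta>) = real n / (2 * (real n + 1))" using c(1) by (simp add: \<delta>_def)
    also have "\<dots> \<le> 1/2" by (simp add: divide_le_eq)
    finally show "c * (real n * \<delta>) \<le> 1/2" .
  qed
  \<comment> \<open>The parameter sum will be at most \<open>2 * c\<close> times the sum of
    coordinate increments; this choice turns that bound into the factor \<open>e\<close>.\<close>
  define \<eta> where "\<eta> = e / (2 * c)"
  have \<eta>: "\<eta> > 0" using e c(1) by (simp add: \<eta>_def)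
  define g where "g h = h \<circ> inv_into V w" for h :: "'a \<Rightarrow> real"
  have strict: "\<exists>r>0. \<forall>z\<in>nbox m (w p) r.
      \<bar>g h z - h p - (\<Sum>j<m. coord_vec N V w j p h * (z j - w p j))\<bar> \<le> \<kappa> * (\<Sum>j<m. \<bar>z j - w p j\<bar>)"
    if h: "smooth_near N p h" and \<kappa>: "\<kappa> > 0" for h and \<kappa> :: real
  proof -
    obtain D where D: "openin (Euclidean_space m) D" "w p \<in> D" "smooth_Rn m D (h \<circ> inv_into V w)"
      by (rule smooth_near_chart_rep[OF LN cw h])
    have C: "Ck_Rn m (Suc 0) D (h \<circ> inv_into V w)"
      by (rule D(3)[unfolded smooth_Rn_def, THEN conjunct2, THEN spec])
    obtain r where r: "r > 0" "\<forall>z\<in>nbox m (w p) r. \<forall>z'\<in>nbox m (w p) r.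
        \<bar>(h \<circ> inv_into V w) z' - (h \<circ> inv_into V w) z - (\<Sum>i<m. partial_deriv i (h \<circ> inv_into V w) (w p) * (z' i - z i))\<bar>
        \<le> \<kappa> * (\<Sum>i<m. \<bar>z' i - z i\<bar>)"
      using C1_strict[OF D(1) C D(2) \<kappa>] by (elim exE conjE) (rule that; assumption)
    have pc: "w p \<in> nbox m (w p) r" by (rule center_in_nbox[OF chart_Rn[OF cw] r(1)])
    have hp: "(h \<circ> inv_into V w) (w p) = h p" using chart_inv[OF cw] by simp
    have cv: "partial_deriv j (h \<circ> inv_into V w) (w p) = coord_vec N V w j p h" if "j < m" for j
      by (rule coord_vec_eq[OF LN cw h that, symmetric])
    show ?thesis
    proof (intro exI[of _ r] conjI r(1) ballI)
      fix z assume z: "z \<in> nbox m (w p) r"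
      have "(\<Sum>j<m. partial_deriv j (h \<circ> inv_into V w) (w p) * (z j - w p j)) = (\<Sum>j<m. coord_vec N V w j p h * (z j - w p j))"
        by (intro sum.cong refl) (simp add: cv)
      then show "\<bar>g h z - h p - (\<Sum>j<m. coord_vec N V w j p h * (z j - w p j))\<bar> \<le> \<kappa> * (\<Sum>j<m. \<bar>z j - w p j\<bar>)"
        using r(2)[rule_format, OF pc z] unfolding hp g_def by simp
    qed
  qed
  define good where "good h \<kappa> r \<longleftrightarrow> (\<forall>z\<in>nbox m (w p) r.
      \<bar>g h z - h p - (\<Sum>j<m. coord_vec N V w j p h * (z j - w p j))\<bar> \<le> \<kappa> * (\<Sum>j<m. \<bar>z j - w p j\<bar>))" for h \<kappa> r
  have ex: "\<exists>r>0. good h \<kappa> r" if "smooth_near N p h" "\<kappa> > 0" for h \<kappa>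
    using strict[OF that] by (simp only: good_def)
  obtain r0 where r0: "r0 > 0" "good \<phi> \<eta> r0" using ex[OF \<phi>s \<eta>] by (elim exE conjE) (rule that; assumption)
  have "\<forall>i. \<exists>r>0. good (f i) \<delta> r" using ex[OF fs \<delta>(1)] by (rule allI)
  from choice[OF this] obtain R where "\<forall>i. R i > 0 \<and> good (f i) \<delta> (R i)" by (rule exE)
  then have R: "\<And>i. R i > 0" "\<And>i. good (f i) \<delta> (R i)" by simp_all
  obtain r1 where r1: "0 < r1" "\<And>i. i < n \<Longrightarrow> r1 \<le> R i" by (rule finite_pos_lower_bound[of n R]) (rule R(1), (rule that; assumption))
  define r where "r = min r0 r1"
  have r: "r > 0" "r \<le> r0" "\<And>i. i < n \<Longrightarrow> r \<le> R i" using r0 r1 by (auto simp: r_def intro: min.coboundedI2)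
  let ?A = "{k \<in> V. w k \<in> nbox m (w p) r}"
  show ?thesis
  proof (intro exI[of _ ?A] conjI ballI)
    show "openin (space_top N) ?A" by (rule chart_preimage_open[OF cw(1) openin_nbox])
    show "p \<in> ?A" using cw center_in_nbox[OF chart_Rn[OF cw] r(1)] by simp
    fix k assume k: "k \<in> ?A"
    then have kV: "k \<in> V" by blast
    define a where "a j = w k j - w p j" for j
    have gk: "g h (w k) = h k" for h using chart_inv[OF cw(1) kV] by (simp add: g_def)
    have wk: "w k \<in> nbox m (w p) s" if "r \<le> s" for s by (rule subsetD[OF nbox_mono[OF that]]) (use k in simp)
    have "\<bar>\<phi> k - \<phi> p - (\<Sum>j<m. coord_vec N V w j p \<phi> * a j)\<bar> \<le> \<eta> * (\<Sum>j<m. \<bar>a j\<bar>)"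
      using r0(2)[unfolded good_def, rule_format, OF wk[OF r(2)]] unfolding gk a_def .
    then have I: "\<bar>\<phi> k - \<phi> p\<bar> \<le> \<eta> * (\<Sum>j<m. \<bar>a j\<bar>)" using \<phi>0 by simp
    have Ai: "\<bar>\<Sum>j<m. A i j * a j\<bar> \<le> \<bar>f i k - f i p\<bar> + \<delta> * (\<Sum>j<m. \<bar>a j\<bar>)" if "i < n" for i
    proof -
      have "\<bar>f i k - f i p - (\<Sum>j<m. A i j * a j)\<bar> \<le> \<delta> * (\<Sum>j<m. \<bar>a j\<bar>)"
        using R(2)[unfolded good_def, rule_format, OF wk[OF r(3)[OF that]]] unfolding gk a_def A_def .
      then show ?thesis by linarith
    qed
    let ?s = "\<Sum>j<m. \<bar>a j\<bar>" and ?X = "\<Sum>i<n. \<bar>f i k - f i p\<bar>"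
    have s0: "?s \<ge> 0" by (rule sum_nonneg) simp
    have "?s \<le> c * (\<Sum>i<n. \<bar>\<Sum>j<m. A i j * a j\<bar>)" by (rule spec[OF c(2)])
    also have "\<dots> \<le> c * (\<Sum>i<n. \<bar>f i k - f i p\<bar> + \<delta> * ?s)"
      using c(1) Ai by (intro mult_left_mono sum_mono) auto
    also have "\<dots> = c * ?X + c * (real n * \<delta>) * ?s" by (simp add: sum.distrib algebra_simps)
    also have "\<dots> \<le> c * ?X + 1/2 * ?s" using \<delta>(2) s0 by (intro add_left_mono mult_right_mono) auto
    finally have "?s \<le> 2 * c * ?X" by simp
    then have "\<eta> * ?s \<le> \<eta> * (2 * c * ?X)" using \<eta> by (intro mult_left_mono) auto
    also have "\<dots> = e * ?X" using c(1) by (simp add: \<eta>_def)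
    finally have "\<bar>\<phi> k - \<phi> p\<bar> \<le> e * ?X" using I by linarith
    moreover have "\<phi> k - \<phi> p = (\<Sum>i<n. \<mu>c i * (x (F k) i - x (F p) i))"
      by (simp add: \<phi>_def f_def right_diff_distrib sum_subtractf)
    ultimately show "\<bar>\<Sum>i<n. \<mu> (coord_vec M U x i (F p)) * (x (F k) i - x (F p) i)\<bar> \<le> e * (\<Sum>i<n. \<bar>x (F k) i - x (F p) i\<bar>)"
      by (simp add: \<mu>c_def f_def)
  qed
qed

text \<open>Lifts of the coordinate vectors of \<open>Q\<close> form a right inverse of the
  derivative of \<open>q\<close>, so the fibre equation in charts is an instance of
  \<open>fibre_points_along_kernel\<close>. The result is the implicit function theorem to first
  order: it gives fibre points in direction \<xi> up to a small relative error, not a smooth curve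
  of them.\<close>

lemma submersion_fibre_points:
  assumes M: "charted M" and Q: "charted Q" and q: "smooth_map M Q q" and p: "p \<in> points M"
    and surj: "tmap Q q p ` tangent M p = tangent Q (q p)"
    and \<xi>: "\<xi> \<in> tangent M p" "tmap Q q p \<xi> = (\<lambda>_. 0)"
    and ch: "chart M U n x" "p \<in> U" and e: "e > 0"
  shows "\<exists>\<delta>>0. \<forall>t. \<bar>t\<bar> < \<delta> \<longrightarrow> (\<exists>g\<in>U. q g = q p \<and> (\<Sum>i<n. \<bar>x g i - x p i - t * \<xi> (\<lambda>q. x q i)\<bar>) \<le> e * \<bar>t\<bar>)"
proof -
  have LM: "local_space M" and LQ: "local_space Q" using M Q charted_local by blast+
  obtain V d y where cy: "chart Q V d y" "q p \<in> V" by (rule charted_pointE[OF Q smooth_map_in[OF q p]])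
  have cq: "continuous_map (space_top M) (space_top Q) q" using q unfolding smooth_map_def by blast
  let ?W = "{g \<in> U. q g \<in> V}"
  have "?W = U \<inter> {g \<in> topspace (space_top M). q g \<in> V}"
    using openin_subset[OF chart_open[OF ch(1)]] by blast
  then have W: "openin (space_top M) ?W"
    using chart_open[OF ch(1)] openin_continuous_map_preimage[OF cq chart_open[OF cy(1)]] by (metis openin_Int)
  define h where "h l g = y (q g) l" for l g
  have hs: "smooth_near M g (h l)" if "g \<in> ?W" for g l
    unfolding h_def using that chart_subset[OF ch(1)]
    by (intro smooth_map_near[OF q _ smooth_near_coord[OF cy(1) _ LQ]]) auto
  have "smooth_fun M ?W (h l)" for l unfolding smooth_fun_iff_near[OF LM] using W hs by blast
  then have sR: "smooth_Rn n (x ` ?W) (h l \<circ> inv_into U x)" for l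
    using chart_smooth_iff[OF ch(1) W] by blast
  have D: "openin (Euclidean_space n) (x ` ?W)" by (rule chart_open_image[OF ch(1) W]) blast
  have pW: "p \<in> ?W" using ch(2) cy(2) by blast
  have hp: "smooth_near M p (h l)" for l by (rule hs[OF pW])
  have "\<exists>b. b \<in> tangent M p \<and> tmap Q q p b = coord_vec Q V y j (q p)" if "j < d" for j
    using coord_vec_tangent[OF Q cy that] unfolding surj[symmetric] by force
  then obtain b where b: "\<And>j. j < d \<Longrightarrow> b j \<in> tangent M p" "\<And>j. j < d \<Longrightarrow> tmap Q q p (b j) = coord_vec Q V y j (q p)"
    by metis
  define B where "B j i = (if i < n then b j (\<lambda>q. x q i) else 0)" for j i
  define v where "v i = (if i < n then \<xi> (\<lambda>q. x q i) else 0)" for i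
  have expand: "(\<Sum>i<n. partial_deriv i (h l \<circ> inv_into U x) (x p) * u (\<lambda>q. x q i)) = tmap Q q p u (\<lambda>q. y q l)"
    if u: "u \<in> tangent M p" for u l
  proof -
    have "tmap Q q p u (\<lambda>q. y q l) = u (h l)"
      unfolding h_def by (simp add: tmap_def smooth_near_coord[OF cy LQ])
    also have "\<dots> = (\<Sum>i<n. u (\<lambda>q. x q i) * coord_vec M U x i p (h l))" by (rule fun_cong[OF tangent_expand[OF M u ch]])
    also have "\<dots> = (\<Sum>i<n. partial_deriv i (h l \<circ> inv_into U x) (x p) * u (\<lambda>q. x q i))"
      by (intro sum.cong refl) (simp add: coord_vec_eq[OF LM ch hp])
    finally show ?thesis by simp
  qed
  define \<beta> where "\<beta> = (\<Sum>j<d. \<Sum>i<n. \<bar>B j i\<bar>) + 1"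
  have \<beta>: "\<beta> > 0" by (simp add: \<beta>_def add_nonneg_pos sum_nonneg)
  \<comment> \<open>The displacement is a combination of the vectors \<open>B j\<close> with
    coefficients \<open>w j\<close>, whose size is controlled by \<beta>; dividing by \<beta> yields
    the accuracy \<open>e\<close>.\<close>
  have e': "e / \<beta> > 0" using e \<beta> by simp
  have "\<exists>\<delta>>0. \<forall>t. \<bar>t\<bar> < \<delta> \<longrightarrow> (\<exists>w. (\<Sum>j<d. \<bar>w j\<bar>) \<le> e / \<beta> * \<bar>t\<bar> \<and>
    (\<lambda>i. x p i + t * v i + (\<Sum>j<d. w j * B j i)) \<in> x ` ?W \<and>
    (\<forall>l<d. (h l \<circ> inv_into U x) (\<lambda>i. x p i + t * v i + (\<Sum>j<d. w j * B j i)) = (h l \<circ> inv_into U x) (x p)))"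
  proof (rule fibre_points_along_kernel[where k = 0, OF D _ _ _ _ _ _ e'])
    show "x p \<in> x ` ?W" using pW by blast
    show "Ck_Rn n (Suc 0) (x ` ?W) (h l \<circ> inv_into U x)" for l using sR unfolding smooth_Rn_def by blast
    show "B j i = 0" "v i = 0" if "n \<le> i" for i j using that by (simp_all add: B_def v_def)
    show "(\<Sum>i<n. partial_deriv i (h l \<circ> inv_into U x) (x p) * B j i) = (if l = j then 1 else 0)" if "l < d" "j < d" for l j
    proof -
      have "(\<Sum>i<n. partial_deriv i (h l \<circ> inv_into U x) (x p) * B j i)
          = (\<Sum>i<n. partial_deriv i (h l \<circ> inv_into U x) (x p) * b j (\<lambda>q. x q i))"
        by (intro sum.cong) (auto simp: B_def)
      then show ?thesis unfolding expand[OF b(1)[OF that(2)]] b(2)[OF that(2)]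
        using coord_vec_coord[OF LQ cy that(2), of l] by auto
    qed
    show "(\<Sum>i<n. partial_deriv i (h l \<circ> inv_into U x) (x p) * v i) = 0" if "l < d" for l
    proof -
      have "(\<Sum>i<n. partial_deriv i (h l \<circ> inv_into U x) (x p) * v i)
          = (\<Sum>i<n. partial_deriv i (h l \<circ> inv_into U x) (x p) * \<xi> (\<lambda>q. x q i))"
        by (intro sum.cong) (auto simp: v_def)
      then show ?thesis unfolding expand[OF \<xi>(1)] \<xi>(2) .
    qed
  qed
  then obtain \<delta> where \<delta>: "\<delta> > 0" "\<forall>t. \<bar>t\<bar> < \<delta> \<longrightarrow> (\<exists>w. (\<Sum>j<d. \<bar>w j\<bar>) \<le> e / \<beta> * \<bar>t\<bar> \<and>
    (\<lambda>i. x p i + t * v i + (\<Sum>j<d. w j * B j i)) \<in> x ` ?W \<and>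
    (\<forall>l<d. (h l \<circ> inv_into U x) (\<lambda>i. x p i + t * v i + (\<Sum>j<d. w j * B j i)) = (h l \<circ> inv_into U x) (x p)))"
    by (elim exE conjE) (rule that; assumption)
  show ?thesis
  proof (intro exI[of _ \<delta>] conjI \<delta>(1) allI impI)
    fix t :: real assume t: "\<bar>t\<bar> < \<delta>"
    obtain w where w: "(\<Sum>j<d. \<bar>w j\<bar>) \<le> e / \<beta> * \<bar>t\<bar>"
      "(\<lambda>i. x p i + t * v i + (\<Sum>j<d. w j * B j i)) \<in> x ` ?W"
      "\<forall>l<d. (h l \<circ> inv_into U x) (\<lambda>i. x p i + t * v i + (\<Sum>j<d. w j * B j i)) = (h l \<circ> inv_into U x) (x p)"
      using \<delta>(2)[rule_format, OF t] by (elim exE conjE) (rule that; assumption)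
    obtain g where g: "(\<lambda>i. x p i + t * v i + (\<Sum>j<d. w j * B j i)) = x g" "g \<in> ?W" using w(2) by (rule imageE)
    have gU: "g \<in> U" "q g \<in> V" using g(2) by auto
    have "y (q g) l = y (q p) l" if "l < d" for l
      using w(3) that unfolding g(1) by (simp add: h_def chart_inv[OF ch(1) gU(1)] chart_inv[OF ch])
    then have "y (q g) = y (q p)"
      using chart_Rn[OF cy(1) gU(2)] chart_Rn[OF cy] unfolding Rn_iff fun_eq_iff by (metis not_le)
    then have qg: "q g = q p" by (rule inj_onD[OF chart_inj[OF cy(1)] _ gU(2) cy(2)])
    have "(\<Sum>i<n. \<bar>x g i - x p i - t * \<xi> (\<lambda>q. x q i)\<bar>) = (\<Sum>i<n. \<bar>\<Sum>j<d. w j * B j i\<bar>)"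
      unfolding g(1)[symmetric] by (intro sum.cong refl) (simp add: v_def)
    also have "\<dots> \<le> (\<Sum>i<n. \<Sum>j<d. \<bar>w j\<bar> * \<bar>B j i\<bar>)"
      by (intro sum_mono order_trans[OF sum_abs]) (simp add: abs_mult)
    also have "\<dots> = (\<Sum>j<d. \<bar>w j\<bar> * (\<Sum>i<n. \<bar>B j i\<bar>))"
      unfolding sum_distrib_left by (rule sum.swap)
    also have "\<dots> \<le> (\<Sum>j<d. \<bar>w j\<bar> * \<beta>)"
    proof (intro sum_mono mult_left_mono)
      fix j assume "j \<in> {..<d}"
      then have "(\<Sum>i<n. \<bar>B j i\<bar>) \<le> (\<Sum>j<d. \<Sum>i<n. \<bar>B j i\<bar>)"
        by (intro member_le_sum[of j _ "\<lambda>j. \<Sum>i<n. \<bar>B j i\<bar>"]) (auto intro: sum_nonneg)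
      then show "(\<Sum>i<n. \<bar>B j i\<bar>) \<le> \<beta>" by (simp add: \<beta>_def)
    qed simp
    also have "\<dots> = (\<Sum>j<d. \<bar>w j\<bar>) * \<beta>" by (simp add: sum_distrib_right)
    also have "\<dots> \<le> e / \<beta> * \<bar>t\<bar> * \<beta>" using w(1) \<beta> by (intro mult_right_mono) auto
    also have "\<dots> = e * \<bar>t\<bar>" using \<beta> by simp
    finally show "\<exists>g\<in>U. q g = q p \<and> (\<Sum>i<n. \<bar>x g i - x p i - t * \<xi> (\<lambda>q. x q i)\<bar>) \<le> e * \<bar>t\<bar>"
      using gU(1) qg by blast
  qed
qed

context lie
begin

text \<open>By Baire's theorem one of countably many translates of a compact neighbourhood in \<open>N\<close> has interior
  points for the subspace topology of \<open>K\<close>.\<close>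

lemma lie_subgroup_open_nbhd:
  assumes sub: "lie_subgroup G K N" and closed: "closedin (space_top M) K"
    and A: "openin (space_top N) A" "\<one> \<in> A"
  shows "\<exists>B. openin (space_top M) B \<and> \<one> \<in> B \<and> K \<inter> B \<subseteq> A"
proof -
  define H where "H = G\<lparr>carrier := K, mfd := N\<rparr>"
  have K: "subgroup K G" using sub unfolding lie_subgroup_def by blast
  have "lie_group H" using sub unfolding lie_subgroup_def H_def by blast
  then interpret H: lie H
    unfolding lie_group_def lie_def lie_axioms_def by blast
  have H: "carrier H = K" "mfd H = N" "x \<otimes>\<^bsub>H\<^esub> y = x \<otimes> y" "\<one>\<^bsub>H\<^esub> = \<one>" for x y by (simp_all add: H_def)
  have Kc: "K \<subseteq> carrier G" by (rule subgroup.subset[OF K])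
  have ptsN: "points N = K" using H.points_mfd H by simp
  have incl: "continuous_map (space_top N) (space_top M) (\<lambda>k. k)"
    using sub unfolding lie_subgroup_def immersion_def smooth_map_def by blast
  have left: "continuous_map (space_top N) (space_top N) (\<lambda>x. k \<otimes> x)" if "k \<in> K" for k
    using H.smooth_left[of k] that unfolding H smooth_map_def by blast
  have hausM: "Hausdorff_space (space_top M)" using manifold unfolding smooth_manifold_def by (elim conjE)
  have compM: "closedin (space_top M) C" if "compactin (space_top N) C" for C
    using compactin_imp_closedin[OF hausM] image_compactin[OF that incl] by simp
  have lcN: "locally_compact_space (space_top N)"
    using charted_locally_compact[OF H.charted_M] unfolding H .
  have "\<one> \<in> topspace (space_top N)" using ptsN subgroup.one_closed[OF K] by (simp add: points_def)
  \<comment> \<open>A compact neighbourhood of the identity for the topology of \<open>N\<close>.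
    The inclusion is continuous, so compact sets of \<open>N\<close> are closed in the
    group.\<close>
  then obtain V C where VC: "openin (space_top N) V" "compactin (space_top N) C" "\<one> \<in> V" "V \<subseteq> C"
    using lcN unfolding locally_compact_space_def by blast
  define W where "W k = {x \<in> topspace (space_top N). inv k \<otimes> x \<in> V}" for k
  have Wop: "openin (space_top N) (W k)" if "k \<in> K" for k
    unfolding W_def by (rule openin_continuous_map_preimage[OF left VC(1)]) (rule subgroup.m_inv_closed[OF K that])
  have kW: "k \<in> W k" if "k \<in> K" for k
    using that ptsN VC(3) Kc by (auto simp: W_def points_def)
  have "second_countable (space_top N)" using H.manifold unfolding H smooth_manifold_def by (elim conjE)
  then have "Lindelof_space (space_top N)" by (rule second_countable_imp_Lindelof_space)
  moreover have "\<Union>(W ` K) = topspace (space_top N)"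
  proof
    show "topspace (space_top N) \<subseteq> \<Union>(W ` K)" using kW ptsN by (auto simp: points_def)
  qed (auto simp: W_def)
  \<comment> \<open>Second countability of the immersed structure makes countably many translates
    sufficient.\<close>
  ultimately obtain \<V> where V: "countable \<V>" "\<V> \<subseteq> W ` K" "\<Union>\<V> = topspace (space_top N)"
    using Wop unfolding Lindelof_space_def by (metis (no_types, lifting) imageE)
  then obtain K' where K': "countable K'" "K' \<subseteq> K" "\<V> = W ` K'" using countable_subset_image[of \<V> W K] by blast
  define tr where "tr k = (\<lambda>x. k \<otimes> x) ` C" for k
  have trN: "compactin (space_top N) (tr k)" if "k \<in> K" for k
    unfolding tr_def by (rule image_compactin[OF VC(2) left[OF that]])
  have CK: "C \<subseteq> K" using compactin_subset_topspace[OF VC(2)] ptsN by (simp add: points_def)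
  have trK: "tr k \<subseteq> K" if "k \<in> K" for k
    unfolding tr_def using CK subgroup.m_closed[OF K that] by blast
  let ?X = "subtopology (space_top M) K"
  have topX: "topspace ?X = K" using Kc points_mfd by (auto simp: points_def)
  have cover: "\<Union>(tr ` K') = topspace ?X"
  proof
    show "\<Union>(tr ` K') \<subseteq> topspace ?X" unfolding topX using trK K'(2) by blast
    show "topspace ?X \<subseteq> \<Union>(tr ` K')"
    proof
      fix x assume "x \<in> topspace ?X"
      then have xK: "x \<in> K" using topX by simp
      then have "x \<in> \<Union>\<V>" using V(3) ptsN by (simp add: points_def)
      then obtain k where k: "k \<in> K'" "x \<in> W k" unfolding K'(3) by blast
      have "inv k \<otimes> x \<in> C" using k(2) VC(4) by (auto simp: W_def)
      moreover have "k \<otimes> (inv k \<otimes> x) = x"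
        using k K'(2) Kc xK by (metis inv_closed inv_cancel inv_inv subsetD)
      ultimately show "x \<in> \<Union>(tr ` K')" using k(1) unfolding tr_def by (metis UN_I imageI)
    qed
  qed
  have lcM: "locally_compact_space (space_top M)" by (rule charted_locally_compact[OF charted_M])
  have lcX: "locally_compact_space ?X" by (rule locally_compact_space_closed_subset[OF lcM closed])
  have "Hausdorff_space ?X" using hausM by (rule Hausdorff_space_subtopology)
  then have regX: "regular_space ?X" using locally_compact_Hausdorff_imp_regular_space[OF lcX] by blast
  \<comment> \<open>If all translates had empty interior in the subspace topology, so would their
    countable union, which is all of \<open>K\<close>.\<close>
  have "\<exists>k\<in>K'. ?X interior_of (tr k) \<noteq> {}"
  proof (rule ccontr)
    assume no: "\<not> (\<exists>k\<in>K'. ?X interior_of (tr k) \<noteq> {})"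
    have "?X interior_of \<Union>(tr ` K') = {}"
    proof (rule Baire_category_alt)
      show "completely_metrizable_space ?X \<or> locally_compact_space ?X \<and> regular_space ?X" using lcX regX by blast
      show "countable (tr ` K')" using K'(1) by simp
      fix Z assume "Z \<in> tr ` K'"
      then obtain k where k: "k \<in> K'" "Z = tr k" by blast
      have "closedin (space_top M) (tr k)" using compM[OF trN] k K'(2) by blast
      then have "closedin ?X (tr k)" using trK k K'(2) by (meson closedin_subset_topspace subsetD)
      then show "closedin ?X Z \<and> ?X interior_of Z = {}" using k no by blast
    qed
    then have "K = {}" unfolding cover by (metis interior_of_topspace topX)
    then show False using subgroup.one_closed[OF K] by blast
  qed
  then obtain k where k: "k \<in> K" "?X interior_of (tr k) \<noteq> {}" using K'(2) by blast
  obtain Z where Z: "openin (space_top M) Z" "?X interior_of (tr k) = Z \<inter> K"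
    using openin_interior_of[of ?X "tr k"] unfolding openin_subtopology by blast
  obtain z where z: "z \<in> Z" "z \<in> K" using k(2) Z(2) by blast
  have ZK: "Z \<inter> K \<subseteq> tr k" using Z(2) interior_of_subset[of ?X "tr k"] by blast
  have zc: "z \<in> carrier G" and kc: "k \<in> carrier G" using z k Kc by auto
  \<comment> \<open>Translation by \<open>inv z\<close> moves the interior point \<open>z\<close> to
    the identity, so that \<open>?C1\<close> contains the points of \<open>K\<close> near the
    identity.\<close>
  let ?k' = "inv z \<otimes> k"
  have k'K: "?k' \<in> K" using z k by (intro subgroup.m_closed[OF K] subgroup.m_inv_closed[OF K])
  let ?C1 = "tr ?k'"
  have C1: "compactin (space_top N) ?C1" by (rule trN[OF k'K])
  \<comment> \<open>The part of this compact set outside \<open>A\<close> is closed in the group and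
    misses the identity, so it can be removed from the neighbourhood.\<close>
  have "compactin (space_top N) (?C1 \<inter> (topspace (space_top N) - A))"
    by (rule compact_Int_closedin[OF C1]) (use A(1) in blast)
  then have cl: "closedin (space_top M) (?C1 \<inter> (topspace (space_top N) - A))" by (rule compM)
  define B0 where "B0 = {x \<in> topspace (space_top M). z \<otimes> x \<in> Z}"
  have B0: "openin (space_top M) B0"
    unfolding B0_def by (rule openin_continuous_map_preimage[OF _ Z(1)]) (use smooth_left[OF zc] in \<open>simp add: smooth_map_def\<close>)
  show ?thesis
  proof (intro exI[of _ "B0 - (?C1 \<inter> (topspace (space_top N) - A))"] conjI)
    show "openin (space_top M) (B0 - (?C1 \<inter> (topspace (space_top N) - A)))" by (rule openin_diff[OF B0 cl])
    show "\<one> \<in> B0 - (?C1 \<inter> (topspace (space_top N) - A))"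
      using A(2) z zc points_mfd by (simp add: B0_def points_def)
    show "K \<inter> (B0 - (?C1 \<inter> (topspace (space_top N) - A))) \<subseteq> A"
    proof
      fix x assume x: "x \<in> K \<inter> (B0 - (?C1 \<inter> (topspace (space_top N) - A)))"
      then have xK: "x \<in> K" and xc: "x \<in> carrier G" using Kc by auto
      have "z \<otimes> x \<in> Z \<inter> K" using x z subgroup.m_closed[OF K] by (auto simp: B0_def)
      then obtain c where c: "c \<in> C" "z \<otimes> x = k \<otimes> c" using ZK unfolding tr_def by blast
      have "x = inv z \<otimes> (k \<otimes> c)" using c(2) inv_cancel[OF zc xc] by simp
      also have "\<dots> = ?k' \<otimes> c" using zc kc c(1) CK Kc by (simp add: m_assoc subset_iff)
      finally have "x \<in> ?C1" using c(1) unfolding tr_def by blast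
      then show "x \<in> A" using x xK ptsN by (auto simp: points_def)
    qed
  qed
qed

text \<open>Near the identity there are points of the fibre \<open>K\<close> in the direction \<open>\<xi>\<close>, up to a small relative error;
  they lie in the part of \<open>K\<close> that is close to \<open>\<one>\<close> in \<open>N\<close>, and this part is tangent to \<open>ker \<mu>\<close>.\<close>

lemma tangent_kernel:
  assumes sub: "lie_subgroup G K N"
    and Q: "smooth_manifold (quot_space M q)" and subm: "submersion M (quot_space M q) q"
    and fib: "\<And>g. g \<in> carrier G \<Longrightarrow> q g = q \<one> \<longleftrightarrow> g \<in> K"
    and \<mu>: "\<mu> \<in> dual_lie_algebra G"
    and van: "\<And>v. v \<in> tangent N \<one> \<Longrightarrow> \<mu> (tmap M (\<lambda>k. k) \<one> v) = 0"
    and \<xi>: "\<xi> \<in> lie_algebra G" "tmap (quot_space M q) q \<one> \<xi> = (\<lambda>_. 0)"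
  shows "\<mu> \<xi> = 0"
proof -
  let ?Q = "quot_space M q"
  have K: "subgroup K G" using sub unfolding lie_subgroup_def by blast
  have Kc: "K \<subseteq> carrier G" by (rule subgroup.subset[OF K])
  have LN: "lie_group (G\<lparr>carrier := K, mfd := N\<rparr>)" using sub unfolding lie_subgroup_def by blast
  have mN: "smooth_manifold N" and pN: "points N = K" using LN unfolding lie_group_def by simp_all
  have cN: "charted N" by (rule manifold_charted[OF mN])
  have imm: "immersion N M (\<lambda>k. k)" using sub unfolding lie_subgroup_def by blast
  have one: "\<one> \<in> points M" "\<one> \<in> points N" using points_mfd pN subgroup.one_closed[OF K] by simp_all
  have smN: "smooth_map N M (\<lambda>k. k)" using imm unfolding immersion_def by blast
  have injN: "inj_on (tmap M (\<lambda>k. k) \<one>) (tangent N \<one>)" using imm one(2) unfolding immersion_def by blast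
  have q: "smooth_map M ?Q q" by (rule smooth_map_quot)
  have cq: "continuous_map (space_top M) (space_top ?Q) q" using q unfolding smooth_map_def by blast
  have hausQ: "Hausdorff_space (space_top ?Q)" using Q unfolding smooth_manifold_def by (elim conjE)
  \<comment> \<open>\<open>K\<close> is a fibre of a continuous map into a Hausdorff space.\<close>
  have closed: "closedin (space_top M) K"
  proof -
    have "q \<one> \<in> topspace (space_top ?Q)" using smooth_map_in[OF q one(1)] by (simp add: points_def)
    then have "closedin (space_top ?Q) {q \<one>}" using closedin_Hausdorff_sing_eq[OF hausQ] by blast
    from closedin_continuous_map_preimage[OF cq this]
    have "closedin (space_top M) {g \<in> topspace (space_top M). q g \<in> {q \<one>}}" .
    moreover have "{g \<in> topspace (space_top M). q g \<in> {q \<one>}} = K"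
      using fib Kc points_mfd by (auto simp: points_def)
    ultimately show ?thesis by simp
  qed
  obtain U n x where ch: "chart M U n x" "\<one> \<in> U" by (rule charted_pointE[OF charted_M one(1)])
  have \<mu>': "\<mu> \<in> cotangent M \<one>" using \<mu> by (simp add: dual_lie_algebra_def)
  have \<xi>': "\<xi> \<in> tangent M \<one>" using \<xi> by (simp add: lie_algebra_def)
  have surj: "tmap ?Q q \<one> ` tangent M \<one> = tangent ?Q (q \<one>)" using subm one(1) unfolding submersion_def by blast
  define m where "m i = \<mu> (coord_vec M U x i \<one>)" for i
  define X where "X = (\<Sum>i<n. \<bar>\<xi> (\<lambda>q. x q i)\<bar>)"
  define mm where "mm = (\<Sum>i<n. \<bar>m i\<bar>)"
  have X0: "X \<ge> 0" "mm \<ge> 0" by (auto simp: X_def mm_def intro: sum_nonneg)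
  have \<mu>\<xi>: "\<mu> \<xi> = (\<Sum>i<n. \<xi> (\<lambda>q. x q i) * m i)" unfolding m_def by (rule cotangent_expand[OF charted_M \<mu>' ch \<xi>'])
  \<comment> \<open>Two estimates at one point \<open>g\<close> of \<open>K\<close> are compared:
    the displacement of \<open>g\<close> is \<open>t\<close> times \<xi> up to \<epsilon> t, and
    \<mu> of the displacement is small relative to it. Dividing by \<open>t\<close> leaves a bound
    that tends to 0 with \<epsilon>.\<close>
  have bound: "\<bar>\<mu> \<xi>\<bar> \<le> \<epsilon> * (X + 1 + mm)" if \<epsilon>: "0 < \<epsilon>" "\<epsilon> \<le> 1" for \<epsilon>
  proof -
    obtain A where A: "openin (space_top N) A" "\<one> \<in> A" "\<And>k. k \<in> A \<Longrightarrow>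
        \<bar>\<Sum>i<n. m i * (x k i - x \<one> i)\<bar> \<le> \<epsilon> * (\<Sum>i<n. \<bar>x k i - x \<one> i\<bar>)"
      using immersion_tangency[OF cN charted_M smN one(2) injN \<mu>' van ch \<epsilon>(1)] unfolding m_def by blast
    obtain B where B: "openin (space_top M) B" "\<one> \<in> B" "K \<inter> B \<subseteq> A"
      using lie_subgroup_open_nbhd[OF sub closed A(1,2)] by blast
    obtain \<delta> where \<delta>: "\<delta> > 0" "\<forall>t. \<bar>t\<bar> < \<delta> \<longrightarrow> (\<exists>g\<in>U. q g = q \<one> \<and>
        (\<Sum>i<n. \<bar>x g i - x \<one> i - t * \<xi> (\<lambda>q. x q i)\<bar>) \<le> \<epsilon> * \<bar>t\<bar>)"
      using submersion_fibre_points[OF charted_M manifold_charted[OF Q] q one(1) surj \<xi>' \<xi>(2) ch \<epsilon>(1)]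
      by (elim exE conjE) (rule that; assumption)
    have BU: "openin (space_top M) (B \<inter> U)" using B chart_open[OF ch(1)] by blast
    have xBU: "openin (Euclidean_space n) (x ` (B \<inter> U))" by (rule chart_open_image[OF ch(1) BU]) blast
    have "x \<one> \<in> x ` (B \<inter> U)" using B(2) ch(2) by blast
    then obtain r where r: "r > 0" "nbox n (x \<one>) r \<subseteq> x ` (B \<inter> U)" using xBU unfolding openin_Euclidean_iff by blast
    \<comment> \<open>Below \<delta>, so that a fibre point exists, and small enough that its
      coordinates remain in the box of radius \<open>r\<close> over
      \<open>B \<inter> U\<close>.\<close>
    define t where "t = min (\<delta> / 2) (r / (2 * (X + 1)))"
    have t: "t > 0" "\<bar>t\<bar> < \<delta>" using \<delta>(1) r(1) X0 by (auto simp: t_def min_less_iff_disj)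
    have tr: "t * (X + 1) < r"
    proof -
      have "t \<le> r / (2 * (X + 1))" by (simp add: t_def)
      then have "t * (2 * (X + 1)) \<le> r" using X0 by (simp add: pos_le_divide_eq)
      then show ?thesis using r(1) t(1) X0 by (smt (verit) mult.commute mult_pos_pos distrib_left)
    qed
    obtain g where g: "g \<in> U" "q g = q \<one>" "(\<Sum>i<n. \<bar>x g i - x \<one> i - t * \<xi> (\<lambda>q. x q i)\<bar>) \<le> \<epsilon> * \<bar>t\<bar>"
      using \<delta>(2)[rule_format, OF t(2)] by (elim bexE conjE) (rule that; assumption)
    have gc: "g \<in> carrier G" using g(1) chart_subset[OF ch(1)] points_mfd by blast
    have gK: "g \<in> K" using fib[OF gc] g(2) by blast
    have sumx: "(\<Sum>i<n. \<bar>x g i - x \<one> i\<bar>) \<le> t * (X + \<epsilon>)"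
    proof -
      have "(\<Sum>i<n. \<bar>x g i - x \<one> i\<bar>) \<le> (\<Sum>i<n. \<bar>x g i - x \<one> i - t * \<xi> (\<lambda>q. x q i)\<bar> + t * \<bar>\<xi> (\<lambda>q. x q i)\<bar>)"
      proof (rule sum_mono)
        fix i
        have "t * \<bar>\<xi> (\<lambda>q. x q i)\<bar> = \<bar>t * \<xi> (\<lambda>q. x q i)\<bar>" using t(1) by (simp add: abs_mult)
        then show "\<bar>x g i - x \<one> i\<bar> \<le> \<bar>x g i - x \<one> i - t * \<xi> (\<lambda>q. x q i)\<bar> + t * \<bar>\<xi> (\<lambda>q. x q i)\<bar>" by linarith
      qed
      also have "\<dots> \<le> \<epsilon> * t + t * X" using g(3) t(1) by (simp add: sum.distrib X_def sum_distrib_left)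
      finally show ?thesis by (simp add: algebra_simps)
    qed
    have "x g \<in> nbox n (x \<one>) r"
      unfolding nbox_def
    proof (intro CollectI conjI allI impI chart_Rn[OF ch(1) g(1)])
      fix i assume "i < n"
      then have "\<bar>x g i - x \<one> i\<bar> \<le> (\<Sum>i<n. \<bar>x g i - x \<one> i\<bar>)"
        by (intro member_le_sum[of i _ "\<lambda>i. \<bar>x g i - x \<one> i\<bar>"]) auto
      also have "\<dots> \<le> t * (X + \<epsilon>)" by (rule sumx)
      also have "\<dots> \<le> t * (X + 1)" using t(1) \<epsilon>(2) by (intro mult_left_mono) auto
      finally show "\<bar>x g i - x \<one> i\<bar> < r" using tr by linarith
    qed
    then have "x g \<in> x ` (B \<inter> U)" using r(2) by blast
    then have "g \<in> B" using inj_on_image_mem_iff[OF chart_inj[OF ch(1)] g(1), of "B \<inter> U"] by blast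
    then have gA: "g \<in> A" using gK B(3) by blast
    have "(\<Sum>i<n. m i * (x g i - x \<one> i)) = t * \<mu> \<xi> + (\<Sum>i<n. m i * (x g i - x \<one> i - t * \<xi> (\<lambda>q. x q i)))"
      unfolding \<mu>\<xi> sum_distrib_left sum.distrib[symmetric] by (intro sum.cong refl) (simp add: algebra_simps)
    moreover have "\<bar>\<Sum>i<n. m i * (x g i - x \<one> i - t * \<xi> (\<lambda>q. x q i))\<bar> \<le> mm * (\<epsilon> * t)"
    proof -
      have "\<bar>\<Sum>i<n. m i * (x g i - x \<one> i - t * \<xi> (\<lambda>q. x q i))\<bar> \<le> (\<Sum>i<n. \<bar>m i\<bar> * \<bar>x g i - x \<one> i - t * \<xi> (\<lambda>q. x q i)\<bar>)"
        by (rule order_trans[OF sum_abs]) (simp add: abs_mult)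
      also have "\<dots> \<le> (\<Sum>i<n. mm * \<bar>x g i - x \<one> i - t * \<xi> (\<lambda>q. x q i)\<bar>)"
      proof (intro sum_mono mult_right_mono)
        fix i assume "i \<in> {..<n}"
        then show "\<bar>m i\<bar> \<le> mm" unfolding mm_def by (intro member_le_sum[of i _ "\<lambda>i. \<bar>m i\<bar>"]) auto
      qed simp
      also have "\<dots> = mm * (\<Sum>i<n. \<bar>x g i - x \<one> i - t * \<xi> (\<lambda>q. x q i)\<bar>)" by (simp add: sum_distrib_left)
      also have "\<dots> \<le> mm * (\<epsilon> * t)" using g(3) t(1) X0 by (intro mult_left_mono) auto
      finally show ?thesis .
    qed
    moreover have "\<bar>\<Sum>i<n. m i * (x g i - x \<one> i)\<bar> \<le> \<epsilon> * (t * (X + \<epsilon>))"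
      using A(3)[OF gA] sumx mult_left_mono[OF sumx, of \<epsilon>] \<epsilon>(1) by linarith
    ultimately have "\<bar>t * \<mu> \<xi>\<bar> \<le> \<epsilon> * (t * (X + \<epsilon>)) + mm * (\<epsilon> * t)" by linarith
    then have "t * \<bar>\<mu> \<xi>\<bar> \<le> t * (\<epsilon> * (X + \<epsilon> + mm))" using t(1) by (simp add: abs_mult algebra_simps)
    then have "\<bar>\<mu> \<xi>\<bar> \<le> \<epsilon> * (X + \<epsilon> + mm)" using t(1) by simp
    also have "\<dots> \<le> \<epsilon> * (X + 1 + mm)" using \<epsilon> by (intro mult_left_mono) auto
    finally show ?thesis .
  qed
  have "\<bar>\<mu> \<xi>\<bar> \<le> 0 + \<epsilon>" if \<epsilon>: "0 < \<epsilon>" for \<epsilon>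
  proof -
    define c where "c = X + 1 + mm"
    have c: "c > 0" using X0 by (simp add: c_def)
    have "\<bar>\<mu> \<xi>\<bar> \<le> min 1 (\<epsilon> / c) * c" unfolding c_def using bound[of "min 1 (\<epsilon> / c)"] \<epsilon> c by (simp add: c_def)
    also have "\<dots> \<le> \<epsilon> / c * c" using c by (intro mult_right_mono) auto
    finally show ?thesis using c by simp
  qed
  then have "\<bar>\<mu> \<xi>\<bar> \<le> 0" by (rule field_le_epsilon)
  then show ?thesis by simp
qed

end

section \<open>The contact form on the quotient\<close>

text \<open>In the local representation \<open>f(p, q) = F(z)\<close>, with \<open>z\<close> made of functions of \<open>p\<close> and functions of \<open>q\<close>,
  both iterated derivatives are the same combination of second partial derivatives of \<open>F\<close>.\<close>

lemma slot_commute: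
  assumes M: "charted M" and N: "charted N" and f: "smooth_fun (prod_space M N) W f" and pq: "(p0, q0) \<in> W"
    and \<xi>: "\<xi> \<in> tangent M p0" and \<zeta>: "\<zeta> \<in> tangent N q0"
  shows "\<xi> (\<lambda>p. \<zeta> (\<lambda>q. f (p, q))) = \<zeta> (\<lambda>q. \<xi> (\<lambda>p. f (p, q)))"
proof -
  obtain U V m n a b D F where *: "openin (space_top M) U" "p0 \<in> U" "openin (space_top N) V" "q0 \<in> V" "U \<times> V \<subseteq> W"
    "\<And>i. i < m \<Longrightarrow> smooth_fun M U (a i)" "\<And>j. j < n \<Longrightarrow> smooth_fun N V (b j)" "smooth_Rn (m + n) D F"
    "\<And>p' q'. p' \<in> U \<Longrightarrow> q' \<in> V \<Longrightarrow>
      (\<lambda>i. if i < m + n then (if i < m then a i p' else b (i - m) q') else 0) \<in> D \<and>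
      f (p', q') = F (\<lambda>i. if i < m + n then (if i < m then a i p' else b (i - m) q') else 0)"
    by (rule smooth_fun_prodE[OF f pq]) (rule that; assumption)
  have p0: "p0 \<in> points M" by (rule tangent_points[OF \<xi>])
  have q0: "q0 \<in> points N" by (rule tangent_points[OF \<zeta>])
  \<comment> \<open>Components that do not depend on the differentiated slot contribute 0; this is
    the default in \<open>c\<close> and in \<open>d\<close>.\<close>
  define c where "c i = (if i < m then \<xi> (a i) else 0)" for i
  define d where "d i = (if i < m then 0 else \<zeta> (b (i - m)))" for i
  let ?z = "\<lambda>p q i. if i < m + n then (if i < m then a i p else b (i - m) q) else 0"
  have near_p: "smooth_near M p0 (\<lambda>p. if i < m then a i p else b (i - m) q)" for i q
    using smooth_nearI[OF *(2) *(6)] smooth_near_const[OF M p0] by (cases "i < m") simp_all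
  have near_q: "smooth_near N q0 (\<lambda>q. if i < m then a i p else b (i - m) q)" if "i < m + n" for i p
    using smooth_nearI[OF *(4) *(7), of "i - m"] smooth_near_const[OF N q0] that by (cases "i < m") simp_all
  have zD: "?z p q \<in> D" if "p \<in> U" "q \<in> V" for p q using *(9)[OF that] by blast
  have vp: "\<xi> (\<lambda>p. if i < m then a i p else b (i - m) q) = c i" for i q
    by (cases "i < m") (simp_all add: c_def tangent_const[OF \<xi>])
  have vq: "\<zeta> (\<lambda>q. if i < m then a i p else b (i - m) q) = d i" for i p
    by (cases "i < m") (simp_all add: d_def tangent_const[OF \<zeta>])
  have dp: "\<xi> (\<lambda>p. H (?z p q)) = (\<Sum>i<m + n. partial_deriv i H (?z p0 q) * c i)"
    if q: "q \<in> V" and H: "smooth_Rn (m + n) D H" for q H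
    using tangent_compose[where f = "\<lambda>i p. if i < m then a i p else b (i - m) q" and D = D, OF M \<xi> near_p H zD[OF *(2) q]]
    unfolding vp .
  have dq: "\<zeta> (\<lambda>q. H (?z p q)) = (\<Sum>i<m + n. partial_deriv i H (?z p q0) * d i)"
    if p: "p \<in> U" and H: "smooth_Rn (m + n) D H" for p H
    using tangent_compose[where f = "\<lambda>i q. if i < m then a i p else b (i - m) q" and D = D, OF N \<zeta> near_q H zD[OF p *(4)]]
    unfolding vq .
  have sp: "smooth_near M p0 (\<lambda>p. H (?z p q0))" if H: "smooth_Rn (m + n) D H" for H
    by (rule smooth_near_compose[where f = "\<lambda>i p. if i < m then a i p else b (i - m) q0" and D = D, OF M p0 near_p H zD[OF *(2,4)]])
  have sq: "smooth_near N q0 (\<lambda>q. H (?z p0 q))" if H: "smooth_Rn (m + n) D H" for H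
    by (rule smooth_near_compose[where f = "\<lambda>i q. if i < m then a i p0 else b (i - m) q" and D = D, OF N q0 near_q H zD[OF *(2,4)]])
  note P = smooth_Rn_partial[OF *(8)]
  have "\<zeta> (\<lambda>q. f (p, q)) = (\<Sum>j<m + n. d j * partial_deriv j F (?z p q0))" if "p \<in> U" for p
  proof -
    have "\<zeta> (\<lambda>q. f (p, q)) = \<zeta> (\<lambda>q. F (?z p q))"
      by (rule tangent_near_cong[OF charted_local[OF N] \<zeta> *(3,4)]) (use *(9)[OF that] in blast)
    then show ?thesis unfolding dq[OF that *(8)] by (simp add: mult.commute)
  qed
  then have "\<xi> (\<lambda>p. \<zeta> (\<lambda>q. f (p, q))) = \<xi> (\<lambda>p. \<Sum>j<m + n. d j * partial_deriv j F (?z p q0))"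
    by (rule tangent_near_cong[OF charted_local[OF M] \<xi> *(1,2)])
  also have "\<dots> = (\<Sum>j<m + n. \<xi> (\<lambda>p. d j * partial_deriv j F (?z p q0)))"
    by (rule tangent_sum[OF M \<xi>]) (rule smooth_near_cmult[OF M sp[OF P]])
  also have "\<dots> = (\<Sum>j<m + n. d j * (\<Sum>i<m + n. partial_deriv i (partial_deriv j F) (?z p0 q0) * c i))"
    by (intro sum.cong refl) (simp only: lessThan_iff tangent_cmult[OF M \<xi> sp[OF P]] dp[OF *(4) P])
  finally have 1: "\<xi> (\<lambda>p. \<zeta> (\<lambda>q. f (p, q))) =
    (\<Sum>j<m + n. \<Sum>i<m + n. d j * (partial_deriv i (partial_deriv j F) (?z p0 q0) * c i))"
    by (simp only: sum_distrib_left)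
  have "\<xi> (\<lambda>p. f (p, q)) = (\<Sum>j<m + n. c j * partial_deriv j F (?z p0 q))" if "q \<in> V" for q
  proof -
    have "\<xi> (\<lambda>p. f (p, q)) = \<xi> (\<lambda>p. F (?z p q))"
      by (rule tangent_near_cong[OF charted_local[OF M] \<xi> *(1,2)]) (use *(9)[OF _ that] in blast)
    then show ?thesis unfolding dp[OF that *(8)] by (simp add: mult.commute)
  qed
  then have "\<zeta> (\<lambda>q. \<xi> (\<lambda>p. f (p, q))) = \<zeta> (\<lambda>q. \<Sum>j<m + n. c j * partial_deriv j F (?z p0 q))"
    by (rule tangent_near_cong[OF charted_local[OF N] \<zeta> *(3,4)])
  also have "\<dots> = (\<Sum>j<m + n. \<zeta> (\<lambda>q. c j * partial_deriv j F (?z p0 q)))"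
    by (rule tangent_sum[OF N \<zeta>]) (rule smooth_near_cmult[OF N sq[OF P]])
  also have "\<dots> = (\<Sum>j<m + n. c j * (\<Sum>i<m + n. partial_deriv i (partial_deriv j F) (?z p0 q0) * d i))"
    by (intro sum.cong refl) (simp only: lessThan_iff tangent_cmult[OF N \<zeta> sq[OF P]] dq[OF *(2) P])
  also have "\<dots> = (\<Sum>j<m + n. \<Sum>i<m + n. c j * (partial_deriv i (partial_deriv j F) (?z p0 q0) * d i))"
    by (simp only: sum_distrib_left)
  \<comment> \<open>With the summations exchanged, the two expressions agree term by term through
    the symmetry of second partial derivatives.\<close>
  also have "\<dots> = (\<Sum>i<m + n. \<Sum>j<m + n. c j * (partial_deriv i (partial_deriv j F) (?z p0 q0) * d i))"
    by (rule sum.swap)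
  also have "\<dots> = (\<Sum>j<m + n. \<Sum>i<m + n. d j * (partial_deriv i (partial_deriv j F) (?z p0 q0) * c i))"
  proof (intro sum.cong refl)
    fix i j assume ij: "i \<in> {..<m + n}" "j \<in> {..<m + n}"
    have "Ck_Rn (m + n) (Suc (Suc 0)) D F" "openin (Euclidean_space (m + n)) D"
      using *(8) unfolding smooth_Rn_def by (blast, blast)
    then show "c j * (partial_deriv i (partial_deriv j F) (?z p0 q0) * d i) = d i * (partial_deriv j (partial_deriv i F) (?z p0 q0) * c j)"
      using partial_deriv_commute[of "m + n" D 0 F "?z p0 q0" i j] zD[OF *(2,4)] ij by simp
  qed
  finally show ?thesis unfolding 1 by (rule sym)
qed

text \<open>In the local expression every argument depends on only one of \<open>A\<close> and
  \<open>B\<close>, so the chain rule sum splits into the two sums in which the other map is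
  frozen.\<close>

lemma diagonal_derivative:
  assumes L: "charted L" and M: "charted M" and N: "charted N" and f: "smooth_fun (prod_space M N) W f" and pq: "(A l, B l) \<in> W"
    and A: "smooth_map L M A" and B: "smooth_map L N B" and v: "v \<in> tangent L l"
  shows "v (\<lambda>x. f (A x, B x)) = v (\<lambda>x. f (A x, B l)) + v (\<lambda>x. f (A l, B x))"
proof -
  obtain U V m n a b D F where *: "openin (space_top M) U" "A l \<in> U" "openin (space_top N) V" "B l \<in> V" "U \<times> V \<subseteq> W"
    "\<And>i. i < m \<Longrightarrow> smooth_fun M U (a i)" "\<And>j. j < n \<Longrightarrow> smooth_fun N V (b j)" "smooth_Rn (m + n) D F"
    "\<And>p' q'. p' \<in> U \<Longrightarrow> q' \<in> V \<Longrightarrow>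
      (\<lambda>i. if i < m + n then (if i < m then a i p' else b (i - m) q') else 0) \<in> D \<and>
      f (p', q') = F (\<lambda>i. if i < m + n then (if i < m then a i p' else b (i - m) q') else 0)"
    by (rule smooth_fun_prodE[OF f pq]) (rule that; assumption)
  have l: "l \<in> points L" by (rule tangent_points[OF v])
  let ?z = "\<lambda>p q i. if i < m + n then (if i < m then a i p else b (i - m) q) else 0"
  define X where "X = {x \<in> topspace (space_top L). A x \<in> U} \<inter> {x \<in> topspace (space_top L). B x \<in> V}"
  have "openin (space_top L) X" unfolding X_def
    by (intro openin_Int openin_continuous_map_preimage[OF _ *(1)] openin_continuous_map_preimage[OF _ *(3)])
      (use A B in \<open>auto simp: smooth_map_def\<close>)
  then have X: "openin (space_top L) X" "l \<in> X" using l *(2,4) by (simp_all add: X_def points_def)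
  have sa: "smooth_near L l (\<lambda>x. a i (A x))" if "i < m" for i
    by (rule smooth_map_near[OF A l]) (rule smooth_nearI[OF *(2) *(6)[OF that]])
  have sb: "smooth_near L l (\<lambda>x. b i (B x))" if "i < n" for i
    by (rule smooth_map_near[OF B l]) (rule smooth_nearI[OF *(4) *(7)[OF that]])
  have zD: "?z p q \<in> D" if "p \<in> U" "q \<in> V" for p q using *(9)[OF that] by blast
  have chain: "v (\<lambda>x. f (A' x, B' x)) = (\<Sum>i<m + n. partial_deriv i F (?z (A l) (B l)) *
      v (\<lambda>x. if i < m then a i (A' x) else b (i - m) (B' x)))"
    if s: "\<And>i. i < m + n \<Longrightarrow> smooth_near L l (\<lambda>x. if i < m then a i (A' x) else b (i - m) (B' x))"
      and X': "\<And>x. x \<in> X \<Longrightarrow> A' x \<in> U \<and> B' x \<in> V" and l': "A' l = A l" "B' l = B l" for A' B'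
  proof -
    have "v (\<lambda>x. f (A' x, B' x)) = v (\<lambda>x. F (?z (A' x) (B' x)))"
      by (rule tangent_near_cong[OF charted_local[OF L] v X]) (use *(9) X' in blast)
    also have "\<dots> = (\<Sum>i<m + n. partial_deriv i F (?z (A' l) (B' l)) * v (\<lambda>x. if i < m then a i (A' x) else b (i - m) (B' x)))"
      by (rule tangent_compose[where f = "\<lambda>i x. if i < m then a i (A' x) else b (i - m) (B' x)" and D = D, OF L v s *(8)])
        (use zD X' X(2) in blast)+
    finally show ?thesis unfolding l' .
  qed
  have XUV: "A x \<in> U" "B x \<in> V" if "x \<in> X" for x using that by (auto simp: X_def)
  have s1: "smooth_near L l (\<lambda>x. if i < m then a i (A x) else b (i - m) (B x))" if "i < m + n" for i
    using sa[of i] sb[of "i - m"] that by (cases "i < m") simp_all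
  have s2: "smooth_near L l (\<lambda>x. if i < m then a i (A x) else b (i - m) (B l))" if "i < m + n" for i
    using sa[of i] smooth_near_const[OF L l] that by (cases "i < m") simp_all
  have s3: "smooth_near L l (\<lambda>x. if i < m then a i (A l) else b (i - m) (B x))" if "i < m + n" for i
    using sb[of "i - m"] smooth_near_const[OF L l] that by (cases "i < m") simp_all
  have c1: "v (\<lambda>x. f (A x, B x)) = (\<Sum>i<m + n. partial_deriv i F (?z (A l) (B l)) *
      v (\<lambda>x. if i < m then a i (A x) else b (i - m) (B x)))"
    by (rule chain) (use XUV in \<open>auto intro: s1\<close>)
  have c2: "v (\<lambda>x. f (A x, B l)) = (\<Sum>i<m + n. partial_deriv i F (?z (A l) (B l)) *
      v (\<lambda>x. if i < m then a i (A x) else b (i - m) (B l)))"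
    by (rule chain) (use XUV *(4) in \<open>auto intro: s2\<close>)
  have c3: "v (\<lambda>x. f (A l, B x)) = (\<Sum>i<m + n. partial_deriv i F (?z (A l) (B l)) *
      v (\<lambda>x. if i < m then a i (A l) else b (i - m) (B x)))"
    by (rule chain) (use XUV *(2) in \<open>auto intro: s3\<close>)
  show ?thesis unfolding c1 c2 c3 sum.distrib[symmetric]
  proof (intro sum.cong refl)
    fix i
    show "partial_deriv i F (?z (A l) (B l)) * v (\<lambda>x. if i < m then a i (A x) else b (i - m) (B x)) =
      partial_deriv i F (?z (A l) (B l)) * v (\<lambda>x. if i < m then a i (A x) else b (i - m) (B l)) +
      partial_deriv i F (?z (A l) (B l)) * v (\<lambda>x. if i < m then a i (A l) else b (i - m) (B x))"
      by (cases "i < m") (simp_all add: tangent_const[OF v])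
  qed
qed

context lie
begin

section \<open>Derivatives of the group operations at the identity\<close>

lemma smooth_fun_mult:
  assumes "smooth_fun M V u"
  shows "smooth_fun (prod_space M M) {p \<in> points (prod_space M M). (case p of (a, b) \<Rightarrow> a \<otimes> b) \<in> V} (\<lambda>p. u (fst p \<otimes> snd p))"
proof -
  have "smooth_fun (prod_space M M) {p \<in> points (prod_space M M). (case p of (a, b) \<Rightarrow> a \<otimes> b) \<in> V} (u \<circ> (\<lambda>(a, b). a \<otimes> b))"
    using mult_smooth assms unfolding smooth_map_def by blast
  moreover have "u \<circ> (\<lambda>(a, b). a \<otimes> b) = (\<lambda>p. u (fst p \<otimes> snd p))" by (simp add: fun_eq_iff split_beta)
  ultimately show ?thesis by (simp only:)
qed

text \<open>Both sides are the mixed second derivative of \<open>f (h \<otimes> k)\<close> at the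
  identity: left-invariant and right-invariant fields commute.\<close>

lemma left_right_commute:
  assumes f: "smooth_near M \<one> f" and \<xi>: "\<xi> \<in> lie_algebra G" and \<zeta>: "\<zeta> \<in> lie_algebra G"
  shows "\<xi> (\<lambda>h. Lv \<zeta> h f) = \<zeta> (\<lambda>h. Rv \<xi> h f)"
proof -
  have t: "\<xi> \<in> tangent M \<one>" "\<zeta> \<in> tangent M \<one>" using \<xi> \<zeta> by (simp_all add: lie_algebra_def)
  obtain V where V: "openin (space_top M) V" "\<one> \<in> V" "smooth_fun M V f" by (rule smooth_nearE_open[OF local_M f])
  have Vc: "h \<in> carrier G" "smooth_near M h f" if "h \<in> V" for h
    using openin_subset[OF V(1)] points_mfd smooth_nearI[OF that V(3)] that by (auto simp: points_def)
  have "\<xi> (\<lambda>h. Lv \<zeta> h f) = \<xi> (\<lambda>h. \<zeta> (\<lambda>k. f (fst (h, k) \<otimes> snd (h, k))))"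
    by (rule tangent_near_cong[OF local_M t(1) V(1,2)]) (simp add: Lv_apply[OF Vc])
  also have "\<dots> = \<zeta> (\<lambda>k. \<xi> (\<lambda>h. f (fst (h, k) \<otimes> snd (h, k))))"
    by (rule slot_commute[OF charted_M charted_M smooth_fun_mult[OF V(3)] _ t]) (use V(2) points_mfd in \<open>simp add: points_prod\<close>)
  also have "\<dots> = \<zeta> (\<lambda>h. Rv \<xi> h f)"
    by (rule tangent_near_cong[OF local_M t(2) V(1,2)]) (simp add: Rv_apply[OF Vc])
  finally show ?thesis .
qed

text \<open>Differentiate the constant function \<open>u (x \<otimes> inv x)\<close> by
  \<open>diagonal_derivative\<close>.\<close>

lemma derivative_inverse:
  assumes u: "smooth_near M \<one> u" and \<xi>: "\<xi> \<in> lie_algebra G"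
  shows "\<xi> (\<lambda>h. u (inv h)) = - \<xi> u"
proof -
  have t: "\<xi> \<in> tangent M \<one>" using \<xi> by (simp add: lie_algebra_def)
  obtain V where V: "openin (space_top M) V" "\<one> \<in> V" "smooth_fun M V u" by (rule smooth_nearE_open[OF local_M u])
  have "\<xi> (\<lambda>x. u (fst (x, inv x) \<otimes> snd (x, inv x)))
      = \<xi> (\<lambda>x. u (fst (x, inv \<one>) \<otimes> snd (x, inv \<one>))) + \<xi> (\<lambda>x. u (fst (\<one>, inv x) \<otimes> snd (\<one>, inv x)))"
    by (rule diagonal_derivative[where A = "\<lambda>x. x" and B = "\<lambda>x. inv x", OF charted_M charted_M charted_M smooth_fun_mult[OF V(3)] _
        smooth_map_ident[OF open_M] inv_smooth t]) (use V(2) points_mfd in \<open>simp add: points_prod\<close>)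
  moreover have "\<xi> (\<lambda>x. u (fst (x, inv x) \<otimes> snd (x, inv x))) = \<xi> (\<lambda>x. u \<one>)"
    by (rule tangent_near_cong[OF local_M t openin_carrier]) simp_all
  moreover have "\<xi> (\<lambda>x. u (fst (x, inv \<one>) \<otimes> snd (x, inv \<one>))) = \<xi> u"
    by (rule tangent_near_cong[OF local_M t openin_carrier]) simp_all
  moreover have "\<xi> (\<lambda>x. u (fst (\<one>, inv x) \<otimes> snd (\<one>, inv x))) = \<xi> (\<lambda>h. u (inv h))"
    by (rule tangent_near_cong[OF local_M t openin_carrier]) simp_all
  ultimately show ?thesis using tangent_const[OF t, of "u \<one>"] by linarith
qed

text \<open>This is \<open>\<langle>\<mu>, [\<xi>, \<zeta>]\<rangle>\<close>, the bracket being the derivative of \<open>Ad\<close> at the identity.\<close>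

definition coad_form :: "'g covec \<Rightarrow> 'g tvec \<Rightarrow> 'g tvec \<Rightarrow> real" where
  "coad_form \<mu> \<xi> \<zeta> = \<xi> (\<lambda>h. \<mu> (Ad G h \<zeta>))"

lemma one_carrier_points: "\<one> \<in> points M" using points_mfd by simp

lemma coad_form_add_right:
  assumes \<mu>: "\<mu> \<in> dual_lie_algebra G" and \<xi>: "\<xi> \<in> lie_algebra G" and \<zeta>: "\<zeta> \<in> lie_algebra G" "\<zeta>' \<in> lie_algebra G"
  shows "coad_form \<mu> \<xi> (\<lambda>f. \<zeta> f + \<zeta>' f) = coad_form \<mu> \<xi> \<zeta> + coad_form \<mu> \<xi> \<zeta>'"
proof -
  have t: "\<xi> \<in> tangent M \<one>" using \<xi> by (simp add: lie_algebra_def)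
  have "\<mu> (Ad G h (\<lambda>f. \<zeta> f + \<zeta>' f)) = \<mu> (Ad G h \<zeta>) + \<mu> (Ad G h \<zeta>')" if h: "h \<in> carrier G" for h
  proof -
    have "Ad G h (\<lambda>f. \<zeta> f + \<zeta>' f) = (\<lambda>f. 1 * Ad G h \<zeta> f + 1 * Ad G h \<zeta>' f)"
      unfolding Ad_def tmap_lincomb[symmetric] by simp
    then show ?thesis using dual_lincomb[OF \<mu> Ad_closed[OF \<zeta>(1) h] Ad_closed[OF \<zeta>(2) h], of 1 1] by simp
  qed
  then have "coad_form \<mu> \<xi> (\<lambda>f. \<zeta> f + \<zeta>' f) = \<xi> (\<lambda>h. \<mu> (Ad G h \<zeta>) + \<mu> (Ad G h \<zeta>'))"
    unfolding coad_form_def by (rule tangent_near_cong[OF local_M t openin_carrier one_closed])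
  also have "\<dots> = coad_form \<mu> \<xi> \<zeta> + coad_form \<mu> \<xi> \<zeta>'" unfolding coad_form_def
    by (rule tangent_add[OF charted_M t Ad_smooth[OF \<mu> \<zeta>(1) one_closed] Ad_smooth[OF \<mu> \<zeta>(2) one_closed]])
  finally show ?thesis .
qed

text \<open>The coadjoint action involves the inverse of the group element, which changes only the
  sign. The isotropy algebra is thus the left radical of \<open>coad_form\<close>.\<close>

lemma isotropy_iff:
  assumes \<mu>: "\<mu> \<in> dual_lie_algebra G" and \<xi>: "\<xi> \<in> lie_algebra G"
  shows "\<xi> \<in> isotropy_algebra G \<mu> \<longleftrightarrow> (\<forall>\<zeta>\<in>lie_algebra G. coad_form \<mu> \<xi> \<zeta> = 0)"
proof -
  have "\<xi> (\<lambda>h. Ad_star G (inv h) \<mu> \<zeta>) = - coad_form \<mu> \<xi> \<zeta>" if \<zeta>: "\<zeta> \<in> lie_algebra G" for \<zeta>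
    using derivative_inverse[OF Ad_smooth[OF \<mu> \<zeta> one_closed] \<xi>] \<zeta> by (simp add: Ad_star_def coad_form_def)
  then show ?thesis using \<xi> by (simp add: isotropy_algebra_def)
qed

lemma coset_eq_iff:
  assumes K: "subgroup K G" and g: "g \<in> carrier G" and h: "h \<in> carrier G"
  shows "K #> g = K #> h \<longleftrightarrow> (\<exists>k\<in>K. h = k \<otimes> g)"
proof
  assume "K #> g = K #> h"
  then have "h \<in> K #> g" using rcos_self[OF h K] by simp
  then show "\<exists>k\<in>K. h = k \<otimes> g" unfolding r_coset_def by blast
next
  assume "\<exists>k\<in>K. h = k \<otimes> g"
  then have "h \<in> K #> g" unfolding r_coset_def by blast
  then show "K #> g = K #> h" by (rule repr_independence[OF _ g K])
qed

end

locale ray_reduction = lie_section G \<sigma> for G :: "'g lie_grp" (structure) and \<sigma> +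
  fixes \<mu> :: "'g covec" and K :: "'g set"
  assumes mu: "\<mu> \<in> dual_lie_algebra G" "\<mu> \<noteq> (\<lambda>_. 0)"
    and kernel: "kernel_group G \<mu> K"
    and span: "{\<lambda>f. \<xi> f + \<zeta> f | \<xi> \<zeta>. \<xi> \<in> lie_algebra G \<and> \<mu> \<xi> = 0 \<and> \<zeta> \<in> isotropy_algebra G \<mu>} = lie_algebra G"
begin

text \<open>The contact form pulled back to the group is \<open>fac\<close> times the
  right-invariant covector field of \<mu>.\<close>

definition fac :: "'g \<Rightarrow> real" where "fac g = f_sigma M \<sigma> (g, rcov \<mu> g)"

lemma fac_pos: "g \<in> carrier G \<Longrightarrow> fac g > 0"
  unfolding fac_def by (rule f_sigma_pos[OF rcov_Sl[OF mu]])

lemma K_subgroup: "subgroup K G"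
  using kernel unfolding kernel_group_def lie_subgroup_def by blast

lemma K_carrier: "k \<in> K \<Longrightarrow> k \<in> carrier G"
  using subgroup.subset[OF K_subgroup] by blast

lemma K_isotropy: "k \<in> K \<Longrightarrow> Ad_star G (inv k) \<mu> = \<mu>"
proof -
  have "K \<subseteq> coad_isotropy G \<mu>"
    using normal_imp_subgroup[of K "G\<lparr>carrier := coad_isotropy G \<mu>\<rparr>"] kernel subgroup.subset unfolding kernel_group_def by fastforce
  then show "k \<in> K \<Longrightarrow> Ad_star G (inv k) \<mu> = \<mu>" unfolding coad_isotropy_def by blast
qed

lemma left_lift_K: "k \<in> K \<Longrightarrow> g \<in> carrier G \<Longrightarrow> left_lift G k (g, rcov \<mu> g) = (k \<otimes> g, rcov \<mu> (k \<otimes> g))"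
  using left_lift_rcov[OF K_carrier] K_isotropy by simp

lemma fac_left: "k \<in> K \<Longrightarrow> g \<in> carrier G \<Longrightarrow> fac (k \<otimes> g) = fac g"
  unfolding fac_def using f_sigma_left[OF K_carrier rcov_Sl[OF mu]] left_lift_K by metis

lemma rcov_left:
  assumes k: "k \<in> K" and v: "v \<in> tangent M g"
  shows "rcov \<mu> (k \<otimes> g) (tmap M (\<lambda>x. k \<otimes> x) g v) = rcov \<mu> g v"
proof -
  have g: "g \<in> carrier G" using tangent_points[OF v] points_mfd by simp
  have kc: "k \<in> carrier G" by (rule K_carrier[OF k])
  let ?w = "tmap M (\<lambda>x. k \<otimes> x) g v"
  have w: "?w \<in> tangent M (k \<otimes> g)" by (rule tmap_tangent[OF smooth_left[OF kc] v])
  have "rcov \<mu> (k \<otimes> g) = (\<lambda>w. if w \<in> tangent M (k \<otimes> g) then rcov \<mu> g (tmap M (\<lambda>x. inv k \<otimes> x) (k \<otimes> g) w) else 0)"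
    using left_lift_K[OF k g] unfolding left_lift_eq by simp
  then have "rcov \<mu> (k \<otimes> g) ?w = rcov \<mu> g (tmap M (\<lambda>x. inv k \<otimes> x) (k \<otimes> g) ?w)" using w by simp
  also have "tmap M (\<lambda>x. inv k \<otimes> x) (k \<otimes> g) ?w = tmap M (\<lambda>x. (inv k \<otimes> k) \<otimes> x) g v"
    by (rule tmap_left_compose[OF v g kc inv_closed[OF kc]])
  also have "\<dots> = v" using kc tmap_one_left[OF v] by simp
  finally show ?thesis .
qed

end

text \<open>The map \<open>q\<close> is left arbitrary: it is instantiated by the orbit map onto the
  reduced space and by the map onto the diagonal, so that the form and its properties are
  constructed once.\<close>

locale ray_quotient = ray_reduction G \<sigma> \<mu> K for G :: "'g lie_grp" (structure) and \<sigma> \<mu> K +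
  fixes q :: "'g \<Rightarrow> 'b"
  assumes quotient: "quotient_manifold M q"
    and fibres: "\<And>g h. g \<in> carrier G \<Longrightarrow> h \<in> carrier G \<Longrightarrow> q g = q h \<longleftrightarrow> K #> g = K #> h"
begin

abbreviation "Q \<equiv> quot_space M q"

section \<open>The quotient by the kernel group\<close>

lemma manifold_Q: "smooth_manifold Q" using quotient unfolding quotient_manifold_def by blast
lemma charted_Q: "charted Q" by (rule manifold_charted[OF manifold_Q])
lemma local_Q: "local_space Q" by (rule manifold_local[OF manifold_Q])
lemma q_smooth: "smooth_map M Q q" by (rule smooth_map_quot)
lemma points_Q: "points Q = q ` carrier G" by (simp add: points_quot_space points_mfd)

lemma tangent_Q: "g \<in> carrier G \<Longrightarrow> tangent Q (q g) = tmap Q q g ` tangent M g"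
  using quotient points_mfd unfolding quotient_manifold_def submersion_def by blast

lemma fibre_K: "g \<in> carrier G \<Longrightarrow> h \<in> carrier G \<Longrightarrow> q g = q h \<longleftrightarrow> (\<exists>k\<in>K. h = k \<otimes> g)"
  using fibres coset_eq_iff[OF K_subgroup] by simp

lemma q_left: "k \<in> K \<Longrightarrow> g \<in> carrier G \<Longrightarrow> q (k \<otimes> g) = q g"
  using fibre_K[of g "k \<otimes> g"] K_carrier by auto

lemma tmap_q_left:
  assumes k: "k \<in> K" and v: "v \<in> tangent M g"
  shows "tmap Q q (k \<otimes> g) (tmap M (\<lambda>x. k \<otimes> x) g v) = tmap Q q g v"
proof -
  have g: "g \<in> carrier G" using tangent_points[OF v] points_mfd by simp
  have "tmap Q q (k \<otimes> g) (tmap M (\<lambda>x. k \<otimes> x) g v) = tmap Q (\<lambda>x. q (k \<otimes> x)) g v"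
    by (rule tmap_compose[OF smooth_left[OF K_carrier[OF k]] q_smooth]) (simp add: g points_mfd)
  also have "\<dots> = tmap Q q g v" by (rule tmap_cong_carrier[OF v]) (rule q_left[OF k])
  finally show ?thesis .
qed

text \<open>Right translation by \<open>inv g\<close> maps cosets of \<open>K\<close> to cosets and
  so induces \<rho> on the quotient. This moves the claim to the identity, where
  \<open>tangent_kernel\<close> applies.\<close>

lemma ker_tmap_q:
  assumes v: "v \<in> tangent M g" and z: "tmap Q q g v = (\<lambda>_. 0)"
  shows "rcov \<mu> g v = 0"
proof -
  have g: "g \<in> carrier G" using tangent_points[OF v] points_mfd by simp
  have gi: "inv g \<in> carrier G" using g by simp
  let ?\<xi> = "tmap M (\<lambda>x. x \<otimes> inv g) g v"
  define \<rho> where "\<rho> y = q (inv_into (carrier G) q y \<otimes> inv g)" for y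
  have \<rho>: "\<rho> (q x) = q (x \<otimes> inv g)" if x: "x \<in> carrier G" for x
  proof -
    let ?x = "inv_into (carrier G) q (q x)"
    have "?x \<in> carrier G" "q ?x = q x" using x by (auto intro: inv_into_into f_inv_into_f)
    then obtain k where "k \<in> K" "x = k \<otimes> ?x" using fibre_K[of ?x x] x by blast
    then have "x \<otimes> inv g = k \<otimes> (?x \<otimes> inv g)" using \<open>?x \<in> carrier G\<close> gi K_carrier m_assoc by metis
    then have "q (x \<otimes> inv g) = q (?x \<otimes> inv g)" using q_left \<open>k \<in> K\<close> \<open>?x \<in> carrier G\<close> gi by simp
    then show ?thesis by (simp add: \<rho>_def)
  qed
  have qr: "smooth_map M Q (\<lambda>x. q (x \<otimes> inv g))" by (rule smooth_map_compose[OF smooth_right[OF gi] q_smooth])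
  have "smooth_map M Q (\<lambda>x. \<rho> (q x))"
    by (rule smooth_map_eq[OF local_M open_domains_quot qr]) (simp add: \<rho> points_mfd)
  then have \<rho>s: "smooth_map Q Q \<rho>" by (rule smooth_map_from_quot[OF _ open_domains_quot])
  have gp: "g \<in> points M" using g points_mfd by simp
  have "tmap Q q \<one> ?\<xi> = tmap Q q (g \<otimes> inv g) ?\<xi>" using g by simp
  also have "\<dots> = tmap Q (\<lambda>x. q (x \<otimes> inv g)) g v" by (rule tmap_compose[OF smooth_right[OF gi] q_smooth gp])
  also have "\<dots> = tmap Q (\<lambda>x. \<rho> (q x)) g v" by (rule tmap_cong_carrier[OF v]) (simp add: \<rho>)
  also have "\<dots> = tmap Q \<rho> (q g) (tmap Q q g v)" by (rule tmap_compose[OF q_smooth \<rho>s gp, symmetric])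
  also have "\<dots> = (\<lambda>_. 0)" unfolding z by (simp add: tmap_def)
  finally have z1: "tmap Q q \<one> ?\<xi> = (\<lambda>_. 0)" .
  obtain N where N: "lie_subgroup G K N" "tmap M (\<lambda>k. k) \<one> ` tangent N \<one> = {\<xi> \<in> isotropy_algebra G \<mu>. \<mu> \<xi> = 0}"
    using kernel unfolding kernel_group_def by blast
  have "\<mu> ?\<xi> = 0"
  proof (rule tangent_kernel[OF N(1) manifold_Q _ _ mu(1) _ right_back_tangent[OF v] z1])
    show "submersion M Q q" using quotient unfolding quotient_manifold_def by blast
    show "q h = q \<one> \<longleftrightarrow> h \<in> K" if h: "h \<in> carrier G" for h
      using fibre_K[of \<one> h] h K_carrier by auto
    show "\<mu> (tmap M (\<lambda>k. k) \<one> w) = 0" if "w \<in> tangent N \<one>" for w using N(2) that by blast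
  qed
  then show ?thesis by (simp add: rcov_apply[OF v])
qed

definition descends :: "'b \<Rightarrow> 'b tvec \<Rightarrow> real \<Rightarrow> bool" where
  "descends y w z \<longleftrightarrow> (\<exists>g v. v \<in> tangent M g \<and> y = q g \<and> w = tmap Q q g v \<and> z = fac g * rcov \<mu> g v)"

text \<open>For images of vectors on the group the chosen value is the only possible one, by
  \<open>descends_unique\<close>. All other arguments get 0, the convention for covectors.\<close>

definition qform :: "'b form1" where
  "qform y w = (if Ex (descends y w) then SOME z. descends y w z else 0)"

text \<open>Representatives over different points of a fibre are brought to one point by left
  translation with \<open>k\<close>, which changes neither the factor nor the pairing. The
  difference of the two vectors is then killed by the projection, hence by the form.\<close>

lemma descends_unique:
  assumes "descends y w z" "descends y w z'"
  shows "z = z'"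
proof -
  obtain g v where 1: "v \<in> tangent M g" "y = q g" "w = tmap Q q g v" "z = fac g * rcov \<mu> g v"
    using assms(1) unfolding descends_def by blast
  obtain g' v' where 2: "v' \<in> tangent M g'" "y = q g'" "w = tmap Q q g' v'" "z' = fac g' * rcov \<mu> g' v'"
    using assms(2) unfolding descends_def by blast
  have g: "g \<in> carrier G" "g' \<in> carrier G" using tangent_points[OF 1(1)] tangent_points[OF 2(1)] points_mfd by simp_all
  obtain k where k: "k \<in> K" "g' = k \<otimes> g" using fibre_K[OF g] 1(2) 2(2) by blast
  let ?u = "tmap M (\<lambda>x. k \<otimes> x) g v"
  have u: "?u \<in> tangent M g'" unfolding k(2) by (rule tmap_tangent[OF smooth_left[OF K_carrier[OF k(1)]] 1(1)])
  have "tmap Q q g' (\<lambda>f. 1 * ?u f + (- 1) * v' f) = (\<lambda>h. 1 * tmap Q q g' ?u h + (- 1) * tmap Q q g' v' h)"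
    by (rule tmap_lincomb)
  also have "\<dots> = (\<lambda>_. 0)" unfolding 2(3)[symmetric] unfolding k(2) tmap_q_left[OF k(1) 1(1)] 1(3)[symmetric] by simp
  finally have "rcov \<mu> g' (\<lambda>f. 1 * ?u f + (- 1) * v' f) = 0"
    by (rule ker_tmap_q[OF tangent_lincomb[OF charted_M u 2(1)]])
  then have "rcov \<mu> g' ?u = rcov \<mu> g' v'"
    using cotangent_lincomb[OF rcov_cotangent[OF mu(1) g(2)] u 2(1), of 1 "- 1"] by simp
  then show ?thesis unfolding 1(4) 2(4) k(2) rcov_left[OF k(1) 1(1)] fac_left[OF k(1) g(1)] by simp
qed

lemma qform_eq:
  assumes "v \<in> tangent M g"
  shows "qform (q g) (tmap Q q g v) = fac g * rcov \<mu> g v"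
proof -
  have d: "descends (q g) (tmap Q q g v) (fac g * rcov \<mu> g v)" 
    unfolding descends_def by (rule exI[of _ g], rule exI[of _ v]) (simp add: assms)
  have "qform (q g) (tmap Q q g v) = (SOME z. descends (q g) (tmap Q q g v) z)"
    unfolding qform_def by (rule if_P) (rule exI[of "descends (q g) (tmap Q q g v)", OF d])
  then have "descends (q g) (tmap Q q g v) (qform (q g) (tmap Q q g v))"
    using someI[of "descends (q g) (tmap Q q g v)", OF d] by simp
  from descends_unique[OF this d] show ?thesis .
qed

lemma qform_outside:
  assumes "w \<notin> tangent Q y"
  shows "qform y w = 0"
proof -
  have "\<not> descends y w z" for z using assms tmap_tangent[OF q_smooth] unfolding descends_def by blast
  then have "\<not> Ex (descends y w)" by blast
  then show ?thesis unfolding qform_def by (rule if_not_P)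
qed

lemma tangent_Q_Rv:
  assumes g: "g \<in> carrier G" and w: "w \<in> tangent Q (q g)"
  obtains \<xi> where "\<xi> \<in> lie_algebra G" "w = tmap Q q g (Rv \<xi> g)"
proof -
  obtain v where v: "v \<in> tangent M g" "w = tmap Q q g v" using w tangent_Q[OF g] by blast
  then show thesis using that[OF right_back_tangent[OF v(1)]] Rv_right_back[OF v(1)] by simp
qed

lemma qform_Rv: "\<xi> \<in> lie_algebra G \<Longrightarrow> g \<in> carrier G \<Longrightarrow> qform (q g) (tmap Q q g (Rv \<xi> g)) = fac g * \<mu> \<xi>"
  using qform_eq[OF Rv_tangent] by (simp add: rcov_Rv)

lemma qform_cotangent:
  assumes "y \<in> points Q"
  shows "qform y \<in> cotangent Q y"
  unfolding cotangent_def
proof (intro CollectI conjI ballI allI impI)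
  obtain g where g: "g \<in> carrier G" "y = q g" using assms points_Q by blast
  fix v w a b assume "v \<in> tangent Q y" "w \<in> tangent Q y"
  then obtain v' w' where v: "v' \<in> tangent M g" "v = tmap Q q g v'" and w: "w' \<in> tangent M g" "w = tmap Q q g w'"
    using tangent_Q[OF g(1)] g(2) by blast
  have "(\<lambda>f. a * v f + b * w f) = tmap Q q g (\<lambda>f. a * v' f + b * w' f)" unfolding v w tmap_lincomb ..
  then show "qform y (\<lambda>f. a * v f + b * w f) = a * qform y v + b * qform y w"
    using qform_eq[OF tangent_lincomb[OF charted_M v(1) w(1)]] qform_eq[OF v(1)] qform_eq[OF w(1)]
      cotangent_lincomb[OF rcov_cotangent[OF mu(1) g(1)] v(1) w(1)] g(2) v(2) w(2) by (simp add: algebra_simps)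
qed (rule qform_outside)

text \<open>Smoothness on the quotient is smoothness of the pulled-back components on the group.
  There the form has the value \<open>fac h * \<mu> \<xi>\<close> on the right-invariant field of
  \<xi>, and right-invariant fields that project to the coordinate vectors at one point determine
  the components nearby.\<close>

lemma qform_one_form: "one_form Q qform"
  unfolding one_form_def
proof (intro conjI ballI allI impI)
  show "qform y \<in> cotangent Q y" if "y \<in> points Q" for y by (rule qform_cotangent[OF that])
  show "qform y = (\<lambda>_. 0)" if "y \<notin> points Q" for y
    by (rule ext, rule qform_outside) (use that tangent_points[of _ Q y] in metis)
  fix U n x i assume ch: "chart Q U n x" and i: "i < (n::nat)"
  show "smooth_fun Q U (\<lambda>p. qform p (coord_vec Q U x i p))"
    unfolding smooth_fun_iff_near[OF local_Q]
  proof (intro conjI ballI)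
    show U: "openin (space_top Q) U" by (rule chart_open[OF ch])
    have "smooth_fun Q U (\<lambda>p. qform p (coord_vec Q U x i p))"
      unfolding smooth_fun_quot_space smooth_fun_iff_near[OF local_M] o_def
    proof (intro conjI ballI U)
      show "openin (space_top M) {p \<in> points M. q p \<in> U}" using U unfolding openin_quot_space by blast
      fix g assume "g \<in> {p \<in> points M. q p \<in> U}"
      then have g: "g \<in> points M" "g \<in> carrier G" and gU: "q g \<in> U" using points_mfd by auto
      have "\<exists>\<xi>. \<xi> \<in> lie_algebra G \<and> coord_vec Q U x j (q g) = tmap Q q g (Rv \<xi> g)" if "j < n" for j
        by (rule tangent_Q_Rv[OF g(2) coord_vec_tangent[OF charted_Q ch gU that]]) (rule exI, rule conjI)
      then have "\<forall>j. \<exists>\<xi>. j < n \<longrightarrow> \<xi> \<in> lie_algebra G \<and> coord_vec Q U x j (q g) = tmap Q q g (Rv \<xi> g)" by blast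
      from choice[OF this] obtain X where X: "\<And>j. j < n \<Longrightarrow> X j \<in> lie_algebra G" "\<And>j. j < n \<Longrightarrow> coord_vec Q U x j (q g) = tmap Q q g (Rv (X j) g)"
        by blast
      show "smooth_near M g (\<lambda>p. qform (q p) (coord_vec Q U x i (q p)))"
      proof (rule covector_components_smooth_pullback[where X = "\<lambda>j. Rv (X j)", OF charted_M charted_Q q_smooth g(1) qform_cotangent _ _ ch gU _ _ i])
        show "Rv (X j) h \<in> tangent M h" if "j < n" "h \<in> points M" for j h
          by (rule Rv_tangent[OF X(1)[OF that(1)]]) (use that points_mfd in simp)
        show "smooth_near M g (\<lambda>h. Rv (X j) h f)" if "j < n" "smooth_near M g f" for j f
          by (rule Rv_smooth[OF X(1)[OF that(1)] that(2)])
        show "tmap Q q g (Rv (X j) g) = coord_vec Q U x j (q g)" if "j < n" for j by (rule X(2)[OF that, symmetric])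
        fix j assume j: "j < n"
        show "smooth_near M g (\<lambda>h. qform (q h) (tmap Q q h (Rv (X j) h)))"
        proof (rule smooth_near_cong[OF local_M openin_carrier g(2)])
          show "fac h * \<mu> (X j) = qform (q h) (tmap Q q h (Rv (X j) h))" if "h \<in> carrier G" for h
            by (rule qform_Rv[OF X(1)[OF j] that, symmetric])
          show "smooth_near M g (\<lambda>h. fac h * \<mu> (X j))" unfolding fac_def
            by (rule smooth_near_mult[OF charted_M f_sigma_smooth[OF mu g(2)] smooth_near_const[OF charted_M g(1)]])
        qed
      qed
    qed
    then show "smooth_near Q p (\<lambda>p. qform p (coord_vec Q U x i p))" if "p \<in> U" for p
      by (rule smooth_nearI[OF that])
  qed
qed

end

text \<open>The coordinate formula regrouped by the components of \<eta>: expanding \<open>v\<close>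
  and \<open>w\<close> in coordinate vectors lets each component be differentiated directly along
  \<open>v\<close> or \<open>w\<close>.\<close>

lemma ext_deriv_eq:
  assumes M: "charted M" and ch: "chart M U n x" "p \<in> U" and v: "v \<in> tangent M p" and w: "w \<in> tangent M p"
  shows "ext_deriv M U n x \<eta> p v w =
    (\<Sum>j<n. v (\<lambda>q. \<eta> q (coord_vec M U x j q)) * w (\<lambda>q. x q j)) -
    (\<Sum>j<n. w (\<lambda>q. \<eta> q (coord_vec M U x j q)) * v (\<lambda>q. x q j))"
proof -
  let ?h = "\<lambda>j q. \<eta> q (coord_vec M U x j q)"
  have v': "v (?h j) = (\<Sum>i<n. v (\<lambda>q. x q i) * coord_vec M U x i p (?h j))" for j
    by (rule fun_cong[OF tangent_expand[OF M v ch]])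
  have w': "w (?h i) = (\<Sum>j<n. w (\<lambda>q. x q j) * coord_vec M U x j p (?h i))" for i
    by (rule fun_cong[OF tangent_expand[OF M w ch]])
  have 1: "(\<Sum>j<n. v (?h j) * w (\<lambda>q. x q j)) =
    (\<Sum>i<n. \<Sum>j<n. coord_vec M U x i p (?h j) * v (\<lambda>q. x q i) * w (\<lambda>q. x q j))"
    unfolding v' sum_distrib_right by (subst sum.swap) (intro sum.cong refl, simp)
  have 2: "(\<Sum>j<n. w (?h j) * v (\<lambda>q. x q j)) =
    (\<Sum>i<n. \<Sum>j<n. coord_vec M U x j p (?h i) * v (\<lambda>q. x q i) * w (\<lambda>q. x q j))"
    unfolding w' sum_distrib_right by (intro sum.cong refl) simp
  show ?thesis unfolding ext_deriv_def 1 2 by (simp add: left_diff_distrib sum_subtractf)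
qed

context ray_quotient
begin

lemma Rv_one: "\<xi> \<in> lie_algebra G \<Longrightarrow> Rv \<xi> \<one> = \<xi>"
  unfolding Rv_def lie_algebra_def by (rule tmap_one_right)

lemma Lv_one: "\<xi> \<in> lie_algebra G \<Longrightarrow> Lv \<xi> \<one> = \<xi>"
  unfolding Lv_def lie_algebra_def by (rule tmap_one_left)

text \<open>The exterior derivative is computed by differentiating \<open>\<eta>\<close> along the two-parameter family
  \<open>q(a b g)\<close>, with \<open>a\<close>, \<open>b\<close> near the identity; the second derivatives of the coordinates cancel.\<close>

lemma ext_deriv_qform:
  assumes g: "g \<in> carrier G" and ch: "chart Q U n x" "q g \<in> U"
    and \<xi>: "\<xi> \<in> lie_algebra G" and \<zeta>: "\<zeta> \<in> lie_algebra G"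
  shows "ext_deriv Q U n x qform (q g) (tmap Q q g (Rv \<xi> g)) (tmap Q q g (Rv \<zeta> g)) =
    \<xi> (\<lambda>h. fac (h \<otimes> g)) * \<mu> \<zeta> - \<zeta> (\<lambda>h. fac (h \<otimes> g)) * \<mu> \<xi> + fac g * coad_form \<mu> \<xi> \<zeta>"
proof -
  have t: "\<xi> \<in> tangent M \<one>" "\<zeta> \<in> tangent M \<one>" using \<xi> \<zeta> by (simp_all add: lie_algebra_def)
  have gp: "g \<in> points M" using g points_mfd by simp
  define hc where "hc j y = qform y (coord_vec Q U x j y)" for j y
  \<comment> \<open>The components of the form and the coordinates, pulled back along the map that
    sends \<open>h\<close> to \<open>q (h \<otimes> g)\<close>, so that all differentiation takes
    place at the identity.\<close>
  define H where "H j h = hc j (q (h \<otimes> g))" for j h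
  define f where "f j p = x (q (p \<otimes> g)) j" for j p
  have hc: "smooth_near Q y (hc j)" if "j < n" "y \<in> U" for j y
  proof (rule smooth_nearI[OF that(2)])
    show "smooth_fun Q U (hc j)" using qform_one_form ch(1) that(1) unfolding one_form_def hc_def by blast
  qed
  have qg: "smooth_map M Q (\<lambda>h. q (h \<otimes> g))" by (rule smooth_map_compose[OF smooth_right[OF g] q_smooth])
  define V where "V = {h \<in> topspace (space_top M). q (h \<otimes> g) \<in> U}"
  have V: "openin (space_top M) V" unfolding V_def
    by (rule openin_continuous_map_preimage[OF _ chart_open[OF ch(1)]]) (use qg in \<open>simp add: smooth_map_def\<close>)
  have V1: "\<one> \<in> V" using ch(2) g one_carrier_points by (simp add: V_def points_def)
  have V': "h \<in> points M" "h \<in> carrier G" "q (h \<otimes> g) \<in> U" if "h \<in> V" for h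
    using that points_mfd by (auto simp: V_def points_def)
  have fs: "smooth_near M h (f j)" if "h \<in> V" for h j
    unfolding f_def by (rule smooth_map_near[OF qg V'(1)[OF that] smooth_near_coord[OF ch(1) V'(3)[OF that] local_Q]])
  have Hs: "smooth_near M \<one> (H j)" if "j < n" for j
    unfolding H_def by (rule smooth_map_near[OF qg V'(1)[OF V1] hc[OF that V'(3)[OF V1]]])
  \<comment> \<open>The value of the form on a right-invariant field, expanded in coordinates.
    Differentiating the right-hand side produces first derivatives of \<open>H\<close> and second
    derivatives of \<open>f\<close>.\<close>
  have key: "fac (h \<otimes> g) * \<mu> \<theta> = (\<Sum>j<n. H j h * Rv \<theta> h (f j))" if h: "h \<in> V" and \<theta>: "\<theta> \<in> lie_algebra G" for h \<theta>
  proof -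
    have hg: "h \<otimes> g \<in> carrier G" using V'(2)[OF h] g by simp
    let ?w = "tmap Q q (h \<otimes> g) (Rv \<theta> (h \<otimes> g))"
    have w: "?w \<in> tangent Q (q (h \<otimes> g))" by (rule tmap_tangent[OF q_smooth Rv_tangent[OF \<theta> hg]])
    have co: "?w (\<lambda>y. x y j) = Rv \<theta> h (f j)" for j
    proof -
      have s: "smooth_near Q (q (h \<otimes> g)) (\<lambda>y. x y j)" by (rule smooth_near_coord[OF ch(1) V'(3)[OF h] local_Q])
      have s': "smooth_near M (h \<otimes> g) (\<lambda>p. x (q p) j)" by (rule smooth_map_near[OF q_smooth _ s]) (simp add: hg points_mfd)
      have "?w (\<lambda>y. x y j) = Rv \<theta> (h \<otimes> g) (\<lambda>p. x (q p) j)" using s by (simp add: tmap_def)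
      also have "\<dots> = \<theta> (\<lambda>p. x (q (p \<otimes> (h \<otimes> g))) j)" by (rule Rv_apply[OF hg s'])
      also have "\<dots> = \<theta> (\<lambda>p. f j (p \<otimes> h))" unfolding f_def
        by (rule tangent_near_cong[OF local_M _ openin_carrier one_closed])
          (use \<theta> g V'(2)[OF h] in \<open>simp_all add: lie_algebra_def m_assoc\<close>)
      also have "\<dots> = Rv \<theta> h (f j)" by (rule Rv_apply[OF V'(2)[OF h] fs[OF h], symmetric])
      finally show ?thesis .
    qed
    have "qform (q (h \<otimes> g)) ?w = (\<Sum>j<n. ?w (\<lambda>y. x y j) * qform (q (h \<otimes> g)) (coord_vec Q U x j (q (h \<otimes> g))))"
      by (rule cotangent_expand[OF charted_Q qform_cotangent ch(1) V'(3)[OF h] w]) (simp add: points_Q hg)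
    then show ?thesis unfolding qform_Rv[OF \<theta> hg] co by (simp add: H_def hc_def mult.commute)
  qed
  have val: "tmap Q q g (Rv \<theta> g) (hc j) = \<theta> (H j)" "tmap Q q g (Rv \<theta> g) (\<lambda>y. x y j) = \<theta> (f j)"
    if j: "j < n" and \<theta>: "\<theta> \<in> lie_algebra G" for \<theta> j
  proof -
    have s: "smooth_near Q (q g) (\<lambda>y. x y j)" by (rule smooth_near_coord[OF ch local_Q])
    show "tmap Q q g (Rv \<theta> g) (hc j) = \<theta> (H j)" unfolding H_def
      using hc[OF j ch(2)] Rv_apply[OF g smooth_map_near[OF q_smooth gp hc[OF j ch(2)]]] by (simp add: tmap_def)
    show "tmap Q q g (Rv \<theta> g) (\<lambda>y. x y j) = \<theta> (f j)" unfolding f_def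
      using s Rv_apply[OF g smooth_map_near[OF q_smooth gp s]] by (simp add: tmap_def)
  qed
  have Rs: "smooth_near M \<one> (\<lambda>h. Rv \<xi> h (f j))" and Ls: "smooth_near M \<one> (\<lambda>h. Lv \<zeta> h (f j))" for j
    by (rule Rv_smooth[OF \<xi> fs[OF V1]], rule Lv_smooth[OF \<zeta> fs[OF V1]])
  have facs: "smooth_near M \<one> (\<lambda>h. fac (h \<otimes> g))"
    by (rule smooth_map_near[OF smooth_right[OF g] one_carrier_points]) (simp add: fac_def f_sigma_smooth[OF mu] g)
  have "\<xi> (\<lambda>h. fac (h \<otimes> g) * \<mu> (Ad G h \<zeta>)) = \<xi> (\<lambda>h. fac (h \<otimes> g)) * \<mu> (Ad G \<one> \<zeta>) + \<xi> (\<lambda>h. \<mu> (Ad G h \<zeta>)) * fac (\<one> \<otimes> g)"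
    by (rule tangent_mult[OF charted_M t(1) facs Ad_smooth[OF mu(1) \<zeta> one_closed]])
  then have A: "\<xi> (\<lambda>h. fac (h \<otimes> g) * \<mu> (Ad G h \<zeta>)) = \<xi> (\<lambda>h. fac (h \<otimes> g)) * \<mu> \<zeta> + fac g * coad_form \<mu> \<xi> \<zeta>"
    using g by (simp add: Ad_one[OF \<zeta>] coad_form_def mult.commute)
  \<comment> \<open>\<open>key\<close> is applied to \<open>Ad G h \<zeta>\<close>, whose
    right-invariant field at \<open>h\<close> is the left-invariant field of \<zeta>. The second
    derivatives that arise are mixed left-right ones, hence symmetric, and cancel at the
    end.\<close>
  have "\<xi> (\<lambda>h. fac (h \<otimes> g) * \<mu> (Ad G h \<zeta>)) = \<xi> (\<lambda>h. \<Sum>j<n. H j h * Lv \<zeta> h (f j))"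
    by (rule tangent_near_cong[OF local_M t(1) V V1])
      (simp add: key Ad_closed[OF \<zeta>] V' Lv_eq_Rv_Ad[OF \<zeta>])
  also have "\<dots> = (\<Sum>j<n. \<xi> (\<lambda>h. H j h * Lv \<zeta> h (f j)))"
    by (rule tangent_sum[OF charted_M t(1)]) (rule smooth_near_mult[OF charted_M Hs Ls])
  also have "\<dots> = (\<Sum>j<n. \<xi> (H j) * \<zeta> (f j) + \<xi> (\<lambda>h. Lv \<zeta> h (f j)) * H j \<one>)"
    by (intro sum.cong refl) (simp add: tangent_mult[OF charted_M t(1) Hs Ls] Lv_one[OF \<zeta>])
  finally have B: "\<xi> (\<lambda>h. fac (h \<otimes> g) * \<mu> (Ad G h \<zeta>)) = \<dots>" .
  have "\<zeta> (\<lambda>h. fac (h \<otimes> g)) * \<mu> \<xi> = \<zeta> (\<lambda>h. \<mu> \<xi> * fac (h \<otimes> g))"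
    by (simp add: tangent_cmult[OF charted_M t(2) facs])
  also have "\<dots> = \<zeta> (\<lambda>h. \<Sum>j<n. H j h * Rv \<xi> h (f j))"
    by (rule tangent_near_cong[OF local_M t(2) V V1]) (simp add: key[OF _ \<xi>, symmetric])
  also have "\<dots> = (\<Sum>j<n. \<zeta> (\<lambda>h. H j h * Rv \<xi> h (f j)))"
    by (rule tangent_sum[OF charted_M t(2)]) (rule smooth_near_mult[OF charted_M Hs Rs])
  also have "\<dots> = (\<Sum>j<n. \<zeta> (H j) * \<xi> (f j) + \<zeta> (\<lambda>h. Rv \<xi> h (f j)) * H j \<one>)"
    by (intro sum.cong refl) (simp add: tangent_mult[OF charted_M t(2) Hs Rs] Rv_one[OF \<xi>])
  finally have C: "\<zeta> (\<lambda>h. fac (h \<otimes> g)) * \<mu> \<xi> = \<dots>" .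
  have com: "\<xi> (\<lambda>h. Lv \<zeta> h (f j)) = \<zeta> (\<lambda>h. Rv \<xi> h (f j))" for j
    by (rule left_right_commute[OF fs[OF V1] \<xi> \<zeta>])
  have "ext_deriv Q U n x qform (q g) (tmap Q q g (Rv \<xi> g)) (tmap Q q g (Rv \<zeta> g)) =
      (\<Sum>j<n. \<xi> (H j) * \<zeta> (f j)) - (\<Sum>j<n. \<zeta> (H j) * \<xi> (f j))"
    unfolding ext_deriv_eq[OF charted_Q ch tmap_tangent[OF q_smooth Rv_tangent[OF \<xi> g]] tmap_tangent[OF q_smooth Rv_tangent[OF \<zeta> g]]]
      hc_def[symmetric] using val \<xi> \<zeta> by (intro arg_cong2[where f = "(-)"] sum.cong refl) auto
  also have "\<dots> = \<xi> (\<lambda>h. fac (h \<otimes> g) * \<mu> (Ad G h \<zeta>)) - \<zeta> (\<lambda>h. fac (h \<otimes> g)) * \<mu> \<xi>"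
    unfolding B C com by (simp add: sum.distrib)
  finally show ?thesis unfolding A by simp
qed

text \<open>Antisymmetry is inherited from \<open>d\<eta>\<close>, so no Lie bracket is needed.\<close>

lemma coad_form_antisym:
  assumes \<xi>: "\<xi> \<in> lie_algebra G" and \<zeta>: "\<zeta> \<in> lie_algebra G"
  shows "coad_form \<mu> \<xi> \<zeta> = - coad_form \<mu> \<zeta> \<xi>"
proof -
  have "q \<one> \<in> points Q" using points_Q by blast
  then obtain U n x where ch: "chart Q U n x" "q \<one> \<in> U" by (rule charted_pointE[OF charted_Q])
  let ?v = "\<lambda>\<xi>. tmap Q q \<one> (Rv \<xi> \<one>)"
  have t: "?v \<xi> \<in> tangent Q (q \<one>)" if "\<xi> \<in> lie_algebra G" for \<xi>
    by (rule tmap_tangent[OF q_smooth Rv_tangent[OF that one_closed]])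
  have "ext_deriv Q U n x qform (q \<one>) (?v \<xi>) (?v \<zeta>) = - ext_deriv Q U n x qform (q \<one>) (?v \<zeta>) (?v \<xi>)"
    unfolding ext_deriv_eq[OF charted_Q ch t[OF \<xi>] t[OF \<zeta>]] ext_deriv_eq[OF charted_Q ch t[OF \<zeta>] t[OF \<xi>]] by simp
  then have "fac \<one> * (coad_form \<mu> \<xi> \<zeta> + coad_form \<mu> \<zeta> \<xi>) = 0"
    unfolding ext_deriv_qform[OF one_closed ch \<xi> \<zeta>] ext_deriv_qform[OF one_closed ch \<zeta> \<xi>] by (simp add: algebra_simps)
  then show ?thesis using fac_pos[OF one_closed] by simp
qed

text \<open>Such a \<xi> is the velocity of a curve in \<open>K\<close>, along which
  \<open>q (c s \<otimes> g)\<close> is constant.\<close>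

lemma tmap_q_kernel_algebra:
  assumes \<xi>: "\<xi> \<in> isotropy_algebra G \<mu>" "\<mu> \<xi> = 0" and g: "g \<in> carrier G"
  shows "tmap Q q g (Rv \<xi> g) = (\<lambda>_. 0)"
proof -
  obtain N where N: "lie_subgroup G K N" "tmap M (\<lambda>k. k) \<one> ` tangent N \<one> = {\<xi> \<in> isotropy_algebra G \<mu>. \<mu> \<xi> = 0}"
    using kernel unfolding kernel_group_def by blast
  then obtain w where w: "w \<in> tangent N \<one>" "\<xi> = tmap M (\<lambda>k. k) \<one> w" using \<xi> by blast
  obtain c where c: "smooth_map real_space N c" "c 0 = \<one>" "w = velocity N c 0" by (rule tangentE[OF w(1)])
  have incl: "smooth_map N M (\<lambda>k. k)" using N(1) unfolding lie_subgroup_def immersion_def by blast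
  have "points N = K" using N(1) unfolding lie_subgroup_def lie_group_def by simp
  then have cK: "c s \<in> K" for s using smooth_map_in[OF c(1), of s] by simp
  have cM: "smooth_map real_space M c" by (rule smooth_map_compose[OF c(1) incl])
  have one: "\<one> \<in> points M" "\<one> \<in> points N" using one_carrier_points smooth_map_in[OF c(1), of 0] c(2) by simp_all
  have "\<xi> = velocity M c 0" unfolding w(2) c(3) by (rule tmap_velocity[OF incl]) (simp_all add: c(2) one)
  then have "Rv \<xi> g = velocity M (\<lambda>s. c s \<otimes> g) 0" unfolding Rv_def
    by (simp add: tmap_velocity[where c = c and t = 0, OF smooth_right[OF g]] c(2) one)
  then have "tmap Q q g (Rv \<xi> g) = velocity Q (\<lambda>s. q (c s \<otimes> g)) 0"
    by (simp add: tmap_velocity[where c = "\<lambda>s. c s \<otimes> g" and t = 0, OF q_smooth] c(2) g points_mfd)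
  also have "\<dots> = (\<lambda>_. 0)" unfolding q_left[OF cK g] velocity_def by auto
  finally show ?thesis .
qed

lemma qform_contact: "contact_form Q qform"
  unfolding contact_form_def
proof (intro conjI ballI allI impI manifold_Q qform_one_form)
  fix p assume "p \<in> points Q"
  then obtain g where g: "g \<in> carrier G" "p = q g" using points_Q by blast
  have "\<mu> \<in> cotangent M \<one>" using mu(1) by (simp add: dual_lie_algebra_def)
  then obtain \<xi> where \<xi>: "\<xi> \<in> lie_algebra G" "\<mu> \<xi> \<noteq> 0" unfolding lie_algebra_def by (rule nonzero_pairing[OF _ mu(2)])
  show "\<exists>v\<in>tangent Q p. qform p v \<noteq> 0"
  proof (rule bexI[of _ "tmap Q q g (Rv \<xi> g)"])
    show "qform p (tmap Q q g (Rv \<xi> g)) \<noteq> 0" unfolding g(2) qform_Rv[OF \<xi>(1) g(1)] using fac_pos[OF g(1)] \<xi>(2) by simp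
    show "tmap Q q g (Rv \<xi> g) \<in> tangent Q p" unfolding g(2) by (rule tmap_tangent[OF q_smooth Rv_tangent[OF \<xi>(1) g(1)]])
  qed
next
  fix p U n x v assume "p \<in> points Q" and ch: "chart Q U n x \<and> p \<in> U" and v: "v \<in> tangent Q p"
    and deg: "qform p v = 0 \<and> (\<forall>w\<in>tangent Q p. qform p w = 0 \<longrightarrow> ext_deriv Q U n x qform p v w = 0)"
  then obtain g where g: "g \<in> carrier G" "p = q g" using points_Q by blast
  obtain \<xi> where \<xi>: "\<xi> \<in> lie_algebra G" "v = tmap Q q g (Rv \<xi> g)" using tangent_Q_Rv[OF g(1)] v g(2) by blast
  have F: "fac g \<noteq> 0" using fac_pos[OF g(1)] by simp
  have \<mu>\<xi>: "\<mu> \<xi> = 0" using deg F unfolding g(2) \<xi>(2) qform_Rv[OF \<xi>(1) g(1)] by simp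
  \<comment> \<open>Both terms with derivatives of \<open>fac\<close> vanish on the kernel of \<mu>,
    which leaves \<open>fac g * coad_form \<mu> \<xi> \<zeta>\<close>.\<close>
  have B1: "coad_form \<mu> \<xi> \<zeta> = 0" if \<zeta>: "\<zeta> \<in> lie_algebra G" "\<mu> \<zeta> = 0" for \<zeta>
  proof -
    let ?w = "tmap Q q g (Rv \<zeta> g)"
    have w: "?w \<in> tangent Q p" unfolding g(2) by (rule tmap_tangent[OF q_smooth Rv_tangent[OF \<zeta>(1) g(1)]])
    have "qform p ?w = 0" unfolding g(2) qform_Rv[OF \<zeta>(1) g(1)] using \<zeta>(2) by simp
    then have "ext_deriv Q U n x qform p v ?w = 0" using deg w by blast
    then show ?thesis using F \<mu>\<xi> \<zeta>(2) ch unfolding g(2) \<xi>(2) by (simp add: ext_deriv_qform[OF g(1) _ _ \<xi>(1) \<zeta>(1)])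
  qed
  \<comment> \<open>Membership in the isotropy algebra concerns the first argument of
    \<open>coad_form\<close>; antisymmetry transfers it to the second.\<close>
  have B2: "coad_form \<mu> \<xi> \<zeta> = 0" if \<zeta>: "\<zeta> \<in> isotropy_algebra G \<mu>" for \<zeta>
  proof -
    have \<zeta>': "\<zeta> \<in> lie_algebra G" using \<zeta> by (simp add: isotropy_algebra_def)
    have z: "coad_form \<mu> \<zeta> \<xi> = 0"
      by (rule bspec[OF \<zeta>[unfolded isotropy_iff[OF mu(1) \<zeta>']] \<xi>(1)])
    have "coad_form \<mu> \<xi> \<zeta> = - coad_form \<mu> \<zeta> \<xi>"
      by (rule coad_form_antisym[OF \<xi>(1) \<zeta>'])
    then show ?thesis
      unfolding z
      by simp
  qed
  have "\<xi> \<in> isotropy_algebra G \<mu>"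
  proof (rule iffD2[OF isotropy_iff[OF mu(1) \<xi>(1)]], rule ballI)
    fix \<zeta> assume \<zeta>: "\<zeta> \<in> lie_algebra G"
    obtain \<zeta>1 \<zeta>2 where z: "\<zeta> = (\<lambda>f. \<zeta>1 f + \<zeta>2 f)" "\<zeta>1 \<in> lie_algebra G" "\<mu> \<zeta>1 = 0" "\<zeta>2 \<in> isotropy_algebra G \<mu>"
      using subsetD[OF equalityD2[OF span] \<zeta>] by (elim CollectE exE conjE) (rule that; assumption)
    then have "\<zeta>2 \<in> lie_algebra G" by (simp add: isotropy_algebra_def)
    then show "coad_form \<mu> \<xi> \<zeta> = 0"
      unfolding z(1) using coad_form_add_right[OF mu(1) \<xi>(1) z(2)] B1[OF z(2,3)] B2[OF z(4)] by simp
  qed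
  then show "v = (\<lambda>_. 0)" unfolding \<xi>(2) by (rule tmap_q_kernel_algebra[OF _ \<mu>\<xi> g(1)])
qed

text \<open>The projection is a submersion, so every tangent vector of the quotient is an image, and
  values on images determine a form.\<close>

lemma qform_unique:
  assumes \<eta>: "one_form Q \<eta>" and eq: "\<And>g v. v \<in> tangent M g \<Longrightarrow> \<eta> (q g) (tmap Q q g v) = fac g * rcov \<mu> g v"
  shows "\<eta> = qform"
proof (intro ext)
  fix y w
  show "\<eta> y w = qform y w"
  proof (cases "y \<in> points Q \<and> w \<in> tangent Q y")
    case True
    then obtain g where g: "g \<in> carrier G" "y = q g" using points_Q by blast
    then obtain v where v: "v \<in> tangent M g" "w = tmap Q q g v" using tangent_Q True by blast
    show ?thesis unfolding g(2) v(2) using eq[OF v(1)] qform_eq[OF v(1)] by simp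
  next
    case False
    have nw: "w \<notin> tangent Q y"
    proof
      assume w: "w \<in> tangent Q y"
      show False using False tangent_points[OF w] w by simp
    qed
    have "\<eta> y w = 0"
    proof (cases "y \<in> points Q")
      case True
      then have "\<eta> y \<in> cotangent Q y" using \<eta> unfolding one_form_def by blast
      then show ?thesis by (rule cotangent_outside[OF _ nw])
    next
      case False
      then have "\<eta> y = (\<lambda>_. 0)" using \<eta> unfolding one_form_def by blast
      then show ?thesis by simp
    qed
    then show ?thesis using qform_outside[OF nw] by simp
  qed
qed

end

section \<open>The reduced space and the diagonal model\<close>

lemma quotient_manifold_cong:
  assumes M: "local_space M" and q: "quotient_manifold M q" and eq: "\<And>p. p \<in> points M \<Longrightarrow> q p = r p"
  shows "quotient_manifold M r"
proof -
  have Q: "quot_space M q = quot_space M r" by (rule quot_space_cong[OF M eq])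
  have op: "openin (space_top M) (points M)" by (simp add: points_def)
  have t: "tmap (quot_space M r) q p v = tmap (quot_space M r) r p v" if "p \<in> points M" "v \<in> tangent M p" for p v
    by (rule tmap_cong[OF M that(2) op that(1) eq])
  show ?thesis unfolding quotient_manifold_def submersion_def
  proof (intro conjI ballI smooth_map_quot)
    show "smooth_manifold (quot_space M r)" using q unfolding quotient_manifold_def Q by blast
    fix p assume p: "p \<in> points M"
    then have "tmap (quot_space M r) q p ` tangent M p = tangent (quot_space M r) (q p)"
      using q unfolding quotient_manifold_def submersion_def Q by blast
    then show "tmap (quot_space M r) r p ` tangent M p = tangent (quot_space M r) (r p)"
      using t[OF p] eq[OF p] by (metis image_cong)
  qed
qed

lemma inv_into_fibre:
  assumes "\<And>p p'. p \<in> A \<Longrightarrow> p' \<in> A \<Longrightarrow> q p = q p' \<Longrightarrow> r p = r p'" and p: "p \<in> A"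
  shows "r (inv_into A q (q p)) = r p"
proof -
  have "inv_into A q (q p) \<in> A" "q (inv_into A q (q p)) = q p"
    using p by (auto intro: inv_into_into f_inv_into_f)
  then show ?thesis using assms(1)[OF _ p] by simp
qed

lemma smooth_map_between_quot:
  assumes M: "local_space M" and eq: "\<And>p p'. p \<in> points M \<Longrightarrow> p' \<in> points M \<Longrightarrow> q p = q p' \<Longrightarrow> r p = r p'"
  shows "smooth_map (quot_space M q) (quot_space M r) (\<lambda>y. r (inv_into (points M) q y))"
proof (rule smooth_map_from_quot[OF _ open_domains_quot])
  show "smooth_map M (quot_space M r) (\<lambda>p. r (inv_into (points M) q (q p)))"
    by (rule smooth_map_eq[OF M open_domains_quot smooth_map_quot[of M r]]) (simp add: inv_into_fibre[of "points M" q r, OF eq])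
qed

text \<open>Each of the two maps is constant on the fibres of the other, so both directions come
  from the universal property of the quotient.\<close>

lemma diffeomorphism_quot:
  assumes M: "local_space M" and eq: "\<And>p p'. p \<in> points M \<Longrightarrow> p' \<in> points M \<Longrightarrow> q p = q p' \<longleftrightarrow> r p = r p'"
  shows "diffeomorphism (quot_space M q) (quot_space M r) (\<lambda>y. r (inv_into (points M) q y))"
proof -
  have qr: "r (inv_into (points M) q (q p)) = r p" if "p \<in> points M" for p
    by (rule inv_into_fibre[OF _ that]) (simp add: eq)
  have rq: "q (inv_into (points M) r (r p)) = q p" if "p \<in> points M" for p
    by (rule inv_into_fibre[OF _ that]) (simp add: eq)
  show ?thesis
    unfolding diffeomorphism_def
  proof (intro conjI exI[of _ "\<lambda>y. q (inv_into (points M) r y)"] ballI)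
    show "smooth_map (quot_space M q) (quot_space M r) (\<lambda>y. r (inv_into (points M) q y))"
      by (rule smooth_map_between_quot[OF M]) (simp add: eq)
    show "smooth_map (quot_space M r) (quot_space M q) (\<lambda>y. q (inv_into (points M) r y))"
      by (rule smooth_map_between_quot[OF M]) (simp add: eq)
    fix y assume "y \<in> points (quot_space M q)"
    then obtain p where p: "p \<in> points M" "y = q p" unfolding points_quot_space by blast
    show "q (inv_into (points M) r (r (inv_into (points M) q y))) = y"
      unfolding p(2) qr[OF p(1)] by (rule rq[OF p(1)])
  next
    fix y assume "y \<in> points (quot_space M r)"
    then obtain p where p: "p \<in> points M" "y = r p" unfolding points_quot_space by blast
    show "r (inv_into (points M) q (q (inv_into (points M) r y))) = y"
      unfolding p(2) rq[OF p(1)] by (rule qr[OF p(1)])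
  qed
qed

lemma ray_scale:
  assumes "r > 0"
  shows "ray (\<lambda>v. r * \<nu> v) = ray \<nu>"
proof -
  have "(\<lambda>v. s * (r * \<nu> v)) \<in> ray \<nu>" if "s > 0" for s
    unfolding ray_def using that assms by (intro CollectI exI[of _ "s * r"]) (simp add: mult.assoc)
  moreover have "(\<lambda>v. s * \<nu> v) \<in> ray (\<lambda>v. r * \<nu> v)" if "s > 0" for s
    unfolding ray_def using that assms by (intro CollectI exI[of _ "s / r"]) simp
  ultimately show ?thesis by (auto simp: ray_def[of \<nu>] ray_def[of "\<lambda>v. r * \<nu> v"])
qed

context ray_reduction
begin

definition sec :: "'g \<Rightarrow> 'g cosphere" where "sec g = cot_ray (g, rcov \<mu> g)"

lemma sec_smooth: "smooth_map M S sec"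
  unfolding sec_def by (rule smooth_map_compose[OF rcov_smooth_Sl[OF mu] smooth_cot_ray])

lemma base_sec: "base (sec g) = g" by (simp add: sec_def base_cot_ray)

lemma sec_inj: "inj_on sec A" by (rule inj_on_inverseI[where g = base]) (rule base_sec)

lemma level_eq: "ray_level G \<sigma> \<mu> = sec ` points M"
  unfolding points_mfd ray_level_eq[OF mu] sec_def ..

lemma level_space_eq: "level_space G \<sigma> \<mu> = quot_space M sec"
  unfolding level_space_def level_eq by (rule sub_space_section[OF local_M open_S sec_smooth smooth_base base_sec])

lemma act_sec: "k \<in> K \<Longrightarrow> g \<in> carrier G \<Longrightarrow> cosphere_act G k (sec g) = sec (k \<otimes> g)"
  unfolding sec_def cosphere_act_ray by (simp add: left_lift_K)

lemma act_orbit_sec: "g \<in> carrier G \<Longrightarrow> act_orbit G K (sec g) = sec ` (K #> g)"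
  unfolding act_orbit_def r_coset_def by (auto simp: act_sec)

lemma ray_reduced_eq: "ray_reduced G \<sigma> \<mu> K = quot_space M (\<lambda>g. act_orbit G K (sec g))"
  unfolding ray_reduced_def level_space_eq quot_space_compose ..

text \<open>\<open>F\<close> renames cosets injectively, so \<open>q\<close> inherits the quotient
  structure and the fibres from the coset map. Both instances of \<open>ray_quotient\<close> arise
  this way.\<close>

lemma quotient_transport:
  assumes q0: "quotient_manifold M (\<lambda>g. K #> g)"
    and inj: "inj_on F ((\<lambda>g. K #> g) ` carrier G)" and eq: "\<And>g. g \<in> carrier G \<Longrightarrow> F (K #> g) = q g"
  shows "ray_quotient G \<sigma> \<mu> K q"
proof (intro ray_quotient.intro ray_quotient_axioms.intro ray_reduction_axioms)
  have "quotient_manifold M (\<lambda>g. F (K #> g))"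
    by (rule quotient_manifold_postcompose[OF local_M q0]) (use inj in \<open>simp add: points_mfd\<close>)
  then show "quotient_manifold M q"
    by (rule quotient_manifold_cong[OF local_M]) (simp add: eq points_mfd)
  fix g h assume "g \<in> carrier G" "h \<in> carrier G"
  then show "q g = q h \<longleftrightarrow> K #> g = K #> h"
    using inj_on_eq_iff[OF inj, of "K #> g" "K #> h"] eq by auto
qed

lemma reduced_quotient:
  assumes q0: "quotient_manifold M (\<lambda>g. K #> g)"
  shows "ray_quotient G \<sigma> \<mu> K (\<lambda>g. act_orbit G K (sec g))"
proof (rule quotient_transport[OF q0])
  show "inj_on ((`) sec) ((\<lambda>g. K #> g) ` carrier G)"
    using sec_inj[of UNIV] by (auto intro!: inj_onI simp: inj_image_eq_iff)
  show "sec ` (K #> g) = act_orbit G K (sec g)" if "g \<in> carrier G" for g using act_orbit_sec[OF that] by simp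
qed

lemma theta_sec:
  assumes v: "v \<in> tangent M g"
  shows "theta_form M \<sigma> (sec g) (tmap S sec g v) = fac g * rcov \<mu> g v"
proof -
  have g: "g \<in> points M" "g \<in> carrier G" using tangent_points[OF v] points_mfd by simp_all
  have "theta_form M \<sigma> (sec g) (tmap S sec g v) = snd (\<sigma> (sec g)) (tmap M base (sec g) (tmap S sec g v))"
    by (rule theta_eq[OF smooth_map_in[OF sec_smooth g(1)] tmap_tangent[OF sec_smooth v]])
  also have "tmap M base (sec g) (tmap S sec g v) = tmap M (\<lambda>x. base (sec x)) g v"
    by (rule tmap_compose[OF sec_smooth smooth_base g(1)])
  also have "\<dots> = v" unfolding base_sec by (rule tmap_ident[OF v])
  also have "snd (\<sigma> (sec g)) v = fac g * rcov \<mu> g v"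
    unfolding sec_def sigma_f_sigma[OF rcov_Sl[OF mu g(2)]] by (simp add: fac_def)
  finally show ?thesis .
qed

text \<open>Every point and every tangent vector of the level set comes from the group through
  \<open>sec\<close>, so the equation between pull-backs can be tested on vectors of the group;
  \<open>theta_sec\<close> evaluates its right-hand side.\<close>

lemma is_reduced_form_iff:
  "is_reduced_form G \<sigma> \<mu> K \<eta> \<longleftrightarrow> contact_form (ray_reduced G \<sigma> \<mu> K) \<eta> \<and>
    (\<forall>g. \<forall>v\<in>tangent M g. \<eta> (act_orbit G K (sec g)) (tmap (ray_reduced G \<sigma> \<mu> K) (\<lambda>g. act_orbit G K (sec g)) g v) = fac g * rcov \<mu> g v)"
proof -
  let ?L = "level_space G \<sigma> \<mu>" and ?R = "ray_reduced G \<sigma> \<mu> K" and ?a = "act_orbit G K"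
  have L: "smooth_map M ?L sec" unfolding level_space_eq by (rule smooth_map_quot)
  have a: "smooth_map ?L ?R ?a" unfolding ray_reduced_def by (rule smooth_map_quot)
  have i: "smooth_map ?L S (\<lambda>x. x)" unfolding level_space_def by (rule smooth_map_sub_incl[OF open_S])
  have pL: "points ?L = sec ` points M" unfolding level_space_eq points_quot_space ..
  have tL: "tmap ?L sec g ` tangent M g = tangent ?L (sec g)" if "g \<in> points M" for g
    unfolding level_space_eq by (rule tangent_injective_quot[OF local_M sec_inj that])
  have l: "pull_form ?L ?R ?a \<eta> (sec g) (tmap ?L sec g v) = \<eta> (?a (sec g)) (tmap ?R (\<lambda>g. ?a (sec g)) g v)"
    and r: "pull_form ?L S (\<lambda>x. x) (theta_form M \<sigma>) (sec g) (tmap ?L sec g v) = fac g * rcov \<mu> g v"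
    if v: "v \<in> tangent M g" for g v
  proof -
    have g: "g \<in> points M" by (rule tangent_points[OF v])
    have p: "sec g \<in> points ?L" "tmap ?L sec g v \<in> tangent ?L (sec g)"
      using smooth_map_in[OF L g] tmap_tangent[OF L v] by simp_all
    show "pull_form ?L ?R ?a \<eta> (sec g) (tmap ?L sec g v) = \<eta> (?a (sec g)) (tmap ?R (\<lambda>g. ?a (sec g)) g v)"
      unfolding pull_form_def using p tmap_compose[OF L a g, of v] by simp
    show "pull_form ?L S (\<lambda>x. x) (theta_form M \<sigma>) (sec g) (tmap ?L sec g v) = fac g * rcov \<mu> g v"
      unfolding pull_form_def using p tmap_compose[OF L i g, of v] theta_sec[OF v] by simp
  qed
  have "pull_form ?L ?R ?a \<eta> = pull_form ?L S (\<lambda>x. x) (theta_form M \<sigma>) \<longleftrightarrow>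
    (\<forall>g. \<forall>v\<in>tangent M g. \<eta> (?a (sec g)) (tmap ?R (\<lambda>g. ?a (sec g)) g v) = fac g * rcov \<mu> g v)" (is "?l = ?r \<longleftrightarrow> ?rhs")
  proof
    assume eq: "?l = ?r"
    show ?rhs
    proof (intro allI ballI)
      fix g v assume v: "v \<in> tangent M g"
      show "\<eta> (?a (sec g)) (tmap ?R (\<lambda>g. ?a (sec g)) g v) = fac g * rcov \<mu> g v"
        unfolding l[OF v, symmetric] eq by (rule r[OF v])
    qed
  next
    assume eq: ?rhs
    show "?l = ?r"
    proof (intro ext)
      fix x w
      show "?l x w = ?r x w"
      proof (cases "x \<in> points ?L \<and> w \<in> tangent ?L x")
        case True
        then obtain g where g: "g \<in> points M" "x = sec g" using pL by blast
        then obtain v where v: "v \<in> tangent M g" "w = tmap ?L sec g v" using True tL[OF g(1)] by blast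
        show ?thesis unfolding g(2) v(2) l[OF v(1)] r[OF v(1)] using eq v(1) by blast
      next
        case False
        then show ?thesis unfolding pull_form_def by (simp only: if_False)
      qed
    qed
  qed
  then show ?thesis unfolding is_reduced_form_def by (simp only:)
qed

section \<open>The diagonal as a graph over the coset space\<close>

definition dmap :: "'g \<Rightarrow> 'g covec set \<times> 'g set" where
  "dmap g = (ray (Ad_star G g \<mu>), K #> g)"

lemma Ad_star_K:
  assumes k: "k \<in> K" and g: "g \<in> carrier G"
  shows "Ad_star G (k \<otimes> g) \<mu> = Ad_star G g \<mu>"
proof -
  have "Ad_star G k \<mu> = \<mu>"
    using K_isotropy[OF subgroup.m_inv_closed[OF K_subgroup k]] K_carrier[OF k] by simp
  then show ?thesis using Ad_star_compose[OF g K_carrier[OF k], of \<mu>] by simp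
qed

lemma Ad_star_coset:
  assumes "g \<in> carrier G" "h \<in> carrier G" "K #> g = K #> h"
  shows "Ad_star G g \<mu> = Ad_star G h \<mu>"
  using assms coset_eq_iff[OF K_subgroup assms(1,2)] Ad_star_K by auto

lemma Diag_eq: "Diag G \<mu> K = dmap ` carrier G"
proof -
  have eq: "(ray (Ad_star G g (\<lambda>\<xi>. r * \<mu> \<xi>)), K #> g) = dmap g" if "r > 0" for g r
    unfolding dmap_def Ad_star_scale ray_scale[OF that] ..
  show ?thesis unfolding Diag_def
  proof (intro equalityI subsetI)
    fix y assume "y \<in> {(ray (Ad_star G g (\<lambda>\<xi>. r * \<mu> \<xi>)), K #> g) | g r. g \<in> carrier G \<and> r > 0}"
    then show "y \<in> dmap ` carrier G" by (elim CollectE exE conjE) (simp add: eq)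
  next
    fix y assume "y \<in> dmap ` carrier G"
    then obtain g where "g \<in> carrier G" "y = dmap g" by blast
    then show "y \<in> {(ray (Ad_star G g (\<lambda>\<xi>. r * \<mu> \<xi>)), K #> g) | g r. g \<in> carrier G \<and> r > 0}"
      unfolding mem_Collect_eq using eq[OF zero_less_one] by (intro exI[of _ g] exI[of _ 1]) simp
  qed
qed

lemma ray_orbit_smooth: "smooth_map M (orbit_sphere G \<mu>) (\<lambda>g. ray (Ad_star G g \<mu>))"
proof -
  let ?P = "prod_space M pos_reals" and ?o = "\<lambda>(g, r). Ad_star G (inv g) (\<lambda>\<xi>. r * \<mu> \<xi>)"
  have pos: "open_domains pos_reals" "1 \<in> points pos_reals"
    unfolding pos_reals_def by (rule open_domains_sub) (simp add: points_sub_space)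
  \<comment> \<open>The orbit is parametrised through \<open>Ad_star G (inv g)\<close>, hence the
    inverse; the dilation parameter is 1.\<close>
  have 1: "smooth_map M ?P (\<lambda>g. (inv g, 1))"
    by (rule smooth_map_pair[OF charted_M inv_smooth smooth_map_const[OF charted_M pos]])
  have 2: "smooth_map ?P (orbit_sphere G \<mu>) (\<lambda>p. ray (?o p))"
    unfolding orbit_sphere_def ray_orbit_def by (rule smooth_map_compose[OF smooth_map_quot smooth_map_quot])
  have op: "open_domains (orbit_sphere G \<mu>)" unfolding orbit_sphere_def by (rule open_domains_quot)
  show ?thesis
    by (rule smooth_map_eq[OF local_M op smooth_map_compose[OF 1 2]]) (simp add: points_mfd)
qed

context
  assumes q0: "quotient_manifold M (\<lambda>g. K #> g)"
begin

lemma manifold_left_quotient: "smooth_manifold (left_quotient G K)"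
  using q0 unfolding quotient_manifold_def left_quotient_def by blast

text \<open>The first coordinate of the diagonal as a function of the coset. Every representative
  gives the same ray, since \<open>K\<close> fixes \<mu>.\<close>

definition orb :: "'g set \<Rightarrow> 'g covec set" where
  "orb y = ray (Ad_star G (inv_into (carrier G) (\<lambda>g. K #> g) y) \<mu>)"

lemma orb_coset:
  assumes g: "g \<in> carrier G"
  shows "orb (K #> g) = ray (Ad_star G g \<mu>)"
proof -
  let ?h = "inv_into (carrier G) (\<lambda>g. K #> g) (K #> g)"
  have "K #> g \<in> (\<lambda>g. K #> g) ` carrier G" using g by blast
  then have "?h \<in> carrier G" "K #> ?h = K #> g"
    using inv_into_into[of "K #> g" "\<lambda>g. K #> g"] f_inv_into_f[of "K #> g" "\<lambda>g. K #> g"] by blast+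
  then show ?thesis unfolding orb_def using Ad_star_coset[OF _ g] by simp
qed

lemma orb_smooth: "smooth_map (left_quotient G K) (orbit_sphere G \<mu>) orb"
proof -
  have op: "open_domains (orbit_sphere G \<mu>)" unfolding orbit_sphere_def by (rule open_domains_quot)
  show ?thesis unfolding left_quotient_def
    by (rule smooth_map_from_quot[OF smooth_map_eq[OF local_M op ray_orbit_smooth] op]) (simp add: orb_coset points_mfd)
qed

text \<open>The projection to the second factor retracts the section that sends \<open>y\<close> to
  \<open>(orb y, y)\<close>, so the induced structure on the diagonal is that of the coset
  space.\<close>

lemma diag_space_eq: "diag_space G \<mu> K = quot_space M dmap"
proof -
  let ?LQ = "left_quotient G K" and ?P = "prod_space (orbit_sphere G \<mu>) (left_quotient G K)"
  have ch: "charted ?LQ" by (rule manifold_charted[OF manifold_left_quotient])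
  have op: "open_domains ?LQ" by (rule local_open_domains[OF charted_local[OF ch]])
  have "sub_space ?P ((\<lambda>y. (orb y, y)) ` points ?LQ) = quot_space ?LQ (\<lambda>y. (orb y, y))"
    by (rule sub_space_section[OF charted_local[OF ch] open_domains_prod
        smooth_map_pair[OF ch orb_smooth smooth_map_ident[OF op]] smooth_map_snd[OF op]]) simp
  moreover have "(\<lambda>y. (orb y, y)) ` points ?LQ = Diag G \<mu> K"
    unfolding left_quotient_def points_quot_space points_mfd Diag_eq image_image dmap_def
    by (intro image_cong refl) (simp add: orb_coset)
  moreover have "quot_space ?LQ (\<lambda>y. (orb y, y)) = quot_space M (\<lambda>g. (orb (K #> g), K #> g))"
    unfolding left_quotient_def by (rule quot_space_compose)
  moreover have "\<dots> = quot_space M dmap"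
    by (rule quot_space_cong[OF local_M]) (simp add: orb_coset dmap_def points_mfd)
  ultimately show ?thesis unfolding diag_space_def by simp
qed

lemma diag_quotient: "ray_quotient G \<sigma> \<mu> K dmap"
proof (rule quotient_transport[OF q0])
  show "inj_on (\<lambda>y. (orb y, y)) ((\<lambda>g. K #> g) ` carrier G)" by (rule inj_onI) simp
  show "(orb (K #> g), K #> g) = dmap g" if "g \<in> carrier G" for g by (simp add: orb_coset[OF that] dmap_def)
qed

end

end

text \<open>The prescribed curve is \<open>dmap\<close> along \<open>g \<otimes> \<gamma> t\<close>.
  Its velocity on the group is the left-invariant field of \<xi> at \<open>g\<close>, that is, the
  right-invariant field of \<open>Ad G g \<xi>\<close>, on which the form is known.\<close>

lemma (in ray_reduction) orbit_form:
  assumes q0: "quotient_manifold M (\<lambda>g. K #> g)"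
  shows "is_orbit_form G \<sigma> \<mu> K (ray_quotient.qform G \<sigma> \<mu> dmap)"
proof -
  interpret D: ray_quotient G \<sigma> \<mu> K dmap by (rule diag_quotient[OF q0])
  show ?thesis
    unfolding is_orbit_form_def Let_def diag_space_eq[OF q0]
  proof (intro conjI ballI allI impI D.qform_one_form)
    fix g r \<xi> r' \<gamma>
    assume g: "g \<in> carrier G" and r: "(r::real) > 0" and \<xi>: "\<xi> \<in> lie_algebra G" and \<gamma>: "exp_curve G \<xi> \<gamma>"
    let ?\<nu> = "Ad_star G g (\<lambda>\<zeta>. r * \<mu> \<zeta>)"
    have sm: "smooth_map real_space M \<gamma>" and hom: "\<gamma> (s + t) = \<gamma> s \<otimes> \<gamma> t" and vel: "velocity M \<gamma> 0 = \<xi>" for s t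
      using \<gamma> unfolding exp_curve_def by blast+
    have \<gamma>c: "\<gamma> t \<in> carrier G" for t using smooth_map_in[OF sm, of t] points_mfd by simp
    have \<gamma>0: "\<gamma> 0 = \<one>" using hom[of 0 0] \<gamma>c[of 0] by (simp add: l_cancel_one)
    \<comment> \<open>The dilations by \<open>r\<close> and \<open>exp (t * r')\<close> disappear in
      the ray, so the velocity does not depend on \<open>r'\<close>.\<close>
    have c: "(ray (Ad_star G (\<gamma> t) (\<lambda>\<zeta>. exp (t * r') * ?\<nu> \<zeta>)), K #> (g \<otimes> \<gamma> t)) = dmap (g \<otimes> \<gamma> t)" for t
      unfolding Ad_star_scale Ad_star_compose[OF \<gamma>c g] ray_scale[OF r] ray_scale[OF exp_gt_zero] dmap_def ..
    have p: "(ray ?\<nu>, K #> g) = dmap g" unfolding Ad_star_scale ray_scale[OF r] dmap_def ..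
    have one: "\<one> \<in> points M" by (rule one_carrier_points)
    have "velocity D.Q (\<lambda>t. dmap (g \<otimes> \<gamma> t)) 0 = tmap D.Q dmap g (velocity M (\<lambda>t. g \<otimes> \<gamma> t) 0)"
      by (rule tmap_velocity[where c = "\<lambda>t. g \<otimes> \<gamma> t" and t = 0, OF D.q_smooth, symmetric]) (simp_all add: \<gamma>0 g points_mfd)
    also have "velocity M (\<lambda>t. g \<otimes> \<gamma> t) 0 = Lv \<xi> g" unfolding Lv_def vel[symmetric]
      by (rule tmap_velocity[where c = \<gamma> and t = 0, OF smooth_left[OF g], symmetric]) (simp_all add: \<gamma>0 one)
    also have "\<dots> = Rv (Ad G g \<xi>) g" by (rule Lv_eq_Rv_Ad[OF \<xi> g])
    finally have v: "velocity D.Q (\<lambda>t. dmap (g \<otimes> \<gamma> t)) 0 = tmap D.Q dmap g (Rv (Ad G g \<xi>) g)" .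
    have "f_sigma M \<sigma> (right_cov G g (\<lambda>\<zeta>. r * \<mu> \<zeta>)) * ?\<nu> \<xi> = f_sigma M \<sigma> (g, \<lambda>v. r * rcov \<mu> g v) * (r * \<mu> (Ad G g \<xi>))"
      unfolding right_cov_eq rcov_scale Ad_star_scale using \<xi> by (simp add: Ad_star_def)
    also have "\<dots> = (r * f_sigma M \<sigma> (g, \<lambda>v. r * rcov \<mu> g v)) * \<mu> (Ad G g \<xi>)" by simp
    \<comment> \<open>Homogeneity of degree -1 of the factor cancels the \<open>r\<close> of the
      pairing.\<close>
    also have "r * f_sigma M \<sigma> (g, \<lambda>v. r * rcov \<mu> g v) = fac g"
      unfolding fac_def by (rule f_sigma_scale[OF rcov_Sl[OF mu g] r])
    finally show "D.qform (ray ?\<nu>, K #> g)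
        (velocity D.Q (\<lambda>t. (ray (Ad_star G (\<gamma> t) (\<lambda>\<zeta>. exp (t * r') * ?\<nu> \<zeta>)), K #> (g \<otimes> \<gamma> t))) 0) =
        f_sigma M \<sigma> (right_cov G g (\<lambda>\<zeta>. r * \<mu> \<zeta>)) * ?\<nu> \<xi>"
      unfolding c p v D.qform_Rv[OF Ad_closed[OF \<xi> g] g] by simp
  qed
qed

lemma (in ray_reduction) reduction_theorem:
  assumes q0: "quotient_manifold M (\<lambda>g. K #> g)"
  shows "ray_reduced_well_defined G \<sigma> \<mu> K \<and>
    (\<exists>\<eta>. is_orbit_form G \<sigma> \<mu> K \<eta> \<and>
       contactomorphic (ray_reduced G \<sigma> \<mu> K) (reduced_form G \<sigma> \<mu> K) (diag_space G \<mu> K) \<eta>)"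
proof -
  let ?q = "\<lambda>g. act_orbit G K (sec g)"
  interpret R: ray_quotient G \<sigma> \<mu> K ?q by (rule reduced_quotient[OF q0])
  interpret D: ray_quotient G \<sigma> \<mu> K dmap by (rule diag_quotient[OF q0])
  have red: "is_reduced_form G \<sigma> \<mu> K R.qform"
    unfolding is_reduced_form_iff ray_reduced_eq using R.qform_contact R.qform_eq by blast
  have uniq: "\<eta> = R.qform" if "is_reduced_form G \<sigma> \<mu> K \<eta>" for \<eta>
  proof (rule R.qform_unique)
    show "one_form R.Q \<eta>" using that unfolding is_reduced_form_iff ray_reduced_eq contact_form_def by blast
    show "\<eta> (?q g) (tmap R.Q ?q g v) = fac g * rcov \<mu> g v" if v: "v \<in> tangent M g" for g v
      using \<open>is_reduced_form G \<sigma> \<mu> K \<eta>\<close> v unfolding is_reduced_form_iff ray_reduced_eq by blast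
  qed
  have form: "reduced_form G \<sigma> \<mu> K = R.qform"
    unfolding reduced_form_def by (rule the_equality, rule red, rule uniq)
  have wd: "ray_reduced_well_defined G \<sigma> \<mu> K"
    unfolding ray_reduced_well_defined_def
  proof (intro conjI ballI)
    have "ray_level G \<sigma> \<mu> \<subseteq> points S" unfolding ray_level_def by (rule Collect_restrict)
    moreover have "smooth_manifold (sub_space S (ray_level G \<sigma> \<mu>))"
      unfolding level_space_def[symmetric] level_space_eq by (rule manifold_injective_quot[OF manifold sec_inj])
    ultimately show "embedded_submanifold S (ray_level G \<sigma> \<mu>)" unfolding embedded_submanifold_def by (rule conjI)
    show "cosphere_act G k x \<in> ray_level G \<sigma> \<mu>" if k: "k \<in> K" and x: "x \<in> ray_level G \<sigma> \<mu>" for k x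
    proof -
      obtain g where g: "g \<in> carrier G" "x = sec g" using x unfolding level_eq points_mfd by blast
      have "k \<otimes> g \<in> carrier G" using K_carrier[OF k] g(1) by simp
      then show ?thesis unfolding g(2) act_sec[OF k g(1)] level_eq points_mfd by (rule imageI)
    qed
    show "quotient_manifold (level_space G \<sigma> \<mu>) (act_orbit G K)"
      unfolding level_space_eq by (rule quotient_manifold_precompose[OF local_M sec_inj R.quotient])
    show "\<exists>!\<eta>. is_reduced_form G \<sigma> \<mu> K \<eta>" by (rule ex1I, rule red, rule uniq)
  qed
  \<comment> \<open>Both maps identify exactly the elements of a common coset, which is what the
    diffeomorphism is built from.\<close>
  have fib: "?q g = ?q h \<longleftrightarrow> dmap g = dmap h" if "g \<in> points M" "h \<in> points M" for g h
    using R.fibres[of g h] D.fibres[of g h] that by (simp add: points_mfd)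
  define F where "F y = dmap (inv_into (points M) ?q y)" for y
  have F: "diffeomorphism R.Q D.Q F" "\<And>g. g \<in> points M \<Longrightarrow> F (?q g) = dmap g"
  proof -
    show "diffeomorphism R.Q D.Q F" unfolding F_def by (rule diffeomorphism_quot[OF local_M]) (rule fib)
    show "F (?q g) = dmap g" if "g \<in> points M" for g
      unfolding F_def by (rule inv_into_fibre[OF _ that]) (simp only: fib)
  qed
  have Fs: "smooth_map R.Q D.Q F" using F(1) unfolding diffeomorphism_def by blast
  \<comment> \<open>The forms correspond exactly, with conformal factor 1, because both are
    determined by the same form on the group.\<close>
  have "pull_form R.Q D.Q F D.qform = (\<lambda>p v. 1 * R.qform p v)"
  proof (intro ext)
    fix p w
    show "pull_form R.Q D.Q F D.qform p w = 1 * R.qform p w"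
    proof (cases "p \<in> points R.Q \<and> w \<in> tangent R.Q p")
      case True
      then obtain g where g: "g \<in> carrier G" "p = ?q g" using R.points_Q by blast
      then obtain v where v: "v \<in> tangent M g" "w = tmap R.Q ?q g v" using R.tangent_Q True by blast
      have gp: "g \<in> points M" using g(1) points_mfd by simp
      have "tmap D.Q F (?q g) (tmap R.Q ?q g v) = tmap D.Q (\<lambda>x. F (?q x)) g v"
        by (rule tmap_compose[OF R.q_smooth Fs gp])
      also have "\<dots> = tmap D.Q dmap g v" by (rule tmap_cong_carrier[OF v(1)]) (simp add: F(2) points_mfd)
      finally have t: "tmap D.Q F p w = tmap D.Q dmap g v" unfolding g(2) v(2) .
      have "pull_form R.Q D.Q F D.qform p w = D.qform (F p) (tmap D.Q F p w)" unfolding pull_form_def using True by simp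
      also have "\<dots> = D.qform (dmap g) (tmap D.Q dmap g v)" unfolding t unfolding g(2) F(2)[OF gp] ..
      also have "\<dots> = R.qform p w" unfolding D.qform_eq[OF v(1)] g(2) v(2) R.qform_eq[OF v(1)] ..
      finally show ?thesis by simp
    next
      case False
      have "w \<notin> tangent R.Q p"
      proof
        assume w: "w \<in> tangent R.Q p"
        show False using False tangent_points[OF w] w by simp
      qed
      then have "R.qform p w = 0" by (rule R.qform_outside)
      moreover have "pull_form R.Q D.Q F D.qform p w = 0" unfolding pull_form_def using False by (simp only: if_False)
      ultimately show ?thesis by simp
    qed
  qed
  moreover have "smooth_fun R.Q (points R.Q) (\<lambda>_. 1)"
    unfolding smooth_fun_iff_near[OF R.local_Q]
    by (auto simp: points_def intro!: smooth_near_const[OF R.charted_Q])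
  ultimately have "contactomorphic R.Q R.qform D.Q D.qform"
    unfolding contactomorphic_def using R.qform_contact D.qform_contact F(1)
    by (intro conjI exI[of _ F] exI[of _ "\<lambda>_. 1"]) simp_all
  then have "contactomorphic (ray_reduced G \<sigma> \<mu> K) (reduced_form G \<sigma> \<mu> K) (diag_space G \<mu> K) D.qform"
    unfolding form ray_reduced_eq diag_space_eq[OF q0] .
  then show ?thesis using wd orbit_form[OF q0] by blast
qed

theorem theorem5p3:
  fixes G :: "'g lie_grp" and \<mu> :: "'g covec" and K :: "'g set"
    and \<sigma> :: "'g cosphere \<Rightarrow> 'g \<times> 'g covec"
  assumes "lie_group G"
    and "invariant_section G \<sigma>"
    and "\<mu> \<in> dual_lie_algebra G" and "\<mu> \<noteq> (\<lambda>_. 0)"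
    and "kernel_group G \<mu> K"
    and "quotient_manifold (mfd G) (\<lambda>g. K #>\<^bsub>G\<^esub> g)"
    and "{\<lambda>f. \<xi> f + \<zeta> f | \<xi> \<zeta>. \<xi> \<in> lie_algebra G \<and> \<mu> \<xi> = 0 \<and> \<zeta> \<in> isotropy_algebra G \<mu>}
         = lie_algebra G"
  shows "ray_reduced_well_defined G \<sigma> \<mu> K \<and>
    (\<exists>\<eta>. is_orbit_form G \<sigma> \<mu> K \<eta> \<and>
       contactomorphic (ray_reduced G \<sigma> \<mu> K) (reduced_form G \<sigma> \<mu> K) (diag_space G \<mu> K) \<eta>)"
proof -
  have "lie G" using assms(1) unfolding lie_group_def lie_def lie_axioms_def by blast
  then have "ray_reduction G \<sigma> \<mu> K"
    by (intro ray_reduction.intro lie_section.intro lie_section_axioms.intro ray_reduction_axioms.intro assms)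
  then show ?thesis using assms(6) by (rule ray_reduction.reduction_theorem)
qed

end
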